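(* Assume conditions (A.1), (A.2), (A.3) stated in the context, and $m_0\ge 2$. Then the following are equivalent: (1) There exists a Borel measure $\mu$ on $X$ such that for any $f\in F_{b,0}(X)$, $\mu_\epsilon(f)$ converges to $\mu(f)$ as $\epsilon\to0$. (2) For any finite subset $Q\subset S$ with $Q\cap U(k)\ne\emptyset$ for each $1\le k\le m_0$, $\mu_\epsilon(\chi_Q)$ converges to a number $a(Q)$ as $\epsilon\to 0$, and if $a(Q)>0$ then $\delta_\epsilon(Q,k)$ converges to a number $\delta(Q,k)$ for all $1\le k\le m_0$ as $\epsilon\to0$. (3) There exists a sequence of finite subsets $Q_n\subset S$ with $Q_n\cap U(k)\ne\emptyset$ for all $1\le k\le m_0$, $Q_n\subset Q_{n+1}$ and $\bigcup_nQ_n=S$ such that $a(n):=\lim_{\epsilon\to0}\mu_\epsilon(\chi_{Q_n})$ exists and, if $a(n)>0$, then $\delta_\epsilon(Q_n,k)$ converges to a number $\delta(Q_n,k)$ as $\epsilon\to0$ for all $k$. (4) There exists a sequence of finite subsets $Q_n\subset S$ with $Q_n\cap U(k)\ne\emptyset$ for all $k$, $Q_n\subset Q_{n+1}$ and $\bigcup_nQ_n=S$ such that $\lim_{\epsilon\to0}\mu_\epsilon(\chi_{Q_n})\delta_\epsilon(Q_n,k)$ exists for all $n\ge1$ and all $1\le k\le m_0$. In this case, the limiting measure $\mu$ has the form $\sum_{k=1}^{m_0}\delta(k)\mu(U(k),\cdot)$ with $\delta(k):=\lim_{n\to\infty}\lim_{\epsilon\to0}\mu_\epsilon(\chi_{Q_n})\delta_\epsilon(Q_n,k)$,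 where $(Q_n)$ is a sequence as in (4).
   Context: **Shift space.** $S$ is a countable set, $A=(A(ij))_{i,j\in S}$ a zero-one matrix, $X=X_A=\{\omega=\omega_0\omega_1\cdots\in\prod_{n\ge 0}S: A(\omega_k\omega_{k+1})=1\ \forall k\ge 0\}$ with the product topology ($S$ discrete), and $\sigma:X\to X$ the left shift. A word $w_1\cdots w_n\in S^n$ is $A$-admissible if $A(w_iw_{i+1})=1$ for $1\le i<n$; $|w|$ is its length; $[w]=\{\omega\in X:\omega_0\cdots\omega_{n-1}=w\}$. $A$ is assumed irreducible: for all $a,b\in S$ there is an $A$-admissible word starting with $a$ and ending with $b$. Fix $\theta\in(0,1)$ and let $d_\theta(\omega,\upsilon)=\theta^{\min\{n:\omega_n\ne\upsilon_n\}}$ for $\omega\neq\upsilon$, $d_\theta(\omega,\omega)=0$. For $k\ge1$, $[f]_k=\sup\{|f(\omega)-f(\upsilon)|/d_\theta(\omega,\upsilon):\omega\ne\upsilon,\ \omega_0\cdots\omega_{k-1}=\upsilon_0\cdots\upsilon_{k-1}\}$. $F_b(X)$ is the Banach space of continuous $f:X\to\mathbb C$ with $\|f\|_1:=\|f\|_\infty+[f]_1<\infty$. For $Q\subset S$, $\Sigma_Q=\bigcup_{a\in Q}[a]$ and $\chi_Q$ is the indicator of $\Sigma_Q$. $F_{b,0}(X)$ is the set of $f\in F_b(X)$ vanishing at infinity: for every $\eta>0$ there is a finite $Q\subset S$ with $|f|<\eta$ on $\Sigma_{S\setminus Q}$. $S_n\psi=\sum_{k=0}^{n-1}\psi\circ\sigma^k$.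 The topological pressure is $P(\psi)=\lim_{n\to\infty}\frac1n\log\sum_{w\in S^n:[w]\neq\emptyset}\exp(\sup_{[w]}S_n\psi)$, with $e^{-\infty}=0$; for a subshift $X_M\subset X$, $P(\psi|X_M)$ is defined in the same way on $X_M$. **Conditions** on functions $\varphi(\epsilon,\cdot):X\to\mathbb R$, $\epsilon\in(0,1)$: (A.1) $\sup_{\epsilon}[\varphi(\epsilon,\cdot)]_2<\infty$. (A.2) $\sum_{a\in S}\exp(\sup_{\epsilon>0}\sup_{\omega\in[a]}\varphi(\epsilon,\omega))<\infty$. (A.3) There is $\varphi:X\to\mathbb R\cup\{-\infty\}$ such that for each $a\in S$, $\sup_{\omega\in[a]}|e^{\varphi(\epsilon,\omega)}-e^{\varphi(\omega)}|\to0$ as $\epsilon\to0$, and $P(\varphi)$ is finite. **Components.** By (A.1), $\varphi$ is either finite on all of $[ij]$ or $-\infty$ on all of $[ij]$. Let $B(ij)=1$ if $[ij]\neq\emptyset$ and $\varphi$ is finite on $[ij]$, and $B(ij)=0$ otherwise. Write $a\leftrightarrow b$ if $a=b$ or there are words $w_1,w_2$ with $a\cdot w_1\cdot b$ and $b\cdot w_2\cdot a$ $B$-admissible. For $U\in S/\!\!\leftrightarrow$, $B[U]$ is the submatrix of $B$ indexed by $U\times U$ and $X_{B[U]}\subset X$ the subshift with states $U$ and transition matrix $B[U]$. Put $\mathscr S_0=\{U\in S/\!\!\leftrightarrow: P(\varphi|X_{B[U]})=P(\varphi)\}$; this set is nonempty and finite, and is written $\{U(1),\dots,U(m_0)\}$.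 **RPF measures.** For a zero-one matrix $M\le A$ indexed by $S_0\subset S$ (extended by $0$), $\mathcal L_{M,\psi}f(\omega)=\sum_{a:M(a\omega_0)=1}e^{\psi(a\omega)}f(a\omega)$. If $M$ is irreducible and $X_M$ has a periodic point, let $\lambda=\exp P(\psi|X_M)$, $h\ge0$ and $\nu$ (a Borel probability measure on $X$ supported on $X_M$) be the Perron eigenvalue, eigenfunction and dual eigenvector: $\mathcal L_{M,\psi}h=\lambda h$, $\mathcal L_{M,\psi}^*\nu=\lambda\nu$, $\nu(h)=1$. The measure $h\nu$ is the Ruelle–Perron–Frobenius (RPF) measure of $\psi|X_M$. $\mu_\epsilon$ is the RPF measure for $M=A$, $\psi=\varphi(\epsilon,\cdot)$; $\mu(U,\cdot)$ is the RPF measure for $M=B[U]$, $\psi=\varphi$ ($U\in\mathscr S_0$). Put $\lambda_\epsilon=\exp P(\varphi(\epsilon,\cdot))$. **Induced operators and the weights $\delta_\epsilon$.** For disjoint $U,V\subset S$, $U\ne\emptyset$, let $W(U:V)=U\times\bigcup_{n\ge0}V^n$ (words with first letter in $U$ and remaining letters, possibly none, in $V$). The bounded operator $\mathcal L_{\varphi(\epsilon,\cdot)}[U,V,\lambda_\epsilon]$ on $F_b(X)$ is $$\mathcal L_{\varphi(\epsilon,\cdot)}[U,V,\lambda_\epsilon]f(\omega)=\sum_{w\in W(U:V):\,w\cdot\omega_0\ A\text{-admissible}}\lambda_\epsilon^{-|w|+1}e^{S_{|w|}\varphi(\epsilon,w\cdot\omega)}f(w\cdot\omega).$$ For a finite $Q\subset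 S$ with $Q\cap U(k)\ne\emptyset$ for all $k$ and distinct $i,j\in\{1,\dots,m_0\}$, $c_\epsilon(Q,i,j)$ is the spectral radius of $\mathcal L_{\varphi(\epsilon,\cdot)}[Q\cap U(i),\,S\setminus((U(i)\cup U(j))\cap Q),\,\lambda_\epsilon]$. (For these operators $V$ is understood as stated, i.e. the complement of $Q\cap(U(i)\cup U(j))$.) Finally $$\delta_\epsilon(Q,i)=\Big(1+\sum_{1\le j\le m_0,\,j\ne i}\frac{\lambda_\epsilon-c_\epsilon(Q,i,j)}{\lambda_\epsilon-c_\epsilon(Q,j,i)}\Big)^{-1}.$$ *)

theory Defs
  imports "HOL-Probability.Probability" "HOL-Library.Omega_Words_Fun"
begin

(* The state space S is the type 's of sort {countable, discrete_topology}, so that 's word =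
   nat => 's carries the product topology of discrete topologies; w \<frown> x is concatenation and
   suffix k x is the k-fold left shift of x. Zero-one matrices are Boolean relations; a matrix
   indexed by a subset of S is extended by False. *)

section \<open>Shift spaces\<close>

definition shift_space :: "('s \<Rightarrow> 's \<Rightarrow> bool) \<Rightarrow> 's word set" where
  "shift_space A = {x. \<forall>k. A (x k) (x (Suc k))}"

definition irreducible_matrix :: "('s \<Rightarrow> 's \<Rightarrow> bool) \<Rightarrow> bool" where
  "irreducible_matrix A \<longleftrightarrow> (\<forall>a b. \<exists>w. w \<noteq> [] \<and> successively A w \<and> hd w = a \<and> last w = b)"

definition cyl :: "('s \<Rightarrow> 's \<Rightarrow> bool) \<Rightarrow> 's list \<Rightarrow> 's word set" where
  "cyl A w = {x \<in> shift_space A. prefix (length w) x = w}"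

definition Sig :: "('s \<Rightarrow> 's \<Rightarrow> bool) \<Rightarrow> 's set \<Rightarrow> 's word set" where
  "Sig A Q = (\<Union>a\<in>Q. cyl A [a])"

definition submatrix_on :: "('s \<Rightarrow> 's \<Rightarrow> bool) \<Rightarrow> 's set \<Rightarrow> 's \<Rightarrow> 's \<Rightarrow> bool" where
  "submatrix_on M U i j \<longleftrightarrow> i \<in> U \<and> j \<in> U \<and> M i j"

definition dtheta :: "real \<Rightarrow> 's word \<Rightarrow> 's word \<Rightarrow> real" where
  "dtheta \<theta> x y = (if x = y then 0 else \<theta> ^ (LEAST n. x n \<noteq> y n))"

section \<open>Function spaces\<close>

definition lip_seminorm ::
  "('s \<Rightarrow> 's \<Rightarrow> bool) \<Rightarrow> real \<Rightarrow> nat \<Rightarrow> ('s word \<Rightarrow> 'b::real_normed_vector) \<Rightarrow> ennreal" where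
  "lip_seminorm A \<theta> k f =
     (SUP (x, y) \<in> {(x, y). x \<in> shift_space A \<and> y \<in> shift_space A \<and> x \<noteq> y \<and>
                           prefix k x = prefix k y}.
        ennreal (norm (f x - f y) / dtheta \<theta> x y))"

definition norm1 :: "('s \<Rightarrow> 's \<Rightarrow> bool) \<Rightarrow> real \<Rightarrow> ('s word \<Rightarrow> complex) \<Rightarrow> ennreal" where
  "norm1 A \<theta> f = (SUP x \<in> shift_space A. ennreal (norm (f x))) + lip_seminorm A \<theta> 1 f"

(* A function on X is represented by its extension by 0 to all sequences, which makes
   F_b(X) a linear space of total functions. *)
definition Fb :: "('s::discrete_topology \<Rightarrow> 's \<Rightarrow> bool) \<Rightarrow> real \<Rightarrow> ('s word \<Rightarrow> complex) set" where
  "Fb A \<theta> = {f. (\<forall>x. x \<notin> shift_space A \<longrightarrow> f x = 0) \<and>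
                continuous_on (shift_space A) f \<and> norm1 A \<theta> f < \<infinity>}"

definition Fb0 :: "('s::discrete_topology \<Rightarrow> 's \<Rightarrow> bool) \<Rightarrow> real \<Rightarrow> ('s word \<Rightarrow> complex) set" where
  "Fb0 A \<theta> = {f \<in> Fb A \<theta>. \<forall>\<eta>>0. \<exists>Q. finite Q \<and> (\<forall>x \<in> Sig A (- Q). norm (f x) < \<eta>)}"

section \<open>Spectral radius on a space of functions\<close>

(* E is a linear space of functions with an (extended-valued) norm N that is finite on E, and
   T maps E to E. *)
definition resolvent_set_on ::
  "('x \<Rightarrow> complex) set \<Rightarrow> (('x \<Rightarrow> complex) \<Rightarrow> ennreal) \<Rightarrow>
   (('x \<Rightarrow> complex) \<Rightarrow> 'x \<Rightarrow> complex) \<Rightarrow> complex set" where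
  "resolvent_set_on E N T =
     {z. bij_betw (\<lambda>f x. z * f x - T f x) E E \<and>
         (\<exists>C::real. \<forall>f\<in>E. N f \<le> ennreal C * N (\<lambda>x. z * f x - T f x))}"

definition spectral_radius_on ::
  "('x \<Rightarrow> complex) set \<Rightarrow> (('x \<Rightarrow> complex) \<Rightarrow> ennreal) \<Rightarrow>
   (('x \<Rightarrow> complex) \<Rightarrow> 'x \<Rightarrow> complex) \<Rightarrow> real" where
  "spectral_radius_on E N T = (SUP z \<in> - resolvent_set_on E N T. cmod z)"

section \<open>Topological pressure\<close>

definition exp_ereal :: "ereal \<Rightarrow> ennreal" where
  "exp_ereal t = (if t = - \<infinity> then 0 else if t = \<infinity> then \<infinity> else ennreal (exp (real_of_ereal t)))"

definition ln_ennreal :: "ennreal \<Rightarrow> ereal" where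
  "ln_ennreal t = (if t = 0 then - \<infinity> else if t = \<infinity> then \<infinity> else ereal (ln (enn2real t)))"

definition birkhoff :: "nat \<Rightarrow> ('s word \<Rightarrow> 'b::comm_monoid_add) \<Rightarrow> 's word \<Rightarrow> 'b" where
  "birkhoff n \<psi> x = (\<Sum>k<n. \<psi> (suffix k x))"

(* pressure M \<psi> is the pressure of the restriction of \<psi> to X_M, with cylinders taken in X_M. *)
definition pressure :: "('s \<Rightarrow> 's \<Rightarrow> bool) \<Rightarrow> ('s word \<Rightarrow> ereal) \<Rightarrow> ereal" where
  "pressure M \<psi> =
     lim (\<lambda>n. ereal (1 / real n) *
       ln_ennreal (\<Sum>\<^sub>\<infinity>w\<in>{w. length w = n \<and> cyl M w \<noteq> {}}.
                     exp_ereal (SUP x \<in> cyl M w. birkhoff n \<psi> x)))"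

section \<open>Conditions on the potentials\<close>

definition cond_A1 ::
  "('s \<Rightarrow> 's \<Rightarrow> bool) \<Rightarrow> real \<Rightarrow> (real \<Rightarrow> 's word \<Rightarrow> real) \<Rightarrow> bool" where
  "cond_A1 A \<theta> \<phi> \<longleftrightarrow> (SUP \<epsilon>\<in>{0<..<1}. lip_seminorm A \<theta> 2 (\<phi> \<epsilon>)) < \<infinity>"

definition cond_A2 :: "('s \<Rightarrow> 's \<Rightarrow> bool) \<Rightarrow> (real \<Rightarrow> 's word \<Rightarrow> real) \<Rightarrow> bool" where
  "cond_A2 A \<phi> \<longleftrightarrow>
     (\<Sum>\<^sub>\<infinity>a\<in>UNIV. exp_ereal (SUP \<epsilon>\<in>{0<..<1}. SUP x \<in> cyl A [a]. ereal (\<phi> \<epsilon> x))) < \<infinity>"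

definition cond_A3 ::
  "('s \<Rightarrow> 's \<Rightarrow> bool) \<Rightarrow> (real \<Rightarrow> 's word \<Rightarrow> real) \<Rightarrow> ('s word \<Rightarrow> ereal) \<Rightarrow> bool" where
  "cond_A3 A \<phi> \<phi>0 \<longleftrightarrow>
     (\<forall>x \<in> shift_space A. \<phi>0 x \<noteq> \<infinity>) \<and>
     (\<forall>a. ((\<lambda>\<epsilon>. SUP x \<in> cyl A [a].
                ennreal \<bar>exp (\<phi> \<epsilon> x) - enn2real (exp_ereal (\<phi>0 x))\<bar>) \<longlongrightarrow> 0) (at_right 0)) \<and>
     \<bar>pressure A \<phi>0\<bar> \<noteq> \<infinity>"

section \<open>Components of the limit potential\<close>

definition Bmat :: "('s \<Rightarrow> 's \<Rightarrow> bool) \<Rightarrow> ('s word \<Rightarrow> ereal) \<Rightarrow> 's \<Rightarrow> 's \<Rightarrow> bool" where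
  "Bmat A \<phi>0 i j \<longleftrightarrow> cyl A [i, j] \<noteq> {} \<and> (\<forall>x \<in> cyl A [i, j]. \<bar>\<phi>0 x\<bar> \<noteq> \<infinity>)"

definition comm_rel :: "('s \<Rightarrow> 's \<Rightarrow> bool) \<Rightarrow> ('s \<times> 's) set" where
  "comm_rel B = {(a, b). a = b \<or> (\<exists>w1 w2. successively B ([a] @ w1 @ [b]) \<and>
                                          successively B ([b] @ w2 @ [a]))}"

definition S0 :: "('s \<Rightarrow> 's \<Rightarrow> bool) \<Rightarrow> ('s word \<Rightarrow> ereal) \<Rightarrow> 's set set" where
  "S0 A \<phi>0 = {U \<in> UNIV // comm_rel (Bmat A \<phi>0).
               pressure (submatrix_on (Bmat A \<phi>0) U) \<phi>0 = pressure A \<phi>0}"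

section \<open>Ruelle--Perron--Frobenius measures\<close>

definition transfer ::
  "('s \<Rightarrow> 's \<Rightarrow> bool) \<Rightarrow> ('s \<Rightarrow> 's \<Rightarrow> bool) \<Rightarrow> ('s word \<Rightarrow> ereal) \<Rightarrow>
   ('s word \<Rightarrow> complex) \<Rightarrow> 's word \<Rightarrow> complex" where
  "transfer A M \<psi> f x =
     (if x \<in> shift_space A
      then \<Sum>\<^sub>\<infinity>a\<in>{a. M a (x 0)}. of_real (enn2real (exp_ereal (\<psi> ([a] \<frown> x)))) * f ([a] \<frown> x)
      else 0)"

abbreviation borel_of_shift :: "('s::discrete_topology \<Rightarrow> 's \<Rightarrow> bool) \<Rightarrow> 's word measure" where
  "borel_of_shift A \<equiv> restrict_space borel (shift_space A)"

(* m = h\<nu> is the RPF measure of \<psi>|X_M. The transfer operator acts on F_b(X), so the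
   eigenfunction h is taken in F_b(X) and the dual eigenvector equation is tested on F_b(X). *)
definition is_RPF_measure ::
  "('s::discrete_topology \<Rightarrow> 's \<Rightarrow> bool) \<Rightarrow> real \<Rightarrow> ('s \<Rightarrow> 's \<Rightarrow> bool) \<Rightarrow> ('s word \<Rightarrow> ereal) \<Rightarrow>
   's word measure \<Rightarrow> bool" where
  "is_RPF_measure A \<theta> M \<psi> m \<longleftrightarrow>
     (\<exists>h \<nu>. let lam = exp (real_of_ereal (pressure M \<psi>)); hc = (\<lambda>x. complex_of_real (h x)) in
        hc \<in> Fb A \<theta> \<and> (\<forall>x. 0 \<le> h x) \<and>
        transfer A M \<psi> hc = (\<lambda>x. of_real lam * hc x) \<and>
        prob_space \<nu> \<and> sets \<nu> = sets (borel_of_shift A) \<and> (AE x in \<nu>. x \<in> shift_space M) \<and>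
        (\<forall>f \<in> Fb A \<theta>. (\<integral>x. transfer A M \<psi> f x \<partial>\<nu>) = of_real lam * (\<integral>x. f x \<partial>\<nu>)) \<and>
        (\<integral>x. h x \<partial>\<nu>) = 1 \<and>
        m = density \<nu> (\<lambda>x. ennreal (h x)))"

section \<open>Induced operators and weights\<close>

definition words_from :: "'s set \<Rightarrow> 's set \<Rightarrow> 's list set" where
  "words_from U V = {a # v | a v. a \<in> U \<and> v \<in> lists V}"

definition induced_op ::
  "('s \<Rightarrow> 's \<Rightarrow> bool) \<Rightarrow> ('s word \<Rightarrow> real) \<Rightarrow> 's set \<Rightarrow> 's set \<Rightarrow> real \<Rightarrow>
   ('s word \<Rightarrow> complex) \<Rightarrow> 's word \<Rightarrow> complex" where
  "induced_op A \<psi> U V lam f x =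
     (if x \<in> shift_space A
      then \<Sum>\<^sub>\<infinity>w\<in>{w \<in> words_from U V. successively A (w @ [x 0])}.
             of_real (lam powi (1 - int (length w)) * exp (birkhoff (length w) \<psi> (w \<frown> x))) * f (w \<frown> x)
      else 0)"

definition lambda_eps :: "('s \<Rightarrow> 's \<Rightarrow> bool) \<Rightarrow> (real \<Rightarrow> 's word \<Rightarrow> real) \<Rightarrow> real \<Rightarrow> real" where
  "lambda_eps A \<phi> \<epsilon> = exp (real_of_ereal (pressure A (\<lambda>x. ereal (\<phi> \<epsilon> x))))"

definition c_eps ::
  "('s::discrete_topology \<Rightarrow> 's \<Rightarrow> bool) \<Rightarrow> real \<Rightarrow> (real \<Rightarrow> 's word \<Rightarrow> real) \<Rightarrow> (nat \<Rightarrow> 's set) \<Rightarrow>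
   real \<Rightarrow> 's set \<Rightarrow> nat \<Rightarrow> nat \<Rightarrow> real" where
  "c_eps A \<theta> \<phi> U \<epsilon> Q i j =
     spectral_radius_on (Fb A \<theta>) (norm1 A \<theta>)
       (induced_op A (\<phi> \<epsilon>) (Q \<inter> U i) (- ((U i \<union> U j) \<inter> Q)) (lambda_eps A \<phi> \<epsilon>))"

definition delta_eps ::
  "('s::discrete_topology \<Rightarrow> 's \<Rightarrow> bool) \<Rightarrow> real \<Rightarrow> (real \<Rightarrow> 's word \<Rightarrow> real) \<Rightarrow> nat \<Rightarrow>
   (nat \<Rightarrow> 's set) \<Rightarrow> real \<Rightarrow> 's set \<Rightarrow> nat \<Rightarrow> real" where
  "delta_eps A \<theta> \<phi> m0 U \<epsilon> Q i =
     inverse (1 + (\<Sum>j\<in>{1..m0} - {i}.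
       (lambda_eps A \<phi> \<epsilon> - c_eps A \<theta> \<phi> U \<epsilon> Q i j) / (lambda_eps A \<phi> \<epsilon> - c_eps A \<theta> \<phi> U \<epsilon> Q j i)))"

section \<open>Notions used in the equivalent conditions\<close>

(* Integrability is what makes \<mu>(f) meaningful, since the integral is a total function. *)
definition is_limit_measure ::
  "('s::discrete_topology \<Rightarrow> 's \<Rightarrow> bool) \<Rightarrow> real \<Rightarrow> (real \<Rightarrow> 's word measure) \<Rightarrow> 's word measure \<Rightarrow> bool"
  where
  "is_limit_measure A \<theta> \<mu>\<epsilon> \<mu> \<longleftrightarrow>
     sets \<mu> = sets (borel_of_shift A) \<and>
     (\<forall>f \<in> Fb0 A \<theta>. integrable \<mu> f \<and>
        ((\<lambda>\<epsilon>. \<integral>x. f x \<partial>(\<mu>\<epsilon> \<epsilon>)) \<longlongrightarrow> (\<integral>x. f x \<partial>\<mu>)) (at_right 0))"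

definition meets_all :: "nat \<Rightarrow> (nat \<Rightarrow> 's set) \<Rightarrow> 's set \<Rightarrow> bool" where
  "meets_all m0 U Q \<longleftrightarrow> finite Q \<and> (\<forall>k\<in>{1..m0}. Q \<inter> U k \<noteq> {})"

definition exhausting :: "nat \<Rightarrow> (nat \<Rightarrow> 's set) \<Rightarrow> (nat \<Rightarrow> 's set) \<Rightarrow> bool" where
  "exhausting m0 U Q \<longleftrightarrow>
     (\<forall>n. meets_all m0 U (Q n)) \<and> (\<forall>n. Q n \<subseteq> Q (Suc n)) \<and> (\<Union>n. Q n) = UNIV"

definition weights_converge ::
  "('s::discrete_topology \<Rightarrow> 's \<Rightarrow> bool) \<Rightarrow> real \<Rightarrow> (real \<Rightarrow> 's word \<Rightarrow> real) \<Rightarrow> nat \<Rightarrow>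
   (nat \<Rightarrow> 's set) \<Rightarrow> (real \<Rightarrow> 's word measure) \<Rightarrow> 's set \<Rightarrow> bool" where
  "weights_converge A \<theta> \<phi> m0 U \<mu>\<epsilon> Q \<longleftrightarrow>
     (\<exists>a::real. ((\<lambda>\<epsilon>. measure (\<mu>\<epsilon> \<epsilon>) (Sig A Q)) \<longlongrightarrow> a) (at_right 0) \<and>
        (a > 0 \<longrightarrow> (\<forall>k\<in>{1..m0}. \<exists>d::real.
           ((\<lambda>\<epsilon>. delta_eps A \<theta> \<phi> m0 U \<epsilon> Q k) \<longlongrightarrow> d) (at_right 0))))"

definition products_converge ::
  "('s::discrete_topology \<Rightarrow> 's \<Rightarrow> bool) \<Rightarrow> real \<Rightarrow> (real \<Rightarrow> 's word \<Rightarrow> real) \<Rightarrow> nat \<Rightarrow>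
   (nat \<Rightarrow> 's set) \<Rightarrow> (real \<Rightarrow> 's word measure) \<Rightarrow> 's set \<Rightarrow> bool" where
  "products_converge A \<theta> \<phi> m0 U \<mu>\<epsilon> Q \<longleftrightarrow>
     (\<forall>k\<in>{1..m0}. \<exists>l::real.
        ((\<lambda>\<epsilon>. measure (\<mu>\<epsilon> \<epsilon>) (Sig A Q) * delta_eps A \<theta> \<phi> m0 U \<epsilon> Q k) \<longlongrightarrow> l) (at_right 0))"

end

theory Submission
 imports Defs
begin

text \<open>Let \<open>U\<close> be a component of full pressure. The eigenfunctions of the perturbed operators are
excessive for a small perturbation of the operator of \<open>U\<close>; integrating the defect of \<open>min F (c h\<^sub>U)\<close>
against the eigenmeasure of \<open>U\<close> forces them, after normalisation, to converge to \<open>h\<^sub>U\<close> uniformly on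
cylinders, and a cone contraction gives the same for the conditional eigenmeasures. States outside
these components lose their mass, by a second moment bound on the number of returns. So on finite sets
of states \<open>\<mu>\<^sub>\<epsilon>\<close> is asymptotically \<open>\<Sum>\<^sub>k q\<^sub>k(\<epsilon>) \<mu>(U(k))\<close>. For the induced operators, \<open>1 - c\<^sub>\<epsilon>(Q,i,j)/\<lambda>\<^sub>\<epsilon>\<close> is
asymptotically the flux from \<open>Q \<inter> U(i)\<close> to \<open>Q \<inter> U(j)\<close> divided by \<open>\<mu>\<^sub>\<epsilon>(Q \<inter> U(i))\<close>. This flux is
symmetric in \<open>i\<close> and \<open>j\<close>, whence \<open>\<mu>\<^sub>\<epsilon>(Q) \<delta>\<^sub>\<epsilon>(Q,i)\<close> is asymptotically \<open>\<mu>\<^sub>\<epsilon>(Q \<inter> U(i))\<close>, and each of the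
four conditions says that all \<open>q\<^sub>k(\<epsilon>)\<close> converge.\<close>

section \<open>Words and cylinders\<close>

text \<open>The obstacle is that nothing is compact and nothing is uniform in the parameter: with
  infinitely many states, and with transitions that degenerate in the limit, neither a uniform
  spectral gap nor tightness of the measures is available. One inequality replaces both: operators
  that sum over any set of words preserve a cone of log-Lipschitz functions with a constant
  \<open>K\<close> that does not depend on the parameter, so a cone function is known on a
  one-cylinder, up to a fixed factor, from one value or from its mean. Only finitely many states and
  words are then compared, and the tails are controlled by eigenfunctions. The weights arise because
  \<open>(\<lambda> - c i j) / (\<lambda> - c j i)\<close> behaves like the mass of
  \<open>Q \<inter> U j\<close> divided by that of \<open>Q \<inter> U i\<close>; hence
  \<open>\<delta> i\<close> is asymptotically the share of \<open>U i\<close> in the mass that the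
  components give to \<open>Q\<close>. To relate a spectral radius to a flux, a positive function is
  needed that belongs to the induced operator and still resembles the eigenfunction on the
  component. Resolvents at points just above the spectral radius serve for this, since they are
  again excessive for the component.\<close>

declare build_split [rule del]
no_notation Stream.stream.SCons (infixr \<open>##\<close> 65)

lemma conc_0: "w ~= [] ==> (w \<frown> x) 0 = hd w"
 by (cases w) auto

lemma shift_space_build: "a ## x \<in> shift_space A \<longleftrightarrow> A a (x 0) & x \<in> shift_space A"
proof -
 have "(ALL k. A ((a ## x) k) ((a ## x) (Suc k))) \<longleftrightarrow>
    A ((a ## x) 0) ((a ## x) (Suc 0)) & (ALL k. A ((a ## x) (Suc k)) ((a ## x) (Suc (Suc k))))"
  by (metis not0_implies_Suc)
 then show ?thesis by (simp add: shift_space_def)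
qed

lemma shift_space_conc:
 "w \<frown> x \<in> shift_space A \<longleftrightarrow> successively A (w @ [x 0]) & x \<in> shift_space A"
proof (induction w)
 case (Cons a w)
 have "(w \<frown> x) 0 = hd (w @ [x 0])" by (cases w) auto
 then have "A a ((w \<frown> x) 0) & successively A (w @ [x 0]) \<longleftrightarrow> successively A ((a # w) @ [x 0])"
  by (cases "w @ [x 0]") auto
 moreover have "(a # w) \<frown> x \<in> shift_space A \<longleftrightarrow> A a ((w \<frown> x) 0) & w \<frown> x \<in> shift_space A"
  by (simp only: build_cons shift_space_build)
 ultimately show ?case using Cons by metis
qed simp

lemma shift_space_suffix: "x \<in> shift_space A ==> suffix k x \<in> shift_space A"
 by (simp add: shift_space_def)

lemma prefix_eq_iff: "prefix n x = prefix n y \<longleftrightarrow> (ALL k<n. x k = y k)"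
 unfolding list_eq_iff_nth_eq by simp

lemma prefix_eq_list_iff: "prefix (length w) x = w \<longleftrightarrow> (ALL k<length w. x k = w ! k)"
 unfolding list_eq_iff_nth_eq by simp

lemma cyl_eq: "cyl A w = {x \<in> shift_space A. ALL k<length w. x k = w ! k}"
 unfolding cyl_def prefix_eq_list_iff ..

lemma cyl_sing: "cyl A [a] = {x \<in> shift_space A. x 0 = a}"
 by (simp add: cyl_eq)

lemma cyl_build: "a ## x \<in> cyl A (b # w) \<longleftrightarrow> a = b & A a (x 0) & x \<in> cyl A w"
proof -
 have "(ALL k<Suc (length w). (a ## x) k = (b # w) ! k) \<longleftrightarrow> a = b & (ALL k<length w. x k = w ! k)"
  by (simp only: All_less_Suc2) simp
 then show ?thesis
  by (simp only: cyl_eq mem_Collect_eq length_Cons shift_space_build) blast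
qed

lemma Sig_eq: "Sig A Q = {x \<in> shift_space A. x 0 \<in> Q}"
 by (auto simp: Sig_def cyl_sing)

section \<open>The metric\<close>

context
 fixes \<theta> :: real
 assumes \<theta>: "0 < \<theta>" "\<theta> < 1"
begin

lemma dtheta_self [simp]: "dtheta \<theta> x x = 0"
 by (simp add: dtheta_def)

lemma dtheta_sym: "dtheta \<theta> x y = dtheta \<theta> y x"
 by (simp add: dtheta_def eq_commute)

lemma dtheta_nonneg: "0 <= dtheta \<theta> x y"
 using \<theta> by (simp add: dtheta_def)

lemma dtheta_le_power:
 assumes "!!k. k < n ==> x k = y k"
 shows "dtheta \<theta> x y <= \<theta> ^ n"
proof (cases "x = y")
 case False
 then obtain k where k: "x k ~= y k" by auto
 have "x (LEAST n. x n ~= y n) ~= y (LEAST n. x n ~= y n)" by (rule LeastI[of "%k. x k ~= y k", OF k])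
 then have "n <= (LEAST n. x n ~= y n)" using assms by (metis not_le)
 then show ?thesis using False \<theta> by (simp add: dtheta_def power_decreasing)
qed (use \<theta> in simp)

lemma dtheta_le_1: "dtheta \<theta> x y <= 1"
 using dtheta_le_power[of 0 x y] by simp

lemma dtheta_build: "dtheta \<theta> (a ## x) (a ## y) = \<theta> * dtheta \<theta> x y"
proof (cases "x = y")
 case False
 then obtain k where k: "x k ~= y k" by auto
 have "(LEAST n. (a ## x) n ~= (a ## y) n) = Suc (LEAST m. (a ## x) (Suc m) ~= (a ## y) (Suc m))"
  by (rule Least_Suc[where n = "Suc k"]) (use k in auto)
 then show ?thesis using False by (simp add: dtheta_def)
qed simp

lemma dtheta_conc: "dtheta \<theta> (w \<frown> x) (w \<frown> y) = \<theta> ^ length w * dtheta \<theta> x y"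
 by (induction w) (auto simp: dtheta_build)

end

section \<open>Borel structure of the sequence space\<close>

lemma open_cylinder_nbhd:
 fixes U :: "('s::discrete_topology) word set"
 assumes "open U" "x \<in> U"
 shows "EX n. ALL y. (ALL k<n. y k = x k) --> y \<in> U"
proof -
 obtain X where X: "x \<in> Pi\<^sub>E UNIV X" "!!i. openin euclidean (X i)"
   "finite {i. X i ~= topspace euclidean}" "Pi\<^sub>E UNIV X \<subseteq> U"
  using product_topology_open_contains_basis[OF assms(1)[unfolded open_fun_def] assms(2)] by blast
 then obtain n where n: "!!i. X i ~= UNIV ==> i < n"
  using finite_nat_set_iff_bounded by auto
 show ?thesis
 proof (intro exI allI impI)
  fix y assume "ALL k<n. y k = x k"
  then have "y \<in> Pi\<^sub>E UNIV X" using X(1) n by (auto simp: PiE_iff) (metis UNIV_I)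
  then show "y \<in> U" using X(4) by auto
 qed
qed

lemma open_cylinder:
 fixes w :: "('s::discrete_topology) list"
 shows "open {y. ALL k<length w. y k = w ! k}"
proof -
 have "{y. ALL k<length w. y k = w ! k} = (\<Inter>k\<in>{..<length w}. (%y. y k) -` {w ! k})" by auto
 also have "open ..."
  by (intro open_INT ballI open_vimage)
   (auto intro: continuous_on_product_coordinates discrete_topology_class.open_discrete)
 finally show ?thesis .
qed

lemma shift_space_borel:
 fixes A :: "'s::{countable,discrete_topology} => 's => bool"
 shows "shift_space A \<in> sets borel"
proof -
 have "closed (shift_space A)"
  unfolding closed_def
 proof (subst open_subopen, intro ballI)
  fix x assume "x \<in> - shift_space A"
  then obtain k where k: "\<not> A (x k) (x (Suc k))" by (auto simp: shift_space_def)
  let ?T = "(%y. y k) -` {x k} \<inter> (%y. y (Suc k)) -` {x (Suc k)}"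
  have "open ?T"
   by (intro open_Int open_vimage)
    (auto intro: continuous_on_product_coordinates discrete_topology_class.open_discrete)
  moreover have "y \<in> - shift_space A" if "y \<in> ?T" for y
  proof -
   have "\<not> A (y k) (y (Suc k))" using k that by simp
   then show ?thesis unfolding shift_space_def by blast
  qed
  ultimately show "EX T. open T & x \<in> T & T \<subseteq> - shift_space A"
   by (intro exI[of _ ?T]) blast
 qed
 then show ?thesis by simp
qed

text \<open>Words over a countable alphabet are countable, so an open set is a countable union of
  the cylinders it contains; \<open>open_cylinder_nbhd\<close> puts one around each of its points.
  This lets a limit measure be identified from its values on cylinders.\<close>

lemma sets_borel_of_shift:
 fixes A :: "'s::{countable,discrete_topology} => 's => bool"
 shows "sets (borel_of_shift A) = sigma_sets (shift_space A) (range (cyl A))"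
proof (rule antisym)
 have "sets (borel_of_shift A) = sigma_sets (shift_space A) ((\<inter>) (shift_space A) ` {U. open U})"
  unfolding borel_def sets_restrict_space
  using shift_space_borel[of A]
  by (subst sets_measure_of) (auto simp: borel_def intro!: sigma_sets_Int)
 also have "... \<subseteq> sigma_sets (shift_space A) (range (cyl A))"
 proof (rule sigma_sets_mono, safe)
  fix U :: "'s word set" assume U: "open U"
  let ?W = "{w. cyl A w \<subseteq> U}"
  have "shift_space A \<inter> U = (\<Union>w\<in>?W. cyl A w)"
  proof safe
   fix x assume x: "x \<in> shift_space A" "x \<in> U"
   obtain n where n: "ALL y. (ALL k<n. y k = x k) --> y \<in> U" using open_cylinder_nbhd[OF U x(2)] by auto
   have "prefix n x \<in> ?W" using n by (auto simp: cyl_eq)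
   moreover have "x \<in> cyl A (prefix n x)" using x by (simp add: cyl_eq)
   ultimately show "x \<in> (\<Union>w\<in>?W. cyl A w)" by blast
  qed (auto simp: cyl_def)
  also have "... \<in> sigma_sets (shift_space A) (range (cyl A))"
   by (rule sigma_sets_UNION) (auto intro: sigma_sets.Basic)
  finally show "shift_space A \<inter> U \<in> sigma_sets (shift_space A) (range (cyl A))" .
 qed
 finally show "sets (borel_of_shift A) \<subseteq> sigma_sets (shift_space A) (range (cyl A))" .
next
 have "cyl A w \<in> sets (borel_of_shift A)" for w
 proof -
  have "cyl A w = shift_space A \<inter> {y. ALL k<length w. y k = w ! k}" by (auto simp: cyl_eq)
  then show ?thesis using open_cylinder[of w] by (auto simp: sets_restrict_space)
 qed
 then show "sigma_sets (shift_space A) (range (cyl A)) \<subseteq> sets (borel_of_shift A)"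
  using sets.sigma_sets_subset[of "range (cyl A)" "borel_of_shift A"]
  by (simp add: space_restrict_space image_subset_iff)
qed

lemma cyl_sets [measurable]:
 fixes A :: "'s::{countable,discrete_topology} => 's => bool"
 shows "cyl A w \<in> sets (borel_of_shift A)"
 by (auto simp: sets_borel_of_shift)

lemma Sig_sets:
 fixes A :: "'s::{countable,discrete_topology} => 's => bool"
 shows "Sig A Q \<in> sets (borel_of_shift A)"
 unfolding Sig_def by (intro sets.countable_UN') auto

lemma cyl_Int:
 assumes "length v <= length w"
 shows "cyl A v \<inter> cyl A w = (if take (length v) w = v then cyl A w else {})"
proof -
 have "take (length v) w = prefix (length v) x" if "x \<in> cyl A w" for x
 proof -
  have "w = prefix (length w) x" using that by (simp add: cyl_def)
  then have "take (length v) w = take (length v) (prefix (length w) x)" by simp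
  then show ?thesis using assms by (simp add: min_absorb1)
 qed
 moreover have "x \<in> cyl A v \<longleftrightarrow> x \<in> shift_space A & prefix (length v) x = v" for x by (simp add: cyl_def)
 moreover have "x \<in> shift_space A" if "x \<in> cyl A w" for x using that by (simp add: cyl_def)
 ultimately show ?thesis by (cases "take (length v) w = v") (metis (no_types, lifting) Int_absorb1 subsetI, metis (no_types, lifting) IntE equals0I)
qed

lemma cyl_Int_cases: "cyl A v \<inter> cyl A w \<in> {{}, cyl A v, cyl A w}"
proof (cases "length v <= length w")
 case False
 then have "cyl A w \<inter> cyl A v \<in> {{}, cyl A v}" by (simp add: cyl_Int)
 then show ?thesis by (auto simp: Int_commute)
qed (simp add: cyl_Int)

text \<open>Two cylinders are nested or disjoint. The empty set is added to obtain a pi-system, as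
  the uniqueness argument in \<open>limit_unique\<close> requires.\<close>

lemma Int_stable_cyl: "Int_stable (insert {} (range (cyl A)))"
proof (rule Int_stableI)
 fix a b assume "a \<in> insert {} (range (cyl A))" "b \<in> insert {} (range (cyl A))"
 then consider "a = {}" | "b = {}" | v w where "a = cyl A v" "b = cyl A w" by blast
 then show "a \<inter> b \<in> insert {} (range (cyl A))"
 proof cases
  case 3 then show ?thesis using cyl_Int_cases[of A v w] by blast
 qed auto
qed

section \<open>Weighted sums over inverse branches\<close>

text \<open>The weight of the inverse branch \<open>x \<mapsto> w \<frown> x\<close>: where
  \<open>G\<close> is the exponential of a potential, this is the exponential of the Birkhoff sum
  along \<open>w\<close>, divided by \<open>l ^ length w\<close> (see
  \<open>p_birkhoff\<close>).\<close>

primrec pw :: "('s word => real) => real => 's list => 's word => real" where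
 "pw G l [] x = 1"
| "pw G l (a # w) x = G (a ## w \<frown> x) / l * pw G l w x"

definition Op :: "('s word => real) => real => 's list set => ('s word => real) => 's word => real" where
 "Op G l I f x = (\<Sum>\<^sub>\<infinity>w\<in>I. pw G l w x * f (w \<frown> x))"

definition letters :: "'s set => 's list set" where
 "letters V = (%a. [a]) ` V"

text \<open>The new letter is the one next to the base point, so in \<open>Op_snoc\<close> it yields
  the outermost operator. Word sets are therefore grown at the end.\<close>

definition snoc :: "'s list set => 's set => 's list set" where
 "snoc I V = (%(a, u). u @ [a]) ` (V \<times> I)"

definition chi :: "'s set => 's word => real" where
 "chi Q x = (if x 0 \<in> Q then 1 else 0)"

abbreviation int_on :: "'s word measure => 's set => ('s word => real) => real" where
 "int_on \<mu> Q f \<equiv> \<integral>x. chi Q x * f x \<partial>\<mu>"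

abbreviation eventually_seq (binder "EV " 10) where "eventually_seq P \<equiv> eventually P sequentially"

lemma pw_append: "pw G l (u @ v) x = pw G l u (v \<frown> x) * pw G l v x"
 by (induction u) (auto simp: mult_ac)

lemma inj_snoc: "inj_on (%(a, u). u @ [a]) S"
 by (auto simp: inj_on_def)

text \<open>Below, \<open>G\<close> is the exponential of the potential, and \<open>K\<close> solves \<open>K = (C + K) \<theta>\<close>, so that the cone
 \<open>harn K\<close> of log-Lipschitz functions is invariant under \<open>Op G l I\<close> for every set \<open>I\<close> of words.\<close>

locale weight =
 fixes A :: "'s::{countable,discrete_topology} => 's => bool" and \<theta> C :: real
  and G :: "'s word => real" and Mj :: "'s => real" and l :: real
 assumes theta: "0 < \<theta>" "\<theta> < 1" and C_nonneg: "0 <= C"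
  and G_nonneg: "!!x. 0 <= G x" and G_off: "!!x. x \<notin> shift_space A ==> G x = 0"
  and G_dist: "!!x y. x \<in> shift_space A ==> y \<in> shift_space A ==> x 0 = y 0 ==>
   x (Suc 0) = y (Suc 0) ==> G x <= exp (C * dtheta \<theta> x y) * G y"
  and G_le: "!!x. G x <= Mj (x 0)" and Mj_sum: "Mj summable_on UNIV"
  and l_pos: "0 < l"
begin

abbreviation X where "X \<equiv> shift_space A"
abbreviation d where "d \<equiv> dtheta \<theta>"
abbreviation p where "p \<equiv> pw G l"
abbreviation T where "T \<equiv> Op G l"
abbreviation T1 where "T1 \<equiv> T (letters UNIV)"

definition K where "K = C * \<theta> / (1 - \<theta>)"

text \<open>The cone of the Harnack inequality: \<open>d\<close> is at most 1, so for
  \<open>k >= 0\<close> two values over the same first letter differ at most by the factor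
  \<open>exp k\<close>. No bound on the function is included.\<close>

definition harn :: "real => ('s word => real) => bool" where
 "harn k f \<longleftrightarrow> (ALL x:X. 0 <= f x & (ALL y:X. x 0 = y 0 --> f x <= exp (k * d x y) * f y))"

definition bd :: "('s word => real) => bool" where
 "bd f \<longleftrightarrow> (EX B. ALL x:X. \<bar>f x\<bar> <= B)"

text \<open>A bound on finite partial sums that is uniform in the base point makes \<open>Op\<close>
  a bounded operator, and it passes to subsets, unions and \<open>snoc\<close>.\<close>

definition adm :: "'s list set => bool" where
 "adm I \<longleftrightarrow> (EX B. ALL x:X. ALL F. finite F & F \<subseteq> I --> (\<Sum>w\<in>F. p w x) <= B)"

text \<open>Up to extension by zero, the members of \<open>Fb\<close> are the functions whose real
  and imaginary parts are of this kind (\<open>Fb_iff\<close>).\<close>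

definition bl :: "('s word => real) => bool" where
 "bl f \<longleftrightarrow> (EX c. ALL x:X. \<bar>f x\<bar> <= c & (ALL y:X. x 0 = y 0 --> \<bar>f x - f y\<bar> <= c * d x y))"

lemma d_nonneg: "0 <= d x y" and d_le_1: "d x y <= 1" and d_sym: "d x y = d y x"
 and d_self: "d x x = 0"
 using dtheta_nonneg[OF theta] dtheta_le_1[OF theta] dtheta_sym[OF theta] dtheta_self[OF theta] by auto

lemma K_nonneg: "0 <= K"
 using theta C_nonneg by (simp add: K_def)

lemma K_eq: "C * \<theta> = K * (1 - \<theta>)"
 using theta by (simp add: K_def)

lemma p_nonneg: "0 <= p w x"
 by (induction w) (auto simp: G_nonneg l_pos less_imp_le)

lemma p_off: "w ~= [] ==> w \<frown> x \<notin> X ==> p w x = 0"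
 by (cases w) (auto simp: G_off)

lemma p_eq_0_or_in_X: "x \<in> X ==> p w x = 0 \<or> w \<frown> x \<in> X"
 using p_off[of w x] by (cases "w = []") auto

lemma conc_same_0: "x 0 = y 0 ==> (w \<frown> x) 0 = (w \<frown> y) 0"
 by (cases w) auto

lemma conc_in_X_cong: "x \<in> X ==> y \<in> X ==> x 0 = y 0 ==> w \<frown> x \<in> X \<longleftrightarrow> w \<frown> y \<in> X"
 by (simp add: shift_space_conc)

lemma d_conc: "d (w \<frown> x) (w \<frown> y) = \<theta> ^ length w * d x y"
 by (rule dtheta_conc[OF theta])

text \<open>A letter followed by \<open>n\<close> others contributes
  \<open>C * \<theta> ^ Suc n\<close>, and these geometric terms add up to
  \<open>K * (1 - \<theta> ^ length w)\<close> because
  \<open>C * \<theta> = K * (1 - \<theta>)\<close>. The constant stays below \<open>K\<close> for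
  words of every length.\<close>

lemma p_dist:
 assumes "x \<in> X" "y \<in> X" "x 0 = y 0"
 shows "p w x <= exp (K * (1 - \<theta> ^ length w) * d x y) * p w y"
proof (induction w)
 case (Cons a w)
 show ?case
 proof (cases "a ## w \<frown> x \<in> X")
  case True
  have y: "a ## w \<frown> y \<in> X" using True conc_in_X_cong[OF assms, of "a # w"] by simp
  have "G (a ## w \<frown> x) <= exp (C * d (a ## w \<frown> x) (a ## w \<frown> y)) * G (a ## w \<frown> y)"
   by (rule G_dist[OF True y]) (use conc_same_0[of x y w, OF assms(3)] in auto)
  also have "C * d (a ## w \<frown> x) (a ## w \<frown> y) = C * (\<theta> * \<theta> ^ length w * d x y)"
   using d_conc[of "a # w" x y] by simp
  also have "... = K * (1 - \<theta>) * \<theta> ^ length w * d x y"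
   using K_eq by (simp add: mult_ac)
  finally have "G (a ## w \<frown> x) / l * p w x <=
    (exp (K * (1 - \<theta>) * \<theta> ^ length w * d x y) * G (a ## w \<frown> y) / l) *
    (exp (K * (1 - \<theta> ^ length w) * d x y) * p w y)"
   using Cons l_pos
   by (intro mult_mono divide_right_mono) (auto simp: G_nonneg p_nonneg less_imp_le)
  also have "... = exp (K * (1 - \<theta>) * \<theta> ^ length w * d x y + K * (1 - \<theta> ^ length w) * d x y) *
    p (a # w) y"
   by (simp add: exp_add mult_ac)
  also have "K * (1 - \<theta>) * \<theta> ^ length w * d x y + K * (1 - \<theta> ^ length w) * d x y
    = K * (1 - \<theta> ^ length (a # w)) * d x y"
   by (simp add: algebra_simps)
  finally show ?thesis by simp
 next
  case False
  then show ?thesis by (simp add: G_off mult_nonneg_nonneg G_nonneg p_nonneg l_pos less_imp_le)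
 qed
qed simp

lemma harnD: "harn k f ==> x \<in> X ==> y \<in> X ==> x 0 = y 0 ==> f x <= exp (k * d x y) * f y"
 and harn_nonneg: "harn k f ==> x \<in> X ==> 0 <= f x"
 by (auto simp: harn_def)

lemma harnD1:
 assumes "harn k f" "0 <= k" "x \<in> X" "y \<in> X" "x 0 = y 0"
 shows "f x <= exp k * f y"
proof -
 have "k * d x y <= k" using assms(2) d_nonneg[of x y] d_le_1[of x y] by (simp add: mult_left_le)
 then have "exp (k * d x y) * f y <= exp k * f y"
  using harn_nonneg[OF assms(1,4)] by (intro mult_right_mono) auto
 then show ?thesis using harnD[OF assms(1,3,4,5)] by linarith
qed

lemma harn_mono:
 assumes "harn k f" "k <= k'"
 shows "harn k' f"
 unfolding harn_def
proof (intro ballI conjI impI)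
 fix x y assume x: "x \<in> X" "y \<in> X" "x 0 = y 0"
 have "exp (k * d x y) * f y <= exp (k' * d x y) * f y"
  using assms x by (intro mult_right_mono) (auto simp: harn_def d_nonneg mult_right_mono)
 then show "f x <= exp (k' * d x y) * f y" using harnD[OF assms(1) x] by linarith
qed (use assms in \<open>auto simp: harn_def\<close>)

text \<open>The distortions of the weight and of \<open>f\<close> add up to
  \<open>K * (1 - \<theta> ^ n) + k * \<theta> ^ n\<close>: words of length \<open>n\<close> pull
  \<open>k\<close> towards \<open>K\<close> by the factor \<open>\<theta> ^ n\<close>. Both the
  invariance and the strict contraction of the cone come from here.\<close>

lemma term_dist:
 assumes "harn k f" "x \<in> X" "y \<in> X" "x 0 = y 0"
 shows "p w x * f (w \<frown> x) <= exp ((K + (k - K) * \<theta> ^ length w) * d x y) * (p w y * f (w \<frown> y))"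
proof (cases "w \<frown> x \<in> X")
 case True
 then have y: "w \<frown> y \<in> X" using conc_in_X_cong[OF assms(2-4), of w] by simp
 have "f (w \<frown> x) <= exp (k * d (w \<frown> x) (w \<frown> y)) * f (w \<frown> y)"
  using harnD[OF assms(1) True y] conc_same_0[of x y w, OF assms(4)] by simp
 then have "p w x * f (w \<frown> x) <= (exp (K * (1 - \<theta> ^ length w) * d x y) * p w y) *
   (exp (k * (\<theta> ^ length w * d x y)) * f (w \<frown> y))"
  using p_dist[OF assms(2-4), of w] harn_nonneg[OF assms(1) True]
  by (intro mult_mono) (auto simp: p_nonneg d_conc)
 also have "... = exp (K * (1 - \<theta> ^ length w) * d x y + k * (\<theta> ^ length w * d x y)) * (p w y * f (w \<frown> y))"
  by (simp add: exp_add mult_ac)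
 also have "K * (1 - \<theta> ^ length w) * d x y + k * (\<theta> ^ length w * d x y) = (K + (k - K) * \<theta> ^ length w) * d x y"
  by (simp add: algebra_simps)
 finally show ?thesis .
next
 case False
 then have "w \<frown> y \<notin> X" "w ~= []" using conc_in_X_cong[OF assms(2-4), of w] assms(2) by auto
 then show ?thesis using False by (simp add: p_off)
qed

lemma bd_const: "bd (%_. c)" and bd_chi: "bd (chi Q)"
 unfolding bd_def chi_def by (rule exI[of _ "\<bar>c\<bar>"], simp) (rule exI[of _ 1], simp)

lemma bdE:
 assumes "bd f" obtains B where "0 <= B" "!!x. x \<in> X ==> \<bar>f x\<bar> <= B"
proof -
 obtain B where B: "ALL x:X. \<bar>f x\<bar> <= B" using assms by (auto simp: bd_def)
 then have "\<bar>f x\<bar> <= max 0 B" if "x \<in> X" for x using that by force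
 then show ?thesis using that[of "max 0 B"] by simp
qed

lemma bd_mult: assumes "bd f" "bd g" shows "bd (%x. f x * g x)"
proof -
 obtain B where B: "0 <= B" "!!x. x \<in> X ==> \<bar>f x\<bar> <= B" by (rule bdE[OF assms(1)]) blast
 obtain B' where B': "0 <= B'" "!!x. x \<in> X ==> \<bar>g x\<bar> <= B'" by (rule bdE[OF assms(2)]) blast
 show ?thesis unfolding bd_def
  by (rule exI[of _ "B * B'"], intro ballI, unfold abs_mult, intro mult_mono B B') auto
qed

lemma bd_add: assumes "bd f" "bd g" shows "bd (%x. f x + g x)"
proof -
 obtain B where B: "0 <= B" "!!x. x \<in> X ==> \<bar>f x\<bar> <= B" by (rule bdE[OF assms(1)]) blast
 obtain B' where B': "0 <= B'" "!!x. x \<in> X ==> \<bar>g x\<bar> <= B'" by (rule bdE[OF assms(2)]) blast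
 have "\<bar>f x + g x\<bar> <= B + B'" if "x \<in> X" for x
  using B(2)[OF that] B'(2)[OF that] by linarith
 then show ?thesis unfolding bd_def by blast
qed

lemma bd_cmult: "bd f ==> bd (%x. c * f x)"
 using bd_mult[OF bd_const] .

lemma bd_diff: "bd f ==> bd g ==> bd (%x. f x - g x)"
 using bd_add[of f "%x. -1 * g x"] bd_cmult[of g "-1"] by simp

lemma admI: "(!!x F. x \<in> X ==> finite F ==> F \<subseteq> I ==> (\<Sum>w\<in>F. p w x) <= B) ==> adm I"
 unfolding adm_def by (rule exI[of _ B]) simp

lemma admE:
 assumes "adm I"
 obtains B where "!!x F. x \<in> X ==> finite F ==> F \<subseteq> I ==> (\<Sum>w\<in>F. p w x) <= B"
proof -
 obtain B where "ALL x:X. ALL F. finite F & F \<subseteq> I --> (\<Sum>w\<in>F. p w x) <= B"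
  using assms[unfolded adm_def] by (elim exE)
 then show ?thesis by (intro that[of B]) simp
qed

lemma adm_mono: assumes "adm I" "J \<subseteq> I" shows "adm J"
proof -
 obtain B where B: "!!x F. x \<in> X ==> finite F ==> F \<subseteq> I ==> (\<Sum>w\<in>F. p w x) <= B"
  by (rule admE[OF assms(1)], rule that)
 show ?thesis by (rule admI, rule B) (use assms(2) in auto)
qed

lemma adm_empty: "adm {}"
 by (rule admI[of _ 0]) simp

lemma Op_summable:
 assumes "adm I" "bd f" "x \<in> X"
 shows "(%w. p w x * f (w \<frown> x)) summable_on I"
proof -
 obtain B where B: "!!F. finite F ==> F \<subseteq> I ==> (\<Sum>w\<in>F. p w x) <= B"
  by (rule admE[OF assms(1)]) (use assms(3) in blast)
 obtain D where D: "0 <= D" "!!x. x \<in> X ==> \<bar>f x\<bar> <= D" by (rule bdE[OF assms(2)]) blast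
 have "(%w. p w x) summable_on I"
  using B by (intro nonneg_bdd_above_summable_on) (auto simp: p_nonneg bdd_above_def)
 then have "(%w. p w x * D) summable_on I" by (rule summable_on_cmult_left)
 then have "(%w. norm (p w x * f (w \<frown> x))) summable_on I"
 proof (rule summable_on_comparison_test)
  fix w assume "w \<in> I"
  show "norm (p w x * f (w \<frown> x)) <= p w x * D"
  proof (cases "p w x = 0")
   case False
   then have "\<bar>f (w \<frown> x)\<bar> <= D" using p_eq_0_or_in_X[OF assms(3), of w] D by blast
   then show ?thesis using p_nonneg[of w x] by (simp add: abs_mult mult_left_mono)
  qed simp
 qed auto
 then show ?thesis by (rule abs_summable_summable)
qed

lemma Op_mono:
 assumes "adm I" "bd f" "bd g" "x \<in> X" "!!w. w \<in> I ==> w \<frown> x \<in> X ==> f (w \<frown> x) <= g (w \<frown> x)"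
 shows "T I f x <= T I g x"
 unfolding Op_def
proof (intro infsum_mono Op_summable assms)
 fix w assume "w \<in> I"
 show "p w x * f (w \<frown> x) <= p w x * g (w \<frown> x)"
  using p_eq_0_or_in_X[OF assms(4), of w] assms(5)[OF \<open>w \<in> I\<close>]
  by (cases "p w x = 0") (auto intro!: mult_left_mono p_nonneg)
qed

lemma Op_cong:
 assumes "x \<in> X" "!!w. w \<in> I ==> w \<frown> x \<in> X ==> f (w \<frown> x) = g (w \<frown> x)"
 shows "T I f x = T I g x"
 unfolding Op_def
proof (intro infsum_cong)
 fix w assume "w \<in> I"
 show "p w x * f (w \<frown> x) = p w x * g (w \<frown> x)"
  using p_eq_0_or_in_X[OF assms(1), of w] assms(2)[OF \<open>w \<in> I\<close>] by auto
qed

lemma Op_nonneg: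
 assumes "x \<in> X" "!!w. w \<in> I ==> w \<frown> x \<in> X ==> 0 <= f (w \<frown> x)"
 shows "0 <= T I f x"
 unfolding Op_def
proof (intro infsum_nonneg)
 fix w assume "w \<in> I"
 show "0 <= p w x * f (w \<frown> x)"
  using p_eq_0_or_in_X[OF assms(1), of w] assms(2)[OF \<open>w \<in> I\<close>] p_nonneg[of w x] by auto
qed

lemma Op_add:
 assumes "adm I" "bd f" "bd g" "x \<in> X"
 shows "T I (%x. f x + g x) x = T I f x + T I g x"
 unfolding Op_def distrib_left
 by (rule infsum_add) (auto intro!: Op_summable assms)

lemma Op_cmult: "T I (%x. c * f x) x = c * T I f x"
 unfolding Op_def by (subst infsum_cmult_right'[symmetric]) (simp add: mult_ac)

lemma Op_diff:
 assumes "adm I" "bd f" "bd g" "x \<in> X"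
 shows "T I (%x. f x - g x) x = T I f x - T I g x"
 using Op_add[OF assms(1,2) bd_cmult[OF assms(3), of "-1"] assms(4)] Op_cmult[of I "-1" g x] by simp

lemma Op_subset:
 assumes "adm I" "bd f" "x \<in> X" "J \<subseteq> I" "!!w. w \<in> I ==> w \<frown> x \<in> X ==> 0 <= f (w \<frown> x)"
 shows "T J f x <= T I f x"
 unfolding Op_def
proof (rule infsum_mono2)
 show "(%w. p w x * f (w \<frown> x)) summable_on J" "(%w. p w x * f (w \<frown> x)) summable_on I"
  using Op_summable[OF adm_mono[OF assms(1,4)] assms(2,3)] Op_summable[OF assms(1-3)] by auto
 fix w assume "w \<in> I - J"
 show "0 <= p w x * f (w \<frown> x)"
  using p_eq_0_or_in_X[OF assms(3), of w] assms(5)[of w] \<open>w \<in> I - J\<close> p_nonneg[of w x] by auto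
qed (use assms in auto)

lemma Op_Un:
 assumes "adm I" "adm J" "bd f" "x \<in> X" "I \<inter> J = {}"
 shows "T (I \<union> J) f x = T I f x + T J f x"
 unfolding Op_def by (rule infsum_Un_disjoint) (auto intro!: Op_summable assms)

lemma adm_Un: assumes "adm I" "adm J" shows "adm (I \<union> J)"
proof -
 obtain B where B: "!!x F. x \<in> X ==> finite F ==> F \<subseteq> I ==> (\<Sum>w\<in>F. p w x) <= B"
  by (rule admE[OF assms(1)], rule that)
 obtain B' where B': "!!x F. x \<in> X ==> finite F ==> F \<subseteq> J ==> (\<Sum>w\<in>F. p w x) <= B'"
  by (rule admE[OF assms(2)], rule that)
 have "(\<Sum>w\<in>F. p w x) <= B + B'" if "x \<in> X" "finite F" "F \<subseteq> I \<union> J" for x F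
 proof -
  have "(\<Sum>w\<in>F. p w x) = (\<Sum>w\<in>F \<inter> I. p w x) + (\<Sum>w\<in>F - I. p w x)"
   by (metis sum.Int_Diff that(2))
  also have "... <= B + B'" using that by (intro add_mono B B') auto
  finally show ?thesis .
 qed
 then show ?thesis by (rule admI)
qed

lemma Op_Diff:
 assumes "adm I" "bd f" "x \<in> X" "J \<subseteq> I"
 shows "T (I - J) f x = T I f x - T J f x"
proof -
 have "T (J \<union> (I - J)) f x = T J f x + T (I - J) f x"
  by (rule Op_Un) (use assms adm_mono in auto)
 moreover have "J \<union> (I - J) = I" using assms by auto
 ultimately show ?thesis by simp
qed

lemma Op_letters: "T (letters V) f x = (\<Sum>\<^sub>\<infinity>a\<in>V. p [a] x * f (a ## x))"
 unfolding Op_def letters_def by (subst infsum_reindex) (auto simp: inj_on_def o_def)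

lemma Op_finite: "finite F ==> T F f x = (\<Sum>w\<in>F. p w x * f (w \<frown> x))"
 by (simp add: Op_def)

lemma p_letter_le: "p [a] x <= Mj a / l"
 using G_le[of "a ## x"] l_pos by (simp add: divide_right_mono)

lemma Mj_nonneg: "0 <= Mj a"
 using G_le[of "a ## x" for x] G_nonneg[of "a ## x" for x] by (metis build.simps(1) order_trans)

lemma adm_letters: "adm (letters V)"
proof -
 have "(\<Sum>w\<in>F. p w x) <= infsum Mj UNIV / l" if fin: "finite F" "F \<subseteq> letters V" for F x
 proof -
  obtain F' where F': "F' \<subseteq> V" "finite F'" "F = (%a. [a]) ` F'"
   using finite_subset_image[OF fin(1) fin(2)[unfolded letters_def]] by blast
  have "(\<Sum>w\<in>F. p w x) = (\<Sum>a\<in>F'. p [a] x)"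
   unfolding F'(3) by (subst sum.reindex) (auto simp: inj_on_def)
  also have "... <= (\<Sum>a\<in>F'. Mj a / l)" by (intro sum_mono p_letter_le)
  also have "... <= infsum Mj UNIV / l"
   unfolding sum_divide_distrib[symmetric] using l_pos
   by (intro divide_right_mono finite_sum_le_infsum Mj_sum F') (auto simp: Mj_nonneg)
  finally show ?thesis .
 qed
 then show ?thesis by (rule admI)
qed

lemma adm_bound:
 assumes "adm I" obtains B where "0 <= B" "!!x. x \<in> X ==> T I (%_. 1) x <= B"
proof -
 obtain B where B: "!!x F. x \<in> X ==> finite F ==> F \<subseteq> I ==> (\<Sum>w\<in>F. p w x) <= B"
  by (rule admE[OF assms], rule that)
 have "T I (%_. 1) x <= max 0 B" if "x \<in> X" for x
 proof -
  have "T I (%_. 1) x <= B" unfolding Op_def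
   using B[OF that] Op_summable[OF assms bd_const[of 1] that] by (intro infsum_le_finite_sums) auto
  then show ?thesis by simp
 qed
 then show ?thesis using that[of "max 0 B"] by simp
qed

lemma Op_abs_le:
 assumes "adm I" "bd f" "x \<in> X" "!!w. w \<in> I ==> w \<frown> x \<in> X ==> \<bar>f (w \<frown> x)\<bar> <= B"
 shows "\<bar>T I f x\<bar> <= B * T I (%_. 1) x"
proof -
 have "T I f x <= T I (%_. B) x"
  using assms by (intro Op_mono bd_const) (auto simp: abs_le_iff)
 moreover have "T I (%_. - B) x <= T I f x"
 proof (intro Op_mono bd_const assms(1-3))
  fix w assume "w \<in> I" "w \<frown> x \<in> X"
  from assms(4)[OF this] show "- B <= f (w \<frown> x)" by linarith
 qed
 ultimately show ?thesis
  using Op_cmult[of I B "%_. 1" x] Op_cmult[of I "-B" "%_. 1" x] by simp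
qed

lemma bd_Op: assumes "adm I" "bd f" shows "bd (T I f)"
proof -
 obtain B where B: "0 <= B" "!!x. x \<in> X ==> \<bar>f x\<bar> <= B" by (rule bdE[OF assms(2)]) blast
 obtain D where D: "0 <= D" "!!x. x \<in> X ==> T I (%_. 1) x <= D" by (rule adm_bound[OF assms(1)]) blast
 have "\<bar>T I f x\<bar> <= B * D" if "x \<in> X" for x
  using Op_abs_le[OF assms that, of B] B(2) mult_left_mono[OF D(2)[OF that] B(1)] by force
 then show ?thesis unfolding bd_def by blast
qed

lemma Op_dist:
 assumes "adm I" "bd f" "harn k f" "x \<in> X" "y \<in> X" "x 0 = y 0"
  and "!!w. w \<in> I ==> K + (k - K) * \<theta> ^ length w <= k'"
 shows "T I f x <= exp (k' * d x y) * T I f y"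
proof -
 have "T I f x <= (\<Sum>\<^sub>\<infinity>w\<in>I. exp (k' * d x y) * (p w y * f (w \<frown> y)))"
  unfolding Op_def
 proof (intro infsum_mono Op_summable summable_on_cmult_right assms(1,2,4,5))
  fix w assume w: "w \<in> I"
  have n: "0 <= p w y * f (w \<frown> y)"
   using p_eq_0_or_in_X[OF assms(5), of w] p_nonneg[of w y] harn_nonneg[OF assms(3), of "w \<frown> y"] by auto
  have "p w x * f (w \<frown> x) <= exp ((K + (k - K) * \<theta> ^ length w) * d x y) * (p w y * f (w \<frown> y))"
   by (rule term_dist[OF assms(3-6)])
  also have "... <= exp (k' * d x y) * (p w y * f (w \<frown> y))"
   using n assms(7)[OF w] by (intro mult_right_mono) (auto intro!: mult_right_mono d_nonneg)
  finally show "p w x * f (w \<frown> x) <= exp (k' * d x y) * (p w y * f (w \<frown> y))" .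
 qed
 also have "... = exp (k' * d x y) * T I f y"
  unfolding Op_def by (rule infsum_cmult_right')
 finally show ?thesis .
qed

lemma harn_Op:
 assumes "adm I" "bd f" "harn k f" "K <= k"
 shows "harn k (T I f)"
 unfolding harn_def
proof (intro ballI conjI impI)
 fix x assume x: "x \<in> X"
 then show "0 <= T I f x" using assms by (intro Op_nonneg) (auto simp: harn_def)
 fix y assume y: "y \<in> X" "x 0 = y 0"
 show "T I f x <= exp (k * d x y) * T I f y"
 proof (rule Op_dist[OF assms(1-3) x y])
  fix w :: "'s list"
  have "(k - K) * \<theta> ^ length w <= (k - K) * 1"
   using theta assms(4) by (intro mult_left_mono) (auto simp: power_le_one)
  then show "K + (k - K) * \<theta> ^ length w <= k" by simp
 qed
qed

text \<open>For words of length at least 1 the excess \<open>k - K\<close> shrinks by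
  \<open>\<theta>\<close>. The gap that this leaves is what \<open>cone_contraction\<close> spends
  on subtracting a multiple of \<open>h\<close>.\<close>

lemma harn_Op_strict:
 assumes "adm I" "bd f" "harn k f" "K <= k" "[] \<notin> I"
 shows "harn (K + (k - K) * \<theta>) (T I f)"
 unfolding harn_def
proof (intro ballI conjI impI)
 fix x assume x: "x \<in> X"
 then show "0 <= T I f x" using assms by (intro Op_nonneg) (auto simp: harn_def)
 fix y assume y: "y \<in> X" "x 0 = y 0"
 show "T I f x <= exp ((K + (k - K) * \<theta>) * d x y) * T I f y"
 proof (rule Op_dist[OF assms(1-3) x y])
  fix w :: "'s list" assume "w \<in> I"
  then have "length w >= 1" using assms(5) by (cases w) auto
  then have "(k - K) * \<theta> ^ length w <= (k - K) * \<theta> ^ 1"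
   using theta assms(4) by (intro mult_left_mono power_decreasing) auto
  then show "K + (k - K) * \<theta> ^ length w <= K + (k - K) * \<theta>" by simp
 qed
qed

lemma harn_const: "0 <= c ==> 0 <= k ==> harn k (%_. c)"
 unfolding harn_def
proof (intro ballI conjI impI)
 fix x y assume "0 <= c" "0 <= k"
 then have "1 <= exp (k * d x y)" using d_nonneg[of x y] by simp
 then show "c <= exp (k * d x y) * c" using \<open>0 <= c\<close> by (simp add: mult_le_cancel_right1)
qed

lemma harn_chi: "harn k f ==> harn k (%x. chi Q x * f x)"
 unfolding harn_def chi_def by auto

lemma harn_chi1: "0 <= k ==> harn k (chi Q)"
 using harn_chi[OF harn_const[of 1 k], of Q] by simp

lemma harn_add:
 assumes "harn k f" "harn k g" shows "harn k (%x. f x + g x)"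
 unfolding harn_def
proof (intro ballI conjI impI)
 fix x y assume "x \<in> X" "y \<in> X" "x 0 = y 0"
 then show "f x + g x <= exp (k * d x y) * (f y + g y)"
  using add_mono[OF harnD[OF assms(1)] harnD[OF assms(2)], of x y x y] by (simp add: distrib_left)
qed (use assms in \<open>auto simp: harn_def\<close>)

lemma harn_cmult: "harn k f ==> 0 <= c ==> harn k (%x. c * f x)"
 unfolding harn_def by (auto simp: mult.left_commute intro!: mult_left_mono)

lemma harn_cong: "harn k f ==> (!!x. x \<in> X ==> f x = g x) ==> harn k g"
 unfolding harn_def by auto

lemma adm_snoc:
 assumes "adm I" shows "adm (snoc I V)"
proof -
 obtain B where B: "!!x F. x \<in> X ==> finite F ==> F \<subseteq> I ==> (\<Sum>w\<in>F. p w x) <= B"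
  by (rule admE[OF assms], rule that)
 obtain D where D: "!!x F. x \<in> X ==> finite F ==> F \<subseteq> letters V ==> (\<Sum>w\<in>F. p w x) <= D"
  by (rule admE[OF adm_letters[of V]], rule that)
 have "(\<Sum>w\<in>F. p w x) <= D * max 0 B" if x: "x \<in> X" "finite F" "F \<subseteq> snoc I V" for F x
 proof -
  obtain F' where F': "F' \<subseteq> V \<times> I" "finite F'" "F = (%(a, u). u @ [a]) ` F'"
   using finite_subset_image[OF x(2) x(3)[unfolded snoc_def]] by blast
  have "(\<Sum>w\<in>F. p w x) = (\<Sum>(a,u)\<in>F'. p [a] x * p u (a ## x))"
   unfolding F'(3) by (subst sum.reindex[OF inj_snoc]) (auto simp: pw_append case_prod_unfold mult_ac)
  \<comment> \<open>Enlarging the finite set of pairs to the rectangle of its projections allows the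
    two bounds to be applied separately.\<close>
  also have "... <= (\<Sum>(a,u)\<in>fst ` F' \<times> snd ` F'. p [a] x * p u (a ## x))"
  proof (rule sum_mono2)
   show "F' \<subseteq> fst ` F' \<times> snd ` F'" by (rule subset_fst_snd)
   show "0 <= (case b of (a, u) => p [a] x * p u (a ## x))" for b
    by (cases b) (simp only: case_prod_conv mult_nonneg_nonneg p_nonneg)
  qed (use F'(2) in simp)
  also have "... = (\<Sum>a\<in>fst ` F'. p [a] x * (\<Sum>u\<in>snd ` F'. p u (a ## x)))"
   by (subst sum.cartesian_product[symmetric]) (simp add: sum_distrib_left)
  also have "... <= (\<Sum>a\<in>fst ` F'. p [a] x * max 0 B)"
  proof (intro sum_mono)
   fix a assume "a \<in> fst ` F'"
   show "p [a] x * (\<Sum>u\<in>snd ` F'. p u (a ## x)) <= p [a] x * max 0 B"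
   proof (cases "a ## x \<in> X")
    case True
    have "(\<Sum>u\<in>snd ` F'. p u (a ## x)) <= B" using F' by (intro B True) auto
    then show ?thesis using p_nonneg[of "[a]" x] by (intro mult_left_mono) auto
   qed (simp add: G_off)
  qed
  also have "... = (\<Sum>w\<in>(%a. [a]) ` fst ` F'. p w x) * max 0 B"
   by (subst sum.reindex) (auto simp: inj_on_def sum_distrib_right)
  also have "... <= D * max 0 B"
   using F' by (intro mult_right_mono D x) (auto simp: letters_def)
  finally show ?thesis .
 qed
 then show ?thesis by (rule admI)
qed

lemma Op_snoc:
 assumes "adm I" "bd f" "x \<in> X"
 shows "T (snoc I V) f x = T (letters V) (T I f) x"
proof -
 have s: "(%w. p w x * f (w \<frown> x)) summable_on snoc I V"
  by (rule Op_summable[OF adm_snoc[OF assms(1)] assms(2,3)])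
 have s2: "(%(a, u). p (u @ [a]) x * f ((u @ [a]) \<frown> x)) summable_on V \<times> I"
  using s unfolding snoc_def by (subst (asm) summable_on_reindex[OF inj_snoc]) (simp add: o_def case_prod_unfold)
 have "T (snoc I V) f x = (\<Sum>\<^sub>\<infinity>(a, u)\<in>V \<times> I. p (u @ [a]) x * f ((u @ [a]) \<frown> x))"
  unfolding Op_def snoc_def by (subst infsum_reindex[OF inj_snoc]) (simp add: o_def case_prod_unfold)
 also have "... = (\<Sum>\<^sub>\<infinity>a\<in>V. \<Sum>\<^sub>\<infinity>u\<in>I. p (u @ [a]) x * f ((u @ [a]) \<frown> x))"
  using infsum_Sigma'_banach[OF s2] by simp
 also have "... = (\<Sum>\<^sub>\<infinity>a\<in>V. p [a] x * T I f (a ## x))"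
 proof (rule infsum_cong)
  fix a assume "a \<in> V"
  show "(\<Sum>\<^sub>\<infinity>u\<in>I. p (u @ [a]) x * f ((u @ [a]) \<frown> x)) = p [a] x * T I f (a ## x)"
   unfolding Op_def by (subst infsum_cmult_right'[symmetric]) (simp add: pw_append mult_ac)
 qed
 finally show ?thesis by (simp add: Op_letters)
qed

lemma Op_letters_chi: "T (letters V) f x = T1 (%y. chi V y * f y) x"
 unfolding Op_letters
 by (rule infsum_cong_neutral) (auto simp: chi_def)

end

section \<open>Bounded locally Lipschitz functions\<close>

lemma dtheta_ge_power:
 assumes "0 < \<theta>" "\<theta> < 1" "x k ~= y k"
 shows "\<theta> ^ k <= dtheta \<theta> x y"
proof -
 have "(LEAST n. x n ~= y n) <= k" using assms(3) by (rule Least_le)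
 then show ?thesis using assms by (auto simp: dtheta_def power_decreasing)
qed

context weight
begin

lemma blI:
 assumes "!!x. x \<in> X ==> \<bar>f x\<bar> <= c"
  and "!!x y. x \<in> X ==> y \<in> X ==> x 0 = y 0 ==> \<bar>f x - f y\<bar> <= c' * d x y"
 shows "bl f"
 unfolding bl_def
proof (intro exI[of _ "max c c'"] ballI conjI impI)
 fix x assume x: "x \<in> X"
 show "\<bar>f x\<bar> <= max c c'" using assms(1)[OF x] by simp
 fix y assume y: "y \<in> X" "x 0 = y 0"
 have "c' * d x y <= max c c' * d x y" by (intro mult_right_mono d_nonneg) simp
 then show "\<bar>f x - f y\<bar> <= max c c' * d x y" using assms(2)[OF x y] by linarith
qed

lemma blE:
 assumes "bl f"
 obtains c where "0 <= c" "!!x. x \<in> X ==> \<bar>f x\<bar> <= c"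
  "!!x y. x \<in> X ==> y \<in> X ==> x 0 = y 0 ==> \<bar>f x - f y\<bar> <= c * d x y"
proof -
 obtain c where c: "ALL x:X. \<bar>f x\<bar> <= c & (ALL y:X. x 0 = y 0 --> \<bar>f x - f y\<bar> <= c * d x y)"
  using assms[unfolded bl_def] by (elim exE)
 show ?thesis
 proof (rule that[of "max 0 c"])
  fix x assume x: "x \<in> X"
  show "\<bar>f x\<bar> <= max 0 c" using bspec[OF c x] by linarith
  fix y assume y: "y \<in> X" "x 0 = y 0"
  have "c * d x y <= max 0 c * d x y" by (intro mult_right_mono d_nonneg) simp
  moreover have "\<bar>f x - f y\<bar> <= c * d x y" using bspec[OF c x] y by simp
  ultimately show "\<bar>f x - f y\<bar> <= max 0 c * d x y" by linarith
 qed simp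
qed

lemma bl_bd: "bl f ==> bd f"
 by (rule blE, assumption) (auto simp: bd_def)

text \<open>Points that differ before position \<open>n\<close> have distance at least
  \<open>\<theta> ^ n\<close>, so the trivial bound \<open>2 * B\<close> on the difference is
  already a Lipschitz bound.\<close>

lemma bl_local:
 assumes "!!x. x \<in> X ==> \<bar>f x\<bar> <= B"
  and "!!x y. x \<in> X ==> y \<in> X ==> (!!k. k < n ==> x k = y k) ==> f x = f y"
 shows "bl f"
proof (rule blI[of f B "2 * B / \<theta> ^ n"])
 fix x y assume x: "x \<in> X" "y \<in> X"
 have B: "0 <= B" using assms(1)[OF x(1)] by linarith
 show "\<bar>f x - f y\<bar> <= 2 * B / \<theta> ^ n * d x y"
 proof (cases "ALL k<n. x k = y k")
  case True
  then have "f x = f y" by (intro assms(2) x) auto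
  then show ?thesis using B d_nonneg[of x y] theta by simp
 next
  case False
  then obtain k where k: "k < n" "x k ~= y k" by blast
  have "\<theta> ^ n <= \<theta> ^ k" using k theta by (simp add: power_decreasing)
  also have "... <= d x y" using k(2) by (intro dtheta_ge_power theta)
  finally have "2 * B * \<theta> ^ n <= 2 * B * d x y" using B by (intro mult_left_mono) auto
  then have "2 * B <= 2 * B / \<theta> ^ n * d x y" using theta by (simp add: field_simps)
  moreover have "\<bar>f x - f y\<bar> <= 2 * B" using assms(1)[OF x(1)] assms(1)[OF x(2)] by linarith
  ultimately show ?thesis by linarith
 qed
qed (rule assms(1))

lemma bl_const: "bl (%_. c)"
 by (rule bl_local[of _ "\<bar>c\<bar>" 0]) auto

lemma bl_chi: "bl (chi Q)"
 by (rule bl_local[of _ 1 1]) (auto simp: chi_def)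

lemma bl_coord: "bl (%x. chi Q (suffix n x))"
 by (rule bl_local[of _ 1 "Suc n"]) (auto simp: chi_def)

lemma bl_cyl: "bl (indicator (cyl A w))"
proof (rule bl_local[of _ 1 "length w"])
 fix x y assume x: "x \<in> X" "y \<in> X" "!!k. k < length w ==> x k = y k"
 have "x \<in> cyl A w \<longleftrightarrow> y \<in> cyl A w" using x by (simp add: cyl_eq)
 then show "indicator (cyl A w) x = (indicator (cyl A w) y :: real)" by (simp add: indicator_def)
qed (simp add: indicator_def)

lemma bl_add: assumes "bl f" "bl g" shows "bl (%x. f x + g x)"
proof -
 obtain c where c: "0 <= c" "!!x. x \<in> X ==> \<bar>f x\<bar> <= c"
  "!!x y. x \<in> X ==> y \<in> X ==> x 0 = y 0 ==> \<bar>f x - f y\<bar> <= c * d x y"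
  by (rule blE[OF assms(1)], rule that)
 obtain c' where c': "0 <= c'" "!!x. x \<in> X ==> \<bar>g x\<bar> <= c'"
  "!!x y. x \<in> X ==> y \<in> X ==> x 0 = y 0 ==> \<bar>g x - g y\<bar> <= c' * d x y"
  by (rule blE[OF assms(2)], rule that)
 show ?thesis
 proof (rule blI[of _ "c + c'" "c + c'"])
  fix x assume x: "x \<in> X"
  then show "\<bar>f x + g x\<bar> <= c + c'" using c(2)[OF x] c'(2)[OF x] by linarith
  fix y assume y: "y \<in> X" "x 0 = y 0"
  show "\<bar>f x + g x - (f y + g y)\<bar> <= (c + c') * d x y"
   using c(3)[OF x y] c'(3)[OF x y] by (simp add: distrib_right)
 qed
qed

lemma bl_mult: assumes "bl f" "bl g" shows "bl (%x. f x * g x)"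
proof -
 obtain c where c: "0 <= c" "!!x. x \<in> X ==> \<bar>f x\<bar> <= c"
  "!!x y. x \<in> X ==> y \<in> X ==> x 0 = y 0 ==> \<bar>f x - f y\<bar> <= c * d x y"
  by (rule blE[OF assms(1)], rule that)
 obtain c' where c': "0 <= c'" "!!x. x \<in> X ==> \<bar>g x\<bar> <= c'"
  "!!x y. x \<in> X ==> y \<in> X ==> x 0 = y 0 ==> \<bar>g x - g y\<bar> <= c' * d x y"
  by (rule blE[OF assms(2)], rule that)
 show ?thesis
 proof (rule blI[of _ "c * c'" "2 * c * c'"])
  fix x assume x: "x \<in> X"
  then show "\<bar>f x * g x\<bar> <= c * c'" unfolding abs_mult using c c' by (intro mult_mono) auto
  fix y assume y: "y \<in> X" "x 0 = y 0"
  have "f x * g x - f y * g y = f x * (g x - g y) + (f x - f y) * g y" by (simp add: algebra_simps)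
  also have "\<bar>...\<bar> <= \<bar>f x\<bar> * \<bar>g x - g y\<bar> + \<bar>f x - f y\<bar> * \<bar>g y\<bar>"
   by (metis abs_mult abs_triangle_ineq)
  also have "... <= c * (c' * d x y) + (c * d x y) * c'"
   using x y c c' by (intro add_mono mult_mono) (auto simp: d_nonneg)
  finally show "\<bar>f x * g x - f y * g y\<bar> <= 2 * c * c' * d x y" by (simp add: mult_ac)
 qed
qed

lemma bl_cmult: "bl f ==> bl (%x. c * f x)"
 using bl_mult[OF bl_const] .

lemma bl_diff: "bl f ==> bl g ==> bl (%x. f x - g x)"
 using bl_add[of f "%x. -1 * g x"] bl_cmult[of g "-1"] by simp

lemma bl_sum: "finite S ==> (!!i. i \<in> S ==> bl (f i)) ==> bl (%x. \<Sum>i\<in>S. f i x)"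
 by (induction S rule: finite_induct) (auto intro: bl_add bl_const)

lemma bl_abs: assumes "bl f" shows "bl (%x. \<bar>f x\<bar>)"
proof -
 obtain c where c: "0 <= c" "!!x. x \<in> X ==> \<bar>f x\<bar> <= c"
  "!!x y. x \<in> X ==> y \<in> X ==> x 0 = y 0 ==> \<bar>f x - f y\<bar> <= c * d x y"
  by (rule blE[OF assms(1)], rule that)
 show ?thesis
 proof (rule blI[of _ c c])
  fix x y assume "x \<in> X" "y \<in> X" "x 0 = y 0"
  from c(3)[OF this] show "\<bar>\<bar>f x\<bar> - \<bar>f y\<bar>\<bar> <= c * d x y" by linarith
 qed (use c in auto)
qed

lemma bl_min: assumes "bl f" "bl g" shows "bl (%x. min (f x) (g x))"
proof -
 have "bl (%x. 1/2 * ((f x + g x) - \<bar>f x - g x\<bar>))"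
  by (intro bl_cmult bl_diff bl_add bl_abs assms)
 moreover have "(%x. 1/2 * ((f x + g x) - \<bar>f x - g x\<bar>)) = (%x. min (f x) (g x))"
  by (auto simp: min_def)
 ultimately show ?thesis by simp
qed

lemma exp_minus_1_le: fixes k t :: real assumes "0 <= k" "0 <= t" "t <= 1" shows "exp (k * t) - 1 <= k * exp k * t"
proof -
 have "1 - k * t <= exp (- (k * t))" using exp_ge_add_one_self[of "- (k * t)"] by simp
 then have "(1 - k * t) * exp (k * t) <= exp (- (k * t)) * exp (k * t)" by (rule mult_right_mono) simp
 then have "exp (k * t) - 1 <= k * t * exp (k * t)" by (simp add: exp_minus left_diff_distrib)
 also have "... <= k * t * exp k" using assms by (intro mult_left_mono) (auto simp: mult_left_le)
 finally show ?thesis by (simp add: mult_ac)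
qed

lemma harn_diff_le:
 assumes "harn k f" "0 <= k" "x \<in> X" "y \<in> X" "x 0 = y 0"
 shows "\<bar>f x - f y\<bar> <= k * exp k * exp k * f y * d x y"
proof -
 have *: "f u - f v <= k * exp k * d x y * f v" if "u \<in> X" "v \<in> X" "u 0 = v 0" "d u v = d x y" for u v
 proof -
  have "f u - f v <= (exp (k * d x y) - 1) * f v"
   using harnD[OF assms(1) that(1-3)] that(4) by (simp add: algebra_simps)
  also have "... <= (k * exp k * d x y) * f v"
   using harn_nonneg[OF assms(1) that(2)] exp_minus_1_le[OF assms(2) d_nonneg d_le_1, of x y]
   by (intro mult_right_mono)
  finally show ?thesis .
 qed
 have k: "0 <= k * exp k * d x y" using assms(2) d_nonneg[of x y] by simp
 have fx: "f x <= exp k * f y" by (rule harnD1[OF assms])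
 have n: "0 <= f y" by (rule harn_nonneg[OF assms(1,4)])
 have "f x - f y <= k * exp k * d x y * f y" using assms by (intro *) auto
 also have "... <= k * exp k * d x y * (exp k * f y)"
  using k n assms(2) by (intro mult_left_mono) (auto simp: mult_le_cancel_right1)
 finally have 1: "f x - f y <= k * exp k * d x y * (exp k * f y)" .
 have "f y - f x <= k * exp k * d x y * f x" using assms d_sym by (intro *) auto
 also have "... <= k * exp k * d x y * (exp k * f y)" using k fx by (rule mult_left_mono[rotated])
 finally have 2: "f y - f x <= k * exp k * d x y * (exp k * f y)" .
 show ?thesis using 1 2 by (simp add: abs_le_iff mult_ac)
qed

lemma harn_bd_bl:
 assumes "harn k f" "bd f" shows "bl f"
proof -
 define k' where "k' = max 0 k"
 have k': "harn k' f" "0 <= k'" using harn_mono[OF assms(1)] by (auto simp: k'_def)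
 obtain B where B: "0 <= B" "!!x. x \<in> X ==> \<bar>f x\<bar> <= B" by (rule bdE[OF assms(2)]) blast
 show ?thesis
 proof (rule blI[of _ B "k' * exp k' * exp k' * B"])
  fix x y assume x: "x \<in> X" "y \<in> X" "x 0 = y 0"
  have "f y <= B" using B(2)[OF x(2)] by linarith
  then have "k' * exp k' * exp k' * f y * d x y <= k' * exp k' * exp k' * B * d x y"
   using k'(2) by (intro mult_right_mono mult_left_mono d_nonneg) auto
  then show "\<bar>f x - f y\<bar> <= k' * exp k' * exp k' * B * d x y"
   using harn_diff_le[OF k' x] by linarith
 qed (rule B(2))
qed

text \<open>After adding \<open>2 * c\<close> the function is at least \<open>c\<close>, and the
  additive oscillation \<open>c * d x y\<close> becomes a relative one of at most
  \<open>d x y\<close>. Linear statements about \<open>bl\<close> thus reduce to the cone.\<close>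

lemma bl_harn_shift:
 assumes "bl f" obtains c where "0 <= c" "harn 1 (%x. f x + c)"
proof -
 obtain c where c: "0 <= c" "!!x. x \<in> X ==> \<bar>f x\<bar> <= c"
  "!!x y. x \<in> X ==> y \<in> X ==> x 0 = y 0 ==> \<bar>f x - f y\<bar> <= c * d x y"
  by (rule blE[OF assms(1)], rule that)
 have "harn 1 (%x. f x + 2 * c)"
  unfolding harn_def
 proof (intro ballI conjI impI)
  fix x assume x: "x \<in> X"
  then show "0 <= f x + 2 * c" using c(1) c(2)[OF x] by linarith
  fix y assume y: "y \<in> X" "x 0 = y 0"
  have fy: "c <= f y + 2 * c" using c(2)[OF y(1)] by linarith
  have "f x + 2 * c <= (f y + 2 * c) + c * d x y" using c(3)[OF x y] by linarith
  also have "... <= (f y + 2 * c) + (f y + 2 * c) * d x y"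
   using fy by (intro add_left_mono mult_right_mono d_nonneg)
  also have "... = (1 + d x y) * (f y + 2 * c)" by (simp add: algebra_simps)
  also have "... <= exp (1 * d x y) * (f y + 2 * c)"
   using fy c(1) by (intro mult_right_mono) auto
  finally show "f x + 2 * c <= exp (1 * d x y) * (f y + 2 * c)" .
 qed
 then show ?thesis using that[of "2 * c"] c(1) by simp
qed

lemma bl_cong: "bl f ==> (!!x. x \<in> X ==> f x = g x) ==> bl g"
 unfolding bl_def by simp

lemma bl_Op: assumes "adm I" "bl f" shows "bl (T I f)"
proof -
 obtain c where c: "0 <= c" "harn 1 (%x. f x + c)" by (rule bl_harn_shift[OF assms(2)]) blast
 have bd: "bd (%x. f x + c)" "bd f" using bl_bd[OF assms(2)] bd_add[OF _ bd_const] by auto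
 have "bl (T I (%x. f x + c))"
  using harn_mono[OF c(2), of "max 1 K"]
  by (intro harn_bd_bl[of "max 1 K"] harn_Op bd_Op assms(1) bd) auto
 moreover have "bl (T I (%_. c))"
  using harn_const[OF c(1) K_nonneg] by (intro harn_bd_bl[of K] harn_Op bd_Op assms(1) bd_const) auto
 ultimately have "bl (%x. T I (%x. f x + c) x - T I (%_. c) x)" by (rule bl_diff)
 then show ?thesis
  by (rule bl_cong) (simp add: Op_add[OF assms(1) bd(2) bd_const])
qed

lemma bl_continuous: assumes "bl f" shows "continuous_on X f"
 unfolding continuous_on_topological
proof (intro ballI allI impI)
 fix x B assume x: "x \<in> X" and B: "open B" "f x \<in> B"
 obtain c where c: "0 <= c"
  "!!x y. x \<in> X ==> y \<in> X ==> x 0 = y 0 ==> \<bar>f x - f y\<bar> <= c * d x y"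
  by (rule blE[OF assms(1)], rule that)
 obtain e where e: "0 < e" "ball (f x) e \<subseteq> B" using B openE by blast
 have "(%n. c * \<theta> ^ n) \<longlonglongrightarrow> c * 0" using theta by (intro tendsto_intros LIMSEQ_power_zero) auto
 then have "EV n. c * \<theta> ^ n < e"
  using e(1) by (intro order_tendstoD(2)) auto
 then obtain n where n: "c * \<theta> ^ n < e" using eventually_happens' sequentially_bot by blast
 let ?S = "{y. ALL k<length (prefix (Suc n) x). y k = prefix (Suc n) x ! k}"
 have "f y \<in> B" if y: "y \<in> X" "y \<in> ?S" for y
 proof -
  have yk: "y k = x k" if "k < Suc n" for k
  proof -
   have "y k = prefix (Suc n) x ! k" using y(2) that by (simp del: subseq_to_Suc)
   then show ?thesis using that by (simp del: subseq_to_Suc)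
  qed
  have "d x y <= \<theta> ^ n" using yk by (intro dtheta_le_power[OF theta]) auto
  then have "c * d x y <= c * \<theta> ^ n" using c(1) by (rule mult_left_mono)
  moreover have "\<bar>f x - f y\<bar> <= c * d x y" using yk[of 0] by (intro c(2) x y) auto
  ultimately show ?thesis using e(2) n by (auto simp: dist_real_def)
 qed
 moreover have "x \<in> ?S" by (simp del: subseq_to_Suc)
 ultimately show "EX S. open S & x \<in> S & (ALL y:X. y \<in> S --> f y \<in> B)"
  using open_cylinder[of "prefix (Suc n) x"] by (intro exI[of _ ?S] conjI ballI impI)
qed

lemma bl_measurable: "bl f ==> f \<in> borel_measurable (borel_of_shift A)"
 by (rule borel_measurable_continuous_on_restrict) (rule bl_continuous)

lemma p_Suc_measurable_bl: "bl (p [a])"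
proof -
 have "bl (T (letters {a}) (%_. 1))" by (rule bl_Op[OF adm_letters bl_const])
 then show ?thesis by (rule bl_cong) (simp add: Op_letters)
qed

end

section \<open>Ruelle--Perron--Frobenius systems\<close>

text \<open>Grown by \<open>snoc\<close>, so that the operator of these words is the
  \<open>n\<close>-th power of the operator of the letters.\<close>

primrec nwords :: "'s set => nat => 's list set" where
 "nwords V 0 = {[]}"
| "nwords V (Suc n) = snoc (nwords V n) V"

lemma length_nwords: "w \<in> nwords V n ==> length w = n"
 by (induction n arbitrary: w) (auto simp: snoc_def)

lemma nwords_iff: "w \<in> nwords V n \<longleftrightarrow> length w = n & set w \<subseteq> V"
proof (induction n arbitrary: w)
 case (Suc n)
 show ?case
 proof (cases w rule: rev_cases)
  case (snoc u a)
  then show ?thesis using Suc[of u] by (auto simp: snoc_def)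
 qed (auto simp: snoc_def)
qed auto

context weight
begin

lemma adm_nwords: "adm (nwords V n)"
proof (induction n)
 case 0
 show ?case
 proof (simp, rule admI[of _ 1])
  fix x and F :: "'s list set" assume "F \<subseteq> {[]}"
  then have "F = {} \<or> F = {[]}" by auto
  then show "(\<Sum>w\<in>F. p w x) <= 1" by auto
 qed
qed (simp add: adm_snoc)

lemma Op_nwords_Suc: "bd f ==> x \<in> X ==> T (nwords V (Suc n)) f x = T (letters V) (T (nwords V n) f) x"
 by (simp add: Op_snoc adm_nwords)

lemma Op_nil [simp]: "T {[]} f = f"
 by (rule ext) (simp add: Op_finite)

end

text \<open>One locale for two uses: each perturbed operator (\<open>M = A\<close>,
  \<open>Us = UNIV\<close>), and the limit operator on a component (\<open>M\<close> the restricted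
  matrix, \<open>Us\<close> the component). \<open>M\<close> records exactly where \<open>G\<close>
  is positive. The eigenvalue is already divided out, so \<open>h\<close> and \<open>\<nu>\<close>
  are fixed by \<open>T1\<close> and its dual, the latter tested only on \<open>bl\<close>.\<close>

locale rpf = weight A \<theta> C G Mj l
 for A :: "'s::{countable,discrete_topology} => 's => bool" and \<theta> C :: real
  and G :: "'s word => real" and Mj :: "'s => real" and l :: real +
 fixes h :: "'s word => real" and \<nu> :: "'s word measure" and Us :: "'s set" and M :: "'s => 's => bool"
 assumes h_bl: "bl h" and h_nonneg: "!!x. x \<in> X ==> 0 <= h x"
  and eigen: "!!x. x \<in> X ==> T1 h x = h x"
  and nu_prob: "prob_space \<nu>" and nu_sets: "sets \<nu> = sets (borel_of_shift A)"
  and dual: "!!f. bl f ==> (\<integral>x. T1 f x \<partial>\<nu>) = (\<integral>x. f x \<partial>\<nu>)"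
  and h_int: "(\<integral>x. h x \<partial>\<nu>) = 1"
  and M_sub: "!!a b. M a b ==> A a b & a \<in> Us & b \<in> Us"
  and G_pos: "!!x. x \<in> X ==> 0 < G x \<longleftrightarrow> M (x 0) (x (Suc 0))"
  and irr: "!!a b. a \<in> Us ==> b \<in> Us ==> EX w. successively M (a # w @ [b])"
begin

sublocale prob_space \<nu> by (rule nu_prob)

lemma nu_space: "space \<nu> = X"
 using sets_eq_imp_space_eq[OF nu_sets] by (simp add: space_restrict_space)

lemma bl_meas: "bl f ==> f \<in> borel_measurable \<nu>"
 using bl_measurable measurable_cong_sets[OF nu_sets refl] by blast

lemma bl_int: assumes "bl f" shows "integrable \<nu> f"
proof -
 obtain c where c: "0 <= c" "!!x. x \<in> X ==> \<bar>f x\<bar> <= c" by (rule blE[OF assms]) blast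
 show ?thesis
  by (rule integrable_const_bound[of _ c]) (auto simp: nu_space c intro!: bl_meas assms)
qed

lemma int_mono: "bl f ==> bl g ==> (!!x. x \<in> X ==> f x <= g x) ==> (\<integral>x. f x \<partial>\<nu>) <= (\<integral>x. g x \<partial>\<nu>)"
 by (intro integral_mono bl_int) (auto simp: nu_space)

lemma int_cong: "(!!x. x \<in> X ==> f x = g x) ==> (\<integral>x. f x \<partial>\<nu>) = (\<integral>x. g x \<partial>\<nu>)"
 by (intro Bochner_Integration.integral_cong) (auto simp: nu_space)

lemma int_nonneg:
 fixes f :: "'s word => real"
 shows "(!!x. x \<in> X ==> 0 <= f x) ==> 0 <= (\<integral>x. f x \<partial>\<nu>)"
 by (intro integral_nonneg_AE AE_I2) (auto simp: nu_space)

lemma int_add: "bl f ==> bl g ==> (\<integral>x. f x + g x \<partial>\<nu>) = (\<integral>x. f x \<partial>\<nu>) + (\<integral>x. g x \<partial>\<nu>)"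
 by (intro Bochner_Integration.integral_add bl_int)

lemma int_diff: "bl f ==> bl g ==> (\<integral>x. f x - g x \<partial>\<nu>) = (\<integral>x. f x \<partial>\<nu>) - (\<integral>x. g x \<partial>\<nu>)"
 by (intro Bochner_Integration.integral_diff bl_int)

lemma cyl_in_sets: "cyl A w \<in> sets \<nu>"
 by (simp add: nu_sets cyl_sets)

lemma int_cyl: "(\<integral>x. indicator (cyl A w) x \<partial>\<nu>) = measure \<nu> (cyl A w)"
 using cyl_in_sets[of w] by simp

lemma p_pos:
 assumes "x \<in> X" shows "0 < p w x \<longleftrightarrow> successively M (w @ [x 0])"
proof (induction w)
 case (Cons a w)
 have n: "0 <= p w x" "0 <= G (a ## w \<frown> x)" by (rule p_nonneg G_nonneg)+
 have e: "hd (w @ [x 0]) = (w \<frown> x) 0" by (cases w) auto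
 have "0 < p (a # w) x \<longleftrightarrow> 0 < G (a ## w \<frown> x) & 0 < p w x"
  using n l_pos by (auto simp: zero_less_mult_iff zero_less_divide_iff)
 also have "... \<longleftrightarrow> M a ((w \<frown> x) 0) & successively M (w @ [x 0])"
 proof -
  have "0 < G (a ## w \<frown> x) \<longleftrightarrow> M a ((w \<frown> x) 0)" if "successively M (w @ [x 0])"
  proof (cases "a ## w \<frown> x \<in> X")
   case True then show ?thesis using G_pos[OF True] by simp
  next
   case False
   have "successively A (w @ [x 0])"
    using that by (rule successively_mono) (use M_sub in auto)
   then have "w \<frown> x \<in> X" using assms by (simp add: shift_space_conc)
   then have "\<not> A a ((w \<frown> x) 0)" using False by (simp add: shift_space_build)
   then show ?thesis using M_sub[of a "(w \<frown> x) 0"] False by (auto simp: G_off)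
  qed
  then show ?thesis using Cons by auto
 qed
 also have "... \<longleftrightarrow> successively M ((a # w) @ [x 0])"
  using e by (cases "w @ [x 0]") auto
 finally show ?case .
qed simp

text \<open>Conformality: the dual equation for the indicator of a cylinder, to which only the
  branch \<open>a\<close> contributes.\<close>

lemma meas_cyl_Cons:
 "measure \<nu> (cyl A (a # w)) = (\<integral>x. indicator (cyl A w) x * p [a] x \<partial>\<nu>)"
proof -
 have "T1 (indicator (cyl A (a # w))) x = indicator (cyl A w) x * p [a] x" if x: "x \<in> X" for x
 proof -
  have "T1 (indicator (cyl A (a # w))) x
   = (\<Sum>\<^sub>\<infinity>b\<in>{a}. p [b] x * indicator (cyl A (a # w)) (b ## x))"
   unfolding Op_letters by (rule infsum_cong_neutral) (auto simp: cyl_build)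
  also have "... = indicator (cyl A w) x * p [a] x"
   using x by (cases "A a (x 0)") (auto simp: cyl_build indicator_def G_off shift_space_build)
  finally show ?thesis .
 qed
 then have "(\<integral>x. T1 (indicator (cyl A (a # w))) x \<partial>\<nu>) =
   (\<integral>x. indicator (cyl A w) x * p [a] x \<partial>\<nu>)" by (rule int_cong)
 then show ?thesis unfolding dual[OF bl_cyl[of "a # w"]] int_cyl[of "a # w"] .
qed

lemma cyl_sing_pos_imp: "0 < measure \<nu> (cyl A [a]) ==> a \<in> Us"
proof (rule ccontr)
 assume "0 < measure \<nu> (cyl A [a])" and a: "a \<notin> Us"
 have "p [a] x = 0" if "x \<in> X" for x
  using p_pos[OF that, of "[a]"] p_nonneg[of "[a]" x] M_sub[of a "x 0"] a by force
 then have "measure \<nu> (cyl A [a]) = (\<integral>x. 0 \<partial>\<nu>)"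
  unfolding meas_cyl_Cons by (intro int_cong) simp
 then show False using \<open>0 < measure \<nu> (cyl A [a])\<close> by simp
qed

text \<open>Over a fixed first letter the weight of \<open>a\<close> varies at most by the factor
  \<open>exp K\<close>, so its positivity at one point \<open>y\<close> is a uniform lower bound for
  the integrand in \<open>meas_cyl_Cons\<close>.\<close>

lemma cyl_step_pos:
 assumes "M a (hd w)" "w ~= []" "0 < measure \<nu> (cyl A w)"
 shows "0 < measure \<nu> (cyl A (a # w))"
proof -
 obtain y where y: "y \<in> cyl A w" using assms(3) by (cases "cyl A w = {}") auto
 then have yX: "y \<in> X" and y0: "y 0 = hd w" using assms(2) by (auto simp: cyl_eq hd_conv_nth)
 have py: "0 < p [a] y" using p_pos[OF yX, of "[a]"] assms(1) y0 by simp
 have "exp (- K) * p [a] y * measure \<nu> (cyl A w) = (\<integral>x. exp (- K) * p [a] y * indicator (cyl A w) x \<partial>\<nu>)"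
  using int_cyl[of w] by simp
 also have "... <= (\<integral>x. indicator (cyl A w) x * p [a] x \<partial>\<nu>)"
 proof (intro int_mono bl_cmult bl_mult bl_cyl p_Suc_measurable_bl)
  fix x assume x: "x \<in> X"
  show "exp (- K) * p [a] y * indicator (cyl A w) x <= indicator (cyl A w) x * p [a] x"
  proof (cases "x \<in> cyl A w")
   case True
   then have "x 0 = y 0" using y assms(2) by (auto simp: cyl_eq)
   then have "T {[a]} (%_. 1) y <= exp K * T {[a]} (%_. 1) x"
    using adm_letters[of "{a}"] harn_const[of 1 K] K_nonneg
    by (intro harnD1[OF harn_Op[of _ _ K] K_nonneg yX x] bd_const) (auto simp: letters_def)
   then have "p [a] y <= exp K * p [a] x" by (simp add: Op_finite)
   then have "exp (- K) * p [a] y <= exp (- K) * (exp K * p [a] x)" by (intro mult_left_mono) auto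
   then show ?thesis using True by (simp add: mult.assoc[symmetric] exp_minus)
  qed simp
 qed
 finally show ?thesis using py assms(3) unfolding meas_cyl_Cons
  by (smt (verit) exp_gt_zero mult_pos_pos)
qed

lemma cyl_path_pos:
 "w ~= [] ==> successively M (v @ w) ==> 0 < measure \<nu> (cyl A w) ==> 0 < measure \<nu> (cyl A (v @ w))"
proof (induction v)
 case (Cons a v)
 have "M a (hd (v @ w))" "successively M (v @ w)"
  using Cons.prems by (cases "v @ w"; auto)+
 then show ?case using Cons cyl_step_pos[of a "v @ w"] by auto
qed simp

text \<open>Some state is charged because \<open>\<nu>\<close> is a probability measure and there
  are countably many states; irreducibility and \<open>cyl_path_pos\<close> carry positivity
  backwards along a path to that state.\<close>

lemma state_pos: assumes "b \<in> Us" shows "0 < measure \<nu> (cyl A [b])"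
proof -
 have "EX c. 0 < measure \<nu> (cyl A [c])"
 proof (rule ccontr)
  assume "\<not> ?thesis"
  then have "measure \<nu> (cyl A [c]) = 0" for c by (metis measure_nonneg order_le_less)
  then have "cyl A [c] \<in> null_sets \<nu>" for c
   using cyl_in_sets by (auto simp: null_sets_def emeasure_eq_measure)
  then have "(\<Union>c. cyl A [c]) \<in> null_sets \<nu>" by (intro null_sets_UN') auto
  moreover have "(\<Union>c. cyl A [c]) = space \<nu>" by (auto simp: cyl_sing nu_space)
  ultimately show False using emeasure_space_1 by (simp add: null_sets_def)
 qed
 then obtain c where c: "0 < measure \<nu> (cyl A [c])" by blast
 obtain w where "successively M (b # w @ [c])" using irr[OF assms cyl_sing_pos_imp[OF c]] by blast
 then have "0 < measure \<nu> (cyl A ((b # w) @ [c]))" using c by (intro cyl_path_pos) auto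
 also have "... <= measure \<nu> (cyl A [b])"
  by (intro finite_measure_mono cyl_in_sets) (auto simp: cyl_eq)
 finally show ?thesis .
qed

lemma cyl_pos: assumes "w ~= []" "successively M w" "last w \<in> Us" shows "0 < measure \<nu> (cyl A w)"
proof -
 have "butlast w @ [last w] = w" using assms(1) by simp
 then show ?thesis using cyl_path_pos[of "[last w]" "butlast w"] state_pos[OF assms(3)] assms(2) by simp
qed

lemma state_nonempty: assumes "b \<in> Us" obtains y where "y \<in> X" "y 0 = b"
proof -
 have "cyl A [b] ~= {}" using state_pos[OF assms] by auto
 then show ?thesis using that by (auto simp: cyl_sing)
qed

lemma int_nwords: "bl f ==> (\<integral>x. T (nwords UNIV n) f x \<partial>\<nu>) = (\<integral>x. f x \<partial>\<nu>)"
proof (induction n)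
 case (Suc n)
 have "(\<integral>x. T (nwords UNIV (Suc n)) f x \<partial>\<nu>) = (\<integral>x. T1 (T (nwords UNIV n) f) x \<partial>\<nu>)"
  by (rule int_cong) (rule Op_nwords_Suc[OF bl_bd[OF Suc.prems]])
 also have "... = (\<integral>x. T (nwords UNIV n) f x \<partial>\<nu>)" by (rule dual[OF bl_Op[OF adm_nwords Suc.prems]])
 finally show ?case using Suc by simp
qed simp

lemma Op_off_Us: assumes "x \<in> X" "x 0 \<notin> Us" "[] \<notin> I" shows "T I f x = 0"
 unfolding Op_def
proof (rule infsum_0)
 fix w assume "w \<in> I"
 then have w: "w ~= []" using assms(3) by auto
 have "\<not> successively M (w @ [x 0])"
 proof
  assume "successively M (w @ [x 0])"
  then have "M (last w) (x 0)" using w by (simp add: successively_append_iff)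
  then show False using M_sub assms(2) by blast
 qed
 then show "p w x * f (w \<frown> x) = 0" using p_pos[OF assms(1), of w] p_nonneg[of w x] by simp
qed

text \<open>Over \<open>[b]\<close> a Harnack function is comparable with its mean.\<close>

lemma harn_int_le:
 assumes "harn k f" "0 <= k" "bd f" "x \<in> X"
 shows "f x * measure \<nu> (cyl A [x 0]) <= exp k * (\<integral>y. indicator (cyl A [x 0]) y * f y \<partial>\<nu>)"
proof -
 have bl: "bl f" by (rule harn_bd_bl[OF assms(1,3)])
 have "f x * measure \<nu> (cyl A [x 0]) = (\<integral>y. f x * indicator (cyl A [x 0]) y \<partial>\<nu>)"
  using int_cyl[of "[x 0]"] by simp
 also have "... <= (\<integral>y. exp k * (indicator (cyl A [x 0]) y * f y) \<partial>\<nu>)"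
 proof (intro int_mono bl_cmult bl_mult bl_cyl bl)
  fix y assume y: "y \<in> X"
  show "f x * indicator (cyl A [x 0]) y <= exp k * (indicator (cyl A [x 0]) y * f y)"
   using harnD1[OF assms(1,2,4) y] y by (auto simp: cyl_sing indicator_def)
 qed
 finally show ?thesis by simp
qed

lemma harn_int_ge:
 assumes "harn k f" "0 <= k" "bd f" "x \<in> X"
 shows "(\<integral>y. indicator (cyl A [x 0]) y * f y \<partial>\<nu>) <= exp k * f x * measure \<nu> (cyl A [x 0])"
proof -
 have bl: "bl f" by (rule harn_bd_bl[OF assms(1,3)])
 have "(\<integral>y. indicator (cyl A [x 0]) y * f y \<partial>\<nu>) <= (\<integral>y. exp k * f x * indicator (cyl A [x 0]) y \<partial>\<nu>)"
 proof (intro int_mono bl_cmult bl_mult bl_cyl bl)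
  fix y assume y: "y \<in> X"
  show "indicator (cyl A [x 0]) y * f y <= exp k * f x * indicator (cyl A [x 0]) y"
   using harnD1[OF assms(1,2) y assms(4)] y by (auto simp: cyl_sing indicator_def)
 qed
 then show ?thesis using int_cyl[of "[x 0]"] by simp
qed

text \<open>The iterates of 1 keep total mass 1 and lie in the cone, so a value is bounded through
  the mean over its cylinder, independently of \<open>n\<close>.\<close>

lemma Op_nwords_1_le:
 assumes "x \<in> X" "x 0 \<in> Us"
 shows "T (nwords V n) (%_. 1) x <= exp K / measure \<nu> (cyl A [x 0])"
proof -
 let ?f = "T (nwords UNIV n) (%_. 1)"
 have hf: "harn K ?f" by (intro harn_Op adm_nwords bd_const harn_const K_nonneg) auto
 have "?f x * measure \<nu> (cyl A [x 0]) <= exp K * (\<integral>y. indicator (cyl A [x 0]) y * ?f y \<partial>\<nu>)"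
  by (intro harn_int_le hf K_nonneg bd_Op adm_nwords bd_const assms)
 also have "... <= exp K * (\<integral>y. ?f y \<partial>\<nu>)"
  using harn_nonneg[OF hf]
  by (intro mult_left_mono int_mono bl_mult bl_cyl bl_Op adm_nwords bl_const) (auto simp: indicator_def)
 also have "(\<integral>y. ?f y \<partial>\<nu>) = 1" by (simp add: int_nwords[OF bl_const] prob_space)
 finally have "?f x <= exp K / measure \<nu> (cyl A [x 0])"
  using state_pos[OF assms(2)] by (simp add: field_simps)
 moreover have "T (nwords V n) (%_. 1) x <= ?f x"
  by (rule Op_subset[OF adm_nwords bd_const assms(1)]) (auto simp: nwords_iff)
 ultimately show ?thesis by linarith
qed

text \<open>Lipschitz continuity compares \<open>f (w \<frown> x)\<close> with
  \<open>f (w \<frown> y)\<close> only up to an additive error \<open>c * \<theta> ^ n\<close>. When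
  the fixed point equation is iterated \<open>n\<close> times, this error is multiplied by the
  bounded iterates of 1 and vanishes; only the distortion of the weights remains.\<close>

lemma fixed_harn:
 assumes "bl f" "!!x. x \<in> X ==> 0 <= f x" "!!x. x \<in> X ==> T (letters V) f x = f x"
 shows "harn K f"
 unfolding harn_def
proof (intro ballI conjI impI)
 fix x y assume x: "x \<in> X" and y: "y \<in> X" and xy: "x 0 = y 0"
 have n: "T (nwords V n) f z = f z" if "z \<in> X" for n z
  using that
 proof (induction n arbitrary: z)
  case (Suc n)
  have "T (nwords V (Suc n)) f z = T (letters V) (T (nwords V n) f) z"
   by (rule Op_nwords_Suc[OF bl_bd[OF assms(1)] Suc.prems])
  also have "... = T (letters V) f z" by (rule Op_cong[OF Suc.prems]) (rule Suc.IH)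
  finally show ?case using assms(3)[OF Suc.prems] by simp
 qed simp
 show "f x <= exp (K * d x y) * f y"
 proof (cases "x 0 \<in> Us")
  case False
  then have "f x = 0" using Op_off_Us[OF x False, of "letters V" f] assms(3)[OF x] by (auto simp: letters_def)
  then show ?thesis using assms(2)[OF y] by simp
 next
  case True
  obtain c where c: "0 <= c"
   "!!x y. x \<in> X ==> y \<in> X ==> x 0 = y 0 ==> \<bar>f x - f y\<bar> <= c * d x y"
   by (rule blE[OF assms(1)], rule that)
  define B where "B = exp K / measure \<nu> (cyl A [y 0])"
  have B: "0 <= B" by (simp add: B_def)
  have le: "f x <= exp (K * d x y) * (f y + c * \<theta> ^ n * B)" for n
  proof -
   have bdf: "bd (%z. f z + c * \<theta> ^ n)" by (intro bd_add bd_const bl_bd assms)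
   have "f x = (\<Sum>\<^sub>\<infinity>w\<in>nwords V n. p w x * f (w \<frown> x))"
    using n[OF x, of n] by (simp add: Op_def)
   also have "... <= (\<Sum>\<^sub>\<infinity>w\<in>nwords V n. exp (K * d x y) * (p w y * (f (w \<frown> y) + c * \<theta> ^ n)))"
   proof (intro infsum_mono)
    show "(%w. p w x * f (w \<frown> x)) summable_on nwords V n"
     by (rule Op_summable[OF adm_nwords bl_bd[OF assms(1)] x])
    show "(%w. exp (K * d x y) * (p w y * (f (w \<frown> y) + c * \<theta> ^ n))) summable_on nwords V n"
     by (intro summable_on_cmult_right) (rule Op_summable[OF adm_nwords bdf y])
    fix w assume w: "w \<in> nwords V n"
    show "p w x * f (w \<frown> x) <= exp (K * d x y) * (p w y * (f (w \<frown> y) + c * \<theta> ^ n))"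
    proof (cases "w \<frown> x \<in> X")
     case True
     then have wy: "w \<frown> y \<in> X" using conc_in_X_cong[OF x y xy, of w] by simp
     have "\<bar>f (w \<frown> x) - f (w \<frown> y)\<bar> <= c * d (w \<frown> x) (w \<frown> y)"
      by (rule c(2)[OF True wy]) (rule conc_same_0[of x y w, OF xy])
     also have "... <= c * \<theta> ^ n"
      using length_nwords[OF w] d_le_1[of x y] theta c(1)
      by (intro mult_left_mono) (auto simp: d_conc mult_left_le)
     finally have 1: "f (w \<frown> x) <= f (w \<frown> y) + c * \<theta> ^ n" by linarith
     have "p w x <= exp (K * (1 - \<theta> ^ length w) * d x y) * p w y"
      by (rule p_dist[OF x y xy])
     also have "... <= exp (K * d x y) * p w y"
      using K_nonneg d_nonneg[of x y] theta
      by (intro mult_right_mono p_nonneg) (auto intro!: mult_right_mono mult_left_le)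
     finally have 2: "p w x <= exp (K * d x y) * p w y" .
     have "p w x * f (w \<frown> x) <= (exp (K * d x y) * p w y) * (f (w \<frown> y) + c * \<theta> ^ n)"
      using 1 2 assms(2)[OF True] p_nonneg[of w x] by (intro mult_mono) (auto intro: p_nonneg)
     then show ?thesis by (simp add: mult_ac)
    next
     case False
     then have "w \<frown> y \<notin> X" "w ~= []" using conc_in_X_cong[OF x y xy, of w] x by auto
     then show ?thesis using False by (simp add: p_off)
    qed
   qed
   also have "... = exp (K * d x y) * T (nwords V n) (%z. f z + c * \<theta> ^ n) y"
    unfolding Op_def by (rule infsum_cmult_right')
   also have "T (nwords V n) (%z. f z + c * \<theta> ^ n) y = f y + T (nwords V n) (%z. c * \<theta> ^ n) y"
    using Op_add[OF adm_nwords bl_bd[OF assms(1)] bd_const y] n[OF y] by simp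
   also have "T (nwords V n) (%z. c * \<theta> ^ n) y = c * \<theta> ^ n * T (nwords V n) (%z. 1) y"
    using Op_cmult[of "nwords V n" "c * \<theta> ^ n" "%_. 1" y] by simp
   also have "exp (K * d x y) * (f y + c * \<theta> ^ n * T (nwords V n) (%z. 1) y) <=
     exp (K * d x y) * (f y + c * \<theta> ^ n * B)"
    unfolding B_def using c(1) theta True xy
    by (intro mult_left_mono add_left_mono Op_nwords_1_le[OF y]) auto
   finally show ?thesis .
  qed
  have "(%n. exp (K * d x y) * (f y + c * \<theta> ^ n * B)) \<longlonglongrightarrow> exp (K * d x y) * (f y + c * 0 * B)"
   using theta by (intro tendsto_intros LIMSEQ_power_zero) auto
  then have "(%n. exp (K * d x y) * (f y + c * \<theta> ^ n * B)) \<longlonglongrightarrow> exp (K * d x y) * f y" by simp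
  then show ?thesis by (rule LIMSEQ_le_const) (use le in blast)
 qed
qed (rule assms(2))

lemma h_harn: "harn K h"
 using h_bl h_nonneg eigen by (rule fixed_harn)

lemma h_bd: "bd h"
 by (rule bl_bd[OF h_bl])

lemma Op_nwords_h: "x \<in> X ==> T (nwords UNIV n) h x = h x"
proof (induction n arbitrary: x)
 case (Suc n)
 have "T (nwords UNIV (Suc n)) h x = T1 (T (nwords UNIV n) h) x"
  by (rule Op_nwords_Suc[OF h_bd Suc.prems])
 also have "... = T1 h x" by (rule Op_cong[OF Suc.prems]) (rule Suc.IH)
 finally show ?case using eigen[OF Suc.prems] by simp
qed simp

text \<open>The normalisation makes \<open>h\<close> nonzero at some point, necessarily over
  \<open>Us\<close>. The cone carries this to the point \<open>?w \<frown> x\<close> with the same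
  first letter, and the iterated eigenvalue equation carries it on to \<open>x\<close>.\<close>

lemma h_pos: assumes "x \<in> X" "x 0 \<in> Us" shows "0 < h x"
proof -
 have "EX y:X. h y ~= 0"
 proof (rule ccontr)
  assume "\<not> ?thesis"
  then have "(\<integral>x. h x \<partial>\<nu>) = (\<integral>x. 0 \<partial>\<nu>)" by (intro int_cong) auto
  then show False using h_int by simp
 qed
 then obtain y where y: "y \<in> X" "h y ~= 0" by blast
 have y0: "y 0 \<in> Us" using Op_off_Us[OF y(1), of "letters UNIV" h] eigen[OF y(1)] y(2) by (auto simp: letters_def)
 obtain v where v: "successively M (y 0 # v @ [x 0])" using irr[OF y0 assms(2)] by blast
 let ?w = "y 0 # v"
 have pw: "0 < p ?w x" using p_pos[OF assms(1), of ?w] v by simp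
 have wX: "?w \<frown> x \<in> X" using p_off[of ?w x] pw by (metis list.distinct(1) order_less_irrefl)
 have "0 < h y" using y h_nonneg[OF y(1)] by simp
 also have "h y <= exp K * h (?w \<frown> x)" by (rule harnD1[OF h_harn K_nonneg y(1) wX]) simp
 finally have hw: "0 < h (?w \<frown> x)" by (simp add: zero_less_mult_iff)
 have "0 < p ?w x * h (?w \<frown> x)" using pw hw by (rule mult_pos_pos)
 also have "... = T {?w} h x" by (simp only: Op_finite finite.intros sum.insert) simp
 also have "... <= T (nwords UNIV (length ?w)) h x"
  using h_nonneg by (intro Op_subset adm_nwords h_bd assms(1)) (auto simp: nwords_iff simp del: nwords.simps)
 also have "... = h x" by (rule Op_nwords_h[OF assms(1)])
 finally show ?thesis .
qed

lemma h_lower: assumes "finite Q" "Q \<subseteq> Us"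
 obtains \<kappa> where "0 < \<kappa>" "!!x. x \<in> X ==> x 0 \<in> Q ==> \<kappa> <= h x"
proof -
 have "EX \<kappa>>0. ALL x:X. x 0 \<in> Q --> \<kappa> <= h x" using assms
 proof (induction Q rule: finite_induct)
  case (insert b Q)
  then obtain \<kappa> where \<kappa>: "0 < \<kappa>" "ALL x:X. x 0 \<in> Q --> \<kappa> <= h x" by auto
  obtain y where y: "y \<in> X" "y 0 = b" using state_nonempty[of b] insert.prems by auto
  have hy: "0 < h y" using h_pos y insert.prems by auto
  let ?k = "min \<kappa> (h y / exp K)"
  have "?k <= h x" if x: "x \<in> X" "x 0 \<in> insert b Q" for x
  proof (cases "x 0 = b")
   case True
   have "h y <= exp K * h x" using y True by (intro harnD1[OF h_harn K_nonneg _ x(1)]) auto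
   then have "h y / exp K <= h x" by (simp add: field_simps)
   then show ?thesis by linarith
  next
   case False
   then have "\<kappa> <= h x" using x \<kappa>(2) by simp
   then show ?thesis by linarith
  qed
  then show ?case using \<kappa>(1) hy by (intro exI[of _ ?k]) auto
 qed (auto intro: exI[of _ 1])
 then show ?thesis using that by blast
qed

end

section \<open>Induced operators\<close>

lemma words_from_hd: "w \<in> words_from Q V ==> w ~= [] & hd w \<in> Q"
 by (auto simp: words_from_def)

text \<open>The last letter, the one next to the base point, is split off: either it is the whole
  word, or it lies in \<open>V\<close>.\<close>

lemma words_from_unfold: "words_from Q V = letters Q \<union> snoc (words_from Q V) V"
proof (intro equalityI subsetI)
 fix w assume "w \<in> words_from Q V"
 then obtain a v where w: "w = a # v" "a \<in> Q" "set v \<subseteq> V" by (auto simp: words_from_def lists_eq_set)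
 show "w \<in> letters Q \<union> snoc (words_from Q V) V"
 proof (cases v rule: rev_cases)
  case Nil then show ?thesis using w by (auto simp: letters_def)
 next
  case (snoc u b)
  then have "w = (a # u) @ [b]" "b \<in> V" "a # u \<in> words_from Q V"
   using w by (auto simp: words_from_def lists_eq_set)
  then show ?thesis unfolding snoc_def by force
 qed
next
 fix w assume "w \<in> letters Q \<union> snoc (words_from Q V) V"
 then show "w \<in> words_from Q V" by (auto simp: words_from_def letters_def snoc_def)
qed

lemma letters_snoc_disjoint: "[] \<notin> I ==> letters Q \<inter> snoc I V = {}"
 by (auto simp: letters_def snoc_def)

text \<open>The words of \<open>words_from\<close> of bounded length, by a recursion parallel to
  \<open>words_from_unfold\<close>. Estimates by induction on the length can thus precede
  summability over all words.\<close>

primrec wle :: "'s set => 's set => nat => 's list set" where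
 "wle Q V 0 = {}"
| "wle Q V (Suc n) = letters Q \<union> snoc (wle Q V n) V"

lemma wle_iff: "w \<in> wle Q V n \<longleftrightarrow> w \<in> words_from Q V & length w <= n"
proof (induction n arbitrary: w)
 case (Suc n)
 have "w \<in> words_from Q V & length w <= Suc n \<longleftrightarrow> w \<in> letters Q \<or> (w \<in> snoc (words_from Q V) V & length w <= Suc n)"
  by (subst words_from_unfold) (auto simp: letters_def)
 also have "w \<in> snoc (words_from Q V) V & length w <= Suc n \<longleftrightarrow> w \<in> snoc (wle Q V n) V"
  using Suc by (auto simp: snoc_def)
 finally show ?case by simp
qed (auto simp: words_from_def)

lemma finite_subset_wle:
 assumes "finite F" "F \<subseteq> words_from Q V"
 shows "F \<subseteq> wle Q V (Max (insert 0 (length ` F)))"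
 using assms by (auto simp: wle_iff)

context weight
begin

text \<open>First-passage decomposition: \<open>F = T (words_from Q V) f\<close> solves
  \<open>F = T1 (chi Q * f + chi V * F)\<close>. The mass balance and the lower bounds along paths
  are derived from this equation.\<close>

lemma words_from_recursion:
 assumes "adm (words_from Q V)" "bd f" "x \<in> X"
 shows "T (words_from Q V) f x = T1 (%y. chi Q y * f y + chi V y * T (words_from Q V) f y) x"
proof -
 let ?W = "words_from Q V"
 have bdT: "bd (T ?W f)" by (rule bd_Op[OF assms(1,2)])
 have "T ?W f x = T (letters Q \<union> snoc ?W V) f x" by (subst words_from_unfold) (rule refl)
 also have "... = T (letters Q) f x + T (snoc ?W V) f x"
  by (intro Op_Un adm_letters adm_snoc assms letters_snoc_disjoint) (auto simp: words_from_def)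
 also have "T (snoc ?W V) f x = T (letters V) (T ?W f) x" by (rule Op_snoc[OF assms])
 also have "T (letters Q) f x + T (letters V) (T ?W f) x =
   T1 (%y. chi Q y * f y + chi V y * T ?W f y) x"
  unfolding Op_letters_chi[of Q] Op_letters_chi[of V]
  by (rule Op_add[symmetric]) (intro adm_letters bd_mult bd_chi assms bdT)+
 finally show ?thesis .
qed

lemma suffix_conc_length: "length w = n ==> suffix n (w \<frown> x) = x"
 by (rule ext) (auto simp: conc_def)

lemma Op_pull_suffix:
 "x \<in> X ==> T (nwords V n) (%y. g y * f (suffix n y)) x = f x * T (nwords V n) g x"
 unfolding Op_def
 by (subst infsum_cmult_right'[symmetric])
  (auto intro!: infsum_cong simp: suffix_conc_length length_nwords)

end

section \<open>Mass balance and recurrence of induced operators\<close>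

context rpf
begin

text \<open>As \<open>Q\<close> and \<open>V\<close> are disjoint,
  \<open>chi Q * h + chi V * h <= h\<close>, so the bound by \<open>h\<close> reproduces itself
  under the recursion. Admissibility is carried along in the same induction.\<close>

lemma Op_wle_h_le:
 assumes "Q \<inter> V = {}" "x \<in> X" shows "T (wle Q V n) h x <= h x" and "adm (wle Q V n)"
proof -
 have "adm (wle Q V n) & (ALL x:X. T (wle Q V n) h x <= h x)"
 proof (induction n)
  case 0 show ?case by (auto simp: adm_empty Op_finite h_nonneg)
 next
  case (Suc n)
  have "T (wle Q V (Suc n)) h x <= h x" if x: "x \<in> X" for x
  proof -
   have "T (wle Q V (Suc n)) h x = T (letters Q) h x + T (snoc (wle Q V n) V) h x"
    unfolding wle.simps using Suc
    by (intro Op_Un adm_letters adm_snoc h_bd x letters_snoc_disjoint) (auto simp: wle_iff words_from_def)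
   also have "T (snoc (wle Q V n) V) h x = T (letters V) (T (wle Q V n) h) x"
    using Suc by (intro Op_snoc h_bd x) auto
   also have "... <= T (letters V) h x"
    using Suc by (intro Op_mono adm_letters bd_Op h_bd x) auto
   also have "T (letters Q) h x + T (letters V) h x = T (letters Q \<union> letters V) h x"
    using assms(1) by (intro Op_Un[symmetric] adm_letters h_bd x) (auto simp: letters_def)
   also have "... <= T1 h x"
    using h_nonneg by (intro Op_subset adm_letters h_bd x) (auto simp: letters_def)
   also have "... = h x" by (rule eigen[OF x])
   finally show ?thesis by simp
  qed
  then show ?case using Suc by (simp add: adm_Un adm_letters adm_snoc)
 qed
 then show "T (wle Q V n) h x <= h x" "adm (wle Q V n)" using assms(2) by auto
qed

lemma finite_words_from_h_le:
 assumes "Q \<inter> V = {}" "x \<in> X" "finite F" "F \<subseteq> words_from Q V"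
 shows "(\<Sum>w\<in>F. p w x * h (w \<frown> x)) <= h x"
proof -
 let ?n = "Max (insert 0 (length ` F))"
 have "(\<Sum>w\<in>F. p w x * h (w \<frown> x)) = T F h x" by (simp add: Op_finite assms)
 also have "... <= T (wle Q V ?n) h x"
  using h_nonneg by (intro Op_subset Op_wle_h_le(2)[OF assms(1,2)] h_bd assms(2) finite_subset_wle assms(3,4)) auto
 also have "... <= h x" by (rule Op_wle_h_le[OF assms(1,2)])
 finally show ?thesis .
qed

text \<open>All words start in the finite set \<open>Q\<close>, over which \<open>h\<close> is
  bounded below, so the bound for sums of \<open>h\<close> becomes one for sums of weights.\<close>

lemma adm_words_from:
 assumes "finite Q" "Q \<subseteq> Us" "Q \<inter> V = {}"
 shows "adm (words_from Q V)"
proof -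
 obtain \<kappa> where \<kappa>: "0 < \<kappa>" "!!x. x \<in> X ==> x 0 \<in> Q ==> \<kappa> <= h x"
  by (rule h_lower[OF assms(1,2)], rule that)
 obtain B where B: "0 <= B" "!!x. x \<in> X ==> \<bar>h x\<bar> <= B" by (rule bdE[OF h_bd]) blast
 have "(\<Sum>w\<in>F. p w x) <= B / \<kappa>" if x: "x \<in> X" and F: "finite F" "F \<subseteq> words_from Q V" for x F
 proof -
  have "(\<Sum>w\<in>F. p w x) * \<kappa> = (\<Sum>w\<in>F. p w x * \<kappa>)" by (rule sum_distrib_right)
  also have "... <= (\<Sum>w\<in>F. p w x * h (w \<frown> x))"
  proof (intro sum_mono)
   fix w assume "w \<in> F"
   then have w: "w ~= []" "hd w \<in> Q" using F words_from_hd[of w Q V] by auto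
   show "p w x * \<kappa> <= p w x * h (w \<frown> x)"
   proof (cases "p w x = 0")
    case False
    then have wX: "w \<frown> x \<in> X" using p_eq_0_or_in_X[OF x, of w] by simp
    have "\<kappa> <= h (w \<frown> x)" by (rule \<kappa>(2)[OF wX]) (simp add: conc_0[OF w(1)] w(2))
    then show ?thesis using p_nonneg[of w x] by (rule mult_left_mono)
   qed simp
  qed
  also have "... <= h x" by (rule finite_words_from_h_le[OF assms(3) x F])
  also have "... <= B" using B(2)[OF x] by simp
  finally show ?thesis using \<kappa>(1) by (simp add: field_simps)
 qed
 then show ?thesis by (rule admI)
qed

lemma Op_words_from_h_le:
 assumes "finite Q" "Q \<subseteq> Us" "Q \<inter> V = {}" "x \<in> X"
 shows "T (words_from Q V) h x <= h x"
 unfolding Op_def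
 by (rule infsum_le_finite_sums)
  (use Op_summable[OF adm_words_from[OF assms(1-3)] h_bd assms(4)] finite_words_from_h_le[OF assms(3,4)] in auto)

text \<open>When the first-passage equation is integrated against \<open>\<nu>\<close>, the mass
  over \<open>V\<close> occurs on both sides and cancels. What remains is the mass balance of the
  induced operator.\<close>

lemma int_words_from:
 assumes "adm (words_from Q V)" "bl f"
 shows "int_on \<nu> (- V) (T (words_from Q V) f) = int_on \<nu> Q f"
proof -
 let ?F = "T (words_from Q V) f"
 have F: "bl ?F" by (rule bl_Op[OF assms])
 have "(\<integral>x. ?F x \<partial>\<nu>) = (\<integral>x. T1 (%y. chi Q y * f y + chi V y * ?F y) x \<partial>\<nu>)"
  by (rule int_cong) (rule words_from_recursion[OF assms(1) bl_bd[OF assms(2)]])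
 also have "... = (\<integral>x. chi Q x * f x + chi V x * ?F x \<partial>\<nu>)"
  by (intro dual bl_add bl_mult bl_chi F assms)
 also have "... = int_on \<nu> Q f + int_on \<nu> V ?F"
  by (intro int_add bl_mult bl_chi F assms)
 finally have "(\<integral>x. ?F x \<partial>\<nu>) - int_on \<nu> V ?F = int_on \<nu> Q f" by simp
 also have "(\<integral>x. ?F x \<partial>\<nu>) - int_on \<nu> V ?F = (\<integral>x. ?F x - chi V x * ?F x \<partial>\<nu>)"
  by (intro int_diff[symmetric] bl_mult bl_chi F)
 also have "(%x. ?F x - chi V x * ?F x) = (%x. chi (- V) x * ?F x)"
  by (auto simp: chi_def)
 finally show ?thesis .
qed

text \<open>This is recurrence, and the eigenmeasure provides it: the defect
  \<open>D = h - T ?W h\<close> is a fixed point of the operator that avoids \<open>Q\<close>, hence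
  lies in the cone, and its integral over \<open>Q\<close> is 0 by the mass balance. The Harnack
  inequality turns the vanishing integral into vanishing on \<open>Q\<close>.\<close>

lemma return_h:
 assumes "finite Q" "Q \<subseteq> Us" "x \<in> X" "x 0 \<in> Q"
 shows "T (words_from Q (- Q)) h x = h x"
proof -
 let ?W = "words_from Q (- Q)"
 have adm: "adm ?W" by (rule adm_words_from) (use assms in auto)
 define D where "D x = h x - T ?W h x" for x
 have blW: "bl (T ?W h)" by (rule bl_Op[OF adm h_bl])
 have blD: "bl D" unfolding D_def by (intro bl_diff h_bl blW)
 have D0: "0 <= D x" if "x \<in> X" for x
  using Op_words_from_h_le[of Q "- Q" x] that assms by (simp add: D_def)
 have fixed: "T (letters (- Q)) D x = D x" if x: "x \<in> X" for x
 proof -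
  have "D x = T1 h x - T1 (%y. chi Q y * h y + chi (- Q) y * T ?W h y) x"
   unfolding D_def using words_from_recursion[OF adm h_bd x] eigen[OF x] by simp
  also have "... = T1 (%y. h y - (chi Q y * h y + chi (- Q) y * T ?W h y)) x"
   by (intro Op_diff[symmetric] adm_letters h_bd x bl_bd bl_add bl_mult bl_chi blW h_bl)
  also have "(%y. h y - (chi Q y * h y + chi (- Q) y * T ?W h y)) = (%y. chi (- Q) y * D y)"
   by (auto simp: chi_def D_def)
  finally show ?thesis by (simp add: Op_letters_chi[symmetric])
 qed
 have harnD: "harn K D" by (rule fixed_harn[OF blD D0 fixed])
 have "int_on \<nu> (- (- Q)) (T ?W h) = int_on \<nu> Q h"
  by (rule int_words_from[OF adm h_bl])
 then have "(\<integral>x. chi Q x * h x - chi Q x * T ?W h x \<partial>\<nu>) = 0"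
  by (subst int_diff) (auto intro!: bl_mult bl_chi h_bl blW)
 then have z: "int_on \<nu> Q D = 0" by (simp add: D_def right_diff_distrib)
 have "D x * measure \<nu> (cyl A [x 0]) <= exp K * (\<integral>y. indicator (cyl A [x 0]) y * D y \<partial>\<nu>)"
  by (rule harn_int_le[OF harnD K_nonneg bl_bd[OF blD] assms(3)])
 also have "(\<integral>y. indicator (cyl A [x 0]) y * D y \<partial>\<nu>) <= int_on \<nu> Q D"
  using assms(4) D0
  by (intro int_mono bl_mult bl_cyl bl_chi blD) (auto simp: indicator_def chi_def cyl_sing)
 finally have "D x * measure \<nu> (cyl A [x 0]) <= 0" using z by simp
 moreover have "0 < measure \<nu> (cyl A [x 0])" using state_pos assms by auto
 ultimately have "D x <= 0" by (simp add: mult_le_0_iff)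
 then show ?thesis using D0[OF assms(3)] by (simp add: D_def)
qed

section \<open>A second moment bound\<close>

lemma bl_suffix_mult: "bl (%x. chi Q (suffix i x) * chi Q (suffix j x))"
 by (intro bl_mult bl_coord)

text \<open>Invariance of the measure \<open>h \<nu>\<close>, expressed by transfer operators: a
  function of the shifted point is pulled out of the \<open>n\<close>-step operator, so only the lag
  \<open>j - i\<close> matters.\<close>

lemma correlation:
 assumes "i <= j"
 shows "(\<integral>x. chi Q (suffix i x) * chi Q (suffix j x) * h x \<partial>\<nu>) =
  (int_on \<nu> Q (T (nwords UNIV (j - i)) (%y. chi Q y * h y)))"
proof -
 have "(\<integral>x. chi Q (suffix i x) * chi Q (suffix j x) * h x \<partial>\<nu>)
  = (\<integral>x. T (nwords UNIV i) (%x. chi Q (suffix i x) * chi Q (suffix j x) * h x) x \<partial>\<nu>)"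
  by (intro int_nwords[symmetric] bl_mult[OF bl_suffix_mult h_bl])
 also have "... = (\<integral>x. chi Q x * chi Q (suffix (j - i) x) * h x \<partial>\<nu>)"
 proof (rule int_cong)
  fix x assume x: "x \<in> X"
  have "T (nwords UNIV i) (%x. chi Q (suffix i x) * chi Q (suffix j x) * h x) x
   = T (nwords UNIV i) (%x. h x * (%y. chi Q y * chi Q (suffix (j - i) y)) (suffix i x)) x"
   using assms by (simp add: mult_ac)
  also have "... = chi Q x * chi Q (suffix (j - i) x) * T (nwords UNIV i) h x"
   by (rule Op_pull_suffix[OF x])
  finally show "T (nwords UNIV i) (%x. chi Q (suffix i x) * chi Q (suffix j x) * h x) x =
    chi Q x * chi Q (suffix (j - i) x) * h x" using Op_nwords_h[OF x] by simp
 qed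
 also have "... = (\<integral>x. T (nwords UNIV (j - i)) (%x. chi Q x * chi Q (suffix (j - i) x) * h x) x \<partial>\<nu>)"
  by (intro int_nwords[symmetric] bl_mult bl_chi bl_coord h_bl)
 also have "... = int_on \<nu> Q (T (nwords UNIV (j - i)) (%y. chi Q y * h y))"
 proof (rule int_cong)
  fix x assume x: "x \<in> X"
  show "T (nwords UNIV (j - i)) (%x. chi Q x * chi Q (suffix (j - i) x) * h x) x =
   chi Q x * T (nwords UNIV (j - i)) (%y. chi Q y * h y) x"
   using Op_pull_suffix[OF x, of UNIV "j - i" "%y. chi Q y * h y" "chi Q"] by (simp add: mult_ac)
 qed
 finally show ?thesis .
qed

text \<open>Let \<open>S\<close> count the visits to \<open>Q\<close> before time \<open>N\<close>.
  Its mean under the probability \<open>h \<nu>\<close> is \<open>N * m\<close>, and the square of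
  the mean is at most the second moment, a double sum of correlations. In \<open>null_state\<close>
  a bound on the sum of the correlations will force \<open>m\<close> to be small.\<close>

lemma second_moment:
 fixes N :: nat and Q and m :: real and c :: "nat => real"
 defines "m \<equiv> \<integral>x. chi Q x * h x \<partial>\<nu>"
  and "c \<equiv> %n. \<integral>x. chi Q x * T (nwords UNIV n) (%y. chi Q y * h y) x \<partial>\<nu>"
 assumes "0 < N"
 shows "N * m\<^sup>2 <= 2 * (\<Sum>n<N. c n)"
proof -
 define S where "S x = (\<Sum>i<N. chi Q (suffix i x))" for x
 have blS: "bl S" unfolding S_def by (intro bl_sum bl_coord) auto
 have c0: "0 <= c n" for n
  unfolding c_def using h_nonneg
  by (intro int_nonneg mult_nonneg_nonneg Op_nonneg) (auto simp: chi_def)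
 have mi: "(\<integral>x. chi Q (suffix i x) * h x \<partial>\<nu>) = m" for i
 proof -
  have "(\<integral>x. chi Q (suffix i x) * h x \<partial>\<nu>) = (\<integral>x. chi Q (suffix i x) * chi Q (suffix i x) * h x \<partial>\<nu>)"
   by (intro int_cong) (simp add: chi_def)
  also have "... = int_on \<nu> Q (%x. (chi Q x * h x))"
   using correlation[of i i Q] by simp
  also have "... = m" unfolding m_def by (intro int_cong) (simp add: chi_def)
  finally show ?thesis .
 qed
 have Sh: "(\<integral>x. S x * h x \<partial>\<nu>) = N * m"
 proof -
  have "(\<integral>x. S x * h x \<partial>\<nu>) = (\<integral>x. (\<Sum>i<N. chi Q (suffix i x) * h x) \<partial>\<nu>)"
   by (simp add: S_def sum_distrib_right)
  also have "... = (\<Sum>i<N. \<integral>x. chi Q (suffix i x) * h x \<partial>\<nu>)"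
   by (intro Bochner_Integration.integral_sum bl_int bl_mult bl_coord h_bl)
  finally show ?thesis by (simp add: mi)
 qed
 have "0 <= (\<integral>x. (S x - N * m) * (S x - N * m) * h x \<partial>\<nu>)"
  using h_nonneg by (intro int_nonneg) auto
 also have "... = (\<integral>x. S x * S x * h x - 2 * (N * m) * (S x * h x) + (N * m)\<^sup>2 * h x \<partial>\<nu>)"
  by (intro int_cong) (simp add: algebra_simps power2_eq_square)
 also have "... = (\<integral>x. S x * S x * h x \<partial>\<nu>) - 2 * (N * m) * (N * m) + (N * m)\<^sup>2 * 1"
 proof -
  have 1: "bl (%x. S x * S x * h x)" "bl (%x. 2 * (N * m) * (S x * h x))" "bl (%x. (N * m)\<^sup>2 * h x)"
   by (intro bl_mult bl_cmult blS h_bl)+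
  show ?thesis using int_add[OF bl_diff[OF 1(1,2)] 1(3)] int_diff[OF 1(1,2)] by (simp add: Sh h_int)
 qed
 finally have "(N * m)\<^sup>2 <= (\<integral>x. S x * S x * h x \<partial>\<nu>)"
  unfolding power2_eq_square by linarith
 also have "... = (\<integral>x. (\<Sum>i<N. \<Sum>j<N. chi Q (suffix i x) * chi Q (suffix j x) * h x) \<partial>\<nu>)"
  by (intro int_cong) (simp only: S_def sum_product, simp only: sum_distrib_right)
 also have "... = (\<Sum>i<N. \<Sum>j<N. \<integral>x. chi Q (suffix i x) * chi Q (suffix j x) * h x \<partial>\<nu>)"
 proof -
  have 1: "integrable \<nu> (%x. chi Q (suffix i x) * chi Q (suffix j x) * h x)" for i j
   by (rule bl_int) (intro bl_mult bl_coord h_bl)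
  show ?thesis by (simp add: Bochner_Integration.integral_sum 1 Bochner_Integration.integrable_sum)
 qed
 also have "... <= (\<Sum>i<N. 2 * (\<Sum>n<N. c n))"
 proof (intro sum_mono)
  fix i assume i: "i \<in> {..<N}"
  \<comment> \<open>Row \<open>i\<close> of the double sum is split at the diagonal. On either side
    each lag below \<open>N\<close> occurs at most once, whence the factor 2.\<close>
  have lo: "(\<Sum>j<i. \<integral>x. chi Q (suffix i x) * chi Q (suffix j x) * h x \<partial>\<nu>) <= (\<Sum>n<N. c n)"
  proof -
   have "(\<Sum>j<i. \<integral>x. chi Q (suffix i x) * chi Q (suffix j x) * h x \<partial>\<nu>) = (\<Sum>j<i. c (i - j))"
   proof (rule sum.cong[OF refl])
    fix j assume "j \<in> {..<i}"
    then show "(\<integral>x. chi Q (suffix i x) * chi Q (suffix j x) * h x \<partial>\<nu>) = c (i - j)"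
     using correlation[of j i Q] by (simp add: c_def mult_ac)
   qed
   also have "... = (\<Sum>n\<in>(%j. i - j) ` {..<i}. c n)"
    by (subst sum.reindex) (auto simp: inj_on_def)
   also have "... <= (\<Sum>n<N. c n)" using i c0 by (intro sum_mono2) auto
   finally show ?thesis .
  qed
  have hi: "(\<Sum>j=i..<N. \<integral>x. chi Q (suffix i x) * chi Q (suffix j x) * h x \<partial>\<nu>) <= (\<Sum>n<N. c n)"
  proof -
   have "(\<Sum>j=i..<N. \<integral>x. chi Q (suffix i x) * chi Q (suffix j x) * h x \<partial>\<nu>) = (\<Sum>j=i..<N. c (j - i))"
    by (intro sum.cong refl) (simp add: correlation c_def)
   also have "... = (\<Sum>n\<in>(%j. j - i) ` {i..<N}. c n)"
    by (subst sum.reindex) (auto simp: inj_on_def)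
   also have "... <= (\<Sum>n<N. c n)" using i c0 by (intro sum_mono2) auto
   finally show ?thesis .
  qed
  have split: "sum g {..<N} = sum g {..<i} + sum g {i..<N}" for g :: "nat => real"
  proof -
   have "sum g ({..<i} \<union> {i..<N}) = sum g {..<i} + sum g {i..<N}"
    by (rule sum.union_disjoint) auto
   moreover have "{..<i} \<union> {i..<N} = {..<N}" using i by auto
   ultimately show ?thesis by simp
  qed
  show "(\<Sum>j<N. \<integral>x. chi Q (suffix i x) * chi Q (suffix j x) * h x \<partial>\<nu>) <= 2 * (\<Sum>n<N. c n)"
   using lo hi split[of "%j. \<integral>x. chi Q (suffix i x) * chi Q (suffix j x) * h x \<partial>\<nu>"] by linarith
 qed
 also have "... = N * (2 * (\<Sum>n<N. c n))" by simp
 finally have "real N * (real N * m\<^sup>2) <= real N * (2 * (\<Sum>n<N. c n))"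
  by (simp add: power2_eq_square mult_ac)
 then show ?thesis using assms(3) by simp
qed

end

section \<open>Perturbations of a component\<close>

lemma infsum_dominated_null:
 fixes s :: "nat => 'a => real"
 assumes nn: "!!n a. 0 <= s n a" and le: "!!n a. s n a <= m a" and m: "m summable_on UNIV"
  and lim: "!!a. (%n. s n a) \<longlonglongrightarrow> 0"
 shows "(%n. infsum (s n) UNIV) \<longlonglongrightarrow> 0"
proof (rule tendstoI)
 fix \<eta> :: real assume "0 < \<eta>"
 have sm: "s n summable_on S" for n S
 proof -
  have "s n summable_on UNIV" by (rule summable_on_comparison_test[OF m]) (use nn le in auto)
  then show ?thesis by (rule summable_on_subset) auto
 qed
 obtain F where F: "finite F" "dist (sum m F) (infsum m UNIV) <= \<eta> / 2"
  using infsum_finite_approximation[OF m, of "\<eta> / 2"] \<open>0 < \<eta>\<close> by auto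
 have mF: "infsum m (- F) <= \<eta> / 2"
 proof -
  have "infsum m (F \<union> - F) = infsum m F + infsum m (- F)"
   by (rule infsum_Un_disjoint) (use summable_on_subset[OF m] in auto)
  then have "infsum m (- F) = infsum m UNIV - sum m F" using F(1) by simp
  then show ?thesis using F(2) unfolding dist_real_def by linarith
 qed
 have "(%n. \<Sum>a\<in>F. s n a) \<longlonglongrightarrow> (\<Sum>a\<in>F. 0)" by (intro tendsto_sum lim)
 then have "EV n. (\<Sum>a\<in>F. s n a) < \<eta> / 2"
  using \<open>0 < \<eta>\<close> by (intro order_tendstoD(2)) auto
 then show "EV n. dist (infsum (s n) UNIV) 0 < \<eta>"
 proof eventually_elim
  case (elim n)
  have "infsum (s n) (F \<union> - F) = infsum (s n) F + infsum (s n) (- F)"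
   by (rule infsum_Un_disjoint) (use sm in auto)
  also have "infsum (s n) (- F) <= infsum m (- F)"
   by (intro infsum_mono sm le summable_on_subset[OF m]) auto
  finally have "infsum (s n) UNIV < \<eta>" using F(1) elim mF by simp
  then show ?case using infsum_nonneg[of UNIV "s n"] nn by simp
 qed
qed

lemma Op_scale: "l > 0 ==> l * Op G l (letters V) f x = Op G 1 (letters V) f x"
 unfolding Op_def letters_def
 by (subst infsum_cmult_right'[symmetric]) (auto intro!: infsum_cong)

lemma (in weight) letters_summable:
 assumes "bd f" "x \<in> X" shows "(%a. G (a ## x) * f (a ## x)) summable_on V"
proof -
 have "(%a. p [a] x * f (a ## x)) summable_on V"
  using Op_summable[OF adm_letters[of V] assms]
  unfolding letters_def by (subst (asm) summable_on_reindex) (auto simp: o_def inj_on_def)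
 then have "(%a. l * (p [a] x * f (a ## x))) summable_on V" by (rule summable_on_cmult_right)
 then show ?thesis using l_pos by simp
qed

lemma (in weight) Op_letters_unscaled: "l * T (letters V) f x = (\<Sum>\<^sub>\<infinity>a\<in>V. G (a ## x) * f (a ## x))"
 unfolding Op_letters using l_pos by (subst infsum_cmult_right'[symmetric]) simp

lemma (in weight) weight_scale: "0 < l' ==> weight A \<theta> C G Mj l'"
 by unfold_locales (use theta C_nonneg G_nonneg G_off G_dist G_le Mj_sum in auto)

text \<open>Restricting the transitions only involves the first two symbols, so it preserves distortion.\<close>

lemma (in weight) weight_restrict:
 "0 < l' ==> weight A \<theta> C (%x. if R (x 0) (x (Suc 0)) then G x else 0) Mj l'"
proof unfold_locales
 fix x y assume "x \<in> X" "y \<in> X" "x 0 = y 0" "x (Suc 0) = y (Suc 0)"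
 then show "(if R (x 0) (x (Suc 0)) then G x else 0) <=
   exp (C * d x y) * (if R (y 0) (y (Suc 0)) then G y else 0)" using G_dist by auto
next
 fix x show "(if R (x 0) (x (Suc 0)) then G x else 0) <= Mj (x 0)"
  using G_le[of x] G_nonneg[of x] by auto
qed (use theta C_nonneg G_nonneg G_off Mj_sum in auto)

text \<open>One component of full pressure as an instance of \<open>rpf\<close>, followed by a
  sequence of perturbed systems on the whole shift. \<open>G0\<close> is the full limit weight, of
  which \<open>GU\<close> keeps the transitions inside the component, and \<open>s n a\<close>
  bounds the error over the state \<open>a\<close>. The bound \<open>ls_upper\<close> on the
  eigenvalues is assumed because it comes from the pressure of the whole system and not from the
  component.\<close>

locale pert = rpf A \<theta> C GU Mj lU hU nU Us MU
 for A :: "'s::{countable,discrete_topology} => 's => bool" and \<theta> C :: real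
  and GU :: "'s word => real" and Mj :: "'s => real" and lU :: real
  and hU :: "'s word => real" and nU :: "'s word measure" and Us :: "'s set"
  and MU :: "'s => 's => bool" +
 fixes Gs :: "nat => 's word => real" and ls :: "nat => real" and hs :: "nat => 's word => real"
  and ns :: "nat => 's word measure" and G0 :: "'s word => real" and s :: "nat => 's => real"
 assumes rpfs: "!!n. rpf A \<theta> C (Gs n) Mj (ls n) (hs n) (ns n) UNIV A"
  and GU_eq: "!!x. GU x = (if MU (x 0) (x (Suc 0)) then G0 x else 0)"
  and Gs_close: "!!n x. x \<in> shift_space A ==> \<bar>Gs n x - G0 x\<bar> <= s n (x 0)"
  and s_nonneg: "!!n a. 0 <= s n a" and s_le: "!!n a. s n a <= 2 * Mj a"
  and s_lim: "!!a. (%n. s n a) \<longlonglongrightarrow> 0"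
  and nU_M: "AE x in nU. x \<in> shift_space MU"
  and ls_upper: "!!\<eta>. 0 < \<eta> ==> EV n. ls n < lU + \<eta>"
begin

text \<open>This restricted weight converges to \<open>GU\<close>, while dropping the other
  transitions lowers the operator and makes the perturbed eigenfunctions excessive.\<close>

definition GUs :: "nat => 's word => real" where
 "GUs n x = (if MU (x 0) (x (Suc 0)) then Gs n x else 0)"

definition e :: "nat => real" where "e n = infsum (s n) UNIV"

lemma e_lim: "e \<longlonglongrightarrow> 0"
 unfolding e_def
 by (rule infsum_dominated_null[of s "%a. 2 * Mj a"])
  (auto intro: s_nonneg s_le s_lim summable_on_cmult_right Mj_sum)

lemma s_summable: "s n summable_on S"
proof -
 have "s n summable_on UNIV"
  by (rule summable_on_comparison_test[of "%a. 2 * Mj a"])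
   (auto intro: s_nonneg s_le summable_on_cmult_right Mj_sum)
 then show ?thesis by (rule summable_on_subset) auto
qed

lemma e_nonneg: "0 <= e n"
 unfolding e_def by (rule infsum_nonneg) (rule s_nonneg)

lemma GUs_nonneg: "0 <= GUs n x"
proof -
 interpret N: rpf A \<theta> C "Gs n" Mj "ls n" "hs n" "ns n" UNIV A by (rule rpfs)
 show ?thesis by (simp add: GUs_def N.G_nonneg)
qed

lemma GUs_weight: "0 < l' ==> weight A \<theta> C (GUs n) Mj l'"
proof -
 interpret N: rpf A \<theta> C "Gs n" Mj "ls n" "hs n" "ns n" UNIV A by (rule rpfs)
 assume "0 < l'"
 then show ?thesis using N.weight_restrict[of l' MU] by (simp add: GUs_def[abs_def])
qed

lemma Gs_weight: "0 < l' ==> weight A \<theta> C (Gs n) Mj l'"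
proof -
 interpret N: rpf A \<theta> C "Gs n" Mj "ls n" "hs n" "ns n" UNIV A by (rule rpfs)
 show "0 < l' ==> ?thesis" by (rule N.weight_scale)
qed

lemma GU_GUs: "x \<in> X ==> \<bar>GUs n x - GU x\<bar> <= s n (x 0)"
 using Gs_close[of x n] s_nonneg[of n "x 0"] by (auto simp: GUs_def GU_eq)

lemma GU_le_GUs: "GU x <= GUs n x + s n (x 0)"
proof -
 interpret N: weight A \<theta> C "GUs n" Mj 1 by (rule GUs_weight) simp
 show ?thesis
 proof (cases "x \<in> X")
  case True then show ?thesis using GU_GUs[OF True, of n] by linarith
 next
  case False then show ?thesis using N.G_off[OF False] G_off[OF False] s_nonneg[of n "x 0"] by simp
 qed
qed

lemma exists_limit_point: assumes "b \<in> Us" obtains y where "y \<in> shift_space MU" "y \<in> X" "y 0 = b"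
proof -
 have "EX y:cyl A [b]. y \<in> shift_space MU"
 proof (rule ccontr)
  assume n: "\<not> ?thesis"
  have "AE x in nU. x \<notin> cyl A [b]" using nU_M by (rule AE_mp) (use n in auto)
  then have "measure nU (cyl A [b]) = 0"
   using cyl_in_sets[of "[b]"] by (simp add: AE_iff_measurable[OF _ refl] emeasure_eq_measure Collect_mem_eq nu_space cyl_def Int_def conj_commute cong: conj_cong)
  then show False using state_pos[OF assms] by simp
 qed
 then show ?thesis using that by (auto simp: cyl_sing)
qed

lemma XU_sub: "x \<in> shift_space MU ==> x \<in> X"
 unfolding shift_space_def using M_sub by blast

lemma XU_Us: "x \<in> shift_space MU ==> x k \<in> Us"
 unfolding shift_space_def using M_sub by blast

lemma XU_prefix: assumes "x \<in> shift_space MU" shows "successively MU (prefix m x)"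
 unfolding successively_conv_nth using assms by (simp add: shift_space_def)

section \<open>Excessive functions\<close>

text \<open>The one-step comparison behind both the convergence of eigenvalues and of eigenfunctions:
 the minimum of an excessive function and an eigenfunction is almost excessive.\<close>

lemma Op_min_le:
 assumes F: "bd F" "!!x. x \<in> X ==> 0 <= F x"
  and ex: "!!x. x \<in> X ==> Op (GUs n) 1 (letters UNIV) F x <= \<kappa> * F x"
  and c: "0 <= c" and H: "!!x. x \<in> X ==> hU x <= H" and x: "x \<in> X"
 shows "lU * T1 (%y. min (F y) (c * hU y)) x <= \<kappa> * F x + c * H * e n"
  and "lU * T1 (%y. min (F y) (c * hU y)) x <= lU * (c * hU x)"
proof -
 let ?k = "%y. min (F y) (c * hU y)"
 interpret N: weight A \<theta> C "GUs n" Mj 1 by (rule GUs_weight) simp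
 interpret U1: weight A \<theta> C GU Mj 1 by (rule weight_scale) simp
 have k0: "0 <= ?k y" if "y \<in> X" for y using F(2)[OF that] h_nonneg[OF that] c by simp
 have H0: "0 <= H" using H[OF x] h_nonneg[OF x] by linarith
 have bdk: "bd ?k"
 proof -
  obtain B where B: "0 <= B" "!!x. x \<in> X ==> \<bar>F x\<bar> <= B" by (rule bdE[OF F(1)]) blast
  have "\<bar>?k y\<bar> <= B" if "y \<in> X" for y using k0[OF that] B(2)[OF that] by linarith
  then show ?thesis unfolding bd_def by blast
 qed
 show "lU * T1 ?k x <= lU * (c * hU x)"
 proof -
  have "T1 ?k x <= T1 (%y. c * hU y) x"
   by (intro Op_mono adm_letters bdk bd_cmult h_bd x) simp
  also have "... = c * hU x" by (simp add: Op_cmult eigen x)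
  finally show ?thesis using l_pos by simp
 qed
 have "lU * T1 ?k x = (\<Sum>\<^sub>\<infinity>a. GU (a ## x) * ?k (a ## x))"
  unfolding Op_scale[OF l_pos] U1.Op_letters by simp
 \<comment> \<open>The minimum is bounded by \<open>F\<close> in the main term and by
   \<open>c * H\<close> in the error term, so the error does not depend on the size of
   \<open>F\<close>.\<close>
 also have "... <= (\<Sum>\<^sub>\<infinity>a. GUs n (a ## x) * F (a ## x) + s n a * (c * H))"
 proof (intro infsum_mono summable_on_add)
  show "(%a. GU (a ## x) * ?k (a ## x)) summable_on UNIV"
   by (rule U1.letters_summable[OF bdk x])
  show "(%a. GUs n (a ## x) * F (a ## x)) summable_on UNIV"
   by (rule N.letters_summable[OF F(1) x])
  show "(%a. s n a * (c * H)) summable_on UNIV" by (intro summable_on_cmult_left s_summable)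
  fix a
  show "GU (a ## x) * ?k (a ## x) <= GUs n (a ## x) * F (a ## x) + s n a * (c * H)"
  proof (cases "a ## x \<in> X")
   case True
   have k: "0 <= ?k (a ## x)" "?k (a ## x) <= F (a ## x)" "?k (a ## x) <= c * H"
    using k0[OF True] mult_left_mono[OF H[OF True] c] by auto
   have "GU (a ## x) * ?k (a ## x) <= (GUs n (a ## x) + s n a) * ?k (a ## x)"
    using GU_le_GUs[of "a ## x" n] k(1) by (intro mult_right_mono) auto
   also have "... <= GUs n (a ## x) * F (a ## x) + s n a * (c * H)"
    unfolding distrib_right using k by (intro add_mono mult_left_mono GUs_nonneg s_nonneg)
   finally show ?thesis .
  next
   case False
   then show ?thesis using c H0 s_nonneg[of n a] by (simp add: G_off N.G_off)
  qed
 qed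
 also have "... = Op (GUs n) 1 (letters UNIV) F x + e n * (c * H)"
 proof -
  have "(%a. GUs n (a ## x) * F (a ## x)) summable_on UNIV"
   by (rule N.letters_summable[OF F(1) x])
  then show ?thesis
   unfolding N.Op_letters e_def
   by (subst infsum_add) (auto intro!: summable_on_cmult_left s_summable simp: infsum_cmult_left')
 qed
 also have "... <= \<kappa> * F x + c * H * e n" using ex[OF x] by (simp add: mult_ac)
 finally show "lU * T1 ?k x <= \<kappa> * F x + c * H * e n" .
qed

text \<open>Beyond the inequality \<open>excessive_le\<close>, the defect has to lie in the cone,
  for every finite set \<open>S\<close> of letters. A bound on it at one point, obtained from
  finitely many pointwise limits, then holds over the whole state
  (\<open>tail_small\<close>).\<close>

definition excessive :: "nat => real => ('s word => real) => bool" where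
 "excessive n \<kappa> F \<longleftrightarrow> harn K F & bd F &
   (ALL S. finite S --> harn K (%x. \<kappa> * F x - Op (GUs n) 1 (letters S) F x))"

lemma excessive_le:
 assumes "excessive n \<kappa> F" "x \<in> X"
 shows "Op (GUs n) 1 (letters UNIV) F x <= \<kappa> * F x"
proof -
 interpret N: weight A \<theta> C "GUs n" Mj 1 by (rule GUs_weight) simp
 have F: "bd F" "harn K F" "!!S. finite S ==> harn K (%x. \<kappa> * F x - Op (GUs n) 1 (letters S) F x)"
  using assms(1) by (auto simp: excessive_def)
 show ?thesis
  unfolding Op_def
 proof (rule infsum_le_finite_sums)
  show "(%w. pw (GUs n) 1 w x * F (w \<frown> x)) summable_on letters UNIV"
   by (rule N.Op_summable[OF N.adm_letters F(1) assms(2)])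
  fix W :: "'s list set" assume W: "finite W" "W \<subseteq> letters UNIV"
  then obtain S where S: "finite S" "W = letters S"
   unfolding letters_def by (metis finite_subset_image)
  have "0 <= \<kappa> * F x - Op (GUs n) 1 (letters S) F x" by (rule harn_nonneg[OF F(3)[OF S(1)] assms(2)])
  then show "(\<Sum>w\<in>W. pw (GUs n) 1 w x * F (w \<frown> x)) <= \<kappa> * F x"
   using W(1) unfolding S(2) by (simp add: Op_def)
 qed
qed

text \<open>The defect is a sum of two images of cone functions: the part of \<open>g\<close> not
  accounted for by \<open>chi Us * F\<close>, and the transitions of \<open>F\<close> that start
  outside \<open>S\<close> or leave the component. This covers eigenfunctions and the resolvents in
  \<open>flux_step\<close>.\<close>

lemma excessiveI:
 assumes F: "harn K F" "bd F" and g: "bd g" "harn K (%x. g x - chi Us x * F x)"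
  and eq: "!!x. x \<in> X ==> \<kappa> * F x = Op (Gs n) 1 (letters UNIV) g x"
 shows "excessive n \<kappa> F"
 unfolding excessive_def
proof (intro conjI allI impI F)
 fix S :: "'s set" assume S: "finite S"
 let ?R = "%x. if \<not> (x 0 \<in> S & MU (x 0) (x (Suc 0))) then Gs n x else 0"
 interpret N1: weight A \<theta> C "Gs n" Mj 1 by (rule Gs_weight) simp
 interpret R: weight A \<theta> C ?R Mj 1
  by (rule N1.weight_restrict[of 1 "%a b. \<not> (a \<in> S & MU a b)"]) simp
 interpret M: weight A \<theta> C "GUs n" Mj 1 by (rule GUs_weight) simp
 let ?F = "%x. chi Us x * F x" let ?g = "%x. g x - chi Us x * F x"
 have bF: "bd ?F" by (intro bd_mult bd_chi F)
 have bg: "bd ?g" by (intro bd_diff g bF)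
 have "harn K (%x. Op (Gs n) 1 (letters UNIV) ?g x + Op ?R 1 (letters UNIV) ?F x)"
  by (intro harn_add R.harn_Op N1.harn_Op R.adm_letters N1.adm_letters bF bg g harn_chi F order_refl)
 then show "harn K (%x. \<kappa> * F x - Op (GUs n) 1 (letters S) F x)"
 proof (rule harn_cong)
  fix x assume x: "x \<in> X"
  have 1: "(%a. Gs n (a ## x) * ?g (a ## x)) summable_on UNIV" by (rule N1.letters_summable[OF bg x])
  have 2: "(%a. ?R (a ## x) * ?F (a ## x)) summable_on UNIV" by (rule R.letters_summable[OF bF x])
  have 3: "(%a. chi S (a ## x) * GUs n (a ## x) * F (a ## x)) summable_on UNIV"
   using M.letters_summable[OF bd_mult[OF bd_chi[of S] F(2)] x, of UNIV] by (simp add: mult_ac)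
  have "Op (Gs n) 1 (letters UNIV) ?g x + Op ?R 1 (letters UNIV) ?F x + Op (GUs n) 1 (letters S) F x =
    (\<Sum>\<^sub>\<infinity>a. Gs n (a ## x) * ?g (a ## x)) + (\<Sum>\<^sub>\<infinity>a. ?R (a ## x) * ?F (a ## x))
    + (\<Sum>\<^sub>\<infinity>a. chi S (a ## x) * GUs n (a ## x) * F (a ## x))"
   unfolding M.Op_letters_chi[of S]
   using N1.Op_letters_unscaled[of UNIV ?g x] R.Op_letters_unscaled[of UNIV ?F x]
    M.Op_letters_unscaled[of UNIV "%y. chi S y * F y" x] by (simp only: mult_1_left) (simp only: mult_ac)
  also have "... = (\<Sum>\<^sub>\<infinity>a. Gs n (a ## x) * ?g (a ## x) + ?R (a ## x) * ?F (a ## x)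
    + chi S (a ## x) * GUs n (a ## x) * F (a ## x))"
   by (simp only: infsum_add[OF 1 2] infsum_add[OF summable_on_add[OF 1 2] 3])
  also have "... = (\<Sum>\<^sub>\<infinity>a. Gs n (a ## x) * g (a ## x))"
   using M_sub by (intro infsum_cong) (auto simp: chi_def GUs_def right_diff_distrib)
  also have "... = \<kappa> * F x" unfolding eq[OF x] using N1.Op_letters_unscaled[of UNIV g x] by simp
  finally show "Op (Gs n) 1 (letters UNIV) ?g x + Op ?R 1 (letters UNIV) ?F x = \<kappa> * F x - Op (GUs n) 1 (letters S) F x"
   by simp
 qed
qed

lemma excessive_scale:
 assumes "excessive n \<kappa> F" "0 <= c" shows "excessive n \<kappa> (%z. c * F z)"
 unfolding excessive_def
proof (intro conjI allI impI)
 interpret N: weight A \<theta> C "GUs n" Mj 1 by (rule GUs_weight) simp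
 show "harn K (%z. c * F z)" "bd (%z. c * F z)"
  using assms by (auto simp: excessive_def intro: harn_cmult bd_cmult)
 fix S :: "'s set" assume "finite S"
 then have "harn K (%x. c * (\<kappa> * F x - Op (GUs n) 1 (letters S) F x))"
  using assms by (intro harn_cmult) (auto simp: excessive_def)
 then show "harn K (%x. \<kappa> * (c * F x) - Op (GUs n) 1 (letters S) (%z. c * F z) x)"
  unfolding N.Op_cmult by (simp add: right_diff_distrib mult_ac)
qed

lemma excessive_hs: "excessive n (ls n) (hs n)"
proof (rule excessiveI)
 interpret N: rpf A \<theta> C "Gs n" Mj "ls n" "hs n" "ns n" UNIV A by (rule rpfs)
 show h: "harn K (hs n)" "bd (hs n)" "bd (hs n)" by (rule N.h_harn N.h_bd)+
 show "harn K (%x. hs n x - chi Us x * hs n x)"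
  by (rule harn_cong[OF harn_chi[OF h(1), of "- Us"]]) (simp add: chi_def)
 show "ls n * hs n x = Op (Gs n) 1 (letters UNIV) (hs n) x" if "x \<in> X" for x
  using N.eigen[OF that] Op_scale[OF N.l_pos, where ?G = "Gs n" and f = "hs n" and x = x and V = UNIV] by simp
qed

end

lemma successively_glue:
 assumes "successively P v" "v ~= []" "successively P (last v # u @ [b])" "successively P w" "w ~= []" "hd w = b"
 shows "successively P (v @ u @ w)"
proof -
 have "successively P ((last v # u) @ [b])" using assms(3) by simp
 then have "successively P (last v # u)" "P (last (last v # u)) b"
  unfolding successively_append_iff by auto
 then have "successively P ((last v # u) @ w)" using assms by (subst successively_append_iff) auto
 then show ?thesis using assms by (simp add: successively_append_iff successively_Cons)
qed

section \<open>Convergence of eigenvalues and pointwise limits of excessive functions\<close>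

context pert
begin

lemma hs_harn: "harn K (hs n)" and hs_bd: "bd (hs n)" and hs_pos: "x \<in> X ==> 0 < hs n x"
proof -
 interpret N: rpf A \<theta> C "Gs n" Mj "ls n" "hs n" "ns n" UNIV A by (rule rpfs)
 show "harn K (hs n)" "bd (hs n)" "x \<in> X ==> 0 < hs n x"
  using N.h_harn N.h_bd N.h_pos by auto
qed

lemma h_upper: obtains H where "0 <= H" "!!x. x \<in> X ==> hU x <= H"
proof -
 obtain B where B: "0 <= B" "!!x. x \<in> X ==> \<bar>hU x\<bar> <= B" by (rule bdE[OF h_bd]) blast
 show ?thesis
 proof (rule that[OF B(1)])
  fix x assume "x \<in> X" then show "hU x <= B" using B(2)[of x] by linarith
 qed
qed

lemma Us_nonempty: obtains y where "y \<in> shift_space MU" "y \<in> X"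
proof -
 have "EX y. y \<in> shift_space MU"
 proof (rule ccontr)
  assume "\<not> ?thesis"
  then have "AE x in nU. False" using nU_M by simp
  then show False using not_empty AE_iff_measurable emeasure_space_1 by (simp add: AE_False)
 qed
 then show ?thesis using that XU_sub by blast
qed

text \<open>The defect of \<open>min F (c hU)\<close> under the dual eigenmeasure is at most the perturbation error.\<close>

lemma min_defect:
 assumes ex: "excessive n \<kappa> F" and c: "0 <= c" and ub: "ALL x:X. hU x <= H"
 defines "k \<equiv> %z. min (F z) (c * hU z)" and "r \<equiv> c * H * e n + max 0 (\<kappa> - lU) * (c * H)"
 defines "\<psi> \<equiv> %z. lU * k z + r - lU * T1 k z"
 shows "bl k" "bl \<psi>" "0 <= r" "(\<integral>z. \<psi> z \<partial>nU) = r" "z \<in> X ==> 0 <= \<psi> z"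
  "z \<in> X ==> F z <= c * hU z ==> (lU - \<kappa>) * F z <= \<psi> z"
proof -
 have H: "hU x <= H" if "x \<in> X" for x using ub that by blast
 obtain x where "x \<in> X" by (rule Us_nonempty)
 then have H0: "0 <= H" using H[of x] h_nonneg[of x] by linarith
 have Fh: "harn K F" and Fbd: "bd F" using ex by (auto simp: excessive_def)
 have F0: "0 <= F z" if "z \<in> X" for z by (rule harn_nonneg[OF Fh that])
 show blk: "bl k" unfolding k_def by (intro bl_min bl_cmult h_bl harn_bd_bl[OF Fh Fbd])
 then have 1: "bl (%z. lU * k z + r)" "bl (%z. lU * T1 k z)"
  by (intro bl_add bl_cmult bl_const bl_Op adm_letters; assumption)+
 show "bl \<psi>" unfolding \<psi>_def by (rule bl_diff[OF 1])
 show "(\<integral>z. \<psi> z \<partial>nU) = r"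
  unfolding \<psi>_def using int_diff[OF 1] int_add[OF bl_cmult[OF blk] bl_const, of lU r] dual[OF blk] by (simp add: prob_space)
 have r: "0 <= c * H * e n" "0 <= max 0 (\<kappa> - lU) * (c * H)" using c H0 e_nonneg by auto
 then show "0 <= r" by (simp add: r_def)
 have le: "lU * T1 k z <= \<kappa> * F z + c * H * e n" "lU * T1 k z <= lU * (c * hU z)"
  if z: "z \<in> X" for z
  unfolding k_def by (rule Op_min_le[OF Fbd F0 excessive_le[OF ex] c H z]; assumption)+
 show below: "(lU - \<kappa>) * F z <= \<psi> z" if "z \<in> X" "F z <= c * hU z" for z
  using le(1)[OF that(1)] that(2) r(2) by (simp add: \<psi>_def k_def r_def left_diff_distrib)
 show "0 <= \<psi> z" if z: "z \<in> X"
 \<comment> \<open>Where the minimum is \<open>F\<close>, excessiveness applies and the second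
   summand of \<open>r\<close> absorbs the case \<open>\<kappa> > lU\<close>. Elsewhere the minimum
   is \<open>c * hU\<close>, for which the eigenvalue equation suffices.\<close>
 proof (cases "F z <= c * hU z")
  case True
  have "(\<kappa> - lU) * F z <= max 0 (\<kappa> - lU) * F z" using F0[OF z] by (intro mult_right_mono) auto
  also have "... <= max 0 (\<kappa> - lU) * (c * H)"
   using True mult_left_mono[OF H[OF z] c] by (intro mult_left_mono) auto
  finally show ?thesis using le(1)[OF z] r(1) True by (simp add: \<psi>_def k_def r_def left_diff_distrib)
 next
  case False
  then show ?thesis using le(2)[OF z] r by (simp add: \<psi>_def k_def r_def)
 qed
qed

text \<open>With \<open>hs n\<close> normalised at \<open>x0\<close> and \<open>c\<close> so large
  that \<open>F <= c * hU\<close> over the state \<open>b\<close>, the defect is at least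
  \<open>(lU - ls n) * exp (- K)\<close> there, while its whole integral is only the perturbation
  error.\<close>

lemma ls_lower: "EX B. ALL n. lU - ls n <= B * e n"
proof -
 obtain x0 where x0: "x0 \<in> shift_space MU" "x0 \<in> X" by (rule Us_nonempty)
 define b where "b = x0 0"
 have b: "b \<in> Us" using XU_Us[OF x0(1)] by (simp add: b_def)
 obtain H where H: "0 <= H" "!!x. x \<in> X ==> hU x <= H" by (rule h_upper) blast
 have hx0: "0 < hU x0" using h_pos[OF x0(2)] b by (simp add: b_def)
 \<comment> \<open>One factor \<open>exp K\<close> bounds \<open>F\<close> over the state
   \<open>b\<close>, the other one the oscillation of \<open>hU\<close> there.\<close>
 define c where "c = exp K * exp K / hU x0"
 define \<beta> where "\<beta> = measure nU (cyl A [b])"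
 have c: "0 <= c" using hx0 by (simp add: c_def)
 have \<beta>: "0 < \<beta>" using state_pos[OF b] by (simp add: \<beta>_def)
 have "lU - ls n <= (c * H * exp K / \<beta>) * e n" for n
 proof (cases "ls n < lU")
  case False
  then show ?thesis using c H(1) \<beta> e_nonneg[of n] by (smt (verit) divide_nonneg_pos exp_ge_zero mult_nonneg_nonneg)
 next
  case True
  define F where "F x = 1 / hs n x0 * hs n x" for x
  have hx: "0 < hs n x0" by (rule hs_pos[OF x0(2)])
  have exF: "excessive n (ls n) F"
   unfolding F_def[abs_def] using hx by (intro excessive_scale excessive_hs) simp
  then have Fh: "harn K F" by (auto simp: excessive_def)
  have H': "ALL x:X. hU x <= H" using H(2) by blast
  note D = min_defect[OF exF c H']
  have pw: "(lU - ls n) * exp (- K) * indicator (cyl A [b]) x <=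
    lU * min (F x) (c * hU x) + (c * H * e n + max 0 (ls n - lU) * (c * H)) - lU * T1 (%z. min (F z) (c * hU z)) x"
   if x: "x \<in> X" for x
  proof (cases "x \<in> cyl A [b]")
   case True
   then have xb: "x 0 = x0 0" by (simp add: cyl_sing b_def)
   have "F x <= exp K * F x0" by (rule harnD1[OF Fh K_nonneg x x0(2) xb])
   then have Fx: "F x <= exp K" using hx by (simp add: F_def)
   have "c * hU x0 <= c * (exp K * hU x)"
    by (rule mult_left_mono[OF harnD1[OF h_harn K_nonneg x0(2) x xb[symmetric]] c])
   then have "exp K * exp K <= exp K * (c * hU x)" using hx0 by (simp add: c_def)
   then have k: "F x <= c * hU x" using Fx by simp
   have "F x0 <= exp K * F x" by (rule harnD1[OF Fh K_nonneg x0(2) x xb[symmetric]])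
   then have "exp (- K) <= F x" using hx by (simp add: F_def exp_minus field_simps)
   then have "(lU - ls n) * exp (- K) <= (lU - ls n) * F x" using \<open>ls n < lU\<close> by (intro mult_left_mono) auto
   then show ?thesis using D(6)[OF x k] True by simp
  qed (use D(5)[OF x] in simp)
  have "(lU - ls n) * exp (- K) * \<beta> = (\<integral>x. (lU - ls n) * exp (- K) * indicator (cyl A [b]) x \<partial>nU)"
   using int_cyl[of "[b]"] by (simp add: \<beta>_def)
  also have "... <= c * H * e n + max 0 (ls n - lU) * (c * H)"
   by (subst D(4)[symmetric]) (intro int_mono bl_cmult bl_cyl D(2) pw)
  also have "... = c * H * e n" using True by simp
  finally show ?thesis using \<beta> by (simp add: exp_minus field_simps)
 qed
 then show ?thesis by blast
qed

lemma ls_lim: "ls \<longlonglongrightarrow> lU"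
proof (rule order_tendstoI)
 fix a assume a: "a < lU"
 obtain B where B: "!!n. lU - ls n <= B * e n" using ls_lower by blast
 have "(%n. B * e n) \<longlonglongrightarrow> B * 0" by (intro tendsto_intros e_lim)
 then have "EV n. B * e n < lU - a" using a by (intro order_tendstoD(2)) auto
 then show "EV n. a < ls n"
  by eventually_elim (use B in \<open>smt (verit)\<close>)
next
 fix a assume "lU < a"
 then show "EV n. ls n < a" using ls_upper[of "a - lU"] by simp
qed

lemma cyl_prefix_dist:
 assumes "x \<in> cyl A (prefix m y)" "y \<in> X" "0 < m"
 shows "x \<in> X" "x 0 = y 0" "d x y <= \<theta> ^ m"
proof -
 have a: "x k = y k" if "k < m" for k using assms(1) that by (auto simp: cyl_eq)
 show "x \<in> X" using assms(1) by (simp add: cyl_def)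
 show "x 0 = y 0" using a assms(3) by blast
 show "d x y <= \<theta> ^ m" using a by (intro dtheta_le_power[OF theta])
qed

lemma harn_cyl_le:
 assumes "harn K f" "x \<in> X" "y \<in> X" "x 0 = y 0" "d x y <= \<theta> ^ m"
 shows "f x <= exp (K * \<theta> ^ m) * f y"
proof -
 have "f x <= exp (K * d x y) * f y" by (rule harnD[OF assms(1-4)])
 also have "... <= exp (K * \<theta> ^ m) * f y"
  using assms K_nonneg harn_nonneg[OF assms(1,3)] by (intro mult_right_mono) (auto intro: mult_left_mono)
 finally show ?thesis .
qed

text \<open>Cylinders of length \<open>m\<close> are so small that two Harnack comparisons on them
  cost only the factor \<open>1 + \<eta>\<close>.\<close>

lemma exp_K_theta_small: assumes "0 < \<eta>" obtains m where "0 < m" "exp (2 * (K * \<theta> ^ m)) <= 1 + \<eta>"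
proof -
 have "(%m. exp (2 * (K * \<theta> ^ m))) \<longlonglongrightarrow> exp (2 * (K * 0))"
  using theta by (intro tendsto_intros LIMSEQ_power_zero) auto
 then have "EV m. exp (2 * (K * \<theta> ^ m)) < 1 + \<eta>"
  using assms by (intro order_tendstoD(2)) auto
 then have "EV m. exp (2 * (K * \<theta> ^ m)) < 1 + \<eta> & 0 < m"
  by (intro eventually_conj eventually_gt_at_top)
 then obtain m where "exp (2 * (K * \<theta> ^ m)) < 1 + \<eta>" "0 < m"
  using eventually_happens' sequentially_bot by blast
 then show ?thesis using that[of m] by simp
qed

text \<open>If an almost excessive function dominates \<open>c hU\<close> near one point of the component, then
 the defect \<open>(c hU - F)\<^sup>+\<close> has small mass on every cylinder leading to that point.\<close>

lemma propagate:
 assumes ex: "!!n. excessive n (\<kappa> n) (F n)" and \<kappa>: "\<kappa> \<longlonglongrightarrow> lU"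
  and x: "x \<in> shift_space MU" and y: "y \<in> shift_space MU" and \<eta>: "0 < \<eta>" and c: "0 < c"
 shows "EV n. (1 + \<eta>) * (c * hU x) <= F n x --> c / (1 + \<eta>)\<^sup>2 * hU y <= F n y"
proof -
 have xX: "x \<in> X" and yX: "y \<in> X" using x y XU_sub by auto
 obtain H where H: "0 <= H" "!!x. x \<in> X ==> hU x <= H" by (rule h_upper) blast
 obtain m where m: "0 < m" "exp (2 * (K * \<theta> ^ m)) <= 1 + \<eta>" by (rule exp_K_theta_small[OF \<eta>])
 define E where "E = exp (K * \<theta> ^ m)"
 have "E * E = exp (2 * (K * \<theta> ^ m))" unfolding E_def mult_exp_exp by simp
 then have E: "1 <= E" "E * E <= 1 + \<eta>"
  using m(2) K_nonneg theta by (simp_all add: E_def)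
 let ?w = "prefix m x" and ?v = "prefix m y"
 have v: "?v ~= []" "successively MU ?v" "last ?v \<in> Us"
  using m(1) XU_prefix[OF y] XU_Us[OF y] by (auto simp: last_conv_nth)
 obtain u' where u': "successively MU (last ?v # u' @ [x 0])"
  using irr[OF v(3) XU_Us[OF x]] by blast
 let ?u = "?v @ u'"
 have w: "?w ~= []" "hd ?w = x 0" "successively MU ?w" "last ?w \<in> Us"
  using m(1) XU_prefix[OF x] XU_Us[OF x] by (auto simp: last_conv_nth hd_conv_nth)
 have adm: "successively MU (?u @ ?w)"
  using v w successively_glue[of MU ?v u' "x 0" ?w] u' by simp
 define \<beta> where "\<beta> = measure nU (cyl A (?u @ ?w))"
 have \<beta>: "0 < \<beta>" unfolding \<beta>_def using w adm by (intro cyl_pos) auto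
 obtain \<kappa>0 where \<kappa>0: "0 < \<kappa>0" "!!z. z \<in> X ==> z 0 \<in> {y 0} ==> \<kappa>0 <= hU z"
  by (rule h_lower[of "{y 0}"], simp, use XU_Us[OF y] in simp, rule that)
 define err where "err n = c * H * e n + max 0 (\<kappa> n - lU) * (c * H)" for n
 have err_lim: "err \<longlonglongrightarrow> c * H * 0 + max 0 (lU - lU) * (c * H)"
  unfolding err_def by (intro tendsto_intros e_lim \<kappa> tendsto_max)
 have "(%n. length ?u * (err n / lU)) \<longlonglongrightarrow> length ?u * ((c * H * 0 + max 0 (lU - lU) * (c * H)) / lU)"
  using l_pos by (intro tendsto_intros err_lim) auto
 moreover have pos: "0 < \<eta> / (1 + \<eta>) * (c * \<kappa>0) * \<beta>" using \<eta> c \<kappa>0(1) \<beta> by simp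
 ultimately have "EV n. length ?u * (err n / lU) < \<eta> / (1 + \<eta>) * (c * \<kappa>0) * \<beta>"
  by (intro order_tendstoD(2)) auto
 then show ?thesis
 proof eventually_elim
  case (elim n)
  show ?case
  proof (rule impI, rule ccontr)
   assume Fx: "(1 + \<eta>) * (c * hU x) <= F n x" and Fy: "\<not> c / (1 + \<eta>)\<^sup>2 * hU y <= F n y"
   have Fh: "harn K (F n)" using ex[of n] by (auto simp: excessive_def)
   have c0: "0 <= c" using c by simp
   let ?k = "%z. min (F n z) (c * hU z)"
   define \<psi> where "\<psi> z = lU * ?k z + err n - lU * T1 ?k z" for z
   have H': "ALL x:X. hU x <= H" using H(2) by blast
   note D = min_defect[OF ex[of n] c0 H', folded err_def]
   note blk = D(1) and err0 = D(3)
   have bl\<psi>: "bl \<psi>" and int\<psi>: "(\<integral>z. \<psi> z \<partial>nU) = err n" and \<psi>0: "z \<in> X ==> 0 <= \<psi> z" for z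
    using D(2,4,5) by (simp_all add: \<psi>_def[abs_def])
   define v where "v z = c * hU z - ?k z" for z
   have blv: "bl v" unfolding v_def by (intro bl_diff bl_cmult h_bl blk)
   have v0: "0 <= v z" for z by (simp add: v_def)
   have Tv: "T1 v z <= v z + \<psi> z / lU" if z: "z \<in> X" for z
   proof -
    have "T1 v z = c * hU z - T1 ?k z"
     unfolding v_def
     using Op_diff[OF adm_letters bd_cmult[OF h_bd] bl_bd[OF blk] z, of UNIV c] by (simp add: Op_cmult eigen z)
    moreover have "lU * (c * hU z - T1 ?k z) = lU * v z + \<psi> z - err n"
     by (simp add: v_def \<psi>_def right_diff_distrib)
    ultimately have "lU * T1 v z <= lU * v z + \<psi> z"
     using err0 by simp
    then show ?thesis using l_pos by (simp add: field_simps)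
   qed
   \<comment> \<open>\<open>J w\<close> is the mass of the shortfall of \<open>F n\<close> below
     \<open>c * hU\<close> on a cylinder. By duality it grows at most by \<open>err n / lU\<close>
     for each letter put in front. It is 0 near \<open>x\<close>, and it would be bounded below near
     \<open>y\<close> if the claim failed.\<close>
   define J where "J w = (\<integral>z. indicator (cyl A w) z * v z \<partial>nU)" for w
   have Jstep: "J (a # w) <= J w + err n / lU" for a w
   proof -
    let ?f = "%z. indicator (cyl A (a # w)) z * v z"
    have blf: "bl ?f" by (intro bl_mult bl_cyl blv)
    have "J (a # w) = (\<integral>z. T1 ?f z \<partial>nU)" unfolding J_def by (rule dual[OF blf, symmetric])
    also have "... <= (\<integral>z. indicator (cyl A w) z * v z + 1 / lU * \<psi> z \<partial>nU)"
    proof (intro int_mono bl_add bl_mult bl_cyl blv bl_const bl\<psi> bl_Op adm_letters)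
     fix z assume z: "z \<in> X"
     have \<psi>l: "0 <= 1 / lU * \<psi> z" using \<psi>0[OF z] l_pos by simp
     show "T1 ?f z <= indicator (cyl A w) z * v z + 1 / lU * \<psi> z"
     proof (cases "z \<in> cyl A w")
      case True
      have "T1 ?f z <= T1 v z"
       using v0 by (intro Op_mono adm_letters bl_bd[OF blf] bl_bd[OF blv] z) (auto simp: indicator_def)
      then show ?thesis using Tv[OF z] True by simp
     next
      case False
      have "T1 ?f z = T1 (%_. 0) z"
       using False by (intro Op_cong z) (auto simp: letters_def cyl_build)
      also have "... = 0" by (simp add: Op_def)
      finally show ?thesis using \<psi>l False by simp
     qed
    qed
    also have "... = J w + err n / lU"
     unfolding J_def using int_add[OF bl_mult[OF bl_cyl blv] bl_cmult[OF bl\<psi>], of w "1 / lU"] by (simp add: int\<psi>)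
    finally show ?thesis .
   qed
   have Jpath: "J (u @ w) <= J w + length u * (err n / lU)" for u w
   proof (induction u)
    case (Cons a u)
    then show ?case using Jstep[of a "u @ w"] by (simp add: algebra_simps)
   qed simp
   have Jw: "J ?w = 0"
   proof -
    have "indicator (cyl A ?w) z * v z = 0" if z: "z \<in> X" for z
    proof (cases "z \<in> cyl A ?w")
     case True
     note zx = cyl_prefix_dist[OF True xX m(1)]
     have "c * hU z <= c * (E * hU x)"
      unfolding E_def using c0 zx xX by (intro mult_left_mono harn_cyl_le h_harn) auto
     then have "c * hU z * E <= c * (E * hU x) * E" using E(1) by (intro mult_right_mono) auto
     also have "... = (E * E) * (c * hU x)" by simp
     also have "... <= (1 + \<eta>) * (c * hU x)" using E(2) c0 h_nonneg[OF xX] by (intro mult_right_mono) auto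
     also have "... <= F n x" by (rule Fx)
     also have "F n x <= E * F n z"
      unfolding E_def using zx xX d_sym[of z x] by (intro harn_cyl_le Fh) auto
     finally have "c * hU z <= F n z" using E(1) by (simp add: mult.commute)
     then show ?thesis by (simp add: v_def)
    qed simp
    then have "J ?w = (\<integral>z. 0 \<partial>nU)" unfolding J_def by (rule int_cong)
    then show ?thesis by simp
   qed
   have "\<eta> / (1 + \<eta>) * (c * \<kappa>0) * \<beta> = (\<integral>z. \<eta> / (1 + \<eta>) * (c * \<kappa>0) * indicator (cyl A (?u @ ?w)) z \<partial>nU)"
    using int_cyl[of "?u @ ?w"] by (simp add: \<beta>_def)
   also have "... <= J (?u @ ?w)"
    unfolding J_def
   proof (intro int_mono bl_cmult bl_mult bl_cyl blv)
    fix z assume z: "z \<in> X"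
    show "\<eta> / (1 + \<eta>) * (c * \<kappa>0) * indicator (cyl A (?u @ ?w)) z <= indicator (cyl A (?u @ ?w)) z * v z"
    proof (cases "z \<in> cyl A (?u @ ?w)")
     case True
     have "z \<in> cyl A ?v"
      unfolding cyl_eq
     proof (intro CollectI conjI z allI impI)
      fix k assume "k < length ?v"
      then show "z k = ?v ! k" using True by (auto simp: cyl_eq nth_append)
     qed
     note zy = cyl_prefix_dist[OF this yX m(1)]
     have "F n z <= E * F n y" unfolding E_def using zy yX by (intro harn_cyl_le Fh) auto
     also have "... <= E * (c / (1 + \<eta>)\<^sup>2 * hU y)" using Fy E(1) by (intro mult_left_mono) auto
     also have "... <= E * (c / (1 + \<eta>)\<^sup>2 * (E * hU z))"
      unfolding E_def[symmetric] using zy yX c0 \<eta> E(1) d_sym[of z y]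
      by (intro mult_left_mono) (auto simp: E_def intro!: harn_cyl_le h_harn)
     also have "... = (E * E) * (c / (1 + \<eta>)\<^sup>2 * hU z)" by simp
     also have "... <= (1 + \<eta>) * (c / (1 + \<eta>)\<^sup>2 * hU z)"
      using E(2) c0 \<eta> h_nonneg[OF z] by (intro mult_right_mono) auto
     also have "... = c * hU z / (1 + \<eta>)" using \<eta> by (simp add: power2_eq_square)
     finally have Fz: "F n z <= c * hU z / (1 + \<eta>)" .
     have "\<eta> / (1 + \<eta>) * (c * \<kappa>0) <= \<eta> / (1 + \<eta>) * (c * hU z)"
      using \<kappa>0(2)[OF z] zy(2) c0 \<eta> by (intro mult_left_mono) auto
     also have "... = c * hU z - c * hU z / (1 + \<eta>)" using \<eta> by (simp add: field_simps)
     also have "... <= v z" using Fz by (simp add: v_def)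
     finally show ?thesis using True by simp
    qed simp
   qed
   also have "... <= length ?u * (err n / lU)" using Jpath[of ?u ?w] Jw by simp
   finally show False using elim by simp
  qed
 qed
qed

text \<open>Domination propagates from \<open>x\<close> to \<open>y\<close> and from
  \<open>y\<close> to \<open>x\<close>. As \<open>F n x = 1\<close>, the first direction gives the
  lower bound, and the second the upper bound by contraposition.\<close>

lemma pointwise_limit:
 assumes ex: "!!n. excessive n (\<kappa> n) (F n)" and \<kappa>: "\<kappa> \<longlonglongrightarrow> lU"
  and x: "x \<in> shift_space MU" and y: "y \<in> shift_space MU" and F1: "!!n. F n x = 1"
 shows "(%n. F n y) \<longlonglongrightarrow> hU y / hU x"
proof -
 have hx: "0 < hU x" and hy: "0 < hU y" using h_pos XU_sub XU_Us x y by auto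
 let ?g = "hU y / hU x"
 have g: "0 < ?g" using hx hy by simp
 have low: "EV n. ?g / (1 + \<eta>) ^ 3 <= F n y" if \<eta>: "0 < \<eta>" for \<eta>
 proof -
  have "EV n. (1 + \<eta>) * (1 / ((1 + \<eta>) * hU x) * hU x) <= F n x -->
    1 / ((1 + \<eta>) * hU x) / (1 + \<eta>)\<^sup>2 * hU y <= F n y"
   by (rule propagate[OF ex \<kappa> x y \<eta>]) (use \<eta> hx in auto)
  then show ?thesis
   by eventually_elim (use \<eta> hx F1 in \<open>simp add: power2_eq_square power3_eq_cube mult_ac\<close>)
 qed
 have up: "EV n. F n y <= (1 + \<eta>) ^ 4 * ?g" if \<eta>: "0 < \<eta>" for \<eta>
 proof -
  \<comment> \<open>With \<open>c = (1 + \<eta>) ^ 3 / hU x\<close> the conclusion at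
    \<open>x\<close> would read \<open>1 + \<eta> <= F n x\<close>, which is false, so the premise
    has to fail.\<close>
  have "EV n. (1 + \<eta>) * ((1 + \<eta>) ^ 3 / hU x * hU y) <= F n y -->
    (1 + \<eta>) ^ 3 / hU x / (1 + \<eta>)\<^sup>2 * hU x <= F n x"
   by (rule propagate[OF ex \<kappa> y x \<eta>]) (use \<eta> hx in auto)
  then show ?thesis
  proof eventually_elim
   case (elim n)
   have "(1 + \<eta>) ^ 3 / hU x / (1 + \<eta>)\<^sup>2 * hU x = 1 + \<eta>"
    using \<eta> hx by (simp add: power2_eq_square power3_eq_cube)
   then have "\<not> (1 + \<eta>) * ((1 + \<eta>) ^ 3 / hU x * hU y) <= F n y" using elim F1[of n] \<eta> by auto
   then show ?case by (simp add: power4_eq_xxxx power3_eq_cube mult_ac)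
  qed
 qed
 show ?thesis
 proof (rule order_tendstoI)
  fix a assume a: "a < ?g"
  have "((%\<eta>. ?g / (1 + \<eta>) ^ 3) \<longlongrightarrow> ?g / (1 + 0) ^ 3) (at_right 0)" by (intro tendsto_intros) auto
  then have "\<forall>\<^sub>F \<eta> in at_right 0. a < ?g / (1 + \<eta>) ^ 3 & 0 < \<eta>"
   using a by (intro eventually_conj order_tendstoD(1) eventually_at_right_less) auto
  then obtain \<eta> where "a < ?g / (1 + \<eta>) ^ 3" "0 < \<eta>"
   using eventually_happens'[OF trivial_limit_at_right_real] by blast
  then show "EV n. a < F n y" using low[of \<eta>] by (auto elim: eventually_mono)
 next
  fix a assume a: "?g < a"
  have "((%\<eta>. (1 + \<eta>) ^ 4 * ?g) \<longlongrightarrow> (1 + 0) ^ 4 * ?g) (at_right 0)" by (intro tendsto_intros)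
  then have "\<forall>\<^sub>F \<eta> in at_right 0. (1 + \<eta>) ^ 4 * ?g < a & 0 < \<eta>"
   using a by (intro eventually_conj order_tendstoD(2) eventually_at_right_less) auto
  then obtain \<eta> where "(1 + \<eta>) ^ 4 * ?g < a" "0 < \<eta>"
   using eventually_happens'[OF trivial_limit_at_right_real] by blast
  then show "EV n. F n y < a" using up[of \<eta>] by (auto elim: eventually_mono)
 qed
qed

end

section \<open>Uniform convergence of excessive functions over a state\<close>

context pert
begin

lemma GUs_lim: "a ## y \<in> X ==> (%n. GUs n (a ## y)) \<longlonglongrightarrow> GU (a ## y)"
 by (rule Lim_null_comparison[THEN LIM_zero_cancel, OF _ s_lim[of a]])
  (use GU_GUs[of "a ## y"] in auto)

text \<open>By summability the letters outside \<open>S\<close> matter little at one point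
  \<open>y\<close> of the component; since the defect lies in the cone, the estimate spreads over
  the whole state at the cost of \<open>exp K\<close>. The factor 2 in \<open>\<eta>'\<close> leaves
  room for passing from the limit to finite \<open>n\<close>.\<close>

lemma tail_small:
 assumes ex: "!!n. excessive n (\<kappa> n) (F n)" and \<kappa>: "\<kappa> \<longlonglongrightarrow> lU"
  and x: "x \<in> shift_space MU" and F1: "!!n. F n x = 1" and b: "b \<in> Us" and \<eta>: "0 < \<eta>"
 defines "g \<equiv> %z. hU z / hU x"
 obtains S where "finite S"
  "EV n. ALL z:X. z 0 = b --> \<kappa> n * F n z - Op (GUs n) 1 (letters S) (F n) z \<in> {0..\<eta>}"
  "!!z. z \<in> X ==> z 0 = b ==> lU * g z - Op GU 1 (letters S) g z \<in> {0..\<eta>}"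
proof -
 obtain y where y: "y \<in> shift_space MU" "y \<in> X" "y 0 = b" by (rule exists_limit_point[OF b])
 interpret U1: weight A \<theta> C GU Mj 1 by (rule weight_scale) simp
 define \<eta>' where "\<eta>' = \<eta> / (2 * exp K)"
 have \<eta>': "0 < \<eta>'" "exp K * (2 * \<eta>') = \<eta>" using \<eta> by (simp_all add: \<eta>'_def)
 have hx: "0 < hU x" using h_pos XU_sub[OF x] XU_Us[OF x] by auto
 have geq: "g = (%z. 1 / hU x * hU z)" by (simp add: g_def)
 have gh: "harn K g" unfolding geq using hx by (intro harn_cmult h_harn) auto
 have gbd: "bd g" unfolding geq by (intro bd_cmult h_bd)
 have Lg: "(\<Sum>\<^sub>\<infinity>a. GU (a ## z) * g (a ## z)) = lU * g z" if z: "z \<in> X" for z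
 proof -
  have "T1 g z = g z" unfolding geq by (simp only: Op_cmult eigen[OF z])
  then show ?thesis using Op_letters_unscaled[of UNIV g z] by simp
 qed
 obtain S where S: "finite S"
  "dist (sum (%a. GU (a ## y) * g (a ## y)) S) (\<Sum>\<^sub>\<infinity>a. GU (a ## y) * g (a ## y)) <= \<eta>'"
  using infsum_finite_approximation[OF letters_summable[OF gbd y(2)] \<eta>'(1)] by blast
 have Sy: "lU * g y - (\<Sum>a\<in>S. GU (a ## y) * g (a ## y)) <= \<eta>'"
  using S(2) Lg[OF y(2)] by (simp add: dist_real_def)
 have limF: "(%n. F n y) \<longlonglongrightarrow> g y" unfolding g_def by (rule pointwise_limit[OF ex \<kappa> x y(1) F1])
 have lima: "(%n. GUs n (a ## y) * F n (a ## y)) \<longlonglongrightarrow> GU (a ## y) * g (a ## y)" for a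
 proof (cases "MU a b")
  case True
  then have ay: "a ## y \<in> shift_space MU" using y(1,3) by (simp add: shift_space_build)
  show ?thesis unfolding g_def
   by (intro tendsto_mult GUs_lim XU_sub[OF ay] pointwise_limit[OF ex \<kappa> x ay F1])
 next
  case False
  then show ?thesis using y(3) by (simp add: GUs_def GU_eq)
 qed
 have lim: "(%n. \<kappa> n * F n y - (\<Sum>a\<in>S. GUs n (a ## y) * F n (a ## y))) \<longlonglongrightarrow>
   lU * g y - (\<Sum>a\<in>S. GU (a ## y) * g (a ## y))"
  by (rule tendsto_diff[OF tendsto_mult[OF \<kappa> limF] tendsto_sum[OF lima]])
 then have "EV n. \<kappa> n * F n y - (\<Sum>a\<in>S. GUs n (a ## y) * F n (a ## y)) < 2 * \<eta>'"
  using Sy \<eta>'(1) by (intro order_tendstoD(2)) auto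
 then have 1: "EV n. ALL z:X. z 0 = b --> \<kappa> n * F n z - Op (GUs n) 1 (letters S) (F n) z \<in> {0..\<eta>}"
 proof eventually_elim
  case (elim n)
  interpret N: weight A \<theta> C "GUs n" Mj 1 by (rule GUs_weight) simp
  have h: "harn K (%z. \<kappa> n * F n z - Op (GUs n) 1 (letters S) (F n) z)"
   using ex[of n] S(1) by (simp add: excessive_def)
  have y': "\<kappa> n * F n y - Op (GUs n) 1 (letters S) (F n) y <= 2 * \<eta>'"
   using elim N.Op_letters_unscaled[of S "F n" y] S(1) by simp
  show ?case
  proof (intro ballI impI)
   fix z assume z: "z \<in> X" "z 0 = b"
   have "\<kappa> n * F n z - Op (GUs n) 1 (letters S) (F n) z <=
    exp K * (\<kappa> n * F n y - Op (GUs n) 1 (letters S) (F n) y)"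
    by (rule harnD1[OF h K_nonneg z(1) y(2)]) (simp add: z y)
   also have "... <= exp K * (2 * \<eta>')" using y' by (intro mult_left_mono) auto
   finally show "\<kappa> n * F n z - Op (GUs n) 1 (letters S) (F n) z \<in> {0..\<eta>}"
    using \<eta>' harn_nonneg[OF h z(1)] by simp
  qed
 qed
 have 2: "lU * g z - Op GU 1 (letters S) g z \<in> {0..\<eta>}" if z: "z \<in> X" "z 0 = b" for z
 proof -
  have sub: "letters S \<subseteq> letters UNIV" by (auto simp: letters_def)
  have eq: "lU * g z - Op GU 1 (letters S) g z = Op GU 1 (letters UNIV - letters S) g z" if "z \<in> X" for z
   using U1.Op_Diff[OF U1.adm_letters gbd that sub] Lg[OF that]
    U1.Op_letters_unscaled[of UNIV g z] by simp
  have h: "harn K (Op GU 1 (letters UNIV - letters S) g)"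
   using U1.adm_mono[OF U1.adm_letters[of UNIV], of "letters UNIV - letters S"]
   by (intro U1.harn_Op gbd gh) auto
  have "Op GU 1 (letters UNIV - letters S) g z <= exp K * Op GU 1 (letters UNIV - letters S) g y"
   by (rule harnD1[OF h K_nonneg z(1) y(2)]) (simp add: z y)
  also have "... <= exp K * \<eta>'"
   using Sy S(1) eq[OF y(2)] U1.Op_letters_unscaled[of S g y] by (intro mult_left_mono) auto
  also have "... <= \<eta>" using \<eta>'(2) \<eta> by simp
  finally show ?thesis using eq[OF z(1)] harn_nonneg[OF h z(1)] by simp
 qed
 show ?thesis by (rule that[OF S(1) 1 2])
qed

text \<open>Uniform convergence on \<open>[b]\<close>: the bound known on long cylinders is transported to shorter
 ones by one application of the transfer operator.\<close>

lemma uniform_limit_excessive: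
 assumes ex: "!!n. excessive n (\<kappa> n) (F n)" and \<kappa>: "\<kappa> \<longlonglongrightarrow> lU"
  and x: "x \<in> shift_space MU" and F1: "!!n. F n x = 1" and b: "b \<in> Us" and \<eta>: "0 < \<eta>"
 shows "EV n. ALL z:X. z 0 = b --> \<bar>F n z - hU z / hU x\<bar> <= \<eta>"
proof -
 define g where "g = (%z. hU z / hU x)"
 have hx: "0 < hU x" using h_pos XU_sub[OF x] XU_Us[OF x] by auto
 have geq: "g = (%z. 1 / hU x * hU z)" by (simp add: g_def)
 have gh: "harn K g" unfolding geq using hx by (intro harn_cmult h_harn) auto
 have gbd: "bd g" unfolding geq by (intro bd_cmult h_bd)
 have g0: "0 <= g z" if "z \<in> X" for z by (rule harn_nonneg[OF gh that])
 obtain Bg where Bg: "0 <= Bg" "!!x. x \<in> X ==> \<bar>g x\<bar> <= Bg" by (rule bdE[OF gbd]) blast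
 have Fh: "harn K (F n)" for n using ex[of n] by (auto simp: excessive_def)
 have lim: "(%n. F n y) \<longlonglongrightarrow> g y" if "y \<in> shift_space MU" for y
  unfolding g_def by (rule pointwise_limit[OF ex \<kappa> x that F1])
 \<comment> \<open>On cylinders of length \<open>N\<close> the error is \<open>\<delta>\<close>
   relative to \<open>g\<close> plus an arbitrarily small constant. The relative part must not grow
   while \<open>N\<close> descends to 1; the additive part may be chosen anew at each step.\<close>
 define P where "P N \<delta> \<longleftrightarrow> (ALL u \<eta>. length u = N --> successively MU u --> set u \<subseteq> Us --> 0 < \<eta> -->
  (EV n. ALL z:cyl A u. \<bar>F n z - g z\<bar> <= \<delta> * g z + \<eta>))" for N :: nat and \<delta> :: real
 \<comment> \<open>The cylinder of an admissible word of the component contains a point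
   \<open>y\<close> of its subshift, where convergence is known, and on the cylinder both functions
   vary at most by the factor \<open>exp (K * \<theta> ^ N)\<close>.\<close>
 have base: "P N (exp (2 * (K * \<theta> ^ N)) - 1)" if N: "0 < N" for N
  unfolding P_def
 proof (intro allI impI)
  fix u and \<eta> :: real assume u: "length u = N" "successively MU u" "set u \<subseteq> Us" and \<eta>: "0 < \<eta>"
  have une: "u ~= []" using u(1) N by auto
  then have "last u \<in> Us" using u(3) last_in_set by blast
  then obtain y' where y': "y' \<in> shift_space MU" "y' 0 = last u" by (rule exists_limit_point)
  define y where "y = butlast u \<frown> y'"
  have yM: "y \<in> shift_space MU" using u(2) une y' by (simp add: y_def shift_space_conc)
  have yX: "y \<in> X" by (rule XU_sub[OF yM])
  have yk: "y k = u ! k" if "k < N" for k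
  proof (cases "k < N - 1")
   case True then show ?thesis using u(1) by (simp add: y_def nth_butlast)
  next
   case False
   then have "k = length (butlast u)" using that u(1) by simp
   then show ?thesis using une y'(2) u(1) by (simp add: y_def last_conv_nth)
  qed
  define E where "E = exp (K * \<theta> ^ N)"
  have E: "exp (2 * (K * \<theta> ^ N)) = E * E" "1 <= E" unfolding E_def mult_exp_exp
   using K_nonneg theta by simp_all
  have "EV n. dist (F n y) (g y) < \<eta> / E" using lim[OF yM] \<eta> E(2) by (intro tendstoD) auto
  then show "EV n. ALL z:cyl A u. \<bar>F n z - g z\<bar> <= (exp (2 * (K * \<theta> ^ N)) - 1) * g z + \<eta>"
  proof eventually_elim
   case (elim n)
   have Fy: "E * \<bar>F n y - g y\<bar> <= \<eta>" using elim E(2) by (simp add: dist_real_def field_simps)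
   show ?case
   proof
    fix z assume z: "z \<in> cyl A u"
    have zX: "z \<in> X" using z by (simp add: cyl_def)
    have zk: "z k = y k" if "k < N" for k using z yk[OF that] that u(1) by (simp add: cyl_eq)
    have z0: "z 0 = y 0" using zk[of 0] N by simp
    have dz: "d z y <= \<theta> ^ N" "d y z <= \<theta> ^ N" using zk by (auto intro!: dtheta_le_power[OF theta])
    have up: "f z <= E * f y" and lo: "f y <= E * f z" if "harn K f" for f
     unfolding E_def using harn_cyl_le[OF that] zX yX z0 dz by auto
    have "F n z <= E * F n y" by (rule up[OF Fh])
    also have "... <= E * g y + \<eta>" using Fy mult_left_mono[OF abs_ge_self, of E "F n y - g y"] E(2)
     by (simp add: right_diff_distrib)
    also have "... <= E * (E * g z) + \<eta>" using lo[OF gh] E(2) by simp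
    finally have 1: "F n z - g z <= (E * E - 1) * g z + \<eta>" by (simp add: algebra_simps)
    have "g z <= E * g y" by (rule up[OF gh])
    also have "... <= E * F n y + \<eta>" using Fy mult_left_mono[OF abs_ge_minus_self, of E "F n y - g y"] E(2)
     by (simp add: right_diff_distrib)
    also have "... <= E * E * F n z + \<eta>" using lo[OF Fh, of n] E(2) by simp
    finally have 2: "g z - F n z <= (E * E - 1) * F n z + \<eta>" by (simp add: algebra_simps)
    have "1 * 1 <= E * E" using E(2) by (intro mult_mono) auto
    then have "F n z <= g z ==> (E * E - 1) * F n z <= (E * E - 1) * g z"
     "0 <= (E * E - 1) * g z" using g0[OF zX] by (auto intro: mult_left_mono)
    then show "\<bar>F n z - g z\<bar> <= (exp (2 * (K * \<theta> ^ N)) - 1) * g z + \<eta>"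
     using 1 2 \<eta> unfolding E(1) by linarith
   qed
  qed
 qed
 \<comment> \<open>Up to small tails, both functions are recovered from their values one letter
   further, and prefixing a letter turns a cylinder of length \<open>N\<close> into one of length
   \<open>Suc N\<close>. A relative error \<open>\<delta>\<close> comes back as
   \<open>\<delta>\<close> because \<open>g\<close> is an eigenfunction; all other errors are
   additive and small.\<close>
 have step: "P N \<delta>" if P: "P (Suc N) \<delta>" and N: "0 < N" and \<delta>: "0 <= \<delta>" for N \<delta>
  unfolding P_def
 proof (intro allI impI)
  fix u and \<eta> :: real assume u: "length u = N" "successively MU u" "set u \<subseteq> Us" and \<eta>: "0 < \<eta>"
  have une: "u ~= []" using u(1) N by auto
  define b where "b = hd u"
  have b: "b \<in> Us" using une u(3) by (simp add: b_def subset_iff)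
  obtain y where y: "y \<in> shift_space MU" "y \<in> X" "y 0 = b" by (rule exists_limit_point[OF b])
  define \<eta>1 where "\<eta>1 = lU * \<eta> / 4"
  have \<eta>1: "0 < \<eta>1" "lU * \<eta> = 4 * \<eta>1" using \<eta> l_pos by (auto simp: \<eta>1_def)
  obtain S where S: "finite S"
   "EV n. ALL z:X. z 0 = b --> \<kappa> n * F n z - Op (GUs n) 1 (letters S) (F n) z \<in> {0..\<eta>1}"
   "!!z. z \<in> X ==> z 0 = b ==> lU * g z - Op GU 1 (letters S) g z \<in> {0..\<eta>1}"
   unfolding g_def by (rule tail_small[OF ex \<kappa> x F1 b \<eta>1(1)]) blast
  define m where "m = sum Mj S"
  have m: "0 <= m" unfolding m_def by (intro sum_nonneg Mj_nonneg)
  define \<eta>2 where "\<eta>2 = \<eta>1 / (m + 1)"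
  have \<eta>2: "0 < \<eta>2" "\<eta>2 * m <= \<eta>1" using \<eta>1(1) m by (auto simp: \<eta>2_def field_simps)
  have ev1: "EV n. ALL a:{a\<in>S. MU a b}. ALL z:cyl A (a # u). \<bar>F n z - g z\<bar> <= \<delta> * g z + \<eta>2"
  proof (rule eventually_ball_finite)
   show "ALL a:{a\<in>S. MU a b}. EV n. ALL z:cyl A (a # u). \<bar>F n z - g z\<bar> <= \<delta> * g z + \<eta>2"
   proof
    fix a assume "a \<in> {a\<in>S. MU a b}"
    then have "successively MU (a # u)" "set (a # u) \<subseteq> Us" "length (a # u) = Suc N"
     using u une M_sub by (auto simp: successively_Cons b_def)
    then show "EV n. ALL z:cyl A (a # u). \<bar>F n z - g z\<bar> <= \<delta> * g z + \<eta>2"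
     using P \<eta>2(1) unfolding P_def by blast
   qed
  qed (use S(1) in simp)
  have "(%n. (1 + \<delta>) * (e n * Bg)) \<longlonglongrightarrow> (1 + \<delta>) * (0 * Bg)" by (intro tendsto_intros e_lim)
  then have ev2: "EV n. (1 + \<delta>) * (e n * Bg) < \<eta>1" using \<eta>1(1) by (intro order_tendstoD(2)) auto
  have "(%n. \<bar>\<kappa> n - lU\<bar> * (exp K * F n y)) \<longlonglongrightarrow> \<bar>lU - lU\<bar> * (exp K * g y)"
   by (intro tendsto_intros \<kappa> lim y)
  then have ev3: "EV n. \<bar>\<kappa> n - lU\<bar> * (exp K * F n y) < \<eta>1"
   using \<eta>1(1) by (intro order_tendstoD(2)) auto
  show "EV n. ALL z:cyl A u. \<bar>F n z - g z\<bar> <= \<delta> * g z + \<eta>"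
   using S(2) ev1 ev2 ev3
  proof eventually_elim
   case (elim n)
   interpret N: weight A \<theta> C "GUs n" Mj 1 by (rule GUs_weight) simp
   interpret U1: weight A \<theta> C GU Mj 1 by (rule weight_scale) simp
   show ?case
   proof
    fix z assume z: "z \<in> cyl A u"
    have zX: "z \<in> X" using z by (simp add: cyl_def)
    have zb: "z 0 = b" using z une by (auto simp: cyl_eq b_def hd_conv_nth)
    have "0 <= F n z" by (rule harn_nonneg[OF Fh zX])
    moreover have "F n z <= exp K * F n y" by (rule harnD1[OF Fh K_nonneg zX y(2)]) (simp add: zb y)
    ultimately have "\<bar>(\<kappa> n - lU) * F n z\<bar> <= \<bar>\<kappa> n - lU\<bar> * (exp K * F n y)"
     by (simp add: abs_mult mult_left_mono)
    then have k: "\<bar>\<kappa> n * F n z - lU * F n z\<bar> <= \<eta>1" using elim(4) by (simp add: left_diff_distrib)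
    let ?D = "%a. GUs n (a ## z) * F n (a ## z) - GU (a ## z) * g (a ## z)"
    have D: "\<bar>?D a\<bar> <= \<delta> * (GU (a ## z) * g (a ## z)) + (1 + \<delta>) * (s n a * Bg) + \<eta>2 * Mj a" if a: "a \<in> S" for a
    proof (cases "a ## z \<in> X & MU a b")
     case True
     then have aX: "a ## z \<in> X" and "a ## z \<in> cyl A (a # u)" using z by (auto simp: cyl_build shift_space_build)
     then have Fg: "\<bar>F n (a ## z) - g (a ## z)\<bar> <= \<delta> * g (a ## z) + \<eta>2" using elim(2) a True by blast
     have ga: "0 <= g (a ## z)" "g (a ## z) <= Bg" using g0[OF aX] Bg(2)[OF aX] by auto
     have "\<bar>GUs n (a ## z) - GU (a ## z)\<bar> * g (a ## z) <= s n a * Bg"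
      using GU_GUs[OF aX, of n] ga s_nonneg by (intro mult_mono) auto
     then have sg: "\<bar>GUs n (a ## z) * g (a ## z) - GU (a ## z) * g (a ## z)\<bar> <= s n a * Bg"
      using ga(1) by (simp add: abs_mult flip: left_diff_distrib)
     have "\<bar>GUs n (a ## z) * (F n (a ## z) - g (a ## z))\<bar> <= GUs n (a ## z) * (\<delta> * g (a ## z) + \<eta>2)"
      unfolding abs_mult using Fg GUs_nonneg by (simp add: mult_left_mono)
     also have "... <= \<delta> * (GUs n (a ## z) * g (a ## z)) + \<eta>2 * Mj a"
      using mult_left_mono[OF N.G_le[of "a ## z"], of \<eta>2] \<eta>2(1) by (simp add: algebra_simps)
     also have "\<delta> * (GUs n (a ## z) * g (a ## z)) <= \<delta> * (GU (a ## z) * g (a ## z) + s n a * Bg)"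
      using sg \<delta> by (intro mult_left_mono) auto
     finally show ?thesis using sg by (simp add: algebra_simps)
    next
     case False
     then have "GUs n (a ## z) = 0" "GU (a ## z) = 0" 
      using zb N.G_off[of "a ## z"] G_off[of "a ## z"] by (auto simp: GUs_def GU_eq)
     then show ?thesis using \<delta> \<eta>2(1) s_nonneg[of n a] Bg(1) Mj_nonneg[of a] by simp
    qed
    have sS: "(\<Sum>a\<in>S. s n a * Bg) <= e n * Bg"
     unfolding e_def sum_distrib_right[symmetric]
     using finite_sum_le_infsum[OF s_summable S(1)] s_nonneg Bg(1) by (intro mult_right_mono) auto
    have GUg: "(\<Sum>a\<in>S. GU (a ## z) * g (a ## z)) = Op GU 1 (letters S) g z"
     and GUsF: "(\<Sum>a\<in>S. GUs n (a ## z) * F n (a ## z)) = Op (GUs n) 1 (letters S) (F n) z"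
     using U1.Op_letters_unscaled[of S g z] N.Op_letters_unscaled[of S "F n" z] S(1) by simp_all
    have "\<bar>\<Sum>a\<in>S. ?D a\<bar> <= (\<Sum>a\<in>S. \<delta> * (GU (a ## z) * g (a ## z)) + (1 + \<delta>) * (s n a * Bg) + \<eta>2 * Mj a)"
     using D by (intro order_trans[OF sum_abs] sum_mono)
    also have "... = \<delta> * Op GU 1 (letters S) g z + (1 + \<delta>) * (\<Sum>a\<in>S. s n a * Bg) + \<eta>2 * m"
     by (simp only: sum.distrib sum_distrib_left[symmetric] GUg m_def)
    also have "... <= \<delta> * (lU * g z) + \<eta>1 + \<eta>1"
     using S(3)[OF zX zb] \<delta> \<eta>2(2) order_trans[OF mult_left_mono[OF sS, of "1 + \<delta>"] less_imp_le[OF elim(3)]]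
     by (intro add_mono mult_left_mono) auto
    finally have "\<bar>Op (GUs n) 1 (letters S) (F n) z - Op GU 1 (letters S) g z\<bar> <= \<delta> * (lU * g z) + 2 * \<eta>1"
     by (simp only: sum_subtractf GUg GUsF)
    moreover have "\<bar>\<kappa> n * F n z - Op (GUs n) 1 (letters S) (F n) z - (lU * g z - Op GU 1 (letters S) g z)\<bar> <= \<eta>1"
     using S(3)[OF zX zb] elim(1) zX zb by fastforce
    ultimately have "\<bar>lU * F n z - lU * g z\<bar> <= \<delta> * (lU * g z) + lU * \<eta>"
     using k unfolding \<eta>1(2) by linarith
    then have "lU * \<bar>F n z - g z\<bar> <= lU * (\<delta> * g z + \<eta>)"
     unfolding right_diff_distrib[symmetric] abs_mult using l_pos by (simp add: distrib_left mult_ac)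
    then show "\<bar>F n z - g z\<bar> <= \<delta> * g z + \<eta>" using l_pos by simp
   qed
  qed
 qed
 have desc: "P (Suc N) \<delta> ==> 0 <= \<delta> ==> P 1 \<delta>" for N \<delta> by (induction N) (auto intro: step)
 define \<tau> where "\<tau> = \<eta> / (2 * (Bg + 1))"
 have \<tau>: "0 < \<tau>" "\<tau> * Bg <= \<eta> / 2" using \<eta> Bg(1) by (auto simp: \<tau>_def field_simps)
 obtain m where m: "0 < m" "exp (2 * (K * \<theta> ^ m)) <= 1 + \<tau>" by (rule exp_K_theta_small[OF \<tau>(1)])
 obtain N where N: "m = Suc N" using m(1) by (cases m) auto
 have "P 1 (exp (2 * (K * \<theta> ^ m)) - 1)"
  using base[OF m(1)] desc[of N] K_nonneg theta unfolding N by simp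
 then have "EV n. ALL z:cyl A [b]. \<bar>F n z - g z\<bar> <= (exp (2 * (K * \<theta> ^ m)) - 1) * g z + \<eta> / 2"
  unfolding P_def by (rule allE[of _ "[b]"]) (use \<eta> b in simp)
 then show ?thesis
 proof eventually_elim
  case (elim n)
  show ?case
  proof (intro ballI impI)
   fix z assume z: "z \<in> X" "z 0 = b"
   have "\<bar>F n z - g z\<bar> <= (exp (2 * (K * \<theta> ^ m)) - 1) * g z + \<eta> / 2" using elim z by (simp add: cyl_sing)
   also have "(exp (2 * (K * \<theta> ^ m)) - 1) * g z <= \<tau> * Bg"
    using m(2) \<tau>(1) g0[OF z(1)] Bg(2)[OF z(1)] by (intro mult_mono) auto
   finally show "\<bar>F n z - hU z / hU x\<bar> <= \<eta>" using \<tau>(2) by (simp add: g_def)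
  qed
 qed
qed

text \<open>Over a single state \<open>hU\<close> is bounded below, so the additive estimate becomes
  a multiplicative one.\<close>

lemma uniform_limit_ratio:
 assumes ex: "!!n. excessive n (\<kappa> n) (F n)" and \<kappa>: "\<kappa> \<longlonglongrightarrow> lU"
  and x: "x \<in> shift_space MU" and F1: "!!n. F n x = 1" and b: "b \<in> Us" and \<eta>: "0 < \<eta>"
 defines "g \<equiv> %z. hU z / hU x"
 shows "EV n. ALL z:X. z 0 = b --> g z <= (1 + \<eta>) * F n z & F n z <= (1 + \<eta>) * g z"
proof -
 have hx: "0 < hU x" using h_pos XU_sub[OF x] XU_Us[OF x] by auto
 obtain \<gamma>h where \<gamma>h: "0 < \<gamma>h" "!!z. z \<in> X ==> z 0 \<in> {b} ==> \<gamma>h <= hU z"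
  by (rule h_lower[of "{b}"], simp, use b in simp, rule that)
 define \<tau> where "\<tau> = \<eta> * (\<gamma>h / hU x) / (1 + \<eta>)"
 have \<tau>0: "0 < \<tau>" using \<gamma>h(1) hx \<eta> by (simp add: \<tau>_def)
 have \<tau>: "(1 + \<eta>) * \<tau> = \<eta> * (\<gamma>h / hU x)" unfolding \<tau>_def using \<eta> by simp
 show ?thesis
 proof (rule eventually_mono[OF uniform_limit_excessive[OF ex \<kappa> x F1 b \<tau>0]], intro ballI impI)
  fix n z assume elim: "ALL z:X. z 0 = b --> \<bar>F n z - hU z / hU x\<bar> <= \<tau>" and z: "z \<in> X" "z 0 = b"
   have "\<gamma>h / hU x <= g z" using \<gamma>h(2) z hx by (simp add: g_def divide_right_mono)
   then have 1: "\<tau> + \<eta> * \<tau> <= \<eta> * g z"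
    using mult_left_mono[OF _ less_imp_le[OF \<eta>]] \<tau> unfolding distrib_right mult_1 by metis
   have "\<bar>F n z - g z\<bar> <= \<tau>" unfolding g_def by (rule mp[OF bspec[OF elim z(1)] z(2)])
   then have Fg: "F n z - g z <= \<tau>" "g z - F n z <= \<tau>" by linarith+
   have "0 <= \<eta> * \<tau>" using \<eta> \<tau>0 by simp
   moreover have "\<eta> * g z - \<eta> * F n z <= \<eta> * \<tau>"
    using mult_left_mono[OF Fg(2), of \<eta>] \<eta> by (simp only: right_diff_distrib less_imp_le)
   ultimately show "g z <= (1 + \<eta>) * F n z & F n z <= (1 + \<eta>) * g z"
    using 1 Fg by (simp only: distrib_right mult_1) linarith
 qed
qed

end

section \<open>Convergence of return operators\<close>

text \<open>A word that revisits \<open>a\<close> or \<open>b\<close> is shortened at that visit: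
  the part from \<open>a\<close> on is kept, or the part up to \<open>b\<close>.\<close>

lemma exists_first_passage:
 assumes "successively P (a # w @ [b])" "a ~= b"
 shows "EX w'. successively P (a # w' @ [b]) & a \<notin> set w' & b \<notin> set w' & set w' \<subseteq> set w"
 using assms(1)
proof (induction "length w" arbitrary: w rule: less_induct)
 case less
 show ?case
 proof (cases "a \<in> set w \<or> b \<in> set w")
  case True
  then consider u v where "w = u @ a # v" | u v where "w = u @ b # v" by (metis split_list)
  then show ?thesis
  proof cases
   case 1
   then have "successively P ((a # u) @ (a # v @ [b]))" using less.prems by simp
   then have "successively P (a # v @ [b])" unfolding successively_append_iff by blast
   then show ?thesis using less.hyps[of v] 1 by fastforce
  next
   case 2
   then have "successively P ((a # u @ [b]) @ (v @ [b]))" using less.prems by simp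
   then have "successively P (a # u @ [b])" unfolding successively_append_iff by blast
   then show ?thesis using less.hyps[of u] 2 by fastforce
  qed
 qed (use less.prems in auto)
qed

context pert
begin

text \<open>Along a word inside the component \<open>Gs\<close> and \<open>GUs\<close> agree, so
  each factor converges uniformly, and bounded uniform limits may be multiplied.\<close>

lemma pw_uniform_limit:
 assumes "successively MU (w @ [b])"
 shows "uniform_limit {x\<in>X. x 0 = b} (%n. pw (Gs n) (ls n) w) (p w) sequentially"
 using assms
proof (induction w)
 case Nil show ?case by (simp add: uniform_limit_const)
next
 case (Cons a w)
 let ?S = "{x\<in>X. x 0 = b}"
 have IH: "uniform_limit ?S (%n. pw (Gs n) (ls n) w) (p w) sequentially"
 proof (rule Cons.IH)
  show "successively MU (w @ [b])" using Cons.prems by (cases w) auto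
 qed
 have M: "MU a ((w \<frown> x) 0)" if "x \<in> ?S" for x
  using Cons.prems that by (cases w) auto
 have G: "uniform_limit ?S (%n x. Gs n (a ## w \<frown> x)) (%x. GU (a ## w \<frown> x)) sequentially"
 proof (rule uniform_limitI)
  fix \<eta> :: real assume "0 < \<eta>"
  then have "EV n. s n a < \<eta>" using s_lim[of a] by (intro order_tendstoD(2)) auto
  then show "EV n. ALL x:?S. dist (Gs n (a ## w \<frown> x)) (GU (a ## w \<frown> x)) < \<eta>"
  proof eventually_elim
   case (elim n)
   show ?case
   proof
    fix x assume x: "x \<in> ?S"
    have e: "Gs n (a ## w \<frown> x) = GUs n (a ## w \<frown> x)" using M[OF x] by (simp add: GUs_def)
    interpret N: weight A \<theta> C "GUs n" Mj 1 by (rule GUs_weight) simp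
    show "dist (Gs n (a ## w \<frown> x)) (GU (a ## w \<frown> x)) < \<eta>"
     unfolding e dist_real_def
     using GU_GUs[of "a ## w \<frown> x" n] elim N.G_off[of "a ## w \<frown> x"] G_off[of "a ## w \<frown> x"] \<open>0 < \<eta>\<close>
     by (cases "a ## w \<frown> x \<in> X") auto
   qed
  qed
 qed
 have "(%n. 1 / ls n) \<longlonglongrightarrow> 1 / lU" using l_pos by (intro tendsto_intros ls_lim) auto
 then have c: "uniform_limit ?S (%n x. 1 / ls n) (%x. 1 / lU) sequentially"
  by (auto simp: uniform_limit_iff tendsto_iff elim!: eventually_mono)
 have bG: "bounded ((%x. GU (a ## w \<frown> x)) ` ?S)"
 proof (rule boundedI)
  fix y assume "y \<in> (%x. GU (a ## w \<frown> x)) ` ?S"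
  then show "norm y <= Mj a" using G_le[of "a ## w \<frown> x" for x] G_nonneg by auto
 qed
 have bp: "bounded (p w ` ?S)"
 proof -
  obtain B where B: "0 <= B" "!!x. x \<in> X ==> T (nwords UNIV (length w)) (%_. 1) x <= B"
   by (rule adm_bound[OF adm_nwords], rule that)
  show ?thesis
  proof (rule boundedI)
   fix y assume "y \<in> p w ` ?S"
   then obtain x where x: "x \<in> X" "y = p w x" by auto
   have "p w x = T {w} (%_. 1) x" by (simp add: Op_finite)
   also have "... <= T (nwords UNIV (length w)) (%_. 1) x"
    by (rule Op_subset[OF adm_nwords bd_const x(1)]) (auto simp: nwords_iff)
   also have "... <= B" by (rule B(2)[OF x(1)])
   finally show "norm y <= B" using x(2) p_nonneg[of w x] by simp
  qed
 qed
 have "uniform_limit ?S (%n x. (Gs n (a ## w \<frown> x) * (1 / ls n)) * pw (Gs n) (ls n) w x)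
   (%x. (GU (a ## w \<frown> x) * (1 / lU)) * p w x) sequentially"
 proof (intro uniform_lim_mult G c IH bp)
  show "bounded ((%x. GU (a ## w \<frown> x)) ` ?S)" by (rule bG)
  show "bounded ((%x. 1 / lU) ` ?S)" by (rule bounded_subset[of "{1 / lU}"]) auto
  show "bounded ((%x. GU (a ## w \<frown> x) * (1 / lU)) ` ?S)"
   using bounded_scaling[OF bG, of "1 / lU"] by (simp add: image_image mult.commute)
 qed
 then show ?case by simp
qed

text \<open>A finite set \<open>E\<close> of return words carries almost all of \<open>g\<close> at
  one point, because \<open>g\<close> is reproduced by its return operator. The cone and the lower
  bound of \<open>g\<close> on \<open>Q\<close> turn this into a small tail for the constant 1 over
  the whole state. The perturbed tail is small too, since \<open>F n\<close> converges to
  \<open>g\<close> and dominates its own return sum. Uniformity in \<open>f\<close> is needed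
  because \<open>f\<close> later ranges over a cone.\<close>

lemma return_limit:
 assumes Q: "finite Q" "Q \<subseteq> Us" and \<eta>: "0 < \<eta>"
 defines "W \<equiv> words_from Q (- Q)"
 shows "EV n. ALL f B. (ALL x:X. \<bar>f x\<bar> <= B) --> (ALL x:X. x 0 \<in> Q -->
  \<bar>Op (Gs n) (ls n) W f x - T W f x\<bar> <= \<eta> * B)"
proof -
 obtain x1 where x1: "x1 \<in> shift_space MU" "x1 \<in> X" by (rule Us_nonempty)
 have hx1: "0 < hU x1" using h_pos[OF x1(2)] XU_Us[OF x1(1)] by simp
 define F where "F n z = hs n z / hs n x1" for n z
 define g where "g z = hU z / hU x1" for z
 have hsx1: "0 < hs n x1" for n by (rule hs_pos[OF x1(2)])
 have Feq: "F n = (%z. 1 / hs n x1 * hs n z)" for n by (simp add: F_def[abs_def])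
 have exF: "excessive n (ls n) (F n)" for n
  unfolding Feq by (rule excessive_scale[OF excessive_hs]) (use hsx1[of n] in simp)
 have F1: "F n x1 = 1" for n using hsx1[of n] by (simp add: F_def)
 have Flim: "(%n. F n y) \<longlonglongrightarrow> g y" if "y \<in> shift_space MU" for y
  unfolding g_def by (rule pointwise_limit[OF exF ls_lim x1(1) that F1])
 have geq: "g = (%z. 1 / hU x1 * hU z)" by (simp add: g_def[abs_def])
 have gh: "harn K g" unfolding geq using hx1 by (intro harn_cmult h_harn) auto
 have gbd: "bd g" unfolding geq by (intro bd_cmult h_bd)
 obtain \<kappa>h where \<kappa>h: "0 < \<kappa>h" "!!x. x \<in> X ==> x 0 \<in> Q ==> \<kappa>h <= hU x"
  by (rule h_lower[OF Q], rule that)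
 define \<kappa> where "\<kappa> = \<kappa>h / hU x1"
 have \<kappa>: "0 < \<kappa>" "!!x. x \<in> X ==> x 0 \<in> Q ==> \<kappa> <= g x"
  using \<kappa>h hx1 by (auto simp: \<kappa>_def g_def divide_right_mono)
 have admW: "adm W" unfolding W_def by (rule adm_words_from[OF Q]) auto
 have Wg: "T W g z = g z" if "z \<in> X" "z 0 \<in> Q" for z
  unfolding geq Op_cmult W_def by (simp add: return_h[OF Q that])
 \<comment> \<open>Chosen so that a tail of size \<open>2 * \<eta>1\<close> at \<open>y\<close>
   costs at most \<open>\<eta> / 3\<close> for the constant 1, even with the halved lower bound
   \<open>\<kappa> / 2\<close> that is available for \<open>F n\<close>.\<close>
 define \<eta>1 where "\<eta>1 = \<eta> * \<kappa> / (12 * exp K)"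
 have \<eta>1: "0 < \<eta>1" "exp K * (2 * \<eta>1) = \<eta> / 6 * \<kappa>" using \<eta> \<kappa>(1) by (auto simp: \<eta>1_def)
 have Flow: "EV n. ALL z:X. z 0 \<in> Q --> \<kappa> / 2 <= F n z"
 proof -
  have "EV n. ALL b:Q. ALL z:X. z 0 = b --> g z <= (1 + 1) * F n z & F n z <= (1 + 1) * g z"
   unfolding g_def
   by (intro eventually_ball_finite Q(1) ballI uniform_limit_ratio[OF exF ls_lim x1(1) F1])
    (use Q(2) in auto)
  then show ?thesis by eventually_elim (use \<kappa>(2) in force)
 qed
 have each: "EV n. ALL f B. (ALL x:X. \<bar>f x\<bar> <= B) --> (ALL x:X. x 0 = b -->
   \<bar>Op (Gs n) (ls n) W f x - T W f x\<bar> <= \<eta> * B)" if b: "b \<in> Q" for b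
 proof -
  have bU: "b \<in> Us" using b Q by auto
  obtain y where y: "y \<in> shift_space MU" "y \<in> X" "y 0 = b" by (rule exists_limit_point[OF bU])
  have yQ: "y 0 \<in> Q" using y b by simp
  have "EX E0. finite E0 & E0 \<subseteq> W &
    dist (sum (%w. p w y * g (w \<frown> y)) E0) (\<Sum>\<^sub>\<infinity>w\<in>W. p w y * g (w \<frown> y)) <= \<eta>1"
   using infsum_finite_approximation[OF Op_summable[OF admW gbd y(2)] \<eta>1(1)] by blast
  then obtain E0 where E0: "finite E0" "E0 \<subseteq> W" "g y - T E0 g y <= \<eta>1"
   using Wg[OF y(2) yQ] by (auto simp: Op_def dist_real_def)
  \<comment> \<open>Words of limit weight 0 are removed, so that every remaining word stays inside
    the component and \<open>pw_uniform_limit\<close> applies.\<close>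
  define E where "E = {w\<in>E0. successively MU (w @ [b])}"
  have E: "finite E" "E \<subseteq> W" "!!w. w \<in> E ==> successively MU (w @ [b])" using E0 by (auto simp: E_def)
  have "p w y = 0" if "w \<in> E0 - E" for w
   using p_pos[OF y(2), of w] p_nonneg[of w y] that y(3) by (force simp: E_def)
  then have "T E g y = T E0 g y"
   unfolding Op_finite[OF E(1)] Op_finite[OF E0(1)] by (intro sum.mono_neutral_left E0(1)) (auto simp: E_def)
  then have Ey: "g y - T E g y <= \<eta>1" using E0(3) by simp
  have admWE: "adm (W - E)" by (rule adm_mono[OF admW]) auto
  have hdQ: "(w \<frown> x) 0 \<in> Q" if "w \<in> W" for w x
   using words_from_hd[of w Q "- Q"] that conc_0[of w x] by (simp add: W_def)
  have tailU: "T (W - E) (%_. 1) x <= \<eta> / 3" if x: "x \<in> X" "x 0 = b" for x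
  proof -
   have "\<kappa> * T (W - E) (%_. 1) x = T (W - E) (%_. \<kappa>) x" using Op_cmult[of "W - E" \<kappa> "%_. 1" x] by simp
   also have "... <= T (W - E) g x"
    by (intro Op_mono admWE bd_const gbd x(1) \<kappa>(2) hdQ) auto
   also have "... <= exp K * T (W - E) g y"
    by (rule harnD1[OF harn_Op[OF admWE gbd gh order_refl] K_nonneg x(1) y(2)]) (simp add: x y)
   also have "T (W - E) g y = g y - T E g y" using Op_Diff[OF admW gbd y(2) E(2)] Wg[OF y(2) yQ] by simp
   also have "exp K * (g y - T E g y) <= exp K * (2 * \<eta>1)" using Ey \<eta>1(1) by (intro mult_left_mono) auto
   finally show ?thesis using \<kappa>(1) \<eta> unfolding \<eta>1(2) by (simp add: field_simps)
  qed
  have limE: "(%n. F n y - (\<Sum>w\<in>E. pw (Gs n) (ls n) w y * F n (w \<frown> y))) \<longlonglongrightarrow> g y - T E g y"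
   unfolding Op_finite[OF E(1)]
  proof (rule tendsto_diff[OF Flim[OF y(1)] tendsto_sum[OF tendsto_mult]])
   fix w assume w: "w \<in> E"
   have "w \<frown> y \<in> shift_space MU" using E(3)[OF w] y by (simp add: shift_space_conc)
   then show "(%n. F n (w \<frown> y)) \<longlonglongrightarrow> g (w \<frown> y)" by (rule Flim)
   show "(%n. pw (Gs n) (ls n) w y) \<longlonglongrightarrow> p w y"
    by (rule tendsto_uniform_limitI[OF pw_uniform_limit[OF E(3)[OF w]]]) (use y in auto)
  qed
  have ev1: "EV n. F n y - (\<Sum>w\<in>E. pw (Gs n) (ls n) w y * F n (w \<frown> y)) < 2 * \<eta>1"
   by (rule order_tendstoD(2)[OF limE]) (use Ey \<eta>1(1) in linarith)
  define c where "c = \<eta> / 3 / (1 + real (card E))"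
  have c: "0 < c" "card E * c <= \<eta> / 3" using \<eta> by (auto simp: c_def field_simps)
  have ev2: "EV n. ALL w:E. ALL x:{x\<in>X. x 0 = b}. dist (pw (Gs n) (ls n) w x) (p w x) < c"
   by (intro eventually_ball_finite E(1) ballI uniform_limitD[OF pw_uniform_limit[OF E(3)]] c)
  show ?thesis using ev1 ev2 Flow
  proof eventually_elim
   case (elim n)
   interpret N: rpf A \<theta> C "Gs n" Mj "ls n" "hs n" "ns n" UNIV A by (rule rpfs)
   have admN: "N.adm W" unfolding W_def by (rule N.adm_words_from[OF Q(1)]) auto
   have admNE: "N.adm (W - E)" by (rule N.adm_mono[OF admN]) auto
   have Fh: "harn K (F n)" and Fbd: "bd (F n)" using exF[of n] by (auto simp: excessive_def)
   have tailN: "N.T (W - E) (%_. 1) x <= \<eta> / 3" if x: "x \<in> X" "x 0 = b" for x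
   proof -
    have "\<kappa> / 2 * N.T (W - E) (%_. 1) x = N.T (W - E) (%_. \<kappa> / 2) x"
     using N.Op_cmult[of "W - E" "\<kappa> / 2" "%_. 1" x] by simp
    also have "... <= N.T (W - E) (F n) x"
     using elim(3) N.p_off
     by (intro N.Op_mono admNE bd_const Fbd x(1)) (use hdQ in blast)
    also have "... <= exp K * N.T (W - E) (F n) y"
     by (rule harnD1[OF N.harn_Op[OF admNE Fbd Fh order_refl] K_nonneg x(1) y(2)]) (simp add: x y)
    also have "N.T (W - E) (F n) y = N.T W (F n) y - N.T E (F n) y" by (rule N.Op_Diff[OF admN Fbd y(2) E(2)])
    also have "N.T W (F n) y <= F n y"
     unfolding Feq N.Op_cmult W_def
     using N.Op_words_from_h_le[OF Q(1) _ _ y(2), of "- Q"] hsx1[of n] by (intro mult_left_mono) auto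
    also have "F n y - N.T E (F n) y <= 2 * \<eta>1" using elim(1) E(1) by (simp add: N.Op_finite)
    finally have "\<kappa> / 2 * N.T (W - E) (%_. 1) x <= exp K * (2 * \<eta>1)" by simp
    then show ?thesis using \<kappa>(1) unfolding \<eta>1(2) by (simp add: field_simps)
   qed
   show ?case
   proof (intro allI impI ballI)
    fix f :: "'s word => real" and B x assume f: "ALL x:X. \<bar>f x\<bar> <= B" and x: "x \<in> X" "x 0 = b"
    have bdf: "bd f" using f unfolding bd_def by blast
    have fB: "\<bar>f z\<bar> <= B" if "z \<in> X" for z using f that by blast
    have B0: "0 <= B" using fB[OF x(1)] by linarith
    have 1: "\<bar>N.T (W - E) f x\<bar> <= B * (\<eta> / 3)"
     by (rule order_trans[OF N.Op_abs_le[OF admNE bdf x(1) fB] mult_left_mono[OF tailN[OF x] B0]])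
    have 2: "\<bar>T (W - E) f x\<bar> <= B * (\<eta> / 3)"
     by (rule order_trans[OF Op_abs_le[OF admWE bdf x(1) fB] mult_left_mono[OF tailU[OF x] B0]])
    have "N.T E f x - T E f x = (\<Sum>w\<in>E. (pw (Gs n) (ls n) w x - p w x) * f (w \<frown> x))"
     using E(1) by (simp add: Op_finite N.Op_finite sum_subtractf left_diff_distrib)
    also have "\<bar>...\<bar> <= (\<Sum>w\<in>E. c * B)"
    proof (rule order_trans[OF sum_abs sum_mono])
     fix w assume w: "w \<in> E"
     have "successively A (w @ [b])" using E(3)[OF w] by (rule successively_mono) (use M_sub in auto)
     then have wX: "w \<frown> x \<in> X" using x by (simp add: shift_space_conc)
     have "dist (pw (Gs n) (ls n) w x) (p w x) < c" using elim(2) w x by blast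
     then show "\<bar>(pw (Gs n) (ls n) w x - p w x) * f (w \<frown> x)\<bar> <= c * B"
      unfolding abs_mult using fB[OF wX] c(1) by (intro mult_mono) (auto simp: dist_real_def)
    qed
    also have "... <= B * (\<eta> / 3)" using mult_right_mono[OF c(2) B0] by (simp add: mult_ac)
    finally have 3: "\<bar>N.T E f x - T E f x\<bar> <= B * (\<eta> / 3)" .
    have "N.T W f x - T W f x = (N.T E f x - T E f x) + N.T (W - E) f x - T (W - E) f x"
     using Op_Diff[OF admW bdf x(1) E(2)] N.Op_Diff[OF admN bdf x(1) E(2)] by simp
    then have "\<bar>N.T W f x - T W f x\<bar> <= B * (\<eta> / 3) + B * (\<eta> / 3) + B * (\<eta> / 3)" using 1 2 3 by linarith
    then show "\<bar>N.T W f x - T W f x\<bar> <= \<eta> * B" by (simp add: mult.commute)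
   qed
  qed
 qed
 have "EV n. ALL b:Q. ALL f B. (ALL x:X. \<bar>f x\<bar> <= B) --> (ALL x:X. x 0 = b -->
   \<bar>Op (Gs n) (ls n) W f x - T W f x\<bar> <= \<eta> * B)"
  by (intro eventually_ball_finite Q(1) ballI each)
 then show ?thesis by eventually_elim blast
qed

end

section \<open>Convergence of conditional measures\<close>

lemma exp_diff_ge: fixes s t :: real assumes "0 <= t" "t <= s" shows "s - t <= exp s - exp t"
proof -
 have "1 + (s - t) <= exp (s - t)" by (rule exp_ge_add_one_self)
 then have "exp t * (1 + (s - t)) <= exp t * exp (s - t)" by (rule mult_left_mono) simp
 then have "exp t * (s - t) <= exp s - exp t" by (simp add: exp_diff distrib_left)
 moreover have "1 * (s - t) <= exp t * (s - t)" using assms by (intro mult_right_mono) auto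
 ultimately show ?thesis by simp
qed

definition mean :: "'s word measure => 's => ('s word => real) => real" where
 "mean \<mu> a f = int_on \<mu> {a} f"

context rpf
begin

lemma mean_sing: "mean \<nu> a f = (\<integral>x. indicator (cyl A [a]) x * f x \<partial>\<nu>)"
 unfolding mean_def by (rule int_cong) (simp add: chi_def indicator_def cyl_sing)

lemma harn_le_mean:
 assumes "harn k f" "0 <= k" "bd f" "x \<in> X" "x 0 = a" "a \<in> Us"
 shows "f x <= exp k / measure \<nu> (cyl A [a]) * mean \<nu> a f"
 using harn_int_le[OF assms(1-4)] state_pos[OF assms(6)] unfolding mean_sing assms(5)
 by (simp add: field_simps)

lemma harn_ge_mean:
 assumes "harn k f" "0 <= k" "bd f" "x \<in> X" "x 0 = a"
 shows "mean \<nu> a f <= exp k * f x"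
proof -
 have "mean \<nu> a f <= exp k * f x * measure \<nu> (cyl A [a])"
  using harn_int_ge[OF assms(1-4)] unfolding mean_sing assms(5) .
 also have "... <= exp k * f x * 1"
  using harn_nonneg[OF assms(1,4)] by (intro mult_left_mono) auto
 finally show ?thesis by simp
qed

lemma mean_lin:
 assumes "bl f" "bl g"
 shows "mean \<nu> a (%x. f x + g x) = mean \<nu> a f + mean \<nu> a g"
  "mean \<nu> a (%x. f x - g x) = mean \<nu> a f - mean \<nu> a g"
  "mean \<nu> a (%x. c * f x) = c * mean \<nu> a f"
proof -
 show "mean \<nu> a (%x. f x + g x) = mean \<nu> a f + mean \<nu> a g"
  unfolding mean_def distrib_left by (intro int_add bl_mult bl_chi assms)
 show "mean \<nu> a (%x. f x - g x) = mean \<nu> a f - mean \<nu> a g"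
  unfolding mean_def right_diff_distrib by (intro int_diff bl_mult bl_chi assms)
 show "mean \<nu> a (%x. c * f x) = c * mean \<nu> a f"
  unfolding mean_def by (subst mult.left_commute) simp
qed

lemma mean_mono:
 assumes "bl f" "bl g" "!!x. x \<in> X ==> x 0 = a ==> f x <= g x" shows "mean \<nu> a f <= mean \<nu> a g"
 unfolding mean_def
 by (intro int_mono bl_mult bl_chi assms(1,2)) (use assms(3) in \<open>simp add: chi_def\<close>)

lemma mean_cong: "(!!x. x \<in> X ==> x 0 = a ==> f x = g x) ==> mean \<nu> a f = mean \<nu> a g"
 unfolding mean_def by (intro int_cong) (simp add: chi_def)

lemma mean_nonneg: "harn k f ==> 0 <= mean \<nu> a f"
 unfolding mean_def using harn_nonneg by (intro int_nonneg) (simp add: chi_def)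

lemma mean_ge:
 assumes "bl f" "!!x. x \<in> X ==> x 0 = a ==> c <= f x" shows "c * mean \<nu> a (%_. 1) <= mean \<nu> a f"
proof -
 have "mean \<nu> a (%_. c * 1) <= mean \<nu> a f" by (intro mean_mono bl_const assms(1)) (use assms(2) in simp)
 then show ?thesis using mean_lin(3)[OF bl_const bl_const, of a c 1] by simp
qed

lemma mean_abs_le:
 assumes "bl f" "!!x. x \<in> X ==> x 0 = a ==> \<bar>f x\<bar> <= B" shows "\<bar>mean \<nu> a f\<bar> <= B * mean \<nu> a (%_. 1)"
 using mean_mono[OF assms(1) bl_const, of a B] mean_ge[OF assms(1), of a "-B"] assms(2)
  mean_lin(3)[OF bl_const bl_const, of a B 1]
 by (auto simp: abs_le_iff minus_le_iff)

lemma mean_1_pos: "a \<in> Us ==> 0 < mean \<nu> a (%_. 1)"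
 unfolding mean_sing using state_pos[of a] int_cyl[of "[a]"] by simp

lemma mean_h_pos: assumes a: "a \<in> Us" shows "0 < mean \<nu> a h"
proof -
 obtain c where c: "0 < c" "!!z. z \<in> X ==> z 0 \<in> {a} ==> c <= h z"
  by (rule h_lower[of "{a}"], simp, use a in simp, rule that)
 then have "c * mean \<nu> a (%_. 1) <= mean \<nu> a h" by (intro mean_ge h_bl) auto
 then show ?thesis using mult_pos_pos[OF c(1) mean_1_pos[OF a]] by linarith
qed

lemma mean_return:
 assumes "adm (words_from {a} (- {a}))" "bl f"
 shows "mean \<nu> a (T (words_from {a} (- {a})) f) = mean \<nu> a f"
 using int_words_from[OF assms] unfolding mean_def by simp

lemma mean_return_pair:
 assumes W: "adm (words_from {a, b} (- {a, b}))" and ab: "a ~= b"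
 shows "mean \<nu> a (T (words_from {a, b} (- {a, b})) (chi {a})) +
  mean \<nu> b (T (words_from {a, b} (- {a, b})) (chi {a})) = mean \<nu> a (%_. 1)"
proof -
 let ?T = "T (words_from {a, b} (- {a, b})) (chi {a})"
 have "int_on \<nu> {a, b} ?T = int_on \<nu> {a, b} (chi {a})"
  using int_words_from[OF W bl_chi, of "{a}"] by simp
 also have "... = mean \<nu> a (%_. 1)" unfolding mean_def by (intro int_cong) (auto simp: chi_def)
 moreover have "chi {a, b} x = chi {a} x + (chi {b} x :: real)" for x using ab by (auto simp: chi_def)
 ultimately show ?thesis
  unfolding mean_def by (simp add: distrib_right int_add bl_mult bl_chi bl_Op[OF W bl_chi])
qed

text \<open>The return operator to a single state maps the cone of Harnack functions strictly inside
 itself, so a fixed fraction of the eigenfunction can be subtracted.\<close>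

lemma cone_contraction:
 assumes a: "a \<in> Us"
 defines "W \<equiv> words_from {a} (- {a})"
 obtains \<alpha> where "0 < \<alpha>" "!!f. bl f ==> harn (K + 1) f ==>
  harn (K + 1) (%x. chi {a} x * (T W f x - \<alpha> * mean \<nu> a f * h x))"
proof -
 \<comment> \<open>One more than the invariant constant: the contraction to
   \<open>K + (k - K) * \<theta>\<close> then leaves a gap of exactly
   \<open>1 - \<theta>\<close>.\<close>
 define k where "k = K + 1"
 have k: "1 <= k" "0 <= k" "K <= k" using K_nonneg by (auto simp: k_def)
 obtain H where H: "0 <= H" "!!x. x \<in> X ==> \<bar>h x\<bar> <= H" by (rule bdE[OF h_bd]) blast
 have admW: "adm W" unfolding W_def by (rule adm_words_from) (use a in auto)
 have nil: "[] \<notin> W" by (simp add: W_def words_from_def)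
 \<comment> \<open>\<open>D\<close> bounds \<open>h\<close>, and \<open>d x y * D\<close> bounds the
   increment \<open>exp (k * d x y) * h y - h x\<close>. With
   \<open>\<alpha> * D = (1 - \<theta>) * exp (- k)\<close>, subtracting
   \<open>\<alpha> * m * h\<close> uses up no more than the gap times the lower bound
   \<open>exp (- k) * m\<close> of the return image.\<close>
 define D where "D = (k * exp k + K) * H + 1"
 have ek: "1 <= exp k" using k by simp
 have kek: "1 <= k * exp k" using mult_mono[OF k(1) ek] k by simp
 have D: "0 < D" "H <= D"
 proof -
  have "1 * H <= (k * exp k + K) * H" using kek K_nonneg H(1) by (intro mult_right_mono) auto
  then show "0 < D" "H <= D" using H(1) by (auto simp: D_def)
 qed
 define \<alpha> where "\<alpha> = (1 - \<theta>) * exp (- k) / D"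
 have \<alpha>: "0 < \<alpha>" "\<alpha> * D = (1 - \<theta>) * exp (- k)" using theta D by (auto simp: \<alpha>_def)
 show ?thesis
 proof (rule that[OF \<alpha>(1)], fold k_def)
  fix f assume bl: "bl f" and hf: "harn k f"
  define m where "m = mean \<nu> a f"
  define g where "g = T W f"
  have K1: "K + (k - K) * \<theta> <= k" using theta by (simp add: k_def)
  have gh: "harn (K + (k - K) * \<theta>) g" unfolding g_def by (rule harn_Op_strict[OF admW bl_bd[OF bl] hf k(3) nil])
  have gh': "harn k g" by (rule harn_mono[OF gh K1])
  have gbl: "bl g" unfolding g_def by (rule bl_Op[OF admW bl])
  have m0: "0 <= m" unfolding m_def by (rule mean_nonneg[OF hf])
  have mg: "mean \<nu> a g = m" unfolding g_def m_def W_def using mean_return[OF _ bl] admW by (simp add: W_def)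
  have glow: "exp (- k) * m <= g x" if "x \<in> X" "x 0 = a" for x
   using harn_ge_mean[OF gh' k(2) bl_bd[OF gbl] that] mg by (simp add: exp_minus field_simps)
  show "harn k (%x. chi {a} x * (T W f x - \<alpha> * mean \<nu> a f * h x))"
   unfolding harn_def g_def[symmetric] m_def[symmetric]
  proof (intro ballI conjI impI)
   fix x assume x: "x \<in> X"
   show "0 <= chi {a} x * (g x - \<alpha> * m * h x)"
   proof (cases "x 0 = a")
    case True
    have "\<alpha> * m * h x <= \<alpha> * m * D" using H(2)[OF x] D(2) \<alpha>(1) m0 by (intro mult_left_mono) auto
    also have "... = (1 - \<theta>) * (exp (- k) * m)" using \<alpha>(2) by (simp add: mult_ac)
    also have "... <= 1 * (exp (- k) * m)" using theta m0 by (intro mult_right_mono) auto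
    also have "... <= g x" using glow[OF x True] by simp
    finally show ?thesis by (simp add: chi_def)
   qed (simp add: chi_def)
   fix y assume y: "y \<in> X" and xy: "x 0 = y 0"
   show "chi {a} x * (g x - \<alpha> * m * h x) <= exp (k * d x y) * (chi {a} y * (g y - \<alpha> * m * h y))"
   proof (cases "x 0 = a")
    case True
    have ya: "y 0 = a" using True xy by simp
    have dd: "0 <= d x y" "d x y <= 1" by (rule d_nonneg d_le_1)+
    have hy: "0 <= h y" "h y <= H" using h_nonneg[OF y] H(2)[OF y] by auto
    have "h y <= exp (K * d x y) * h x" using harnD[OF h_harn y x xy[symmetric]] d_sym[of x y] by simp
    then have "exp (- (K * d x y)) * h y <= exp (- (K * d x y)) * (exp (K * d x y) * h x)"
     by (rule mult_left_mono) simp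
    then have hx: "exp (- (K * d x y)) * h y <= h x" by (simp add: mult.assoc[symmetric] exp_minus)
    have "exp (k * d x y) * h y - h x <= (exp (k * d x y) - 1 + (1 - exp (- (K * d x y)))) * h y"
     using hx by (simp add: algebra_simps)
    also have "... <= (k * exp k * d x y + K * d x y) * h y"
    proof (intro mult_right_mono add_mono hy)
     show "exp (k * d x y) - 1 <= k * exp k * d x y" by (rule exp_minus_1_le[OF k(2) dd])
     show "1 - exp (- (K * d x y)) <= K * d x y" using exp_ge_add_one_self[of "- (K * d x y)"] by simp
    qed
    also have "... = d x y * ((k * exp k + K) * h y)" by (simp add: algebra_simps)
    also have "... <= d x y * D"
    proof (rule mult_left_mono[OF _ dd(1)])
     have "(k * exp k + K) * h y <= (k * exp k + K) * H"
      using hy kek K_nonneg by (intro mult_left_mono) auto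
     then show "(k * exp k + K) * h y <= D" by (simp add: D_def)
    qed
    finally have "\<alpha> * m * (exp (k * d x y) * h y - h x) <= \<alpha> * m * (d x y * D)"
     using \<alpha>(1) m0 by (intro mult_left_mono) auto
    also have "... = ((1 - \<theta>) * d x y) * (exp (- k) * m)" using \<alpha>(2) by (simp add: mult_ac)
    also have "... <= ((1 - \<theta>) * d x y) * g y" using glow[OF y ya] theta dd by (intro mult_left_mono) auto
    also have "... <= (exp (k * d x y) - exp ((K + (k - K) * \<theta>) * d x y)) * g y"
    proof (rule mult_right_mono[OF _ harn_nonneg[OF gh y]])
     have "(1 - \<theta>) * d x y = k * d x y - (K + (k - K) * \<theta>) * d x y" by (simp add: k_def algebra_simps)
     also have "... <= exp (k * d x y) - exp ((K + (k - K) * \<theta>) * d x y)"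
      using K1 dd K_nonneg theta k by (intro exp_diff_ge mult_right_mono) auto
     finally show "(1 - \<theta>) * d x y <= exp (k * d x y) - exp ((K + (k - K) * \<theta>) * d x y)" .
    qed
    also have "... <= exp (k * d x y) * g y - g x"
     using harnD[OF gh x y xy] by (simp add: left_diff_distrib)
    finally show ?thesis using True ya by (simp add: chi_def algebra_simps)
   qed (use xy in \<open>simp add: chi_def\<close>)
  qed
 qed
qed

end

section \<open>Contraction of the difference between eigenmeasures\<close>

context pert
begin

abbreviation mn where "mn n \<equiv> mean (ns n)"
abbreviation mU where "mU \<equiv> mean nU"

lemmas mn_lin = rpf.mean_lin[OF rpfs]
 and mn_cong = rpf.mean_cong[OF rpfs] and mn_ge = rpf.mean_ge[OF rpfs]
 and mn_abs_le = rpf.mean_abs_le[OF rpfs] and mn_1_pos = rpf.mean_1_pos[OF rpfs UNIV_I]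
 and mn_hs_pos = rpf.mean_h_pos[OF rpfs UNIV_I] and mn_return = rpf.mean_return[OF rpfs]

lemma mn_hU_ge:
 assumes "a \<in> Us" obtains c where "0 < c" "!!n. c * mn n a (%_. 1) <= mn n a hU" "!!n. 0 < mn n a hU"
proof -
 obtain c where c: "0 < c" "!!z. z \<in> X ==> z 0 \<in> {a} ==> c <= hU z"
  by (rule h_lower[of "{a}"], simp, use assms in simp, rule that)
 have ge: "c * mn n a (%_. 1) <= mn n a hU" for n using c(2) by (intro mn_ge h_bl) auto
 have "0 < mn n a hU" for n using mult_pos_pos[OF c(1) mn_1_pos[of n a]] ge[of n] by linarith
 then show ?thesis by (rule that[OF c(1) ge])
qed

text \<open>\<open>\<Delta>\<close> compares the two eigenmeasures over \<open>a\<close>, each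
  divided by its value on \<open>hU\<close>, so that \<open>\<Delta> hU = 0\<close>. Each is
  invariant under its own return operator, and these operators are close by
  \<open>return_limit\<close>. Hence \<open>f\<close> may be replaced by its return image minus
  \<open>\<alpha> * m * hU\<close>, whose mean is smaller by the factor \<open>1 - t\<close>, at a
  cost proportional to the mean. Iteration removes the initial difference and leaves a geometric sum
  of costs.\<close>

lemma cone_limit:
 assumes a: "a \<in> Us" and \<eta>: "0 < \<eta>"
 shows "EV n. ALL f. bl f & harn (K + 1) f -->
  \<bar>mn n a f / mn n a hU - mU a f / mU a hU\<bar> <= \<eta> * mU a f"
proof -
 let ?W = "words_from {a} (- {a})"
 have Q: "finite {a}" "{a} \<subseteq> Us" "{a} \<inter> - {a} = {}" using a by auto
 have admW: "adm ?W" by (rule adm_words_from[OF Q])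
 obtain \<alpha> where \<alpha>: "0 < \<alpha>" "!!f. bl f ==> harn (K + 1) f ==>
  harn (K + 1) (%x. chi {a} x * (T ?W f x - \<alpha> * mU a f * hU x))"
  by (rule cone_contraction[OF a]) blast
 obtain \<kappa> where \<kappa>: "0 < \<kappa>" "!!n. \<kappa> * mn n a (%_. 1) <= mn n a hU" "!!n. 0 < mn n a hU"
  by (rule mn_hU_ge[OF a]) blast
 define B1 where "B1 = exp (K + 1) / measure nU (cyl A [a])"
 have B1: "0 < B1" unfolding B1_def using state_pos[OF a] by simp
 have hU: "0 < mU a hU" by (rule mean_h_pos[OF a])
 define t where "t = \<alpha> * mU a hU"
 have t: "0 < t" using \<alpha>(1) hU by (simp add: t_def)
 \<comment> \<open>Scaled so that one replacement costs \<open>\<eta> * t\<close> times the mean.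
   Summed with ratio \<open>1 - t\<close>, the costs give \<open>\<eta>\<close>.\<close>
 define \<eta>' where "\<eta>' = \<eta> * (\<kappa> * t) / B1"
 have \<eta>': "0 < \<eta>'" "\<eta>' * B1 / \<kappa> = \<eta> * t" using \<eta> \<kappa>(1) t B1 by (simp_all add: \<eta>'_def)
 have K1: "0 <= K + 1" using K_nonneg by simp
 have fle: "f x <= B1 * mU a f" if "bl f" "harn (K + 1) f" "x \<in> X" "x 0 = a" for f x
  unfolding B1_def by (rule harn_le_mean[OF that(2) K1 bl_bd[OF that(1)] that(3,4) a])
 have "EV n. ALL f B. (ALL x:X. \<bar>f x\<bar> <= B) --> (ALL x:X. x 0 \<in> {a} -->
   \<bar>Op (Gs n) (ls n) ?W f x - T ?W f x\<bar> <= \<eta>' * B)"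
  by (rule return_limit[OF Q(1,2) \<eta>'(1)])
 then show ?thesis
 proof eventually_elim
  case (elim n)
  interpret N: rpf A \<theta> C "Gs n" Mj "ls n" "hs n" "ns n" UNIV A by (rule rpfs)
  have admN: "N.adm ?W" by (rule N.adm_words_from) auto
  define mh where "mh = mn n a hU"
  have mh: "0 < mh" "mn n a (%_. 1) <= mh / \<kappa>" using \<kappa>(1) \<kappa>(2,3)[of n] by (auto simp: mh_def field_simps)
  define \<Delta> where "\<Delta> f = mn n a f / mh - mU a f / mU a hU" for f
  define B0 where "B0 = B1 / \<kappa> + 1 / mU a hU"
  have start: "\<bar>\<Delta> f\<bar> <= B0 * mU a f" if f: "bl f" "harn (K + 1) f" for f
  proof -
   have "\<bar>mn n a f\<bar> <= B1 * mU a f * mn n a (%_. 1)"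
    using fle[OF f] harn_nonneg[OF f(2)] by (intro mn_abs_le f) auto
   also have "... <= B1 * mU a f * (mh / \<kappa>)"
    using mh B1 mean_nonneg[OF f(2)] by (intro mult_left_mono) auto
   finally have "\<bar>mn n a f / mh\<bar> <= B1 / \<kappa> * mU a f" using mh by (simp add: field_simps)
   moreover have "\<bar>mU a f / mU a hU\<bar> = 1 / mU a hU * mU a f" using mean_nonneg[OF f(2)] hU by simp
   ultimately show ?thesis unfolding \<Delta>_def B0_def distrib_right by linarith
  qed
  have contr: "EX f'. bl f' & harn (K + 1) f' & mU a f' = (1 - t) * mU a f & \<bar>\<Delta> f - \<Delta> f'\<bar> <= \<eta> * t * mU a f"
   if f: "bl f" "harn (K + 1) f" for f
  proof -
   define m where "m = mU a f"
   have m: "0 <= m" unfolding m_def by (rule mean_nonneg[OF f(2)])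
   let ?g = "%x. T ?W f x - \<alpha> * m * hU x"
   have blT: "bl (T ?W f)" and blTn: "bl (N.T ?W f)" by (rule bl_Op[OF admW f(1)] N.bl_Op[OF admN f(1)])+
   have bl2: "bl (%x. \<alpha> * m * hU x)" by (intro bl_cmult h_bl)
   have U: "mU a (%x. chi {a} x * ?g x) = m - \<alpha> * m * mU a hU"
    using mean_cong[of a "%x. chi {a} x * ?g x" ?g] mean_lin(2)[OF blT bl2] mean_lin(3)[OF h_bl h_bl]
     mean_return[OF admW f(1)] by (simp add: chi_def m_def)
   have N: "mn n a (%x. chi {a} x * ?g x) = mn n a (T ?W f) - \<alpha> * m * mh"
    using mn_cong[of a "%x. chi {a} x * ?g x" ?g n] mn_lin(2)[OF blT bl2, of n a]
     mn_lin(3)[OF h_bl h_bl, of n a "\<alpha> * m"] by (simp add: chi_def mh_def)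
   have "\<bar>mn n a (%x. N.T ?W f x - T ?W f x)\<bar> <= \<eta>' * (B1 * m) * mn n a (%_. 1)"
   proof (rule mn_abs_le[OF bl_diff[OF blTn blT]])
    fix x assume x: "x \<in> X" "x 0 = a"
    let ?f = "%y. chi {a} y * f y"
    have "\<bar>?f y\<bar> <= B1 * m" if "y \<in> X" for y
     using fle[OF f that] harn_nonneg[OF f(2) that] m B1 by (auto simp: chi_def m_def)
    then have "\<bar>N.T ?W ?f x - T ?W ?f x\<bar> <= \<eta>' * (B1 * m)" using elim x by simp
    moreover have "T ?W ?f x = T ?W f x" "N.T ?W ?f x = N.T ?W f x"
     by (rule Op_cong[OF x(1)] N.Op_cong[OF x(1)]; auto simp: chi_def words_from_def)+
    ultimately show "\<bar>N.T ?W f x - T ?W f x\<bar> <= \<eta>' * (B1 * m)" by simp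
   qed
   also have "... <= \<eta>' * (B1 * m) * (mh / \<kappa>)"
    using mh(2) B1 m \<eta>'(1) by (intro mult_left_mono) auto
   also have "... = \<eta>' * B1 / \<kappa> * m * mh" by simp
   finally have E: "\<bar>mn n a f - mn n a (T ?W f)\<bar> <= \<eta> * t * m * mh"
    using mn_lin(2)[OF blTn blT, of n a] mn_return[OF admN f(1)] unfolding \<eta>'(2) by simp
   have "\<Delta> f - \<Delta> (%x. chi {a} x * ?g x) = (mn n a f - mn n a (T ?W f)) / mh"
    unfolding \<Delta>_def U N m_def[symmetric] using mh(1) hU by (simp add: field_simps)
   then have D: "\<bar>\<Delta> f - \<Delta> (%x. chi {a} x * ?g x)\<bar> <= \<eta> * t * mU a f"
    using E mh(1) by (simp add: abs_divide pos_divide_le_eq m_def)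
   show ?thesis
   proof (intro exI[of _ "%x. chi {a} x * ?g x"] conjI D)
    show "bl (%x. chi {a} x * ?g x)" by (intro bl_mult bl_chi bl_diff blT bl2)
    show "harn (K + 1) (%x. chi {a} x * ?g x)" unfolding m_def by (rule \<alpha>(2)[OF f])
    show "mU a (%x. chi {a} x * ?g x) = (1 - t) * mU a f" unfolding U by (simp add: t_def m_def algebra_simps)
   qed
  qed
  \<comment> \<open>The contracted image of the constant 1 lies in the cone, so its mean,
    \<open>1 - t\<close> times that of 1, cannot be negative.\<close>
  have t1: "t <= 1"
  proof -
   obtain f' where "harn (K + 1) f'" "mU a f' = (1 - t) * mU a (%_. 1)"
    using contr[OF bl_const harn_const, of 1] K1 by auto
   then have "0 <= (1 - t) * mU a (%_. 1)" using mean_nonneg[of "K + 1" f' a] by simp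
   then show ?thesis using mean_1_pos[OF a] by (simp add: zero_le_mult_iff)
  qed
  have iter: "\<bar>\<Delta> f\<bar> <= ((1 - t) ^ k * B0 + \<eta>) * mU a f" if f: "bl f" "harn (K + 1) f" for f k
   using f
  proof (induction k arbitrary: f)
   case 0
   have "B0 * mU a f <= (B0 + \<eta>) * mU a f" using \<eta> mean_nonneg[OF 0(2)] by (intro mult_right_mono) auto
   then show ?case using start[OF 0] by simp
  next
   case (Suc k)
   obtain f' where f': "bl f'" "harn (K + 1) f'" "mU a f' = (1 - t) * mU a f" "\<bar>\<Delta> f - \<Delta> f'\<bar> <= \<eta> * t * mU a f"
    using contr[OF Suc.prems] by blast
   have "\<bar>\<Delta> f\<bar> <= \<bar>\<Delta> f'\<bar> + \<eta> * t * mU a f" using f'(4) by linarith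
   also have "\<bar>\<Delta> f'\<bar> <= ((1 - t) ^ k * B0 + \<eta>) * ((1 - t) * mU a f)" using Suc.IH[OF f'(1,2)] f'(3) by simp
   also have "... + \<eta> * t * mU a f = ((1 - t) ^ Suc k * B0 + \<eta>) * mU a f" by (simp add: algebra_simps)
   finally show ?case by simp
  qed
  show ?case
  proof (intro allI impI)
   fix f assume f: "bl f & harn (K + 1) f"
   have "(%k. ((1 - t) ^ k * B0 + \<eta>) * mU a f) \<longlonglongrightarrow> (0 * B0 + \<eta>) * mU a f"
    using t t1 by (intro tendsto_intros LIMSEQ_power_zero) auto
   then have "\<bar>\<Delta> f\<bar> <= (0 * B0 + \<eta>) * mU a f" using iter f by (intro LIMSEQ_le_const) auto
   then show "\<bar>mn n a f / mn n a hU - mU a f / mU a hU\<bar> <= \<eta> * mU a f" by (simp add: \<Delta>_def mh_def)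
  qed
 qed
qed

end

section \<open>Limits of conditional means and of mass ratios inside a component\<close>

context pert
begin

lemma cone_tendsto:
 assumes a: "a \<in> Us" and f: "bl f"
 shows "(%n. mn n a f / mn n a hU) \<longlonglongrightarrow> mU a f / mU a hU"
proof -
 have K1: "0 <= K + 1" using K_nonneg by simp
 have cone: "(%n. mn n a f / mn n a hU) \<longlonglongrightarrow> mU a f / mU a hU" if f: "bl f" "harn (K + 1) f" for f
 proof (rule tendstoI)
  fix e :: real assume e: "0 < e"
  have m0: "0 <= mU a f" by (rule mean_nonneg[OF f(2)])
  define \<eta> where "\<eta> = e / (1 + mU a f)"
  have \<eta>: "0 < \<eta>" "\<eta> * mU a f < e" using e m0 by (auto simp: \<eta>_def field_simps)
  show "EV n. dist (mn n a f / mn n a hU) (mU a f / mU a hU) < e"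
   using cone_limit[OF a \<eta>(1)]
  proof eventually_elim
   case (elim n)
   then have "\<bar>mn n a f / mn n a hU - mU a f / mU a hU\<bar> <= \<eta> * mU a f" using f by simp
   then show ?case using \<eta>(2) by (simp add: dist_real_def)
  qed
 qed
 obtain c where c: "0 <= c" "harn 1 (%x. f x + c)" by (rule bl_harn_shift[OF f]) blast
 have h1: "harn (K + 1) (%x. f x + c)" by (rule harn_mono[OF c(2)]) (use K_nonneg in simp)
 have "(%n. mn n a (%x. f x + c) / mn n a hU - mn n a (%_. c) / mn n a hU) \<longlonglongrightarrow>
   mU a (%x. f x + c) / mU a hU - mU a (%_. c) / mU a hU"
  by (intro tendsto_diff cone bl_add bl_const f h1 harn_const c K1)
 then show ?thesis
  unfolding mn_lin(1)[OF f bl_const] mean_lin(1)[OF f bl_const] by (simp add: add_divide_distrib)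
qed

lemma cond_limit:
 assumes a: "a \<in> Us" and f: "bl f"
 shows "(%n. mn n a f / mn n a (%_. 1)) \<longlonglongrightarrow> mU a f / mU a (%_. 1)"
proof -
 have p: "0 < mU a (%_. 1)" "0 < mU a hU" using mean_1_pos[OF a] mean_h_pos[OF a] by auto
 have mnh: "mn n a hU ~= 0" for n by (rule mn_hU_ge[OF a]) (metis less_irrefl)
 have "(%n. (mn n a f / mn n a hU) / (mn n a (%_. 1) / mn n a hU)) \<longlonglongrightarrow>
   (mU a f / mU a hU) / (mU a (%_. 1) / mU a hU)"
  by (intro tendsto_divide cone_tendsto a f bl_const) (use p in auto)
 then show ?thesis using mnh p by simp
qed

lemma cond_limit_uniform:
 assumes b: "b \<in> Us" and bl: "!!n. bl (f n)" "bl g"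
  and close: "!!\<eta>. 0 < \<eta> ==> EV n. ALL x:X. x 0 = b --> \<bar>f n x - g x\<bar> <= \<eta>"
 shows "(%n. mn n b (f n) / mn n b (%_. 1)) \<longlonglongrightarrow> mU b g / mU b (%_. 1)"
proof -
 have "(%n. mn n b (f n) / mn n b (%_. 1) - mn n b g / mn n b (%_. 1)) \<longlonglongrightarrow> 0"
 proof (rule tendstoI)
  fix e :: real assume "0 < e"
  then have "EV n. ALL x:X. x 0 = b --> \<bar>f n x - g x\<bar> <= e / 2" by (intro close) simp
  then show "EV n. dist (mn n b (f n) / mn n b (%_. 1) - mn n b g / mn n b (%_. 1)) 0 < e"
  proof eventually_elim
   case (elim n)
   have "\<bar>mn n b (f n) - mn n b g\<bar> <= e / 2 * mn n b (%_. 1)"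
    using mn_abs_le[OF bl_diff[OF bl(1)[of n] bl(2)], of b "e / 2" n] mn_lin(2)[OF bl(1)[of n] bl(2), of n b] elim by simp
   then have "\<bar>mn n b (f n) / mn n b (%_. 1) - mn n b g / mn n b (%_. 1)\<bar> <= e / 2"
    using mn_1_pos[of n b] by (simp add: diff_divide_distrib[symmetric] pos_divide_le_eq)
   then show ?case using \<open>0 < e\<close> by (simp add: dist_real_def)
  qed
 qed
 then show ?thesis using tendsto_add[OF _ cond_limit[OF b bl(2)]] by fastforce
qed

lemma return_cond:
 assumes Q: "finite Q" "Q \<subseteq> Us" and c: "c \<in> Q" and f: "bl f"
 defines "W \<equiv> words_from Q (- Q)"
 shows "(%n. mn n c (Op (Gs n) (ls n) W f) / mn n c (%_. 1)) \<longlonglongrightarrow> mU c (T W f) / mU c (%_. 1)"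
proof (rule cond_limit_uniform)
 show "c \<in> Us" using c Q by auto
 show "bl (T W f)" unfolding W_def by (intro bl_Op[OF adm_words_from] Q f) auto
 show "bl (Op (Gs n) (ls n) W f)" for n
 proof -
  interpret N: rpf A \<theta> C "Gs n" Mj "ls n" "hs n" "ns n" UNIV A by (rule rpfs)
  show ?thesis unfolding W_def by (intro N.bl_Op[OF N.adm_words_from] Q f) auto
 qed
 obtain B where B: "0 <= B" "!!x. x \<in> X ==> \<bar>f x\<bar> <= B" by (rule bdE[OF bl_bd[OF f]]) blast
 fix \<eta> :: real assume "0 < \<eta>"
 then have "0 < \<eta> / (B + 1)" "\<eta> / (B + 1) * B <= \<eta>" using B(1) by (auto simp: field_simps)
 note \<eta> = this
 show "EV n. ALL x:X. x 0 = c --> \<bar>Op (Gs n) (ls n) W f x - T W f x\<bar> <= \<eta>"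
  using return_limit[OF Q \<eta>(1), folded W_def]
 proof eventually_elim
  case (elim n)
  show ?case
  proof (intro ballI impI)
   fix x assume "x \<in> X" "x 0 = c"
   then show "\<bar>Op (Gs n) (ls n) W f x - T W f x\<bar> <= \<eta>"
    using elim[rule_format, of f B x] B(2) c \<eta>(2) by simp
  qed
 qed
qed

text \<open>Conditional means over one state say nothing about the ratio between two states. The
  return operator of the pair couples them: the mass of \<open>a\<close> splits into a part over
  \<open>a\<close> and a part over \<open>b\<close>, and relative to the masses of \<open>a\<close>
  and \<open>b\<close> these parts are conditional means with known limits. Solving for the ratio
  needs the part over \<open>b\<close> to be positive, which a first passage from \<open>a\<close>
  to \<open>b\<close> provides.\<close>

lemma mass_ratio:
 assumes a: "a \<in> Us" and b: "b \<in> Us"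
 shows "(%n. mn n b (%_. 1) / mn n a (%_. 1)) \<longlonglongrightarrow> mU b (%_. 1) / mU a (%_. 1)"
proof (cases "a = b")
 case True
 have "mn n a (%_. 1) ~= 0" for n using mn_1_pos[of n a] by simp
 then show ?thesis using True mean_1_pos[OF a] by simp
next
 case False
 let ?Q = "{a, b}"
 let ?W = "words_from ?Q (- ?Q)"
 have Q: "finite ?Q" "?Q \<subseteq> Us" using a b by auto
 have admW: "adm ?W" by (rule adm_words_from[OF Q]) auto
 have sumN: "mn n a (Op (Gs n) (ls n) ?W (chi {a})) + mn n b (Op (Gs n) (ls n) ?W (chi {a})) = mn n a (%_. 1)" for n
 proof -
  interpret N: rpf A \<theta> C "Gs n" Mj "ls n" "hs n" "ns n" UNIV A by (rule rpfs)
  show ?thesis by (rule N.mean_return_pair[OF N.adm_words_from[OF Q(1)] False]) auto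
 qed
 note sumU = mean_return_pair[OF admW False]
 let ?An = "%n. mn n a (Op (Gs n) (ls n) ?W (chi {a})) / mn n a (%_. 1)"
 let ?Bn = "%n. mn n b (Op (Gs n) (ls n) ?W (chi {a})) / mn n b (%_. 1)"
 have A: "?An \<longlonglongrightarrow> mU a (T ?W (chi {a})) / mU a (%_. 1)"
  by (rule return_cond[OF Q _ bl_chi]) simp
 have B: "?Bn \<longlonglongrightarrow> mU b (T ?W (chi {a})) / mU b (%_. 1)"
  by (rule return_cond[OF Q _ bl_chi]) simp
 have p: "0 < mU a (%_. 1)" "0 < mU b (%_. 1)" using mean_1_pos a b by auto
 have Bpos: "0 < mU b (T ?W (chi {a}))"
 proof -
  obtain w0 where "successively MU (a # w0 @ [b])" using irr[OF a b] by blast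
  then obtain w where w: "successively MU (a # w @ [b])" "a \<notin> set w" "b \<notin> set w"
   using exists_first_passage[OF _ False] by blast
  have wW: "a # w \<in> ?W" using w by (auto simp: words_from_def)
  have Tpos: "0 < T ?W (chi {a}) x" if x: "x \<in> X" "x 0 = b" for x
  proof -
   have "0 < p (a # w) x" using p_pos[OF x(1), of "a # w"] w(1) x(2) by simp
   also have "p (a # w) x = T {a # w} (chi {a}) x" by (simp add: Op_finite chi_def)
   also have "... <= T ?W (chi {a}) x"
    by (rule Op_subset[OF admW bd_chi x(1)]) (use wW in \<open>auto simp: chi_def\<close>)
   finally show ?thesis .
  qed
  obtain y where y: "y \<in> X" "y 0 = b" by (rule state_nonempty[OF b])
  have hT: "harn K (T ?W (chi {a}))" by (intro harn_Op admW bd_chi harn_chi1 K_nonneg order_refl)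
  have "T ?W (chi {a}) y <= exp K / measure nU (cyl A [b]) * mU b (T ?W (chi {a}))"
   by (rule harn_le_mean[OF hT K_nonneg bl_bd[OF bl_Op[OF admW bl_chi]] y b])
  then have "0 < exp K / measure nU (cyl A [b]) * mU b (T ?W (chi {a}))" using Tpos[OF y] by linarith
  then show ?thesis using state_pos[OF b] by (simp add: zero_less_mult_iff zero_less_divide_iff)
 qed
 have "(%n. (1 - ?An n) / ?Bn n) \<longlonglongrightarrow>
   (1 - mU a (T ?W (chi {a})) / mU a (%_. 1)) / (mU b (T ?W (chi {a})) / mU b (%_. 1))"
  by (intro tendsto_intros A B) (use Bpos p in simp)
 also have "(1 - mU a (T ?W (chi {a})) / mU a (%_. 1)) / (mU b (T ?W (chi {a})) / mU b (%_. 1)) = mU b (%_. 1) / mU a (%_. 1)"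
 proof -
  have "1 - mU a (T ?W (chi {a})) / mU a (%_. 1) = mU b (T ?W (chi {a})) / mU a (%_. 1)"
   using sumU p by (simp add: field_simps)
  then show ?thesis using Bpos p by simp
 qed
 finally have lim: "(%n. (1 - ?An n) / ?Bn n) \<longlonglongrightarrow> mU b (%_. 1) / mU a (%_. 1)" .
 have Bn0: "EV n. 0 < ?Bn n"
  by (rule order_tendstoD(1)[OF B]) (use Bpos p in simp)
 then have "EV n. (1 - ?An n) / ?Bn n = mn n b (%_. 1) / mn n a (%_. 1)"
 proof eventually_elim
  case (elim n)
  have q: "0 < mn n a (%_. 1)" "0 < mn n b (%_. 1)" by (rule mn_1_pos)+
  have "1 - ?An n = mn n b (Op (Gs n) (ls n) ?W (chi {a})) / mn n a (%_. 1)"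
   using sumN[of n] q by (simp add: field_simps)
  then show ?case using elim q by (simp add: zero_less_divide_iff)
 qed
 then show ?thesis using lim by (simp add: tendsto_cong)
qed

text \<open>The mass over \<open>a\<close> is a conditional mean times a mass ratio. The normalising
  factors \<open>hs n x1\<close> cancel in the quotient by the mass of \<open>a0\<close>.\<close>

lemma component_limit:
 assumes a: "a \<in> Us" and a0: "a0 \<in> Us" and f: "bl f"
 shows "(%n. mn n a (%x. f x * hs n x) / mn n a0 (hs n)) \<longlonglongrightarrow> mU a (%x. f x * hU x) / mU a0 hU"
proof -
 obtain x1 where x1: "x1 \<in> shift_space MU" "x1 \<in> X" by (rule Us_nonempty)
 have hx1: "0 < hU x1" using h_pos[OF x1(2)] XU_Us[OF x1(1)] by simp
 have hsx1: "0 < hs n x1" for n by (rule hs_pos[OF x1(2)])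
 define F where "F n = (%z. 1 / hs n x1 * hs n z)" for n
 define g where "g = (%z. hU z / hU x1)"
 have exF: "excessive n (ls n) (F n)" for n
  unfolding F_def by (rule excessive_scale[OF excessive_hs]) (use hsx1[of n] in simp)
 have F1: "F n x1 = 1" for n using hsx1[of n] by (simp add: F_def)
 have Fbl: "bl (F n)" for n using exF[of n] harn_bd_bl by (auto simp: excessive_def)
 have geq: "g = (%z. 1 / hU x1 * hU z)" by (simp add: g_def)
 have gbl: "bl g" unfolding geq by (intro bl_cmult h_bl)
 have lim: "(%n. mn n b (%x. \<phi> x * F n x) / mn n b (%_. 1)) \<longlonglongrightarrow> mU b (%x. \<phi> x * g x) / mU b (%_. 1)"
  if b: "b \<in> Us" and \<phi>: "bl \<phi>" for b \<phi>
 proof (rule cond_limit_uniform[OF b])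
  show "bl (%x. \<phi> x * F n x)" "bl (%x. \<phi> x * g x)" for n by (intro bl_mult \<phi> Fbl gbl)+
  obtain B where B: "0 <= B" "!!x. x \<in> X ==> \<bar>\<phi> x\<bar> <= B" by (rule bdE[OF bl_bd[OF \<phi>]]) blast
  fix \<eta> :: real assume "0 < \<eta>"
  then have \<eta>: "0 < \<eta> / (B + 1)" "B * (\<eta> / (B + 1)) <= \<eta>" using B(1) by (auto simp: field_simps)
  show "EV n. ALL x:X. x 0 = b --> \<bar>\<phi> x * F n x - \<phi> x * g x\<bar> <= \<eta>"
   using uniform_limit_excessive[OF exF ls_lim x1(1) F1 b \<eta>(1)]
  proof eventually_elim
   case (elim n)
   show ?case
   proof (intro ballI impI)
    fix x assume x: "x \<in> X" "x 0 = b"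
    have "\<bar>\<phi> x\<bar> * \<bar>F n x - g x\<bar> <= B * (\<eta> / (B + 1))"
     using elim x B(1) B(2)[OF x(1)] by (intro mult_mono) (auto simp: g_def)
    then show "\<bar>\<phi> x * F n x - \<phi> x * g x\<bar> <= \<eta>"
     using \<eta>(2) by (simp add: abs_mult[symmetric] right_diff_distrib)
   qed
  qed
 qed
 have pos: "0 < mU a0 (%_. 1)" "0 < mU a (%_. 1)" "0 < mU a0 hU" using mean_1_pos mean_h_pos a a0 by auto
 have scaleU: "mU b (%x. \<phi> x * g x) = 1 / hU x1 * mU b (%x. \<phi> x * hU x)" if "bl \<phi>" for b \<phi>
  using mean_lin(3)[OF bl_mult[OF that h_bl] bl_mult[OF that h_bl], of b "1 / hU x1"] by (simp add: g_def)
 have hsbl: "bl (hs n)" for n using harn_bd_bl[OF hs_harn hs_bd] .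
 have scaleN: "mn n b (%x. \<phi> x * F n x) = 1 / hs n x1 * mn n b (%x. \<phi> x * hs n x)" if "bl \<phi>" for b \<phi> n
  using mn_lin(3)[OF bl_mult[OF that hsbl] bl_mult[OF that hsbl], of n b "1 / hs n x1"] by (simp add: F_def)
 have "(%n. (mn n a (%x. f x * F n x) / mn n a (%_. 1)) * (mn n a (%_. 1) / mn n a0 (%_. 1)) /
   (mn n a0 (%x. 1 * F n x) / mn n a0 (%_. 1))) \<longlonglongrightarrow>
   (mU a (%x. f x * g x) / mU a (%_. 1)) * (mU a (%_. 1) / mU a0 (%_. 1)) /
   (mU a0 (%x. 1 * g x) / mU a0 (%_. 1))"
 proof (intro tendsto_mult tendsto_divide[OF _ lim[OF a0 bl_const]] lim[OF a f] mass_ratio[OF a0 a])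
  show "mU a0 (%x. 1 * g x) / mU a0 (%_. 1) ~= 0"
   using scaleU[OF bl_const, of a0 1] pos hx1 by simp
 qed
 moreover have "(mU a (%x. f x * g x) / mU a (%_. 1)) * (mU a (%_. 1) / mU a0 (%_. 1)) /
   (mU a0 (%x. 1 * g x) / mU a0 (%_. 1)) = mU a (%x. f x * hU x) / mU a0 hU"
  unfolding scaleU[OF f] scaleU[OF bl_const] using pos hx1 by simp
 moreover have "(mn n a (%x. f x * F n x) / mn n a (%_. 1)) * (mn n a (%_. 1) / mn n a0 (%_. 1)) /
   (mn n a0 (%x. 1 * F n x) / mn n a0 (%_. 1)) = mn n a (%x. f x * hs n x) / mn n a0 (hs n)" for n
  unfolding scaleN[OF f] scaleN[OF bl_const] using hsx1[of n] mn_1_pos[of n a] mn_1_pos[of n a0] by simp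
 ultimately show ?thesis by simp
qed

end

section \<open>The growth rate of an induced operator\<close>

context weight
begin

lemma Op_suminf:
 assumes "adm I" "x \<in> X" and b: "summable b"
  and g: "!!n y. y \<in> X ==> \<bar>g n y\<bar> <= b n"
 shows "summable (%n. T I (g n) x)" "T I (%y. \<Sum>n. g n y) x = (\<Sum>n. T I (g n) x)"
proof -
 have bdg: "bd (g n)" for n using g unfolding bd_def by blast
 have b0: "0 <= b n" for n using g[OF assms(2), of n] by linarith
 obtain D where D: "0 <= D" "!!x. x \<in> X ==> T I (%_. 1) x <= D" by (rule adm_bound[OF assms(1)], rule that)
 have sg: "summable (%n. g n y)" if "y \<in> X" for y
  by (rule summable_comparison_test'[OF b, of 0]) (use g[OF that] in simp)
 have Tle: "\<bar>T I (g n) x\<bar> <= b n * D" for n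
 proof -
  have "\<bar>T I (g n) x\<bar> <= b n * T I (%_. 1) x" by (rule Op_abs_le[OF assms(1) bdg assms(2) g])
  also have "... <= b n * D" by (rule mult_left_mono[OF D(2)[OF assms(2)] b0])
  finally show ?thesis .
 qed
 show sT: "summable (%n. T I (g n) x)"
  by (rule summable_comparison_test'[OF summable_mult2[OF b, of D], of 0]) (use Tle in simp)
 have tail: "\<bar>\<Sum>n. g (n + N) y\<bar> <= (\<Sum>n. b (n + N))" if y: "y \<in> X" for y N
 proof -
  have sb: "summable (%n. b (n + N))" using b by (rule summable_ignore_initial_segment)
  have "\<bar>\<Sum>n. g (n + N) y\<bar> <= (\<Sum>n. \<bar>g (n + N) y\<bar>)"
   by (rule summable_rabs[OF summable_comparison_test'[OF sb, of 0]]) (use g[OF y] in simp)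
  also have "... <= (\<Sum>n. b (n + N))"
   by (rule suminf_le[OF g[OF y] summable_comparison_test'[OF sb, of 0] sb]) (use g[OF y] in simp)
  finally show ?thesis .
 qed
 have bdsum: "bd (%y. \<Sum>n<N. g n y)" for N
  by (induction N) (auto intro: bd_add bdg bd_const)
 have Tsum: "T I (%y. \<Sum>n<N. g n y) x = (\<Sum>n<N. T I (g n) x)" for N
 proof (induction N)
  case (Suc N)
  then show ?case using Op_add[OF assms(1) bdsum bdg assms(2), of N N] by simp
 qed (simp add: Op_def)
 have bdt: "bd (%y. \<Sum>n. g (n + N) y)" for N using tail[of _ N] unfolding bd_def by blast
 have "(%N. \<Sum>n<N. T I (g n) x) \<longlonglongrightarrow> T I (%y. \<Sum>n. g n y) x"
 proof (rule Lim_null_comparison[THEN LIM_zero_cancel])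
  show "EV N. norm ((\<Sum>n<N. T I (g n) x) - T I (%y. \<Sum>n. g n y) x) <= (\<Sum>n. b (n + N)) * D"
  proof (rule always_eventually, rule allI)
   fix N
   have "T I (%y. \<Sum>n. g n y) x = T I (%y. (\<Sum>n<N. g n y) + (\<Sum>n. g (n + N) y)) x"
    by (rule Op_cong[OF assms(2)]) (use suminf_split_initial_segment[OF sg, where k = N] in \<open>simp add: add.commute[of N]\<close>)
   also have "... = (\<Sum>n<N. T I (g n) x) + T I (%y. \<Sum>n. g (n + N) y) x"
    unfolding Op_add[OF assms(1) bdsum bdt assms(2)] Tsum ..
   finally have "norm ((\<Sum>n<N. T I (g n) x) - T I (%y. \<Sum>n. g n y) x) = \<bar>T I (%y. \<Sum>n. g (n + N) y) x\<bar>" by simp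
   also have "... <= (\<Sum>n. b (n + N)) * T I (%_. 1) x" by (rule Op_abs_le[OF assms(1) bdt assms(2) tail])
   also have "... <= (\<Sum>n. b (n + N)) * D"
   proof (rule mult_left_mono[OF D(2)[OF assms(2)]])
    show "0 <= (\<Sum>n. b (n + N))" by (rule suminf_nonneg[OF summable_ignore_initial_segment[OF b] b0])
   qed
   finally show "norm ((\<Sum>n<N. T I (g n) x) - T I (%y. \<Sum>n. g n y) x) <= (\<Sum>n. b (n + N)) * D" .
  qed
  have "(%N. \<Sum>n. b (n + N)) \<longlonglongrightarrow> 0" by (rule suminf_exist_split2[OF b])
  then have "(%N. (\<Sum>n. b (n + N)) * D) \<longlonglongrightarrow> 0 * D" by (intro tendsto_intros)
  then show "(%N. (\<Sum>n. b (n + N)) * D) \<longlonglongrightarrow> 0" by simp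
 qed
 then have "(%n. T I (g n) x) sums T I (%y. \<Sum>n. g n y) x" unfolding sums_def .
 then show "T I (%y. \<Sum>n. g n y) x = (\<Sum>n. T I (g n) x)" by (simp add: sums_iff)
qed

end

text \<open>Since every state of \<open>Q\<close> leads to \<open>x0\<close>, the growth at \<open>x0\<close> is that of the whole operator.\<close>

locale killed = rpf A \<theta> C G Mj l h \<nu> Us M
 for A :: "'s::{countable,discrete_topology} => 's => bool" and \<theta> C :: real
  and G :: "'s word => real" and Mj :: "'s => real" and l :: real
  and h :: "'s word => real" and \<nu> :: "'s word measure" and Us :: "'s set" and M :: "'s => 's => bool" +
 fixes Q V :: "'s set" and x0 :: "'s word"
 assumes Q_fin: "finite Q" and Q_Us: "Q \<subseteq> Us" and QV: "Q \<inter> V = {}"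
  and x0: "x0 \<in> X" "x0 0 \<in> Q"
  and conn: "!!b. b \<in> Q ==> EX v. successively M (b # v @ [x0 0]) & set v \<subseteq> Q \<union> V"
begin

abbreviation W where "W \<equiv> words_from Q V"

lemma admW: "adm W"
 by (rule adm_words_from[OF Q_fin Q_Us QV])

definition it :: "nat => ('s word => real) => 's word => real" where
 "it n f = (T W ^^ n) f"

lemma it_0: "it 0 f = f" and it_Suc: "it (Suc n) f = T W (it n f)"
 by (simp_all add: it_def)

abbreviation one where "one n \<equiv> it n (%_. 1)"

lemma it_bd: "bd f ==> bd (it n f)"
 by (induction n) (auto simp: it_0 it_Suc intro: bd_Op admW)

lemma it_harn: "harn k f ==> bd f ==> K <= k ==> harn k (it n f)"
 by (induction n) (auto simp: it_0 it_Suc intro!: harn_Op admW it_bd)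

lemma it_mono: "bd f ==> bd g ==> (!!x. x \<in> X ==> f x <= g x) ==> x \<in> X ==> it n f x <= it n g x"
 by (induction n arbitrary: x) (auto simp: it_0 it_Suc intro!: Op_mono admW it_bd)

lemma it_cmult: "it n (%x. c * f x) = (%x. c * it n f x)"
proof (induction n)
 case (Suc n) show ?case unfolding it_Suc Suc by (rule ext) (rule Op_cmult)
qed (simp add: it_0)

lemma it_add:
 assumes "bd f" "bd g" "x \<in> X" shows "it n (%x. f x + g x) x = it n f x + it n g x"
 using assms(3)
proof (induction n arbitrary: x)
 case (Suc n)
 have "it (Suc n) (%x. f x + g x) x = T W (%x. it n f x + it n g x) x"
  unfolding it_Suc by (rule Op_cong[OF Suc.prems]) (rule Suc.IH)
 then show ?case unfolding it_Suc using Op_add[OF admW it_bd[OF assms(1)] it_bd[OF assms(2)] Suc.prems] by simp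
qed (simp add: it_0)

lemma one_harn: "harn K (one n)" and one_bd: "bd (one n)"
 and one_nonneg: "x \<in> X ==> 0 <= one n x"
proof -
 show h: "harn K (one n)" using K_nonneg by (intro it_harn harn_const bd_const) auto
 show "bd (one n)" by (rule it_bd[OF bd_const])
 show "x \<in> X ==> 0 <= one n x" by (rule harn_nonneg[OF h])
qed

lemma W_hd: "w \<in> W ==> (w \<frown> x) 0 \<in> Q"
 using words_from_hd[of w Q V] conc_0[of w x] by auto

lemma it_abs_le:
 assumes "bd f" "!!x. x \<in> X ==> \<bar>f x\<bar> <= B" "x \<in> X"
 shows "\<bar>it n f x\<bar> <= B * one n x"
proof -
 have "it n f x <= it n (%x. B * 1) x" "it n (%x. (- B) * 1) x <= it n f x"
  using assms(2) by (auto intro!: it_mono bd_const assms(1,3) simp: abs_le_iff minus_le_iff)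
 then show ?thesis unfolding it_cmult by (simp add: abs_le_iff)
qed

text \<open>Growth is measured by the constant 1 in the supremum norm. By positivity this controls
  all functions (\<open>it_abs_le\<close>), and through the cone also their local Lipschitz
  constants (\<open>it_lip\<close>).\<close>

definition growth :: "real => bool" where
 "growth s \<longleftrightarrow> 0 < s & (EX B. ALL n. ALL x:X. one n x <= B * s ^ n)"

definition \<rho> :: real where "\<rho> = Inf {s. growth s}"

lemma growth_1: "growth 1"
proof -
 obtain \<kappa> where \<kappa>: "0 < \<kappa>" "!!x. x \<in> X ==> x 0 \<in> Q ==> \<kappa> <= h x"
  by (rule h_lower[OF Q_fin Q_Us], rule that)
 obtain B where B: "0 <= B" "!!x. x \<in> X ==> \<bar>h x\<bar> <= B" by (rule bdE[OF h_bd]) blast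
 have Wh: "T W h x <= h x" if "x \<in> X" for x by (rule Op_words_from_h_le[OF Q_fin Q_Us QV that])
 have le: "\<kappa> * one (Suc n) x <= h x" if "x \<in> X" for n x
  using that
 proof (induction n arbitrary: x)
  case 0
  have "\<kappa> * one (Suc 0) x = T W (%_. \<kappa> * 1) x" unfolding it_Suc it_0 by (rule Op_cmult[symmetric])
  also have "... <= T W h x" using \<kappa>(2) W_hd by (intro Op_mono admW bd_const h_bd 0) auto
  finally show ?case using Wh[OF 0] by simp
 next
  case (Suc n)
  have "\<kappa> * one (Suc (Suc n)) x = T W (%y. \<kappa> * one (Suc n) y) x"
   unfolding it_Suc[of "Suc n"] by (rule Op_cmult[symmetric])
  also have "... <= T W h x" by (intro Op_mono admW bd_cmult one_bd h_bd Suc.prems Suc.IH)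
  finally show ?case using Wh[OF Suc.prems] by simp
 qed
 have "one n x <= max 1 (B / \<kappa>) * 1 ^ n" if x: "x \<in> X" for n x
 proof (cases n)
  case (Suc m)
  have "\<kappa> * one n x <= B" using le[OF x, of m] B(2)[OF x] Suc by simp
  then have "one n x <= B / \<kappa>" using \<kappa>(1) by (simp add: field_simps)
  then show ?thesis by simp
 qed (simp add: it_0)
 then show ?thesis unfolding growth_def by (intro conjI exI[of _ "max 1 (B / \<kappa>)"] allI ballI) auto
qed

lemma growth_bdd: "bdd_below {s. growth s}"
 by (rule bdd_belowI[of _ 0]) (auto simp: growth_def)

lemma growthD: assumes "growth s" obtains B where "0 < B" "!!n x. x \<in> X ==> one n x <= B * s ^ n"
proof -
 obtain B where B: "ALL n. ALL x:X. one n x <= B * s ^ n" and s: "0 < s" using assms by (auto simp: growth_def)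
 show ?thesis
 proof (rule that[of "max 1 B"])
  fix n x assume "x \<in> X"
  then have "one n x <= B * s ^ n" using B by blast
  also have "... <= max 1 B * s ^ n" using s by (intro mult_right_mono) auto
  finally show "one n x <= max 1 B * s ^ n" .
 qed simp
qed

lemma \<rho>_le: "growth s ==> \<rho> <= s"
 unfolding \<rho>_def by (rule cInf_lower[OF _ growth_bdd]) simp

lemma \<rho>_le_1: "\<rho> <= 1"
 by (rule \<rho>_le[OF growth_1])

lemma \<rho>_nonneg: "0 <= \<rho>"
 unfolding \<rho>_def
proof (rule cInf_greatest)
 show "{s. growth s} ~= {}" using growth_1 by blast
qed (simp add: growth_def)

lemma growth_above: assumes "\<rho> < z" obtains s where "growth s" "s < z"
proof -
 have "Inf {s. growth s} < z" using assms by (simp add: \<rho>_def)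
 then show ?thesis using cInf_lessD[of "{s. growth s}" z] growth_1 that by auto
qed

text \<open>The inverse of \<open>z - T W\<close> applied to the constant 1, by its Neumann
  series.\<close>

definition res :: "real => 's word => real" where
 "res z x = (\<Sum>n. one n x / z ^ Suc n)"

lemma res_summable:
 assumes "\<rho> < z" obtains b where "summable b" "!!n x. x \<in> X ==> one n x / z ^ Suc n <= b n" "!!n. 0 <= b n"
proof -
 obtain s where s: "growth s" "s < z" by (rule growth_above[OF assms])
 obtain B where B: "0 < B" "!!n x. x \<in> X ==> one n x <= B * s ^ n" by (rule growthD[OF s(1)], rule that)
 have s0: "0 < s" using s by (simp add: growth_def)
 show ?thesis
 proof (rule that[of "%n. B / z * (s / z) ^ n"])
  show "summable (%n. B / z * (s / z) ^ n)" using s s0 by (intro summable_mult summable_geometric) auto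
  fix n x assume x: "x \<in> X"
  have "one n x / z ^ Suc n <= B * s ^ n / z ^ Suc n" using B(2)[OF x] s s0 by (intro divide_right_mono) auto
  also have "... = B / z * (s / z) ^ n" by (simp add: power_divide)
  finally show "one n x / z ^ Suc n <= B / z * (s / z) ^ n" .
 qed (use s s0 B in simp)
qed

lemma
 assumes z: "\<rho> < z"
 shows res_harn: "harn K (res z)" and res_bd: "bd (res z)"
  and res_eq: "!!x. x \<in> X ==> z * res z x = T W (res z) x + 1"
proof -
 have z0: "0 < z" using \<rho>_nonneg z by linarith
 obtain b where b: "summable b" "!!n x. x \<in> X ==> one n x / z ^ Suc n <= b n" "!!n. 0 <= b n"
  by (rule res_summable[OF z], rule that)
 have pos: "0 <= one n x / z ^ Suc n" if "x \<in> X" for n x using one_nonneg[OF that] z0 by simp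
 have s: "summable (%n. one n x / z ^ Suc n)" if x: "x \<in> X" for x
  by (rule summable_comparison_test'[OF b(1), of 0]) (use b(2)[OF x] in \<open>simp only: real_norm_def abs_of_nonneg[OF pos[OF x]]\<close>)
 show "harn K (res z)"
  unfolding harn_def
 proof (intro ballI conjI impI)
  fix x assume x: "x \<in> X"
  show "0 <= res z x" unfolding res_def by (rule suminf_nonneg[OF s[OF x] pos[OF x]])
  fix y assume y: "y \<in> X" "x 0 = y 0"
  have "res z x <= (\<Sum>n. exp (K * d x y) * (one n y / z ^ Suc n))"
   unfolding res_def
  proof (rule suminf_le[OF _ s[OF x] summable_mult[OF s[OF y(1)]]])
   fix n
   have "one n x / z ^ Suc n <= (exp (K * d x y) * one n y) / z ^ Suc n"
    using harnD[OF one_harn x y, of n] z0 by (intro divide_right_mono) auto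
   then show "one n x / z ^ Suc n <= exp (K * d x y) * (one n y / z ^ Suc n)" by simp
  qed
  also have "... = exp (K * d x y) * res z y" unfolding res_def by (rule suminf_mult[OF s[OF y(1)]])
  finally show "res z x <= exp (K * d x y) * res z y" .
 qed
 show "bd (res z)"
 proof -
  have "\<bar>res z x\<bar> <= suminf b" if x: "x \<in> X" for x
   using suminf_le[OF b(2)[OF x] s[OF x] b(1)] suminf_nonneg[OF s[OF x] pos[OF x]] by (simp add: res_def)
  then show ?thesis unfolding bd_def by blast
 qed
 fix x assume x: "x \<in> X"
 have g: "\<bar>one n y / z ^ Suc n\<bar> <= b n" if "y \<in> X" for n y
  unfolding abs_of_nonneg[OF pos[OF that]] by (rule b(2)[OF that])
 have "T W (res z) x = (\<Sum>n. T W (%y. one n y / z ^ Suc n) x)"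
  unfolding res_def[abs_def] by (rule Op_suminf(2)[OF admW x b(1) g])
 also have "... = (\<Sum>n. z * (one (Suc n) x / z ^ Suc (Suc n)))"
 proof (rule suminf_cong)
  fix n
  show "T W (%y. one n y / z ^ Suc n) x = z * (one (Suc n) x / z ^ Suc (Suc n))"
   using Op_cmult[of W "1 / z ^ Suc n" "one n" x] z0 by (simp add: it_Suc)
 qed
 also have "... = z * (\<Sum>n. one (Suc n) x / z ^ Suc (Suc n))"
  using s[OF x] by (intro suminf_mult) (subst summable_Suc_iff)
 also have "(\<Sum>n. one (Suc n) x / z ^ Suc (Suc n)) = res z x - one 0 x / z ^ Suc 0"
  unfolding res_def by (rule suminf_split_head[OF s[OF x]])
 finally show "z * res z x = T W (res z) x + 1" using z0 by (simp add: it_0 right_diff_distrib)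
qed

lemma res_lower: assumes "\<rho> < z" "x \<in> X" shows "1 / z <= res z x"
proof -
 have z0: "0 < z" using \<rho>_nonneg assms(1) by linarith
 have "0 <= T W (res z) x"
  using harn_nonneg[OF res_harn[OF assms(1)]] by (intro Op_nonneg[OF assms(2)]) auto
 then show ?thesis using res_eq[OF assms] z0 by (simp add: field_simps)
qed

text \<open>A uniform bound on the resolvent would make a slightly smaller value admissible.\<close>

lemma res_unbounded:
 assumes z: "\<rho> < z" and B: "0 < B" "!!x. x \<in> X ==> res z x <= B"
 shows "\<rho> <= z - 1 / B"
proof (rule field_le_epsilon)
 fix e :: real assume e: "0 < e"
 have z0: "0 < z" using \<rho>_nonneg z by linarith
 have "1 / z <= B" using res_lower[OF z x0(1)] B(2)[OF x0(1)] by linarith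
 then have zB: "0 <= z - 1 / B" using z0 B(1) by (simp add: field_simps)
 define s where "s = z - 1 / B + e"
 have s: "0 < s" "z - 1 / B <= s" using zB e by (auto simp: s_def)
 have le: "it n (res z) x <= s ^ n * res z x" if "x \<in> X" for n x
  using that
 proof (induction n arbitrary: x)
  case (Suc n)
  have "it (Suc n) (res z) x <= T W (%y. s ^ n * res z y) x"
   unfolding it_Suc by (intro Op_mono admW it_bd bd_cmult res_bd[OF z] Suc)
  also have "... = s ^ n * (z * res z x - 1)" using res_eq[OF z Suc.prems] by (simp add: Op_cmult)
  also have "... <= s ^ n * (s * res z x)"
  proof (rule mult_left_mono)
   have "res z x * (1 / B) <= B * (1 / B)" using B Suc.prems by (intro mult_right_mono) auto
   then have "z * res z x - 1 <= (z - 1 / B) * res z x" using B(1) by (simp add: left_diff_distrib)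
   also have "... <= s * res z x" using s(2) harn_nonneg[OF res_harn[OF z] Suc.prems] by (rule mult_right_mono)
   finally show "z * res z x - 1 <= s * res z x" .
  qed (use s in simp)
  finally show ?case by (simp add: mult_ac)
 qed (simp add: it_0)
 have "one n x <= (z * B) * s ^ n" if x: "x \<in> X" for n x
 proof -
  have "one n x <= it n (%y. z * res z y) x"
  proof (rule it_mono[OF bd_const bd_cmult[OF res_bd[OF z]] _ x])
   fix y assume "y \<in> X"
   then have "1 / z <= res z y" by (rule res_lower[OF z])
   then show "1 <= z * res z y" using z0 by (simp add: field_simps)
  qed
  also have "... <= z * (s ^ n * res z x)" unfolding it_cmult using le[OF x] z0 by (intro mult_left_mono) auto
  also have "... <= z * (s ^ n * B)" using B(2)[OF x] z0 s by (intro mult_left_mono) auto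
  finally show ?thesis by (simp add: mult_ac)
 qed
 then have "growth s" unfolding growth_def using s(1) by blast
 then show "\<rho> <= z - 1 / B + e" using \<rho>_le by (simp add: s_def)
qed

text \<open>Read from the base point on, a letter in \<open>V\<close> prolongs the current
  excursion, as in \<open>words_from_recursion\<close>. A letter in \<open>Q\<close> completes one,
  and starting the next costs \<open>1 / z\<close>, because \<open>res z\<close> is at least
  \<open>T W (res z) / z\<close>. The factor \<open>min 1 (1 / z)\<close> covers both cases.\<close>

lemma path_bound:
 assumes z: "\<rho> < z" and v: "set v \<subseteq> Q \<union> V" and b: "b \<in> Q" and x: "x \<in> X"
 shows "min 1 (1 / z) ^ length v * p (b # v) x * res z ((b # v) \<frown> x) <= T W (res z) x"
 using v x
proof (induction v arbitrary: x rule: rev_induct)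
 let ?F = "T W (res z)" and ?u = "res z" and ?m = "min 1 (1 / z)"
 have z0: "0 < z" using \<rho>_nonneg z by linarith
 have m0: "0 <= ?m" using z0 by simp
 have u0: "0 <= ?u y" if "y \<in> X" for y by (rule harn_nonneg[OF res_harn[OF z] that])
 have F0: "0 <= ?F y" if "y \<in> X" for y using u0 by (intro Op_nonneg that)
 have bdF: "bd ?F" by (rule bd_Op[OF admW res_bd[OF z]])
 have step: "p [a] y * \<phi> <= ?F y"
  if y: "y \<in> X" and \<phi>: "a ## y \<in> X ==> \<phi> <= chi Q (a ## y) * ?u (a ## y) + chi V (a ## y) * ?F (a ## y)" for a y \<phi>
 proof -
  let ?f = "%y. chi Q y * ?u y + chi V y * ?F y"
  have "p [a] y * \<phi> <= p [a] y * ?f (a ## y)"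
  proof (cases "a ## y \<in> X")
   case True then show ?thesis using \<phi> by (intro mult_left_mono p_nonneg) auto
  qed (simp add: G_off)
  also have "... = T (letters {a}) ?f y" by (simp add: Op_letters)
  also have "... <= T1 ?f y"
   using u0 F0 by (intro Op_subset adm_letters bd_add bd_mult bd_chi bdF res_bd[OF z] y) (auto simp: letters_def chi_def)
  also have "... = ?F y" by (rule words_from_recursion[OF admW res_bd[OF z] y, symmetric])
  finally show ?thesis .
 qed
 {
  case Nil
  have "b \<notin> V" using b QV by auto
  then show ?case using step[OF Nil(2), of b "?u (b ## x)"] b by (simp add: chi_def)
 next
  case (snoc a v)
  let ?y = "a ## x"
  show ?case
  proof (cases "?y \<in> X")
   case True
   define R where "R = ?m ^ length v * p (b # v) ?y * ?u ((b # v) \<frown> ?y)"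
   have R: "R <= ?F ?y" unfolding R_def using snoc.prems True by (intro snoc.IH) auto
   have u: "?m * ?F ?y <= ?u ?y"
   proof -
    have "?m * ?F ?y <= 1 / z * ?F ?y" using F0[OF True] by (intro mult_right_mono) auto
    also have "... <= ?u ?y" using res_eq[OF z True] z0 by (simp add: field_simps)
    finally show ?thesis .
   qed
   have F: "?m * ?F ?y <= ?F ?y" using F0[OF True] z0 by (intro mult_left_le_one_le) auto
   have "p [a] x * (?m * R) <= ?F x"
   proof (rule step[OF snoc.prems(2)])
    have "a \<in> Q \<or> a \<in> V" using snoc.prems by auto
    then have "?m * ?F ?y <= chi Q ?y * ?u ?y + chi V ?y * ?F ?y"
     using u F u0[OF True] F0[OF True] QV by (auto simp: chi_def)
    then show "?m * R <= chi Q ?y * ?u ?y + chi V ?y * ?F ?y" using mult_left_mono[OF R m0] by linarith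
   qed
   moreover have "p (b # v @ [a]) x = p (b # v) ?y * p [a] x" using pw_append[of G l "b # v" "[a]" x] by simp
   ultimately show ?thesis unfolding R_def by (simp add: mult_ac)
  next
   case False
   then have "p (b # v @ [a]) x = 0" using pw_append[of G l "b # v" "[a]" x] by (simp add: G_off)
   then show ?thesis using F0[OF snoc.prems(2)] by (simp del: pw.simps)
  qed
 }
qed

lemma return_path: assumes "b \<in> Q" obtains v where "set v \<subseteq> Q \<union> V" "0 < p (b # v) x0"
proof -
 obtain v where v: "successively M (b # v @ [x0 0])" "set v \<subseteq> Q \<union> V" using conn[OF assms] by blast
 have "0 < p (b # v) x0" using p_pos[OF x0(1), of "b # v"] v(1) by simp
 then show ?thesis using that v(2) by blast
qed

text \<open>A loop at \<open>x0\<close> gives a positive lower bound for the growth. It is stated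
  for all \<open>z\<close> above \<open>\<rho>\<close> because it serves there to divide by
  \<open>z\<close>.\<close>

lemma \<rho>_pos_aux: obtains z0 where "0 < z0" "!!z. \<rho> < z ==> z0 <= z"
proof -
 obtain v where v: "set v \<subseteq> Q \<union> V" "0 < p (x0 0 # v) x0" by (rule return_path[OF x0(2)])
 let ?w = "x0 0 # v"
 show ?thesis
 proof (rule that[of "min 1 (p ?w x0 * exp (- K))"])
  show "0 < min 1 (p ?w x0 * exp (- K))" using v(2) by (simp del: pw.simps)
  fix z assume z: "\<rho> < z"
  have z0: "0 < z" using \<rho>_nonneg z by linarith
  show "min 1 (p ?w x0 * exp (- K)) <= z"
  proof (cases "z <= 1")
   case True
   then have m: "min 1 (1 / z) = 1" using z0 by (simp add: min_def field_simps)
   have wX: "?w \<frown> x0 \<in> X" using p_eq_0_or_in_X[OF x0(1), of ?w] v(2) by (metis less_irrefl)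
   have u: "0 < res z x0"
   proof -
    have "0 < 1 / z" using z0 by simp
    then show ?thesis using res_lower[OF z x0(1)] by linarith
   qed
   have "res z x0 <= exp K * res z (?w \<frown> x0)"
    by (rule harnD1[OF res_harn[OF z] K_nonneg x0(1) wX]) simp
   then have "exp (- K) * res z x0 <= exp (- K) * (exp K * res z (?w \<frown> x0))" by (rule mult_left_mono) simp
   then have "exp (- K) * res z x0 <= res z (?w \<frown> x0)" by (simp add: mult.assoc[symmetric] exp_minus)
   then have "p ?w x0 * (exp (- K) * res z x0) <= p ?w x0 * res z (?w \<frown> x0)"
    by (rule mult_left_mono[OF _ p_nonneg])
   also have "... <= T W (res z) x0" using path_bound[OF z v(1) x0(2) x0(1)] unfolding m power_one mult_1_left .
   also have "... <= z * res z x0" using res_eq[OF z x0(1)] by simp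
   finally have "p ?w x0 * exp (- K) * res z x0 <= z * res z x0" by (simp only: mult.assoc)
   then have "p ?w x0 * exp (- K) <= z" using u by (rule mult_right_le_imp_le)
   then show ?thesis by linarith
  qed auto
 qed
qed

text \<open>If \<open>T W (res z) x0\<close> stayed bounded, \<open>path_bound\<close> along a word
  from each \<open>b\<close> in \<open>Q\<close> to \<open>x0\<close> would bound
  \<open>res z\<close> over \<open>Q\<close>, and the resolvent equation would then bound it
  everywhere. By \<open>res_unbounded\<close> this is impossible for \<open>z\<close> close to
  \<open>\<rho>\<close>.\<close>

lemma res_blows_up:
 obtains \<zeta> where "0 < \<zeta>" "!!z. \<rho> < z ==> z < \<rho> + \<zeta> ==> D < T W (res z) x0"
proof -
 obtain z0 where z0: "0 < z0" "!!z. \<rho> < z ==> z0 <= z" by (rule \<rho>_pos_aux, rule that)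
 obtain CW where CW: "0 <= CW" "!!x. x \<in> X ==> T W (%_. 1) x <= CW" by (rule adm_bound[OF admW], rule that)
 have "EX c>=0. ALL z x. \<rho> < z --> z < 2 --> x \<in> X --> x 0 = b --> res z x <= c * T W (res z) x0" if b: "b \<in> Q" for b
 proof -
  obtain v where v: "set v \<subseteq> Q \<union> V" "0 < p (b # v) x0" by (rule return_path[OF b])
  let ?w = "b # v"
  define q where "q = (1/2) ^ length v * p ?w x0"
  have q: "0 < q" using v(2) unfolding q_def by (intro mult_pos_pos) auto
  have wX: "?w \<frown> x0 \<in> X" using p_eq_0_or_in_X[OF x0(1), of ?w] v(2) by (metis less_irrefl)
  have "res z x <= exp K / q * T W (res z) x0" if z: "\<rho> < z" "z < 2" and x: "x \<in> X" "x 0 = b" for z x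
  proof -
   have zp: "0 < z" using \<rho>_nonneg z by linarith
   have m: "(1/2) ^ length v <= min 1 (1 / z) ^ length v" using zp z(2) by (intro power_mono) (auto simp: field_simps)
   have u0: "0 <= res z (?w \<frown> x0)" by (rule harn_nonneg[OF res_harn[OF z(1)] wX])
   have "res z x <= exp K * res z (?w \<frown> x0)"
    by (rule harnD1[OF res_harn[OF z(1)] K_nonneg x(1) wX]) (simp add: x)
   moreover have "q * res z (?w \<frown> x0) <= T W (res z) x0"
   proof -
    have "q * res z (?w \<frown> x0) <= min 1 (1 / z) ^ length v * p ?w x0 * res z (?w \<frown> x0)"
     unfolding q_def by (intro mult_right_mono m u0 p_nonneg)
    then show ?thesis using path_bound[OF z(1) v(1) b x0(1)] by linarith
   qed
   then have "exp K * res z (?w \<frown> x0) <= exp K / q * T W (res z) x0" using q by (simp add: field_simps)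
   ultimately show ?thesis by linarith
  qed
  then show ?thesis using q by (intro exI[of _ "exp K / q"]) auto
 qed
 then obtain cf where cf: "!!b. b \<in> Q ==> 0 <= cf b"
   "!!b z x. b \<in> Q ==> \<rho> < z ==> z < 2 ==> x \<in> X ==> x 0 = b ==> res z x <= cf b * T W (res z) x0"
  by metis
 define c where "c = sum cf Q"
 have c: "0 <= c" "!!b. b \<in> Q ==> cf b <= c"
  unfolding c_def using cf(1) Q_fin by (auto intro: sum_nonneg member_le_sum)
 define D' where "D' = max D 0"
 define B where "B = (c * D' * CW + 1) / z0"
 have B: "0 < B" unfolding B_def using c CW z0 by (intro divide_pos_pos add_nonneg_pos) (auto simp: D'_def)
 show ?thesis
 \<comment> \<open>Below \<open>\<rho> + 1 / B\<close> the bound \<open>B\<close> contradicts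
   \<open>res_unbounded\<close>. The 1 keeps \<open>z\<close> below 2, so that
   \<open>min 1 (1 / z)\<close> is at least \<open>1 / 2\<close> along the paths.\<close>
 proof (rule that[of "min 1 (1 / B)"])
  show "0 < min 1 (1 / B)" using B by simp
  fix z assume z: "\<rho> < z" "z < \<rho> + min 1 (1 / B)"
  have z2: "z < 2" using z(2) \<rho>_le_1 by simp
  have zz: "z0 <= z" by (rule z0(2)[OF z(1)])
  show "D < T W (res z) x0"
  proof (rule ccontr)
   assume "\<not> ?thesis"
   then have FD: "T W (res z) x0 <= D'" by (simp add: D'_def)
   have F0: "0 <= T W (res z) x0" using harn_nonneg[OF res_harn[OF z(1)]] by (intro Op_nonneg x0(1)) auto
   have uQ: "res z x <= c * D'" if x: "x \<in> X" "x 0 \<in> Q" for x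
   proof -
    have "res z x <= cf (x 0) * T W (res z) x0" by (rule cf(2)[OF x(2) z(1) z2 x(1) refl])
    also have "... <= c * D'" using c cf(1) x FD F0 by (intro mult_mono) auto
    finally show ?thesis .
   qed
   have "res z x <= B" if x: "x \<in> X" for x
   proof -
    have "T W (res z) x <= T W (%_. c * D' * 1) x"
     using uQ W_hd by (intro Op_mono admW res_bd[OF z(1)] bd_const x) auto
    also have "... = c * D' * T W (%_. 1) x" by (rule Op_cmult)
    also have "... <= c * D' * CW" using CW(2)[OF x] c(1) by (intro mult_left_mono) (auto simp: D'_def)
    finally have le: "z * res z x <= c * D' * CW + 1" using res_eq[OF z(1) x] by simp
    have "z0 * res z x <= z * res z x"
     using zz harn_nonneg[OF res_harn[OF z(1)] x] by (rule mult_right_mono)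
    then have "z0 * res z x <= c * D' * CW + 1" using le by linarith
    then show ?thesis using z0(1) by (simp add: B_def field_simps)
   qed
   then have "\<rho> <= z - 1 / B" by (rule res_unbounded[OF z(1) B])
   then show False using z(2) by linarith
  qed
 qed
qed

end

section \<open>The spectral radius of an induced operator\<close>

context weight
begin

text \<open>The complex version of \<open>bl\<close> with an explicit constant: the resolvent set
  asks for a bound in terms of \<open>norm1\<close>, which agrees with the least such constant up to
  the factor 2.\<close>

definition cl :: "real => ('s word => complex) => bool" where
 "cl c f \<longleftrightarrow> (ALL x:X. norm (f x) <= c & (ALL y:X. x 0 = y 0 --> norm (f x - f y) <= c * d x y))"

lemma clD: "cl c f ==> x \<in> X ==> norm (f x) <= c"
  "cl c f ==> x \<in> X ==> y \<in> X ==> x 0 = y 0 ==> norm (f x - f y) <= c * d x y"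
 by (simp_all add: cl_def)

lemma clI:
 assumes "!!x. x \<in> X ==> norm (f x) <= c"
  and "!!x y. x \<in> X ==> y \<in> X ==> x 0 = y 0 ==> norm (f x - f y) <= c * d x y"
 shows "cl c f"
 using assms by (simp add: cl_def)

lemma d_pos: "x ~= y ==> 0 < d x y"
 using theta by (simp add: dtheta_def)

lemma norm1_le_of_cl: assumes "cl c f" "0 <= c" shows "norm1 A \<theta> f <= ennreal (2 * c)"
proof -
 have "(SUP x \<in> X. ennreal (norm (f x))) <= ennreal c"
  using clD(1)[OF assms(1)] by (intro SUP_least ennreal_leI)
 moreover have "lip_seminorm A \<theta> 1 f <= ennreal c"
  unfolding lip_seminorm_def
 proof (rule SUP_least, clarify)
  fix x y :: "'s word" assume xy: "x \<in> X" "y \<in> X" "x ~= y" and "prefix 1 x = prefix 1 y"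
  then have "x 0 = y 0" by simp
  then have "norm (f x - f y) <= c * d x y" by (rule clD(2)[OF assms(1) xy(1,2)])
  then show "ennreal (norm (f x - f y) / d x y) <= ennreal c"
   using d_pos[OF xy(3)] by (intro ennreal_leI) (simp add: field_simps)
 qed
 ultimately have "norm1 A \<theta> f <= ennreal c + ennreal c" unfolding norm1_def by (rule add_mono)
 then show ?thesis using assms(2) by (simp flip: ennreal_plus)
qed

lemma cl_of_norm1_le: assumes "norm1 A \<theta> f <= ennreal c" "0 <= c" shows "cl c f"
proof (rule clI)
 fix x assume x: "x \<in> X"
 have "ennreal (norm (f x)) <= (SUP x \<in> X. ennreal (norm (f x)))" using x by (rule SUP_upper)
 also have "... <= norm1 A \<theta> f" unfolding norm1_def by simp
 also note assms(1)
 finally show "norm (f x) <= c" using assms(2) by simp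
 fix y assume y: "y \<in> X" "x 0 = y 0"
 show "norm (f x - f y) <= c * d x y"
 proof (cases "x = y")
  case False
  have "ennreal (norm (f x - f y) / d x y) <= lip_seminorm A \<theta> 1 f"
   unfolding lip_seminorm_def
   by (rule SUP_upper2[of "(x, y)"]) (use x y False in auto)
  also have "... <= norm1 A \<theta> f" unfolding norm1_def by simp
  also note assms(1)
  finally show ?thesis using assms(2) d_pos[OF False] by (simp add: field_simps)
 qed (simp add: d_self)
qed

lemma cl_bl: assumes "cl c f" shows "bl (%x. Re (f x))" "bl (%x. Im (f x))"
proof -
 have "\<bar>Re (f x)\<bar> <= c" "\<bar>Im (f x)\<bar> <= c" if "x \<in> X" for x
  using clD(1)[OF assms that] abs_Re_le_cmod abs_Im_le_cmod order_trans by blast+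
 moreover have "\<bar>Re (f x) - Re (f y)\<bar> <= c * d x y" "\<bar>Im (f x) - Im (f y)\<bar> <= c * d x y"
  if "x \<in> X" "y \<in> X" "x 0 = y 0" for x y
  using clD(2)[OF assms that] abs_Re_le_cmod[of "f x - f y"] abs_Im_le_cmod[of "f x - f y"] by auto
 ultimately show "bl (%x. Re (f x))" "bl (%x. Im (f x))" by (auto intro!: blI)
qed

lemma bl_cl:
 assumes "bl (%x. Re (f x))" "bl (%x. Im (f x))" obtains c where "0 <= c" "cl c f"
proof -
 obtain a where a: "0 <= a" "!!x. x \<in> X ==> \<bar>Re (f x)\<bar> <= a"
  "!!x y. x \<in> X ==> y \<in> X ==> x 0 = y 0 ==> \<bar>Re (f x) - Re (f y)\<bar> <= a * d x y"
  by (rule blE[OF assms(1)], rule that)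
 obtain b where b: "0 <= b" "!!x. x \<in> X ==> \<bar>Im (f x)\<bar> <= b"
  "!!x y. x \<in> X ==> y \<in> X ==> x 0 = y 0 ==> \<bar>Im (f x) - Im (f y)\<bar> <= b * d x y"
  by (rule blE[OF assms(2)], rule that)
 have "cl (a + b) f"
 proof (rule clI)
  fix x assume x: "x \<in> X"
  show "norm (f x) <= a + b" using cmod_le[of "f x"] a(2)[OF x] b(2)[OF x] by linarith
  fix y assume "y \<in> X" "x 0 = y 0"
  then show "norm (f x - f y) <= (a + b) * d x y"
   using cmod_le[of "f x - f y"] a(3)[OF x] b(3)[OF x] by (fastforce simp: distrib_right)
 qed
 then show ?thesis using that[of "a + b"] a(1) b(1) by simp
qed

lemma Fb_iff:
 "f \<in> Fb A \<theta> \<longleftrightarrow> (ALL x. x \<notin> X --> f x = 0) & bl (%x. Re (f x)) & bl (%x. Im (f x))"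
proof
 assume f: "f \<in> Fb A \<theta>"
 then have "norm1 A \<theta> f <= ennreal (enn2real (norm1 A \<theta> f))" by (simp add: Fb_def)
 then have "cl (enn2real (norm1 A \<theta> f)) f" by (rule cl_of_norm1_le) simp
 from cl_bl[OF this] f show "(ALL x. x \<notin> X --> f x = 0) & bl (%x. Re (f x)) & bl (%x. Im (f x))"
  by (simp add: Fb_def)
next
 assume f: "(ALL x. x \<notin> X --> f x = 0) & bl (%x. Re (f x)) & bl (%x. Im (f x))"
 then obtain c where c: "0 <= c" "cl c f" using bl_cl by blast
 have "norm1 A \<theta> f < \<infinity>" using norm1_le_of_cl[OF c(2,1)] by (rule order.strict_trans1) simp
 moreover have "continuous_on X (%x. Complex (Re (f x)) (Im (f x)))"
  unfolding Complex_eq using f by (intro continuous_intros bl_continuous) auto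
 ultimately show "f \<in> Fb A \<theta>" using f by (simp add: Fb_def)
qed

lemma Fb_cl: assumes "f \<in> Fb A \<theta>" shows "cl (enn2real (norm1 A \<theta> f)) f" "norm1 A \<theta> f = ennreal (enn2real (norm1 A \<theta> f))"
proof -
 show e: "norm1 A \<theta> f = ennreal (enn2real (norm1 A \<theta> f))" using assms by (simp add: Fb_def)
 show "cl (enn2real (norm1 A \<theta> f)) f" by (rule cl_of_norm1_le) (use e in auto)
qed

lemma Fb_of_real: assumes "bl f" shows "(%x. if x \<in> X then complex_of_real (f x) else 0) \<in> Fb A \<theta>"
 unfolding Fb_iff using bl_cong[OF assms, of "%x. if x \<in> X then f x else 0"] bl_const[of 0]
 by (simp add: if_distrib[of Re] if_distrib[of Im] cong: if_cong)

definition TC :: "'s list set => ('s word => complex) => 's word => complex" where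
 "TC I f x = Complex (T I (%x. Re (f x)) x) (T I (%x. Im (f x)) x)"

lemma TC_cmult:
 assumes "adm I" "bd (%x. Re (f x))" "bd (%x. Im (f x))" "x \<in> X"
 shows "TC I (%y. c * f y) x = c * TC I f x"
 unfolding TC_def complex_eq_iff
 using assms by (simp add: Op_add Op_diff Op_cmult bd_cmult)

lemma suffix_conc_Cons: "suffix (Suc k) ((a # w) \<frown> x) = suffix k (w \<frown> x)"
 by (rule ext) simp

lemma p_birkhoff:
 assumes "!!x. x \<in> X ==> G x = exp (\<phi> x)" "w \<frown> x \<in> X"
 shows "p w x = exp (birkhoff (length w) \<phi> (w \<frown> x)) / l ^ length w"
 using assms(2)
proof (induction w)
 case (Cons a w)
 have w: "w \<frown> x \<in> X" using Cons.prems by (simp add: shift_space_build)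
 have "birkhoff (length (a # w)) \<phi> ((a # w) \<frown> x) = \<phi> ((a # w) \<frown> x) + birkhoff (length w) \<phi> (w \<frown> x)"
  unfolding birkhoff_def length_Cons sum.lessThan_Suc_shift suffix_conc_Cons by simp
 then show ?case using Cons.IH[OF w] assms(1)[OF Cons.prems] by (simp add: exp_add)
qed (simp add: birkhoff_def)

text \<open>The factor \<open>l powi (1 - n)\<close> times the exponential of the Birkhoff sum is
  \<open>l\<close> times the normalised weight, so the induced operator is \<open>l\<close> times
  \<open>TC\<close>. Words that are not admissible have weight 0 and may be added to the index
  set.\<close>

lemma induced_op_eq:
 assumes \<phi>: "!!x. x \<in> X ==> G x = exp (\<phi> x)" and adm: "adm (words_from Q V)" and x: "x \<in> X"
  and f: "bd (%x. Re (f x))" "bd (%x. Im (f x))"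
 shows "induced_op A \<phi> Q V l f x = l * TC (words_from Q V) f x"
proof -
 let ?W = "words_from Q V"
 have "((%w. of_real (p w x * Re (f (w \<frown> x))) + \<i> * of_real (p w x * Im (f (w \<frown> x)))) has_sum
   of_real (T ?W (%x. Re (f x)) x) + \<i> * of_real (T ?W (%x. Im (f x)) x)) ?W"
  unfolding Op_def using Op_summable[OF adm f(1) x] Op_summable[OF adm f(2) x]
  by (intro has_sum_add has_sum_cmult_right has_sum_bounded_linear[OF bounded_linear_of_real, unfolded o_def] has_sum_infsum)
 then have s: "(\<Sum>\<^sub>\<infinity>w\<in>?W. of_real l * (of_real (p w x * Re (f (w \<frown> x))) + \<i> * of_real (p w x * Im (f (w \<frown> x)))))
   = l * TC ?W f x"
  unfolding TC_def Complex_eq by (intro infsumI has_sum_cmult_right)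
 have "induced_op A \<phi> Q V l f x = (\<Sum>\<^sub>\<infinity>w\<in>{w \<in> ?W. successively A (w @ [x 0])}.
   of_real (l powi (1 - int (length w)) * exp (birkhoff (length w) \<phi> (w \<frown> x))) * f (w \<frown> x))"
  using x by (simp add: induced_op_def)
 also have "... = (\<Sum>\<^sub>\<infinity>w\<in>?W. of_real l * (of_real (p w x * Re (f (w \<frown> x))) + \<i> * of_real (p w x * Im (f (w \<frown> x)))))"
 proof (rule infsum_cong_neutral)
  fix w assume "w \<in> ?W - {w \<in> ?W. successively A (w @ [x 0])}"
  then have "w ~= []" "w \<frown> x \<notin> X" using words_from_hd by (auto simp: shift_space_conc)
  then have "p w x = 0" by (rule p_off)
  then show "of_real l * (of_real (p w x * Re (f (w \<frown> x))) + \<i> * of_real (p w x * Im (f (w \<frown> x)))) = 0" by simp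
 next
  fix w assume "w \<in> {w \<in> ?W. successively A (w @ [x 0])} \<inter> ?W"
  then have wX: "w \<frown> x \<in> X" using x by (simp add: shift_space_conc)
  have pw: "p w x = exp (birkhoff (length w) \<phi> (w \<frown> x)) / l ^ length w"
   by (rule p_birkhoff) (use \<phi> wX in auto)
  have "l powi (1 - int (length w)) * exp (birkhoff (length w) \<phi> (w \<frown> x)) = l * p w x"
   unfolding pw using l_pos by (simp add: power_int_diff)
  moreover have "f (w \<frown> x) = of_real (Re (f (w \<frown> x))) + \<i> * of_real (Im (f (w \<frown> x)))" by (rule complex_eq)
  ultimately show "of_real (l powi (1 - int (length w)) * exp (birkhoff (length w) \<phi> (w \<frown> x))) * f (w \<frown> x)
   = of_real l * (of_real (p w x * Re (f (w \<frown> x))) + \<i> * of_real (p w x * Im (f (w \<frown> x))))"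
   unfolding complex_eq_iff by (simp add: mult.assoc)
 qed blast
 finally show ?thesis using s by simp
qed

end

section \<open>Resolvent of the induced operator on the space of locally Lipschitz functions\<close>

context killed
begin

text \<open>Shifted by \<open>2 * c\<close>, the function \<open>g\<close> lies in the cone, where
  oscillation is bounded by values, and these are at most \<open>3 * c\<close> times the iterate of
  1. Undoing the shift costs another \<open>2 * c\<close>, hence the factor 5.\<close>

lemma it_lip:
 assumes g: "!!x. x \<in> X ==> \<bar>g x\<bar> <= c"
  "!!x y. x \<in> X ==> y \<in> X ==> x 0 = y 0 ==> \<bar>g x - g y\<bar> <= c * d x y"
  and xy: "x \<in> X" "y \<in> X" "x 0 = y 0"
 shows "\<bar>it n g x - it n g y\<bar> <= 5 * (max 1 K * exp (max 1 K) * exp (max 1 K)) * c * one n y * d x y"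
proof -
 let ?k = "max 1 K" let ?e = "?k * exp ?k * exp ?k" let ?F = "%x. g x + 2 * c"
 have c0: "0 <= c" using g(1)[OF xy(1)] by linarith
 have bdg: "bd g" using g(1) unfolding bd_def by blast
 have "harn 1 ?F"
  unfolding harn_def
 proof (intro ballI conjI impI)
  fix x assume x: "x \<in> X"
  show "0 <= ?F x" using g(1)[OF x] c0 by linarith
  fix y assume y: "y \<in> X" "x 0 = y 0"
  have "?F x <= c * d x y + ?F y" using g(2)[OF x y] by linarith
  also have "... <= ?F y * d x y + ?F y"
   using g(1)[OF y(1)] c0 by (intro add_right_mono mult_right_mono d_nonneg) linarith
  also have "... = (1 + d x y) * ?F y" by (simp add: algebra_simps)
  also have "... <= exp (1 * d x y) * ?F y"
   using g(1)[OF y(1)] c0 exp_ge_add_one_self[of "d x y"] by (intro mult_right_mono) (simp, linarith)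
  finally show "?F x <= exp (1 * d x y) * ?F y" .
 qed
 then have hF: "harn ?k ?F" by (rule harn_mono) simp
 have bdF: "bd ?F" by (intro bd_add bdg bd_const)
 have k0: "0 <= ?k" "0 <= ?e" by auto
 have 1: "\<bar>it n ?F x - it n ?F y\<bar> <= ?e * it n ?F y * d x y"
  by (rule harn_diff_le[OF it_harn[OF hF bdF] k0(1) xy]) simp
 have "it n ?F y <= it n (%x. 3 * c * 1) y"
 proof (rule it_mono[OF bdF bd_const _ xy(2)])
  fix x assume "x \<in> X" then show "?F x <= 3 * c * 1" using g(1)[of x] by simp
 qed
 then have "?e * it n ?F y * d x y <= ?e * (3 * c * one n y) * d x y"
  unfolding it_cmult by (intro mult_right_mono mult_left_mono d_nonneg k0)
 moreover have 2: "\<bar>one n x - one n y\<bar> <= ?e * one n y * d x y"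
  by (rule harn_diff_le[OF harn_mono[OF one_harn] k0(1) xy]) simp
 then have "2 * c * \<bar>one n x - one n y\<bar> <= 2 * c * (?e * one n y * d x y)"
  using c0 by (intro mult_left_mono) auto
 moreover have "it n ?F w = it n g w + 2 * c * one n w" if "w \<in> X" for w
  using it_add[OF bdg bd_const that, of n "2 * c"] it_cmult[of n "2 * c" "%_. 1"] by simp
 then have "\<bar>it n g x - it n g y\<bar> <= \<bar>it n ?F x - it n ?F y\<bar> + \<bar>2 * c * (one n x - one n y)\<bar>"
  using xy by (simp add: right_diff_distrib)
 moreover have "\<bar>2 * c * (one n x - one n y)\<bar> = 2 * c * \<bar>one n x - one n y\<bar>"
  using c0 by (simp add: abs_mult)
 ultimately have "\<bar>it n g x - it n g y\<bar> <= ?e * (3 * c * one n y) * d x y + 2 * c * (?e * one n y * d x y)"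
  using 1 by linarith
 also have "... = 5 * ?e * c * one n y * d x y" by (simp add: algebra_simps)
 finally show ?thesis .
qed

definition ct :: "nat => ('s word => complex) => 's word => complex" where
 "ct n f x = Complex (it n (%x. Re (f x)) x) (it n (%x. Im (f x)) x)"

lemma ct_Suc: "ct (Suc n) f = TC W (ct n f)" and ct_0: "ct 0 f = f"
 by (rule ext, simp add: ct_def TC_def it_Suc it_0)+

lemma ct_le:
 assumes f: "cl c f" and x: "x \<in> X" shows "norm (ct n f x) <= 2 * c * one n x"
proof -
 have "norm (ct n f x) <= \<bar>it n (%x. Re (f x)) x\<bar> + \<bar>it n (%x. Im (f x)) x\<bar>"
  using cmod_le[of "ct n f x"] by (simp add: ct_def)
 also have "... <= c * one n x + c * one n x"
  using clD(1)[OF f] by (intro add_mono it_abs_le bl_bd cl_bl[OF f] x) (meson abs_Re_le_cmod abs_Im_le_cmod order_trans)+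
 finally show ?thesis by simp
qed

lemma ct_lip:
 obtains L where "0 <= L"
  "!!c f n x y. cl c f ==> x \<in> X ==> y \<in> X ==> x 0 = y 0 ==> norm (ct n f x - ct n f y) <= L * c * one n y * d x y"
proof (rule that[of "10 * (max 1 K * exp (max 1 K) * exp (max 1 K))"])
 let ?e = "max 1 K * exp (max 1 K) * exp (max 1 K)"
 fix c f n x y assume f: "cl c f" and xy: "x \<in> X" "y \<in> X" "x 0 = y 0"
 have b: "\<bar>Re (f x)\<bar> <= c" "\<bar>Im (f x)\<bar> <= c" if "x \<in> X" for x
  using clD(1)[OF f that] abs_Re_le_cmod[of "f x"] abs_Im_le_cmod[of "f x"] by linarith+
 have l: "\<bar>Re (f x) - Re (f y)\<bar> <= c * d x y" "\<bar>Im (f x) - Im (f y)\<bar> <= c * d x y" if "x \<in> X" "y \<in> X" "x 0 = y 0" for x y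
  using clD(2)[OF f that] abs_Re_le_cmod[of "f x - f y"] abs_Im_le_cmod[of "f x - f y"] by simp_all
 have "norm (ct n f x - ct n f y) <= \<bar>it n (%x. Re (f x)) x - it n (%x. Re (f x)) y\<bar> + \<bar>it n (%x. Im (f x)) x - it n (%x. Im (f x)) y\<bar>"
  using cmod_le[of "ct n f x - ct n f y"] by (simp add: ct_def)
 also have "... <= 5 * ?e * c * one n y * d x y + 5 * ?e * c * one n y * d x y"
  by (intro add_mono it_lip b l xy)
 finally show "norm (ct n f x - ct n f y) <= 10 * ?e * c * one n y * d x y" by (simp add: mult_ac)
qed simp

text \<open>The Neumann series converges geometrically, in values by \<open>ct_le\<close> and in
  local Lipschitz constants by \<open>ct_lip\<close>, with a growth rate below
  \<open>cmod z / l\<close>. The constant \<open>L\<close> depends only on \<open>z\<close>, as the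
  definition of the resolvent set demands.\<close>

lemma resolvent_solve:
 assumes z: "l * \<rho> < cmod z"
 obtains L where "0 <= L"
  "!!c f. cl c f ==> 0 <= c ==> EX u. cl (L * c) u & (ALL x:X. z * u x - l * TC W u x = f x)"
proof -
 define \<zeta> where "\<zeta> = z / l"
 have n\<zeta>: "cmod \<zeta> = cmod z / l" using l_pos by (simp add: \<zeta>_def norm_divide)
 have "\<rho> < cmod \<zeta>" using z l_pos by (simp add: n\<zeta> field_simps)
 then obtain s where s: "growth s" "s < cmod \<zeta>" by (rule growth_above)
 obtain B where B: "0 < B" "!!n x. x \<in> X ==> one n x <= B * s ^ n" by (rule growthD[OF s(1)], rule that)
 obtain L where L: "0 <= L"
  "!!c f n x y. cl c f ==> x \<in> X ==> y \<in> X ==> x 0 = y 0 ==> norm (ct n f x - ct n f y) <= L * c * one n y * d x y"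
  by (rule ct_lip, rule that)
 have s0: "0 < s" using s(1) by (simp add: growth_def)
 have z0: "z ~= 0" "\<zeta> ~= 0" using s s0 l_pos by (auto simp: \<zeta>_def)
 define q where "q = s / cmod \<zeta>"
 have \<zeta>0: "0 < cmod \<zeta>" using s(2) s0 by linarith
 then have q: "0 < q" "q < 1" using s(2) s0 unfolding q_def by (simp_all add: divide_less_eq)
 define E where "E = (L + 2) * B / cmod z"
 have E0: "0 <= E" using L B by (simp add: E_def)
 show ?thesis
 proof (rule that[of "E / (1 - q)"])
  show "0 <= E / (1 - q)" using E0 q by simp
  fix c f assume f: "cl c f" and c0: "0 <= c"
  define t where "t n x = 1 / z * (1 / \<zeta>) ^ n * ct n f x" for n x
  have nt: "norm (1 / z * (1 / \<zeta>) ^ n) = 1 / cmod z / cmod \<zeta> ^ n" for n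
   by (simp add: norm_mult norm_divide norm_power power_divide)
  have t1: "norm (t n x) <= E * c * q ^ n" if x: "x \<in> X" for n x
  proof -
   have "norm (ct n f x) <= 2 * c * one n x" by (rule ct_le[OF f x])
   also have "... <= (L + 2) * c * (B * s ^ n)"
    using B(2)[OF x] c0 L(1) one_nonneg[OF x] by (intro mult_mono) auto
   finally have "1 / cmod z / cmod \<zeta> ^ n * norm (ct n f x) <= 1 / cmod z / cmod \<zeta> ^ n * ((L + 2) * c * (B * s ^ n))"
    by (rule mult_left_mono) simp
   then show ?thesis unfolding t_def norm_mult[of _ "ct n f x"] nt by (simp add: E_def q_def power_divide mult_ac)
  qed
  have t2: "norm (t n x - t n y) <= E * c * d x y * q ^ n" if xy: "x \<in> X" "y \<in> X" "x 0 = y 0" for n x y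
  proof -
   have "norm (ct n f x - ct n f y) <= L * c * one n y * d x y" by (rule L(2)[OF f xy])
   also have "... <= (L + 2) * c * (B * s ^ n) * d x y"
    using B(2)[OF xy(2)] c0 L(1) one_nonneg[OF xy(2)] B(1) s0 by (intro mult_mono d_nonneg) auto
   finally have "1 / cmod z / cmod \<zeta> ^ n * norm (ct n f x - ct n f y) <= 1 / cmod z / cmod \<zeta> ^ n * ((L + 2) * c * (B * s ^ n) * d x y)"
    by (rule mult_left_mono) simp
   then show ?thesis unfolding t_def right_diff_distrib[symmetric] norm_mult[of _ "ct n f x - ct n f y"] nt
    by (simp add: E_def q_def power_divide mult_ac)
  qed
  have sq: "(%n. a * q ^ n) sums (a / (1 - q))" for a
   using sums_mult[OF geometric_sums, of q a] q by simp
  have sb: "summable (%n. E * c * q ^ n)" using sq by (rule sums_summable)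
  have st: "summable (%n. norm (t n x))" if "x \<in> X" for x
   by (rule summable_comparison_test'[OF sb, of 0]) (use t1[OF that] in simp)
  have st': "summable (%n. t n x)" if "x \<in> X" for x by (rule summable_norm_cancel[OF st[OF that]])
  define u where "u x = (\<Sum>n. t n x)" for x
  have "cl (E / (1 - q) * c) u"
  proof (rule clI)
   fix x assume x: "x \<in> X"
   have "norm (u x) <= (\<Sum>n. norm (t n x))" unfolding u_def by (rule summable_norm[OF st[OF x]])
   also have "... <= (\<Sum>n. E * c * q ^ n)" by (rule suminf_le[OF t1[OF x] st[OF x] sb])
   also have "... = E / (1 - q) * c" using sums_unique[OF sq[of "E * c"]] by simp
   finally show "norm (u x) <= E / (1 - q) * c" .
   fix y assume y: "y \<in> X" "x 0 = y 0"
   have sd: "summable (%n. E * c * d x y * q ^ n)" using sq by (rule sums_summable)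
   have sn: "summable (%n. norm (t n x - t n y))"
    by (rule summable_comparison_test'[OF sd, of 0]) (use t2[OF x y] in simp)
   have "norm (u x - u y) = norm (\<Sum>n. t n x - t n y)"
    unfolding u_def by (simp add: suminf_diff st' x y)
   also have "... <= (\<Sum>n. norm (t n x - t n y))" by (rule summable_norm[OF sn])
   also have "... <= (\<Sum>n. E * c * d x y * q ^ n)" by (rule suminf_le[OF t2[OF x y] sn sd])
   also have "... = E / (1 - q) * c * d x y" using sums_unique[OF sq[of "E * c * d x y"]] by simp
   finally show "norm (u x - u y) <= E / (1 - q) * c * d x y" .
  qed
  moreover have "z * u x - l * TC W u x = f x" if x: "x \<in> X" for x
  proof -
   have ReIm: "\<bar>Re (t n y)\<bar> <= E * c * q ^ n" "\<bar>Im (t n y)\<bar> <= E * c * q ^ n" if "y \<in> X" for n y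
    using t1[OF that, of n] abs_Re_le_cmod[of "t n y"] abs_Im_le_cmod[of "t n y"] by linarith+
   have ru: "Re (u y) = (\<Sum>n. Re (t n y))" "Im (u y) = (\<Sum>n. Im (t n y))" if "y \<in> X" for y
    using sums_Re[OF summable_sums[OF st'[OF that]]] sums_Im[OF summable_sums[OF st'[OF that]]]
    by (simp_all add: u_def sums_unique)
   have R: "T W (%y. Re (u y)) x = T W (%y. \<Sum>n. Re (t n y)) x"
    by (rule Op_cong[OF x]) (rule ru(1))
   have I: "T W (%y. Im (u y)) x = T W (%y. \<Sum>n. Im (t n y)) x"
    by (rule Op_cong[OF x]) (rule ru(2))
   have "(%n. TC W (t n) x) sums TC W u x"
   proof -
    have "summable (%n. T W (%y. Re (t n y)) x)" "summable (%n. T W (%y. Im (t n y)) x)"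
     "T W (%y. \<Sum>n. Re (t n y)) x = (\<Sum>n. T W (%y. Re (t n y)) x)"
     "T W (%y. \<Sum>n. Im (t n y)) x = (\<Sum>n. T W (%y. Im (t n y)) x)"
     by (rule Op_suminf[OF admW x sb], rule ReIm, assumption)+
    then show ?thesis unfolding sums_complex_iff TC_def complex.sel R I by (simp add: summable_sums)
   qed
   moreover have "TC W (t n) x = \<zeta> * t (Suc n) x" for n
   proof -
    have "TC W (t n) x = 1 / z * (1 / \<zeta>) ^ n * TC W (ct n f) x"
     unfolding t_def[abs_def]
     by (rule TC_cmult[OF admW _ _ x]) (unfold ct_def complex.sel, (intro it_bd bl_bd cl_bl[OF f])+)
    then show ?thesis using z0 by (simp add: t_def ct_Suc)
   qed
   moreover have "(%n. t (Suc n) x) sums (u x - t 0 x)"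
    using summable_sums[OF st'[OF x]] by (intro iffD2[OF sums_Suc_iff]) (simp add: u_def)
   then have "(%n. \<zeta> * t (Suc n) x) sums (\<zeta> * (u x - t 0 x))" by (rule sums_mult)
   ultimately have "TC W u x = \<zeta> * (u x - t 0 x)" by (simp add: sums_iff)
   then have "l * TC W u x = z * u x - z * t 0 x"
    using l_pos by (simp add: \<zeta>_def right_diff_distrib)
   moreover have "z * t 0 x = f x" using z0 by (simp add: t_def ct_0)
   ultimately show ?thesis by simp
  qed
  ultimately show "EX u. cl (E / (1 - q) * c) u & (ALL x:X. z * u x - l * TC W u x = f x)" by blast
 qed
qed

text \<open>A solution of the homogeneous equation satisfies \<open>ct n g = \<zeta> ^ n * g\<close>
  on \<open>X\<close>, which outgrows the iterates unless \<open>g\<close> vanishes there.\<close>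

lemma resolvent_inj:
 assumes z: "l * \<rho> < cmod z" and g: "cl c g" and eq: "!!x. x \<in> X ==> z * g x = l * TC W g x" and x: "x \<in> X"
 shows "g x = 0"
proof -
 define \<zeta> where "\<zeta> = z / l"
 have n\<zeta>: "cmod \<zeta> = cmod z / l" using l_pos by (simp add: \<zeta>_def norm_divide)
 have "\<rho> < cmod \<zeta>" using z l_pos by (simp add: n\<zeta> field_simps)
 then obtain s where s: "growth s" "s < cmod \<zeta>" by (rule growth_above)
 obtain B where B: "0 < B" "!!n x. x \<in> X ==> one n x <= B * s ^ n" by (rule growthD[OF s(1)], rule that)
 have s0: "0 < s" using s(1) by (simp add: growth_def)
 have \<zeta>0: "0 < cmod \<zeta>" using s(2) s0 by linarith
 have c0: "0 <= c" using clD(1)[OF g x] norm_ge_zero order_trans by blast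
 have bdg: "bd (%x. Re (g x))" "bd (%x. Im (g x))" by (intro bl_bd cl_bl[OF g])+
 have "ct n g y = \<zeta> ^ n * g y" if "y \<in> X" for n y
  using that
 proof (induction n arbitrary: y)
  case (Suc n)
  have "TC W (ct n g) y = TC W (%y. \<zeta> ^ n * g y) y"
   unfolding TC_def using Suc.IH by (intro arg_cong2[where f = Complex] Op_cong Suc.prems) auto
  also have "... = \<zeta> ^ n * TC W g y" by (rule TC_cmult[OF admW bdg Suc.prems])
  finally show ?case using eq[OF Suc.prems] l_pos by (simp add: ct_Suc \<zeta>_def field_simps)
 qed (simp add: ct_0)
 then have "norm (g x) <= 2 * c * B * (s / cmod \<zeta>) ^ n" for n
 proof -
  have "cmod \<zeta> ^ n * norm (g x) = norm (ct n g x)" using \<open>!!y n. y \<in> X ==> ct n g y = \<zeta> ^ n * g y\<close>[OF x, of n] by (simp add: norm_mult norm_power)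
  also have "... <= 2 * c * one n x" by (rule ct_le[OF g x])
  also have "... <= 2 * c * (B * s ^ n)" using B(2)[OF x] c0 by (intro mult_left_mono) auto
  finally show ?thesis using \<zeta>0 by (simp add: power_divide pos_le_divide_eq mult_ac)
 qed
 moreover have "(%n. 2 * c * B * (s / cmod \<zeta>) ^ n) \<longlonglongrightarrow> 2 * c * B * 0"
  using s s0 \<zeta>0 by (intro tendsto_intros LIMSEQ_power_zero) (simp add: divide_less_eq)
 ultimately have "norm (g x) <= 2 * c * B * 0" by (intro LIMSEQ_le_const) auto
 then show ?thesis by simp
qed

context
 fixes \<phi> :: "'s word => real"
 assumes \<phi>: "!!x. x \<in> X ==> G x = exp (\<phi> x)"
begin

abbreviation S where "S \<equiv> induced_op A \<phi> Q V l"

lemma S_eq: assumes "cl c f" "x \<in> X" shows "S f x = l * TC W f x"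
 by (rule induced_op_eq[OF \<phi> admW assms(2)]) (auto intro!: bl_bd cl_bl[OF assms(1)])

lemma S_Fb: assumes f: "f \<in> Fb A \<theta>" shows "(%x. z * f x - S f x) \<in> Fb A \<theta>"
proof -
 note b = cl_bl[OF Fb_cl(1)[OF f]]
 have Re: "bl (%x. (Re z * Re (f x) - Im z * Im (f x)) - l * T W (%x. Re (f x)) x)"
  and Im: "bl (%x. (Re z * Im (f x) + Im z * Re (f x)) - l * T W (%x. Im (f x)) x)"
  by (intro bl_diff bl_add bl_cmult b bl_Op admW)+
 have "z * f x - S f x = 0" if "x \<notin> X" for x using f that by (simp add: Fb_def induced_op_def)
 moreover have "bl (%x. Re (z * f x - S f x))" "bl (%x. Im (z * f x - S f x))"
  by (rule bl_cong[OF Re], simp add: S_eq[OF Fb_cl(1)[OF f]] TC_def)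
   (rule bl_cong[OF Im], simp add: S_eq[OF Fb_cl(1)[OF f]] TC_def)
 ultimately show ?thesis unfolding Fb_iff by blast
qed

lemma in_resolvent: assumes z: "l * \<rho> < cmod z" shows "z \<in> resolvent_set_on (Fb A \<theta>) (norm1 A \<theta>) S"
proof -
 let ?R = "%f x. z * f x - S f x"
 obtain L where L: "0 <= L"
  "!!c f. cl c f ==> 0 <= c ==> EX u. cl (L * c) u & (ALL x:X. z * u x - l * TC W u x = f x)"
  by (rule resolvent_solve[OF z], rule that)
 have solve: "EX u:Fb A \<theta>. ?R u = g & norm1 A \<theta> u <= ennreal (2 * L) * norm1 A \<theta> g" if g: "g \<in> Fb A \<theta>" for g
 proof -
  let ?c = "enn2real (norm1 A \<theta> g)"
  obtain v where v: "cl (L * ?c) v" "!!x. x \<in> X ==> z * v x - l * TC W v x = g x"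
   using L(2)[OF Fb_cl(1)[OF g]] by auto
  define u where "u x = (if x \<in> X then v x else 0)" for x
  have u: "cl (L * ?c) u" using v(1) by (simp add: cl_def u_def)
  have uF: "u \<in> Fb A \<theta>" unfolding Fb_iff using cl_bl[OF u] by (simp add: u_def)
  have "?R u x = g x" for x
  proof (cases "x \<in> X")
   case True
   have "TC W u x = TC W v x" unfolding TC_def by (intro arg_cong2[where f = Complex] Op_cong True) (auto simp: u_def)
   then show ?thesis using v(2)[OF True] True by (simp add: S_eq[OF u True]) (simp add: u_def)
  qed (use g in \<open>simp add: u_def induced_op_def Fb_def\<close>)
  moreover have "norm1 A \<theta> u <= ennreal (2 * (L * ?c))" by (rule norm1_le_of_cl[OF u]) (use L in simp)
  then have "norm1 A \<theta> u <= ennreal (2 * L) * ennreal ?c" using L by (simp add: ennreal_mult' mult.assoc)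
  then have "norm1 A \<theta> u <= ennreal (2 * L) * norm1 A \<theta> g" using Fb_cl(2)[OF g] by simp
  ultimately show ?thesis using uF by blast
 qed
 have inj: "f = g" if fg: "f \<in> Fb A \<theta>" "g \<in> Fb A \<theta>" "?R f = ?R g" for f g
 proof
  fix x
  show "f x = g x"
  proof (cases "x \<in> X")
   case True
   note bf = cl_bl[OF Fb_cl(1)[OF fg(1)]] and bg = cl_bl[OF Fb_cl(1)[OF fg(2)]]
   let ?h = "%x. f x - g x"
   have "bl (%x. Re (?h x))" "bl (%x. Im (?h x))" using bl_diff[OF bf(1) bg(1)] bl_diff[OF bf(2) bg(2)] by simp_all
   then obtain c where c: "cl c ?h" by (rule bl_cl)
   have "?h x = 0"
   proof (rule resolvent_inj[OF z c _ True])
    fix y assume y: "y \<in> X"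
    have "TC W ?h y = TC W f y - TC W g y"
     unfolding TC_def using y by (simp add: complex_eq_iff Op_diff[OF admW] bl_bd bf bg)
    then have "l * TC W ?h y = S f y - S g y"
     by (simp add: S_eq[OF Fb_cl(1)[OF fg(1)] y] S_eq[OF Fb_cl(1)[OF fg(2)] y] right_diff_distrib)
    moreover have "z * f y - S f y = z * g y - S g y" using fg(3) by (rule fun_cong)
    ultimately show "z * ?h y = l * TC W ?h y" by (simp add: right_diff_distrib diff_eq_eq)
   qed
   then show ?thesis by simp
  qed (use fg in \<open>simp add: Fb_def\<close>)
 qed
 have "bij_betw ?R (Fb A \<theta>) (Fb A \<theta>)"
  unfolding bij_betw_def
 proof
  show "inj_on ?R (Fb A \<theta>)" by (rule inj_onI) (rule inj)
  have "g \<in> ?R ` Fb A \<theta>" if "g \<in> Fb A \<theta>" for g using solve[OF that] by blast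
  then show "?R ` Fb A \<theta> = Fb A \<theta>" using S_Fb[of _ z] by blast
 qed
 moreover have "norm1 A \<theta> f <= ennreal (2 * L) * norm1 A \<theta> (?R f)" if f: "f \<in> Fb A \<theta>" for f
  using solve[OF S_Fb[OF f]] inj[OF _ f] by blast
 ultimately show ?thesis unfolding resolvent_set_on_def by blast
qed

text \<open>The functions \<open>res z\<close> with \<open>z\<close> close to \<open>\<rho>\<close>
  serve as test functions: \<open>l * \<rho> - S\<close> maps \<open>res z\<close> to
  \<open>l * (1 - (z - \<rho>) * res z)\<close>. A bounded inverse would bound \<open>res z\<close>
  by a constant plus a small multiple of itself, hence uniformly near \<open>\<rho>\<close>, against
  \<open>res_blows_up\<close>.\<close>

lemma not_resolvent: "complex_of_real (l * \<rho>) \<notin> resolvent_set_on (Fb A \<theta>) (norm1 A \<theta>) S"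
proof
 let ?z = "complex_of_real (l * \<rho>)" let ?R = "%f x. ?z * f x - S f x"
 assume "?z \<in> resolvent_set_on (Fb A \<theta>) (norm1 A \<theta>) S"
 then obtain C0 where "ALL f:Fb A \<theta>. norm1 A \<theta> f <= ennreal C0 * norm1 A \<theta> (?R f)"
  unfolding resolvent_set_on_def by blast
 then have C0: "norm1 A \<theta> f <= ennreal C0 * norm1 A \<theta> (?R f)" if "f \<in> Fb A \<theta>" for f
  using that by blast
 have bound: "norm1 A \<theta> f <= ennreal (max 1 C0) * norm1 A \<theta> (?R f)" if "f \<in> Fb A \<theta>" for f
  by (rule order_trans[OF C0[OF that] mult_right_mono[OF ennreal_leI]]) auto
 define C1 where "C1 = max 1 C0"
 have C1: "1 <= C1" by (simp add: C1_def)
 define k where "k = max 1 (K * exp K * exp K)"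
 have k: "1 <= k" "K * exp K * exp K <= k" by (simp_all add: k_def)
 \<comment> \<open>For \<open>z - \<rho> <= \<zeta>1\<close> the term containing the supremum
   \<open>m\<close> of \<open>res z\<close> is at most \<open>m / 2\<close> and can be absorbed,
   which leaves \<open>m <= B\<close>.\<close>
 define \<zeta>1 where "\<zeta>1 = 1 / (4 * C1 * l * k)"
 define B where "B = 4 * C1 * l"
 have pos: "0 < \<zeta>1" "0 < B" using C1 k l_pos by (simp_all add: \<zeta>1_def B_def)
 obtain \<zeta>2 where \<zeta>2: "0 < \<zeta>2" "!!z. \<rho> < z ==> z < \<rho> + \<zeta>2 ==> 2 * B < T W (res z) x0"
  by (rule res_blows_up[of "2 * B"], rule that)
 define z where "z = \<rho> + min 1 (min \<zeta>1 \<zeta>2) / 2"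
 have z: "\<rho> < z" "z - \<rho> <= \<zeta>1" "z < \<rho> + \<zeta>2" "z <= 2" using \<zeta>2(1) pos \<rho>_le_1 by (auto simp: z_def min_def)
 obtain B0 where B0: "!!x. x \<in> X ==> \<bar>res z x\<bar> <= B0" by (rule bdE[OF res_bd[OF z(1)]]) blast
 define m where "m = (SUP x\<in>X. res z x)"
 have bdd: "bdd_above (res z ` X)" using B0 abs_le_D1 by (intro bdd_aboveI2[of _ _ B0]) blast
 have m: "res z x <= m" if "x \<in> X" for x unfolding m_def by (rule cSUP_upper[OF that bdd])
 have r0: "0 <= res z x" if "x \<in> X" for x by (rule harn_nonneg[OF res_harn[OF z(1)] that])
 have m0: "0 <= m" using m[OF x0(1)] r0[OF x0(1)] by linarith
 define f where "f x = (if x \<in> X then complex_of_real (res z x) else 0)" for x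
 have f: "f \<in> Fb A \<theta>" unfolding f_def[abs_def] by (rule Fb_of_real[OF harn_bd_bl[OF res_harn[OF z(1)] res_bd[OF z(1)]]])
 have Rf: "?R f x = complex_of_real (l * (1 - (z - \<rho>) * res z x))" if x: "x \<in> X" for x
 proof -
  have "TC W f x = complex_of_real (T W (res z) x)"
  proof -
   have "T W (%x. Re (f x)) x = T W (res z) x" by (rule Op_cong[OF x]) (simp add: f_def)
   moreover have "T W (%x. Im (f x)) x = T W (%_. 0 * 1) x" by (rule Op_cong[OF x]) (simp add: f_def)
   moreover have "T W (%_. 0 * 1) x = 0" unfolding Op_cmult by simp
   ultimately show ?thesis unfolding TC_def by (simp add: complex_eq_iff)
  qed
  then have "?R f x = complex_of_real (l * \<rho> * res z x - l * T W (res z) x)"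
   using x by (simp add: S_eq[OF Fb_cl(1)[OF f] x]) (simp add: f_def)
  moreover have T: "T W (res z) x = z * res z x - 1" using res_eq[OF z(1) x] by simp
  have "l * \<rho> * res z x - l * T W (res z) x = l * (1 - (z - \<rho>) * res z x)" unfolding T by (simp add: algebra_simps)
  ultimately show ?thesis by simp
 qed
 define c where "c = l * (1 + (z - \<rho>) * k * m)"
 have c0: "0 <= c" using l_pos z k m0 by (simp add: c_def)
 have "cl c (?R f)"
 proof (rule clI)
  fix x assume x: "x \<in> X"
  have "\<bar>1 - (z - \<rho>) * res z x\<bar> <= 1 + (z - \<rho>) * k * m"
  proof -
   have "(z - \<rho>) * res z x <= (z - \<rho>) * m" using m[OF x] z by (intro mult_left_mono) auto
   also have "... <= (z - \<rho>) * k * m" using z k m0 by (intro mult_right_mono) (auto simp: mult_le_cancel_left1)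
   finally have "(z - \<rho>) * res z x <= (z - \<rho>) * k * m" .
   moreover have "0 <= (z - \<rho>) * res z x" using z r0[OF x] by simp
   ultimately show ?thesis unfolding abs_le_iff by linarith
  qed
  then show "norm (?R f x) <= c" unfolding Rf[OF x] norm_of_real c_def using l_pos by (simp add: abs_mult)
  fix y assume y: "y \<in> X" "x 0 = y 0"
  have "\<bar>res z x - res z y\<bar> <= K * exp K * exp K * res z y * d x y"
   by (rule harn_diff_le[OF res_harn[OF z(1)] K_nonneg x y])
  also have "... <= k * m * d x y" using k m[OF y(1)] r0[OF y(1)] by (intro mult_right_mono mult_mono d_nonneg) auto
  finally have "l * (z - \<rho>) * \<bar>res z x - res z y\<bar> <= l * (z - \<rho>) * (k * m * d x y)"
   using l_pos z by (intro mult_left_mono) auto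
  also have "... = l * ((z - \<rho>) * k * m) * d x y" by (simp add: mult_ac)
  also have "... <= c * d x y" unfolding c_def using l_pos by (intro mult_right_mono mult_left_mono d_nonneg) auto
  finally have "l * (z - \<rho>) * \<bar>res z x - res z y\<bar> <= c * d x y" .
  moreover have "?R f x - ?R f y = complex_of_real (- (l * (z - \<rho>) * (res z x - res z y)))"
   unfolding Rf[OF x] Rf[OF y(1)] of_real_diff[symmetric] by (rule arg_cong) (simp add: algebra_simps)
  ultimately show "norm (?R f x - ?R f y) <= c * d x y"
   using l_pos z by (simp only: norm_of_real abs_minus_cancel abs_mult)
 qed
 then have "norm1 A \<theta> (?R f) <= ennreal (2 * c)" by (rule norm1_le_of_cl[OF _ c0])
 then have "norm1 A \<theta> f <= ennreal C1 * ennreal (2 * c)"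
  by (rule order_trans[OF bound[OF f, folded C1_def] mult_left_mono]) simp
 then have "norm1 A \<theta> f <= ennreal (C1 * (2 * c))" using C1 c0 by (simp add: ennreal_mult')
 then have fc: "cl (C1 * (2 * c)) f" by (rule cl_of_norm1_le) (use C1 c0 in simp)
 have "res z x <= C1 * (2 * c)" if x: "x \<in> X" for x
  using clD(1)[OF fc x] x r0[OF x] by (simp add: f_def)
 then have "m <= C1 * (2 * c)" unfolding m_def using x0(1) by (intro cSUP_least) auto
 also have "... = 2 * C1 * l + 2 * C1 * l * k * m * (z - \<rho>)" by (simp add: c_def algebra_simps)
 also have "2 * C1 * l * k * m * (z - \<rho>) <= 2 * C1 * l * k * m * \<zeta>1"
  using C1 l_pos k m0 z by (intro mult_left_mono) auto
 also have "... = m / 2" using C1 l_pos k by (simp add: \<zeta>1_def)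
 finally have mB: "m <= B" by (simp add: B_def)
 have "T W (res z) x0 <= z * res z x0" using res_eq[OF z(1) x0(1)] by simp
 also have "... <= 2 * B" using z(4) m[OF x0(1)] mB r0[OF x0(1)] by (intro mult_mono) auto
 finally show False using \<zeta>2(2)[OF z(1,3)] by simp
qed

theorem spectral_radius_killed:
 "spectral_radius_on (Fb A \<theta>) (norm1 A \<theta>) S = l * \<rho>"
 unfolding spectral_radius_on_def
proof (rule cSup_eq_maximum)
 have "cmod (complex_of_real (l * \<rho>)) = l * \<rho>" using l_pos \<rho>_nonneg by (simp only: norm_of_real) simp
 then show "l * \<rho> \<in> cmod ` (- resolvent_set_on (Fb A \<theta>) (norm1 A \<theta>) S)"
  using not_resolvent by (intro image_eqI[of _ _ "complex_of_real (l * \<rho>)"]) auto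
 fix r assume "r \<in> cmod ` (- resolvent_set_on (Fb A \<theta>) (norm1 A \<theta>) S)"
 then obtain z where z: "z \<notin> resolvent_set_on (Fb A \<theta>) (norm1 A \<theta>) S" "r = cmod z" by auto
 show "r <= l * \<rho>" unfolding z(2) using in_resolvent[of z] z(1) by (rule_tac ccontr) simp
qed

end

end

section \<open>The flux between two sets of states\<close>

context rpf
begin

lemma int_chi_Un:
 assumes "bl f" "Q1 \<inter> Q2 = {}"
 shows "int_on \<nu> (Q1 \<union> Q2) f = int_on \<nu> Q1 f + int_on \<nu> Q2 f"
proof -
 have "int_on \<nu> (Q1 \<union> Q2) f = (\<integral>x. chi Q1 x * f x + chi Q2 x * f x \<partial>\<nu>)"
  using assms(2) by (intro int_cong) (auto simp: chi_def)
 then show ?thesis by (simp add: int_add bl_mult bl_chi assms(1))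
qed

context
 fixes Q1 Q2 :: "'s set"
 assumes fin: "finite Q1" "finite Q2" and sub: "Q1 \<subseteq> Us" "Q2 \<subseteq> Us" and disj: "Q1 \<inter> Q2 = {}"
begin

lemma flux_adm: "adm (words_from Q1 (- (Q1 \<union> Q2)))" "adm (words_from Q2 (- (Q1 \<union> Q2)))"
 using fin sub by (auto intro!: adm_words_from)

lemma flux_balance:
 assumes "bl f"
 shows "int_on \<nu> Q1 (T (words_from Q1 (- (Q1 \<union> Q2))) f) + int_on \<nu> Q2 (T (words_from Q1 (- (Q1 \<union> Q2))) f)
  = int_on \<nu> Q1 f"
 using int_words_from[OF flux_adm(1) assms] int_chi_Un[OF bl_Op[OF flux_adm(1) assms] disj] by simp

text \<open>By \<open>return_h\<close> the return sums from \<open>Q1\<close> and from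
  \<open>Q2\<close> add up to \<open>h\<close> on \<open>Q1 \<union> Q2\<close>. So the mass of
  \<open>Q1\<close> splits in two ways: words from \<open>Q1\<close> seen over \<open>Q1\<close> and
  \<open>Q2\<close>, or words from \<open>Q1\<close> and \<open>Q2\<close> seen over
  \<open>Q1\<close>. The common term cancels.\<close>

lemma flux_sym:
 "int_on \<nu> Q2 (T (words_from Q1 (- (Q1 \<union> Q2))) h) = int_on \<nu> Q1 (T (words_from Q2 (- (Q1 \<union> Q2))) h)"
proof -
 let ?V = "- (Q1 \<union> Q2)"
 let ?H1 = "T (words_from Q1 ?V) h" and ?H2 = "T (words_from Q2 ?V) h"
 have b: "bl ?H1" "bl ?H2" by (intro bl_Op flux_adm h_bl)+
 have h: "?H1 x + ?H2 x = h x" if x: "x \<in> X" "x 0 \<in> Q1 \<union> Q2" for x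
 proof -
  have W: "words_from (Q1 \<union> Q2) ?V = words_from Q1 ?V \<union> words_from Q2 ?V" by (auto simp: words_from_def)
  have "words_from Q1 ?V \<inter> words_from Q2 ?V = {}" using disj by (auto simp: words_from_def)
  from Op_Un[OF flux_adm h_bd x(1) this] show ?thesis
   using return_h[of "Q1 \<union> Q2", OF _ _ x] fin sub unfolding W by simp
 qed
 have "int_on \<nu> Q1 ?H1 + int_on \<nu> Q1 ?H2 = (\<integral>x. chi Q1 x * ?H1 x + chi Q1 x * ?H2 x \<partial>\<nu>)"
  by (intro int_add[symmetric] bl_mult bl_chi b)
 also have "... = int_on \<nu> Q1 h"
 proof (rule int_cong)
  fix x assume x: "x \<in> X"
  show "chi Q1 x * ?H1 x + chi Q1 x * ?H2 x = chi Q1 x * h x"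
   using h[OF x] by (cases "x 0 \<in> Q1") (simp_all add: chi_def)
 qed
 finally show ?thesis using flux_balance[OF h_bl] by simp
qed

lemma flux_pos:
 assumes ne: "Q1 ~= {}" "Q2 ~= {}"
 shows "0 < int_on \<nu> Q2 (T (words_from Q1 (- (Q1 \<union> Q2))) h)"
proof -
 let ?V = "- (Q1 \<union> Q2)"
 \<comment> \<open>A path from \<open>Q1\<close> to \<open>Q2\<close> is shortened until its
   interior avoids both sets: it is started at an interior letter of \<open>Q1\<close>, or ended at
   one of \<open>Q2\<close>.\<close>
 have "EX a b w. a \<in> Q1 & b \<in> Q2 & successively M (a # w @ [b]) & set w \<subseteq> ?V"
  if "a \<in> Q1" "b \<in> Q2" "successively M (a # w @ [b])" for a b w
  using that
 proof (induction "length w" arbitrary: a b w rule: less_induct)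
  case less
  show ?case
  proof (cases "set w \<subseteq> ?V")
   case False
   then obtain c where "c \<in> set w" and c: "c \<in> Q1 \<union> Q2" by blast
   then obtain u v where w: "w = u @ c # v" using split_list by metis
   have s: "successively M (a # u @ [c])" "successively M (c # v @ [b])"
    using less.prems(3) successively_append_iff[of M "a # u @ [c]" "v @ [b]"]
     successively_append_iff[of M "a # u" "c # v @ [b]"] unfolding w by simp_all
   show ?thesis
   proof (cases "c \<in> Q1")
    case True
    show ?thesis by (rule less.hyps[OF _ True less.prems(2) s(2)]) (simp add: w)
   next
    case False
    then have "c \<in> Q2" using c by simp
    from less.hyps[OF _ less.prems(1) this s(1)] show ?thesis by (simp add: w)
   qed
  qed (use less.prems in blast)
 qed
 moreover obtain a b where "a \<in> Q1" "b \<in> Q2" using ne by blast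
 moreover from this obtain w where "successively M (a # w @ [b])" using irr sub by (meson subsetD)
 ultimately obtain a b w where ab: "a \<in> Q1" "b \<in> Q2" "successively M (a # w @ [b])" "set w \<subseteq> ?V" by meson
 have bU: "b \<in> Us" using ab(2) sub by blast
 obtain y where y: "y \<in> X" "y 0 = b" by (rule state_nonempty[OF bU])
 let ?F = "T (words_from Q1 ?V) h"
 have F: "harn K ?F" "bd ?F" "bl ?F" by (intro harn_Op bd_Op bl_Op flux_adm h_bd h_harn h_bl order_refl)+
 have pp: "0 < p (a # w) y" using p_pos[OF y(1), of "a # w"] ab(3) y(2) by simp
 then have wy: "(a # w) \<frown> y \<in> X" using p_eq_0_or_in_X[OF y(1), of "a # w"] by (metis less_irrefl)
 have "0 < p (a # w) y * h ((a # w) \<frown> y)"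
  using h_pos[OF wy] ab(1) sub by (intro mult_pos_pos pp) auto
 also have "... = T {a # w} h y" by (simp add: Op_finite del: pw.simps)
 also have "... <= ?F y"
  using ab by (intro Op_subset flux_adm h_bd y h_nonneg) (auto simp: words_from_def)
 finally have Fy: "0 < ?F y" .
 have "0 < ?F y * measure \<nu> (cyl A [y 0])" using Fy state_pos[OF bU] y(2) by simp
 also have "... <= exp K * (\<integral>x. indicator (cyl A [y 0]) x * ?F x \<partial>\<nu>)"
  by (rule harn_int_le[OF F(1) K_nonneg F(2) y(1)])
 also have "... <= exp K * int_on \<nu> Q2 ?F"
 proof (intro mult_left_mono int_mono bl_mult bl_cyl bl_chi F)
  fix x assume x: "x \<in> X"
  show "indicator (cyl A [y 0]) x * ?F x <= chi Q2 x * ?F x"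
   using harn_nonneg[OF F(1) x] ab(2) y(2) by (auto simp: indicator_def chi_def cyl_sing)
 qed simp
 finally show ?thesis by (simp add: zero_less_mult_iff)
qed

end

end

section \<open>Escape rate and flux\<close>

context killed
begin

text \<open>Let \<open>F = T W (res z)\<close>. The mass balance relates the flux of
  \<open>F\<close> into \<open>Q2\<close> to \<open>1 - z\<close> times its mass on
  \<open>Q\<close>. If \<open>F\<close> and \<open>s * h\<close> agree on \<open>Q\<close> up to the
  factor \<open>c\<close>, the relation passes to \<open>h\<close> with the factor
  \<open>c\<^sup>2\<close>. The inhomogeneity contributes at most \<open>c / s\<close>, which
  becomes negligible because \<open>F\<close>, and with it \<open>s\<close>, can be made
  large.\<close>

lemma flux_bounds:
 assumes Q2: "finite Q2" "Q2 \<subseteq> Us" "Q \<inter> Q2 = {}" "V = - (Q \<union> Q2)" and z: "\<rho> < z"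
  and s: "0 < s" and c: "1 <= c"
  and cmp: "!!y. y \<in> X ==> y 0 \<in> Q ==> s * h y <= c * T W (res z) y"
   "!!y. y \<in> X ==> y 0 \<in> Q ==> T W (res z) y <= c * (s * h y)"
 defines "fl \<equiv> \<integral>x. chi Q2 x * T W h x \<partial>\<nu>" and "m \<equiv> \<integral>x. chi Q x * h x \<partial>\<nu>"
 shows "(1 - z) * m <= c\<^sup>2 * fl" and "fl <= c\<^sup>2 * (max 0 (1 - z) * m) + c / s"
proof -
 let ?u = "res z" let ?F = "T W ?u"
 have c0: "0 < c" using c by simp
 have ubl: "bl ?u" by (rule harn_bd_bl[OF res_harn[OF z] res_bd[OF z]])
 have Fbl: "bl ?F" by (rule bl_Op[OF admW ubl])
 have Fbd: "bd ?F" by (rule bl_bd[OF Fbl])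
 have Hbl: "bl (T W h)" by (rule bl_Op[OF admW h_bl])
 have u0: "0 <= ?u x" if "x \<in> X" for x by (rule harn_nonneg[OF res_harn[OF z] that])
 have F0: "0 <= ?F x" if "x \<in> X" for x using u0 by (intro Op_nonneg that)
 have zu: "z * ?u x = ?F x + 1" if "x \<in> X" for x by (rule res_eq[OF z that])
 have zF: "z * ?F x = T W ?F x + T W (%_. 1) x" if x: "x \<in> X" for x
 proof -
  have "z * ?F x = T W (%x. z * ?u x) x" by (rule Op_cmult[symmetric])
  also have "... = T W (%x. ?F x + 1) x" by (rule Op_cong[OF x]) (rule zu)
  finally show ?thesis by (simp add: Op_add[OF admW Fbd bd_const x])
 qed
 note balance = flux_balance[OF Q_fin Q2(1) Q_Us Q2(2,3), folded Q2(4)]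
 let ?I = "%Q f. \<integral>x. chi Q x * f x \<partial>\<nu>"
 have Imono: "?I Q f <= ?I Q g" if "bl f" "bl g" "!!x. x \<in> X ==> x 0 \<in> Q ==> f x <= g x" for Q f g
  by (intro int_mono bl_mult bl_chi that) (use that(3) in \<open>auto simp: chi_def\<close>)
 have Icm: "?I Q (%x. a * f x) = a * ?I Q f" for Q f a by (simp add: mult.left_commute[of _ a])
 have Iadd: "?I Q (%x. f x + g x) = ?I Q f + ?I Q g" if "bl f" "bl g" for Q f g
  using int_add[OF bl_mult[OF bl_chi that(1)] bl_mult[OF bl_chi that(2)]] by (simp add: distrib_left)
 have I0: "0 <= ?I Q f" if "!!x. x \<in> X ==> 0 <= f x" for Q f
  by (rule int_nonneg) (use that in \<open>auto simp: chi_def\<close>)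
 \<comment> \<open>The balance for \<open>res z\<close>, multiplied by \<open>z\<close>, with
   \<open>z * res z = F + 1\<close> inserted.\<close>
 have id: "z * ?I Q2 ?F = (1 - z) * ?I Q ?F + ?I Q (%_. 1)"
 proof -
  have "z * ?I Q ?u = ?I Q (%x. z * ?u x)" by (rule Icm[symmetric])
  also have "... = ?I Q (%x. ?F x + 1)" by (intro int_cong) (simp add: zu)
  also have "... = ?I Q ?F + ?I Q (%_. 1)" by (rule Iadd[OF Fbl bl_const])
  finally show ?thesis using arg_cong[OF balance[OF ubl], of "(*) z"] by (simp add: algebra_simps)
 qed
 have mQ: "?I Q (%_. 1) <= 1"
  using int_mono[OF bl_mult[OF bl_chi bl_const] bl_const[of 1], of Q 1] prob_space by (simp add: chi_def)
 have m0: "0 <= m" unfolding m_def by (rule I0[OF h_nonneg])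
 have fl0: "0 <= fl" unfolding fl_def by (intro I0 Op_nonneg h_nonneg)
 have IF: "s * m <= c * ?I Q ?F" "?I Q ?F <= c * (s * m)"
  using Imono[OF bl_cmult[OF h_bl] bl_cmult[OF Fbl] cmp(1), of Q]
   Imono[OF Fbl bl_cmult[OF bl_cmult[OF h_bl]] cmp(2), of Q] unfolding Icm m_def by auto
 show "(1 - z) * m <= c\<^sup>2 * fl"
 proof (cases "z <= 1")
  case True
  have "(1 - z) * (s * m) <= (1 - z) * (c * ?I Q ?F)" using True IF(1) by (intro mult_left_mono) auto
  also have "... = c * ((1 - z) * ?I Q ?F)" by simp
  \<comment> \<open>The mass of \<open>Q\<close> is at least the flux of the constant 1 into
    \<open>Q2\<close>, so in this direction the inhomogeneity leaves no error term.\<close>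
  also have "(1 - z) * ?I Q ?F <= z * ?I Q2 ?F - ?I Q2 (T W (%_. 1))"
  proof -
   have "0 <= ?I Q (T W (%_. 1))" by (intro I0 Op_nonneg) auto
   then show ?thesis using balance[OF bl_const[of 1]] unfolding id by simp
  qed
  also have "... = ?I Q2 (T W ?F)"
  proof -
   have "z * ?I Q2 ?F = ?I Q2 (%x. T W ?F x + T W (%_. 1) x)"
    unfolding Icm[symmetric] by (intro int_cong) (simp add: zF)
   then show ?thesis by (simp add: Iadd bl_Op admW Fbl bl_const)
  qed
  also have "... <= ?I Q2 (%x. (c * s) * T W h x)"
  proof (rule Imono[OF bl_Op[OF admW Fbl] bl_cmult[OF Hbl]])
   fix x assume x: "x \<in> X"
   have "T W ?F x <= T W (%x. (c * s) * h x) x"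
    using cmp(2) W_hd by (intro Op_mono admW Fbd bd_cmult h_bd x) (simp add: mult.assoc)
   then show "T W ?F x <= (c * s) * T W h x" by (simp add: Op_cmult)
  qed
  also have "... = c * s * fl" unfolding Icm fl_def ..
  finally have "(1 - z) * (s * m) <= c * (c * s * fl)" using c0 by simp
  then have "s * ((1 - z) * m) <= s * (c\<^sup>2 * fl)" by (simp add: power2_eq_square mult_ac)
  then show ?thesis using s by simp
 next
  case False
  then have "(1 - z) * m <= 0" using m0 by (intro mult_nonpos_nonneg) auto
  also have "0 <= c\<^sup>2 * fl" using fl0 by simp
  finally show ?thesis .
 qed
 have "s * fl = ?I Q2 (%x. s * T W h x)" unfolding Icm fl_def ..
 also have "... <= ?I Q2 (%x. (c * z) * ?F x)"
 proof (rule Imono[OF bl_cmult[OF Hbl] bl_cmult[OF Fbl]])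
  fix x assume x: "x \<in> X"
  have "s * T W h x = T W (%x. s * h x) x" by (rule Op_cmult[symmetric])
  also have "... <= T W (%x. c * ?F x) x"
   using cmp(1) W_hd by (intro Op_mono admW bd_cmult Fbd h_bd x) simp
  also have "... = c * T W ?F x" by (rule Op_cmult)
  also have "... <= c * (z * ?F x)"
  proof (rule mult_left_mono)
   have "0 <= T W (%_. 1) x" by (rule Op_nonneg[OF x]) simp
   then show "T W ?F x <= z * ?F x" using zF[OF x] by simp
  qed (use c0 in simp)
  finally show "s * T W h x <= (c * z) * ?F x" by simp
 qed
 also have "... = c * ((1 - z) * ?I Q ?F + ?I Q (%_. 1))" unfolding Icm id[symmetric] by simp
 also have "... <= c * (max 0 (1 - z) * (c * (s * m)) + 1)"
 proof (intro mult_left_mono add_mono mQ)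
  have "(1 - z) * ?I Q ?F <= max 0 (1 - z) * ?I Q ?F" using I0[OF F0] by (intro mult_right_mono) auto
  also have "... <= max 0 (1 - z) * (c * (s * m))" by (intro mult_left_mono IF(2)) simp
  finally show "(1 - z) * ?I Q ?F <= max 0 (1 - z) * (c * (s * m))" .
 qed (use c0 in simp)
 also have "... = s * (c\<^sup>2 * (max 0 (1 - z) * m) + c / s)" using s by (simp add: power2_eq_square algebra_simps)
 finally show "fl <= c\<^sup>2 * (max 0 (1 - z) * m) + c / s" using s by simp
qed

end

context pert
begin

context
 fixes Q1 Q2 :: "'s set"
 assumes fin: "finite Q1" "finite Q2" and ne: "Q1 ~= {}" "Q2 ~= {}" and Q1: "Q1 \<subseteq> Us" and Q2: "Q2 \<inter> Us = {}"
begin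

abbreviation (input) W1 where "W1 \<equiv> words_from Q1 (- (Q1 \<union> Q2))"

definition fl where "fl n = int_on (ns n) Q2 (Op (Gs n) (ls n) W1 (hs n))"
definition mass where "mass n = int_on (ns n) Q1 (hs n)"
definition \<rho>s where "\<rho>s n = killed.\<rho> A (Gs n) (ls n) Q1 (- (Q1 \<union> Q2))"

lemma flux_disj: "Q1 \<inter> Q2 = {}"
 using Q1 Q2 by blast

lemma fl_pos: "0 < fl n"
proof -
 interpret N: rpf A \<theta> C "Gs n" Mj "ls n" "hs n" "ns n" UNIV A by (rule rpfs)
 show ?thesis unfolding fl_def by (rule N.flux_pos[OF fin _ _ flux_disj ne]) auto
qed

lemma mass_bounds: "0 <= mass n" "mass n <= 1"
proof -
 interpret N: rpf A \<theta> C "Gs n" Mj "ls n" "hs n" "ns n" UNIV A by (rule rpfs)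
 show "0 <= mass n" unfolding mass_def
  by (rule N.int_nonneg) (simp add: chi_def N.h_nonneg)
 have "mass n <= (\<integral>x. hs n x \<partial>ns n)" unfolding mass_def
  by (intro N.int_mono N.bl_mult N.bl_chi N.h_bl) (simp add: chi_def N.h_nonneg)
 then show "mass n <= 1" by (simp add: N.h_int)
qed

text \<open>Paths of the component stay in \<open>Us\<close> and hence avoid \<open>Q2\<close>, so
  every state of \<open>Q1\<close> leads to \<open>x0\<close> without visiting
  \<open>Q2\<close>.\<close>

lemma flux_killed:
 assumes x0: "x0 \<in> X" "x0 0 \<in> Q1"
 shows "killed A \<theta> C (Gs n) Mj (ls n) (hs n) (ns n) UNIV A Q1 (- (Q1 \<union> Q2)) x0"
proof (intro killed.intro killed_axioms.intro rpfs fin x0)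
 fix b assume b: "b \<in> Q1"
 then obtain v where v: "successively MU (b # v @ [x0 0])" using irr Q1 x0 by (meson subsetD)
 have succ: "successively A u" if "successively MU u" for u
  using that M_sub by (induction u rule: induct_list012) auto
 have "set u \<subseteq> Us" if "successively MU (u @ [x0 0])" for u
  using that M_sub by (induction u rule: induct_list012) auto
 from this[of "b # v"] have "set v \<subseteq> Us" using v by simp
 then show "EX v. successively A (b # v @ [x0 0]) & set v \<subseteq> Q1 \<union> - (Q1 \<union> Q2)"
  using succ[OF v] Q2 by (intro exI[of _ v]) auto
qed auto

text \<open>The flux may tend to 0, so all errors have to be small relative to it. Hence
  \<open>z\<close> lies within \<open>fl n / Suc n\<close> of the growth rate, and so close to it
  that the blow-up of the resolvent exceeds \<open>Suc n / fl n\<close>.\<close>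

lemma flux_step:
 assumes x0: "x0 \<in> X" "x0 0 \<in> Q1"
 obtains z F where "\<rho>s n < z" "z <= \<rho>s n + fl n / Suc n" "z <= 1 + 1 / Suc n"
  "excessive n (max z 1 * ls n) F" "0 < F x0"
  "!!c. 1 <= c ==> (!!y. y \<in> X ==> y 0 \<in> Q1 ==> F x0 / hs n x0 * hs n y <= c * F y & F y <= c * (F x0 / hs n x0 * hs n y)) ==>
    (1 - z) * mass n <= c\<^sup>2 * fl n & fl n <= c\<^sup>2 * (max 0 (1 - z) * mass n) + c * fl n / Suc n"
proof -
 interpret N: killed A \<theta> C "Gs n" Mj "ls n" "hs n" "ns n" UNIV A Q1 "- (Q1 \<union> Q2)" x0
  by (rule flux_killed[OF x0])
 have hx: "0 < hs n x0" by (rule hs_pos[OF x0(1)])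
 obtain \<zeta> where \<zeta>: "0 < \<zeta>"
  "!!z. N.\<rho> < z ==> z < N.\<rho> + \<zeta> ==> Suc n * hs n x0 / fl n < N.T W1 (N.res z) x0"
  by (rule N.res_blows_up, rule that)
 define t where "t = min \<zeta> (min (fl n / Suc n) (1 / Suc n))"
 define z where "z = N.\<rho> + t / 2"
 have f0: "0 < fl n / Suc n" using fl_pos by simp
 have z: "N.\<rho> < z" "z < N.\<rho> + \<zeta>" "z <= N.\<rho> + fl n / Suc n" "z <= 1 + 1 / Suc n"
 proof -
  have "0 < t" "t <= \<zeta>" "t <= fl n / Suc n" "t <= 1 / Suc n" unfolding t_def using \<zeta>(1) f0 by auto
  then show "N.\<rho> < z" "z < N.\<rho> + \<zeta>" "z <= N.\<rho> + fl n / Suc n" "z <= 1 + 1 / Suc n"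
   unfolding z_def using N.\<rho>_le_1 by linarith+
 qed
 have z0: "0 < z" using z(1) N.\<rho>_nonneg by linarith
 let ?u = "N.res z" let ?V = "- (Q1 \<union> Q2)" let ?F = "N.T W1 ?u" let ?m = "max z 1"
 have F: "harn K ?F" "bd ?F" by (intro N.harn_Op bd_Op N.admW N.res_harn N.res_bd z order_refl N.bd_Op)+
 \<comment> \<open>The factor \<open>max z 1\<close> makes the coefficients
   \<open>?m / z - 1\<close> and \<open>?m - 1\<close> below nonnegative, so that
   \<open>?g - chi Us * ?F\<close> is in the cone. It tends to 1 and leaves the limit eigenvalue
   unchanged.\<close>
 let ?g = "%y. ?m * (chi Q1 y * ?u y + chi ?V y * ?F y)"
 have bg: "bd (%y. chi Q1 y * ?u y + chi ?V y * ?F y)"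
  by (intro bd_add bd_mult bd_chi F N.res_bd z)
 have ex: "excessive n (?m * ls n) ?F"
 proof (rule excessiveI[OF F bd_cmult[OF bg]])
  have "harn K (%x. chi Q1 x * ((?m / z - 1) * ?F x + ?m / z) + ((?m - 1) * (chi ?V x * ?F x) + chi (?V - Us) x * ?F x))"
   using z0 K_nonneg by (intro harn_add harn_chi harn_cmult F harn_const) (auto simp: field_simps)
  then show "harn K (%x. ?g x - chi Us x * ?F x)"
  proof (rule harn_cong)
   fix x assume x: "x \<in> X"
   have u: "?u x = (?F x + 1) / z" using N.res_eq[OF z(1) x] z0 by (simp add: field_simps)
   show "chi Q1 x * ((?m / z - 1) * ?F x + ?m / z) + ((?m - 1) * (chi ?V x * ?F x) + chi (?V - Us) x * ?F x)
    = ?g x - chi Us x * ?F x"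
    unfolding u using Q1 Q2 z0 by (auto simp: chi_def field_simps)
  qed
  fix x assume x: "x \<in> X"
  have "?F x = N.T1 (%y. chi Q1 y * ?u y + chi ?V y * ?F y) x"
   by (rule N.words_from_recursion[OF N.admW N.res_bd[OF z(1)] x])
  then have "?m * ls n * ?F x = ?m * (ls n * N.T1 (%y. chi Q1 y * ?u y + chi ?V y * ?F y) x)"
   by simp
  also have "... = Op (Gs n) 1 (letters UNIV) ?g x"
  proof -
   interpret N1: weight A \<theta> C "Gs n" Mj 1 by (rule Gs_weight) simp
   show ?thesis unfolding Op_scale[OF N.l_pos] by (rule N1.Op_cmult[symmetric])
  qed
  finally show "?m * ls n * ?F x = Op (Gs n) 1 (letters UNIV) ?g x" .
 qed
 have big: "Suc n / fl n < ?F x0 / hs n x0" using \<zeta>(2)[OF z(1,2)] hx by (simp add: field_simps)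
 have "0 < Suc n / fl n" using fl_pos by simp
 then have s0: "0 < ?F x0 / hs n x0" using big by linarith
 then have F0: "0 < ?F x0" using hx by (simp add: zero_less_divide_iff)
 show ?thesis
 proof (rule that[OF _ _ z(4) ex F0])
  show "\<rho>s n < z" "z <= \<rho>s n + fl n / Suc n" unfolding \<rho>s_def by (rule z(1,3))+
  fix c :: real assume c: "1 <= c"
   and cmp: "!!y. y \<in> X ==> y 0 \<in> Q1 ==> ?F x0 / hs n x0 * hs n y <= c * ?F y & ?F y <= c * (?F x0 / hs n x0 * hs n y)"
  note b = N.flux_bounds[OF fin(2) subset_UNIV flux_disj refl z(1) s0 c cmp[THEN conjunct1] cmp[THEN conjunct2], folded fl_def mass_def]
  have "c / (?F x0 / hs n x0) <= c / (Suc n / fl n)"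
   using c by (intro divide_left_mono less_imp_le[OF big] mult_pos_pos[OF s0 \<open>0 < Suc n / fl n\<close>]) simp
  then have "c / (?F x0 / hs n x0) <= c * fl n / Suc n" by simp
  then show "(1 - z) * mass n <= c\<^sup>2 * fl n & fl n <= c\<^sup>2 * (max 0 (1 - z) * mass n) + c * fl n / Suc n"
   using b by linarith
 qed
qed

text \<open>Normalised at \<open>x0\<close>, the resolvent function and the eigenfunction are both
  excessive with factors tending to \<open>lU\<close>, so both converge to \<open>hU / hU x0\<close>
  over \<open>Q1\<close> and are comparable up to any \<open>c > 1\<close>. The bounds of
  \<open>flux_step\<close> then squeeze the quotient.\<close>

theorem flux_limit: "(%n. (1 - \<rho>s n) * mass n / fl n) \<longlonglongrightarrow> 1"
proof -
 obtain a where a: "a \<in> Q1" using ne by blast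
 then have "a \<in> Us" using Q1 by blast
 then obtain x0 where x0: "x0 \<in> shift_space MU" "x0 \<in> X" "x0 0 = a" by (rule exists_limit_point)
 have x0Q: "x0 0 \<in> Q1" using x0(3) a by simp
 have "EX z F. \<rho>s n < z & z <= \<rho>s n + fl n / Suc n & z <= 1 + 1 / Suc n &
  excessive n (max z 1 * ls n) F & 0 < F x0 &
  (ALL c>=1. (ALL y:X. y 0 \<in> Q1 --> F x0 / hs n x0 * hs n y <= c * F y & F y <= c * (F x0 / hs n x0 * hs n y)) -->
    (1 - z) * mass n <= c\<^sup>2 * fl n & fl n <= c\<^sup>2 * (max 0 (1 - z) * mass n) + c * fl n / Suc n)" for n
  by (rule flux_step[OF x0(2) x0Q, of n]) (intro exI conjI allI impI; assumption?; blast)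
 then obtain z F where z: "!!n. \<rho>s n < z n" "!!n. z n <= \<rho>s n + fl n / Suc n" "!!n. z n <= 1 + 1 / Suc n"
  and ex: "!!n. excessive n (max (z n) 1 * ls n) (F n)" and F0: "!!n. 0 < F n x0"
  and bnd: "!!n c. 1 <= c ==> (ALL y:X. y 0 \<in> Q1 --> F n x0 / hs n x0 * hs n y <= c * F n y & F n y <= c * (F n x0 / hs n x0 * hs n y)) ==>
    (1 - z n) * mass n <= c\<^sup>2 * fl n & fl n <= c\<^sup>2 * (max 0 (1 - z n) * mass n) + c * fl n / Suc n"
  by metis
 have hx: "0 < hs n x0" for n by (rule hs_pos[OF x0(2)])
 have inv: "(%n. 1 / real (Suc n)) \<longlonglongrightarrow> 0" using LIMSEQ_inverse_real_of_nat by (simp add: inverse_eq_divide)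
 have "(%n. max (z n) 1) \<longlonglongrightarrow> 1"
 proof (rule tendsto_sandwich[of "%_. 1" _ _ "%n. 1 + 1 / Suc n"])
  show "(%n. 1 + 1 / real (Suc n)) \<longlonglongrightarrow> 1" using tendsto_add[OF tendsto_const[of 1] inv] by simp
 qed (use z(3) in \<open>auto simp del: of_nat_Suc\<close>)
 then have \<kappa>: "(%n. max (z n) 1 * ls n) \<longlonglongrightarrow> lU" using tendsto_mult[OF _ ls_lim] by fastforce
 have cmp: "EV n. (1 - z n) * mass n <= c\<^sup>2 * fl n & fl n <= c\<^sup>2 * (max 0 (1 - z n) * mass n) + c * fl n / Suc n"
  if c: "1 < c" for c
 proof -
  \<comment> \<open>Two comparisons with the common limit, each costing \<open>1 + \<eta>\<close>,
    make up the factor \<open>c\<close>.\<close>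
  define \<eta> where "\<eta> = sqrt c - 1"
  have \<eta>: "0 < \<eta>" "(1 + \<eta>) * (1 + \<eta>) = c" using c by (auto simp: \<eta>_def)
  let ?g = "%z. hU z / hU x0"
  have 1: "EV n. ALL b:Q1. ALL y:X. y 0 = b --> ?g y <= (1 + \<eta>) * (1 / hs n x0 * hs n y) & 1 / hs n x0 * hs n y <= (1 + \<eta>) * ?g y"
  proof (rule eventually_ball_finite[OF fin(1)], rule ballI, rule uniform_limit_ratio[OF _ ls_lim x0(1) _ _ \<eta>(1)])
   show "excessive n (ls n) (%y. 1 / hs n x0 * hs n y)" for n
    using hx[of n] by (intro excessive_scale excessive_hs) simp
  qed (use hx Q1 in \<open>auto simp: less_imp_neq[symmetric]\<close>)
  have 2: "EV n. ALL b:Q1. ALL y:X. y 0 = b --> ?g y <= (1 + \<eta>) * (1 / F n x0 * F n y) & 1 / F n x0 * F n y <= (1 + \<eta>) * ?g y"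
  proof (rule eventually_ball_finite[OF fin(1)], rule ballI, rule uniform_limit_ratio[OF _ \<kappa> x0(1) _ _ \<eta>(1)])
   show "excessive n (max (z n) 1 * ls n) (%y. 1 / F n x0 * F n y)" for n
    using F0[of n] by (intro excessive_scale ex) simp
  qed (use F0 Q1 in \<open>auto simp: less_imp_neq[symmetric]\<close>)
  show ?thesis
   using 1 2
  proof eventually_elim
   case (elim n)
   show ?case
   proof (rule bnd[OF less_imp_le[OF c]], intro ballI impI conjI)
    fix y assume y: "y \<in> X" "y 0 \<in> Q1"
    have h: "?g y <= (1 + \<eta>) * (1 / hs n x0 * hs n y)" "1 / hs n x0 * hs n y <= (1 + \<eta>) * ?g y"
     and f: "?g y <= (1 + \<eta>) * (1 / F n x0 * F n y)" "1 / F n x0 * F n y <= (1 + \<eta>) * ?g y"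
     using elim y by auto
    have "1 / hs n x0 * hs n y <= (1 + \<eta>) * ((1 + \<eta>) * (1 / F n x0 * F n y))"
     using order_trans[OF h(2) mult_left_mono[OF f(1)]] \<eta>(1) by simp
    then have "1 / hs n x0 * hs n y <= c * (1 / F n x0 * F n y)" unfolding mult.assoc[symmetric] \<eta>(2) .
    from mult_left_mono[OF this, of "F n x0"] show "F n x0 / hs n x0 * hs n y <= c * F n y"
     using F0[of n] by simp
    have "1 / F n x0 * F n y <= (1 + \<eta>) * ((1 + \<eta>) * (1 / hs n x0 * hs n y))"
     using order_trans[OF f(2) mult_left_mono[OF h(1)]] \<eta>(1) by simp
    then have "1 / F n x0 * F n y <= c * (1 / hs n x0 * hs n y)" unfolding mult.assoc[symmetric] \<eta>(2) .
    from mult_left_mono[OF this, of "F n x0"] show "F n y <= c * (F n x0 / hs n x0 * hs n y)"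
     using F0[of n] by (simp add: mult_ac)
   qed
  qed
 qed
 define r where "r n = (1 - \<rho>s n) * mass n / fl n" for n
 have up: "EV n. r n <= c\<^sup>2 + 1 / Suc n & 1 <= c\<^sup>2 * max 0 (r n) + c * (1 / Suc n)" if c: "1 < c" for c
  using cmp[OF c]
 proof eventually_elim
  case (elim n)
  have f: "0 < fl n" by (rule fl_pos)
  have "(z n - \<rho>s n) * mass n <= (z n - \<rho>s n) * 1"
   using z(1)[of n] mass_bounds[of n] by (intro mult_left_mono) auto
  also have "... <= fl n * (1 / Suc n)" using z(2)[of n] by simp
  finally have "(1 - \<rho>s n) * mass n <= c\<^sup>2 * fl n + fl n * (1 / Suc n)" using elim by (simp add: algebra_simps)
  then have "(1 - \<rho>s n) * mass n <= (c\<^sup>2 + 1 / Suc n) * fl n" by (simp add: algebra_simps)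
  then have "r n <= c\<^sup>2 + 1 / Suc n" unfolding r_def pos_divide_le_eq[OF f] .
  moreover have "max 0 (1 - z n) * mass n <= max 0 (r n) * fl n"
  proof -
   have "(1 - z n) * mass n <= (1 - \<rho>s n) * mass n" using z(1)[of n] mass_bounds[of n] by (intro mult_right_mono) auto
   also have "... = r n * fl n" using f by (simp add: r_def)
   also have "... <= max 0 (r n) * fl n" using f by (intro mult_right_mono) auto
   finally show ?thesis using f by (cases "z n <= 1") (auto simp: max_def[of 0 "1 - z n"])
  qed
  then have "c\<^sup>2 * (max 0 (1 - z n) * mass n) <= c\<^sup>2 * (max 0 (r n) * fl n)" by (rule mult_left_mono) simp
  then have "1 * fl n <= (c\<^sup>2 * max 0 (r n) + c * (1 / Suc n)) * fl n"
   using elim by (simp add: distrib_right mult.assoc del: of_nat_Suc)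
  then have "1 <= c\<^sup>2 * max 0 (r n) + c * (1 / Suc n)" using f by (rule mult_right_le_imp_le)
  ultimately show ?case ..
 qed
 show ?thesis
  unfolding r_def[symmetric]
 proof (rule order_tendstoI)
  fix a :: real assume a: "a < 1"
  define c where "c = sqrt (2 / (1 + max 0 a))"
  have c: "1 < c" "c\<^sup>2 = 2 / (1 + max 0 a)" using a by (auto simp: c_def field_simps)
  have "c\<^sup>2 * max 0 a < 1" unfolding c(2) using a by (simp add: field_simps)
  moreover have "(%n. c * (1 / Suc n)) \<longlonglongrightarrow> c * 0" by (intro tendsto_intros inv)
  ultimately have "EV n. c * (1 / Suc n) < 1 - c\<^sup>2 * max 0 a" by (intro order_tendstoD(2)) auto
  then show "EV n. a < r n"
   using up[OF c(1)]
  proof eventually_elim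
   case (elim n)
   then have "c\<^sup>2 * max 0 a < c\<^sup>2 * max 0 (r n)" by linarith
   then have "max 0 a < max 0 (r n)" using c(1) by (simp add: mult_less_cancel_left_pos)
   then show ?case by (simp add: max_def split: if_splits)
  qed
 next
  fix a :: real assume a: "1 < a"
  define c where "c = sqrt ((1 + a) / 2)"
  have c: "1 < c" "c\<^sup>2 = (1 + a) / 2" using a by (auto simp: c_def)
  have "EV n. 1 / real (Suc n) < a - c\<^sup>2" using a c by (intro order_tendstoD(2)[OF inv]) simp
  then show "EV n. r n < a" using up[OF c(1)] by eventually_elim linarith
 qed
qed

end

end

section \<open>Pressure\<close>

lemma exp_ereal_mono: "a <= b ==> exp_ereal a <= exp_ereal b"
 by (cases a; cases b) (auto simp: exp_ereal_def ennreal_leI)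

lemma exp_ereal_add: "a ~= \<infinity> ==> b ~= \<infinity> ==> exp_ereal (a + b) = exp_ereal a * exp_ereal b"
 by (cases a; cases b) (auto simp: exp_ereal_def exp_add ennreal_mult)

lemma exp_ereal_finite_iff: "exp_ereal a < \<infinity> \<longleftrightarrow> a ~= \<infinity>"
 by (cases a) (auto simp: exp_ereal_def)

lemma ln_ennreal_mono: "a <= b ==> ln_ennreal a <= ln_ennreal b"
 by (cases a; cases b) (auto simp: ln_ennreal_def top_unique)

lemma ln_ennreal_ennreal: "0 < r ==> ln_ennreal (ennreal r) = ereal (ln r)"
 by (simp add: ln_ennreal_def ennreal_eq_0_iff)

lemma exp_ereal_le_iff: "exp_ereal a <= t \<longleftrightarrow> a <= ln_ennreal t"
 by (cases a; cases t) (auto simp: exp_ereal_def ln_ennreal_def ennreal_eq_0_iff not_le ln_ge_iff)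

text \<open>Write \<open>n = q * m + r\<close> with \<open>r < m\<close>: submultiplicativity bounds
  \<open>z n\<close> by the \<open>q\<close>-th power of \<open>z m\<close> times
  \<open>z r\<close>, and \<open>E\<close> bounds the finitely many remainders. The case
  \<open>z m = 0\<close> is separate, as all later values then vanish.\<close>

lemma fekete_aux:
 fixes z :: "nat => ennreal"
 assumes sub: "!!m n. z (m + n) <= z m * z n" and fin: "!!n. z n < \<infinity>"
  and m: "0 < m" "ereal (1 / real m) * ln_ennreal (z m) < x"
 shows "EV n. ereal (1 / real n) * ln_ennreal (z n) < x"
proof (cases "z m = 0")
 case True
 have "- \<infinity> < x" using m(2) less_ereal.simps(3) by (cases x) auto
 moreover have "z n = 0" if "m <= n" for n using sub[of m "n - m"] that True by simp
 ultimately show ?thesis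
  by (intro eventually_sequentiallyI[of m]) (use m(1) in \<open>auto simp: ln_ennreal_def\<close>)
next
 case False
 define v where "v n = enn2real (z n)" for n
 have v: "z n = ennreal (v n)" "0 <= v n" for n using fin[of n] by (auto simp: v_def)
 have vm: "0 < v m" using False v[of m] by (simp add: less_le ennreal_eq_0_iff)
 define E where "E = 1 + (\<Sum>r<m. v r)"
 have E: "1 <= E" unfolding E_def using v(2) by (simp add: sum_nonneg)
 have pow: "z (q * m + r) <= z m ^ q * z r" for q r
 proof (induction q)
  case (Suc q)
  have "z (Suc q * m + r) <= z m * z (q * m + r)" using sub[of m "q * m + r"] by (simp add: add.assoc)
  also have "... <= z m * (z m ^ q * z r)" by (rule mult_left_mono[OF Suc]) simp
  finally show ?case by (simp add: mult.assoc)
 qed simp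
 let ?b = "ln (v m)"
 have le: "ln_ennreal (z n) <= ereal (n * (?b / m) + (\<bar>?b\<bar> + ln E))" for n
 proof (cases "z n = 0")
  case False
  let ?q = "n div m" let ?r = "n mod m"
  have "z n <= ennreal (v m) ^ ?q * ennreal (v ?r)" using pow[of ?q ?r] by (simp add: v(1))
  then have "v n <= v m ^ ?q * v ?r" using v(2) vm by (simp add: v(1)[of n] ennreal_power ennreal_mult[symmetric])
  also have "v ?r <= E"
   using member_le_sum[of ?r "{..<m}" v] m(1) v(2) by (simp add: E_def)
  finally have le: "v n <= v m ^ ?q * E" using vm by (simp add: mult_left_mono)
  have vn: "0 < v n" using False v[of n] by (simp add: less_le ennreal_eq_0_iff)
  have "ln (v n) <= ln (v m ^ ?q * E)" using le vn by (subst ln_le_cancel_iff) auto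
  also have "... = ?q * ?b + ln E" using vm E by (simp add: ln_mult ln_realpow)
  also have "?q * ?b <= n * (?b / m) + \<bar>?b\<bar>"
  proof -
   have "real n = real m * ?q + ?r" by (metis mult_div_mod_eq of_nat_add of_nat_mult)
   then have "n * (?b / m) = ?q * ?b + ?r * (?b / m)" using m(1) by (simp add: field_simps)
   moreover have "\<bar>?r * (?b / m)\<bar> <= \<bar>?b\<bar>"
   proof -
    have "real ?r / m <= 1" using m(1) mod_less_divisor[of m n] by simp
    then have "real ?r / m * \<bar>?b\<bar> <= \<bar>?b\<bar>" by (rule mult_left_le_one_le[rotated 2]) auto
    then show ?thesis by (simp add: abs_mult)
   qed
   ultimately show ?thesis by linarith
  qed
  finally show ?thesis using vn unfolding v(1)[of n] by (simp add: ln_ennreal_def add.assoc)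
 qed (simp add: ln_ennreal_def)
 have bm: "ereal (?b / m) < x" using m(2) vm unfolding v(1)[of m] by (simp add: ln_ennreal_def)
 obtain y where y: "ereal (?b / m) < ereal y" "ereal y < x" using ereal_dense2[OF bm] by blast
 define c D where "c = ?b / m" and "D = \<bar>?b\<bar> + ln E"
 have "(%n. c + D * (1 / real n)) \<longlonglongrightarrow> c + D * 0" by (intro tendsto_intros lim_1_over_n)
 then have "EV n. c + D * (1 / real n) < y" using y(1) by (intro order_tendstoD(2)) (auto simp: c_def)
 then show ?thesis
  using eventually_gt_at_top[of 0]
 proof eventually_elim
  case (elim n)
  have "ereal (1 / real n) * ln_ennreal (z n) <= ereal (1 / real n) * ereal (n * c + D)"
   by (rule ereal_mult_left_mono[OF le[folded c_def D_def]]) simp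
  also have "... = ereal (c + D * (1 / real n))"
   unfolding times_ereal.simps(1) ereal.inject using elim(2) by (simp add: distrib_left)
  also have "... < ereal y" using elim(1) by (simp only: less_ereal.simps)
  also note y(2)
  finally show ?case .
 qed
qed

text \<open>\<open>pressure\<close> is defined by \<open>lim\<close>, whose value carries
  information only once convergence is known. The limit is the infimum over positive
  \<open>n\<close>.\<close>

lemma fekete:
 fixes z :: "nat => ennreal"
 assumes sub: "!!m n. z (m + n) <= z m * z n" and fin: "!!n. z n < \<infinity>"
 shows "(%n. ereal (1 / real n) * ln_ennreal (z n)) \<longlonglongrightarrow> lim (%n. ereal (1 / real n) * ln_ennreal (z n))"
proof -
 let ?a = "%n. ereal (1 / real n) * ln_ennreal (z n)"
 have "?a \<longlonglongrightarrow> (INF n\<in>{0<..}. ?a n)"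
 proof (rule order_tendstoI)
  fix x assume x: "x < (INF n\<in>{0<..}. ?a n)"
  show "EV n. x < ?a n"
   using eventually_gt_at_top[of 0]
  proof eventually_elim
   case (elim n) then show ?case using x INF_lower[of n "{0<..}" ?a] by simp
  qed
 next
  fix x assume "(INF n\<in>{0<..}. ?a n) < x"
  then obtain m where "0 < m" "?a m < x" unfolding INF_less_iff by auto
  then show "EV n. ?a n < x" by (rule fekete_aux[OF sub fin])
 qed
 then show ?thesis using limI by fastforce
qed

definition Zp :: "('s => 's => bool) => ('s word => ereal) => nat => ennreal" where
 "Zp M \<psi> n = (\<Sum>\<^sub>\<infinity>w\<in>{w. length w = n & cyl M w ~= {}}. exp_ereal (SUP x \<in> cyl M w. birkhoff n \<psi> x))"

lemma pressure_eq: "pressure M \<psi> = lim (%n. ereal (1 / real n) * ln_ennreal (Zp M \<psi> n))"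
 by (simp add: pressure_def Zp_def)

lemma Zp_mono:
 assumes "shift_space M \<subseteq> shift_space A"
 shows "Zp M \<psi> n <= Zp A \<psi> n"
proof -
 have c: "cyl M w \<subseteq> cyl A w" for w using assms by (auto simp: cyl_def)
 show ?thesis
  unfolding Zp_def using c
  by (intro infsum_mono_neutral exp_ereal_mono SUP_subset_mono nonneg_summable_on_complete) auto
qed

lemma birkhoff_add: "birkhoff (m + n) \<psi> x = birkhoff m \<psi> x + birkhoff n \<psi> (suffix m x)"
proof (induction n)
 case (Suc n)
 have "suffix n (suffix m x) = suffix (m + n) x" by (rule ext) (simp add: add.assoc)
 then show ?case using Suc by (simp add: birkhoff_def add.assoc del: suffix_nth)
qed (simp add: birkhoff_def)

context
 fixes M :: "'s::discrete_topology => 's => bool" and \<psi> :: "'s word => ereal" and b :: real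
 assumes b: "!!x. x \<in> shift_space M ==> \<psi> x <= ereal b" and Z1: "Zp M \<psi> 1 < \<infinity>"
begin

lemma birkhoff_le: "x \<in> shift_space M ==> birkhoff n \<psi> x <= ereal (n * b)"
proof (induction n)
 case (Suc n)
 have "birkhoff (Suc n) \<psi> x = birkhoff n \<psi> x + \<psi> (suffix n x)" by (simp add: birkhoff_def)
 also have "... <= ereal (n * b) + ereal b" using Suc b shift_space_suffix by (intro add_mono) auto
 finally show ?case by (simp add: algebra_simps)
qed (simp add: birkhoff_def)

text \<open>A word of length \<open>m + n\<close> with nonempty cylinder splits injectively into two
  such words, and the suprema of Birkhoff sums are subadditive under the split.\<close>

lemma Zp_submult: "Zp M \<psi> (m + n) <= Zp M \<psi> m * Zp M \<psi> n"
proof -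
 let ?f = "%n w. exp_ereal (SUP x \<in> cyl M w. birkhoff n \<psi> x)"
 let ?I = "%n. {w. length w = n & cyl M w ~= {}}"
 have "sum (?f (m + n)) F <= Zp M \<psi> m * Zp M \<psi> n" if F: "finite F" "F \<subseteq> ?I (m + n)" for F
 proof -
  let ?t = "take m ` F" and ?d = "drop m ` F"
  have cyl: "x \<in> cyl M (take m w)" "suffix m x \<in> cyl M (drop m w)" if "w \<in> F" "x \<in> cyl M w" for w x
   using F that by (auto simp: cyl_eq shift_space_suffix)
  have td: "?t \<subseteq> ?I m" "?d \<subseteq> ?I n" using F cyl by fastforce+
  have fin: "(SUP x \<in> cyl M w. birkhoff n \<psi> x) ~= \<infinity>" for w n
   using SUP_least[of "cyl M w" "birkhoff n \<psi>" "ereal (n * b)"] birkhoff_le by (auto simp: cyl_def)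
  have "sum (?f (m + n)) F <= (\<Sum>w\<in>F. ?f m (take m w) * ?f n (drop m w))"
  proof (rule sum_mono)
   fix w assume w: "w \<in> F"
   have "(SUP x \<in> cyl M w. birkhoff (m + n) \<psi> x)
    <= (SUP x \<in> cyl M (take m w). birkhoff m \<psi> x) + (SUP x \<in> cyl M (drop m w). birkhoff n \<psi> x)"
    unfolding birkhoff_add using cyl[OF w] by (intro SUP_least add_mono SUP_upper)
   then show "?f (m + n) w <= ?f m (take m w) * ?f n (drop m w)"
    unfolding exp_ereal_add[OF fin fin, symmetric] by (rule exp_ereal_mono)
  qed
  also have "... = (\<Sum>(u, v)\<in>(%w. (take m w, drop m w)) ` F. ?f m u * ?f n v)"
   by (subst sum.reindex) (auto intro: inj_onI simp: o_def append_take_drop_id intro!: inj_on_inverseI[of _ "%(u, v). u @ v"])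
  also have "... <= (\<Sum>(u, v)\<in>?t \<times> ?d. ?f m u * ?f n v)"
   using F by (intro sum_mono2) auto
  also have "... = sum (?f m) ?t * sum (?f n) ?d" by (simp add: sum_product sum.cartesian_product)
  also have "... <= Zp M \<psi> m * Zp M \<psi> n"
   unfolding Zp_def using F td by (intro mult_mono) (auto simp: nonneg_infsum_complete intro!: SUP_upper)
  finally show ?thesis .
 qed
 then show ?thesis unfolding Zp_def[of M \<psi> "m + n"] by (subst nonneg_infsum_complete) (auto intro!: SUP_least)
qed

lemma Zp_finite: "Zp M \<psi> n < \<infinity>"
proof (induction n)
 case 0
 have "Zp M \<psi> 0 <= (\<Sum>\<^sub>\<infinity>w\<in>{[]::'s list}. exp_ereal 0)"
  unfolding Zp_def
  by (intro infsum_mono_neutral exp_ereal_mono SUP_least) (auto simp: birkhoff_def)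
 then show ?case by (rule order.strict_trans1) (simp add: exp_ereal_def)
next
 case (Suc n)
 have "Zp M \<psi> (1 + n) <= Zp M \<psi> 1 * Zp M \<psi> n" by (rule Zp_submult)
 also have "... < \<infinity>" using Z1 Suc by (simp add: ennreal_mult_less_top)
 finally show ?case by simp
qed

lemma pressure_tendsto: "(%n. ereal (1 / real n) * ln_ennreal (Zp M \<psi> n)) \<longlonglongrightarrow> pressure M \<psi>"
 unfolding pressure_eq by (rule fekete[OF Zp_submult Zp_finite])

lemma Zp_growth:
 assumes "pressure M \<psi> < ereal (ln r)" "0 < r"
 shows "EV n. Zp M \<psi> n <= ennreal (r ^ n)"
 using order_tendstoD(2)[OF pressure_tendsto assms(1)] eventually_gt_at_top[of 0]
proof eventually_elim
 case (elim n)
 obtain t where t: "0 <= t" "Zp M \<psi> n = ennreal t" using Zp_finite[of n] by (cases "Zp M \<psi> n") auto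
 show ?case
 proof (cases "t = 0")
  case False
  then have "ln t < ln (r ^ n)" using elim t assms(2) by (simp add: ln_ennreal_def ln_realpow field_simps)
  then show ?thesis using t False assms(2) by (simp add: ennreal_leI)
 qed (use t in simp)
qed

end

section \<open>Pressure bounds for eigenvalues and for states of smaller pressure\<close>

context weight
begin

lemma pw_scale: "l ^ length w * p w x = pw G 1 w x"
 using l_pos by (induction w) auto

lemma Op_nwords_scale: "l ^ n * T (nwords V n) f x = Op G 1 (nwords V n) f x"
proof -
 have "l ^ n * T (nwords V n) f x = (\<Sum>\<^sub>\<infinity>w\<in>nwords V n. l ^ n * (p w x * f (w \<frown> x)))"
  unfolding Op_def using l_pos by (intro infsum_cmult_right'[symmetric])
 also have "... = Op G 1 (nwords V n) f x"
  unfolding Op_def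
 proof (rule infsum_cong)
  fix w assume "w \<in> nwords V n"
  then show "l ^ n * (p w x * f (w \<frown> x)) = pw G 1 w x * f (w \<frown> x)"
   using pw_scale[of w x] length_nwords[of w V n] by (simp flip: mult.assoc)
 qed
 finally show ?thesis .
qed

lemma harn_chi_Op_le:
 assumes h: "harn K h" "bd h" and I: "adm I" and x: "x \<in> X" "x 0 = a"
 shows "T I (%y. chi {a} y * h y) x <= exp K * h x * T I (chi {a}) x"
proof -
 have "T I (%y. chi {a} y * h y) x <= T I (%y. exp K * h x * chi {a} y) x"
 proof (rule Op_mono[OF I bd_mult[OF bd_chi h(2)] bd_cmult[OF bd_chi] x(1)])
  fix w assume "w \<frown> x \<in> X"
  then show "chi {a} (w \<frown> x) * h (w \<frown> x) <= exp K * h x * chi {a} (w \<frown> x)"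
   using harnD1[OF h(1) K_nonneg _ x(1), of "w \<frown> x"] x(2) by (simp add: chi_def del: conc_fst)
 qed
 then show ?thesis by (simp add: Op_cmult)
qed

end

text \<open>No component is singled out here. Partition functions give two facts: asymptotically the
  eigenvalues do not exceed the exponential of the limit pressure, and states whose closed words
  live in a subshift of smaller pressure lose their mass.\<close>

locale perturbed = weight A \<theta> C G0 Mj 1
 for A :: "'s::{countable,discrete_topology} => 's => bool" and \<theta> C :: real
  and G0 :: "'s word => real" and Mj :: "'s => real" +
 fixes Gs :: "nat => 's word => real" and ls :: "nat => real" and hs :: "nat => 's word => real"
  and ns :: "nat => 's word measure" and s :: "nat => 's => real" and \<psi> :: "'s word => ereal"
 assumes rpfs: "!!n. rpf A \<theta> C (Gs n) Mj (ls n) (hs n) (ns n) UNIV A"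
  and Gs_close: "!!n x. x \<in> shift_space A ==> \<bar>Gs n x - G0 x\<bar> <= s n (x 0)"
  and s_nonneg: "!!n a. 0 <= s n a" and s_le: "!!n a. s n a <= 2 * Mj a"
  and s_lim: "!!a. (%n. s n a) \<longlonglongrightarrow> 0"
  and psi: "!!x. x \<in> shift_space A ==> exp_ereal (\<psi> x) = ennreal (G0 x)"
  and P_fin: "\<bar>pressure A \<psi>\<bar> ~= \<infinity>"
begin

definition lam where "lam = exp (real_of_ereal (pressure A \<psi>))"

lemma lam_pos: "0 < lam" and P_eq: "pressure A \<psi> = ereal (ln lam)"
 using P_fin by (auto simp: lam_def)

lemma exp_birkhoff: "w \<frown> x \<in> X ==> exp_ereal (birkhoff (length w) \<psi> (w \<frown> x)) = ennreal (p w x)"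
proof (induction w)
 case (Cons a w)
 let ?y = "(a # w) \<frown> x"
 have w: "w \<frown> x \<in> X" using Cons.prems by (simp add: shift_space_build)
 have "birkhoff (length (a # w)) \<psi> ?y = \<psi> ?y + birkhoff (length w) \<psi> (w \<frown> x)"
  unfolding birkhoff_def length_Cons sum.lessThan_Suc_shift suffix_conc_Cons by simp
 moreover have "\<psi> ?y ~= \<infinity>" using psi[OF Cons.prems] unfolding exp_ereal_finite_iff[symmetric] by simp
 moreover have "birkhoff (length w) \<psi> (w \<frown> x) ~= \<infinity>"
  using Cons.IH[OF w] unfolding exp_ereal_finite_iff[symmetric] by simp
 ultimately show ?case
  using Cons.IH[OF w] psi[OF Cons.prems] G_nonneg p_nonneg by (simp add: exp_ereal_add ennreal_mult)
qed (simp add: birkhoff_def exp_ereal_def)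

lemma psi_le: assumes "x \<in> X" shows "\<psi> x <= ln_ennreal (ennreal (Mj (x 0)))"
 unfolding exp_ereal_le_iff[symmetric] psi[OF assms] by (intro ennreal_leI G_le)

context
 fixes M :: "'s => 's => bool" assumes M: "shift_space M \<subseteq> X"
begin

lemma psi_bounded: "EX b. ALL x:shift_space M. \<psi> x <= ereal b"
proof (intro exI ballI)
 fix x assume "x \<in> shift_space M"
 then have x: "x \<in> X" using M by blast
 have "Mj (x 0) <= infsum Mj UNIV"
  using finite_sum_le_infsum[OF Mj_sum, of "{x 0}"] Mj_nonneg by simp
 then have "ln_ennreal (ennreal (Mj (x 0))) <= ln_ennreal (ennreal (infsum Mj UNIV + 1))"
  by (intro ln_ennreal_mono ennreal_leI) simp
 also have "... = ereal (ln (infsum Mj UNIV + 1))"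
  using infsum_nonneg[of UNIV Mj] Mj_nonneg by (intro ln_ennreal_ennreal) (simp add: add_nonneg_pos)
 finally show "\<psi> x <= ereal (ln (infsum Mj UNIV + 1))" using psi_le[OF x] by simp
qed

lemma Zp_1: "Zp M \<psi> 1 < \<infinity>"
proof -
 have "sum (%w. exp_ereal (SUP x \<in> cyl M w. birkhoff 1 \<psi> x)) F <= ennreal (infsum Mj UNIV)"
  if F: "finite F" "F \<subseteq> {w. length w = 1 & cyl M w ~= {}}" for F
 proof -
  have "sum (%w. exp_ereal (SUP x \<in> cyl M w. birkhoff 1 \<psi> x)) F <= (\<Sum>w\<in>F. ennreal (Mj (hd w)))"
  proof (rule sum_mono)
   fix w assume "w \<in> F"
   then have w: "length w = 1" using F by auto
   have "birkhoff 1 \<psi> x <= ln_ennreal (ennreal (Mj (hd w)))" if "x \<in> cyl M w" for x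
   proof -
    obtain c where "w = [c]" using w by (auto simp: length_Suc_conv)
    then have "x \<in> X" "x 0 = hd w" using that M by (auto simp: cyl_sing)
    then show ?thesis using psi_le[of x] by (simp add: birkhoff_def)
   qed
   then show "exp_ereal (SUP x \<in> cyl M w. birkhoff 1 \<psi> x) <= ennreal (Mj (hd w))"
    unfolding exp_ereal_le_iff by (rule SUP_least)
  qed
  also have "... = ennreal (\<Sum>w\<in>F. Mj (hd w))" by (simp add: sum_ennreal Mj_nonneg)
  also have "(\<Sum>w\<in>F. Mj (hd w)) = sum Mj (hd ` F)"
  proof (rule sum.reindex_cong[symmetric, of hd])
   show "inj_on hd F"
   proof (rule inj_onI)
    fix u v assume "u \<in> F" "v \<in> F" "hd u = hd v"
    moreover from this have "length u = 1" "length v = 1" using F(2) by auto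
    ultimately show "u = v" by (auto simp: length_Suc_conv)
   qed
  qed auto
  also have "... <= infsum Mj UNIV" using F Mj_nonneg by (intro finite_sum_le_infsum Mj_sum) auto
  finally show ?thesis by (simp add: ennreal_leI)
 qed
 then have "Zp M \<psi> 1 <= ennreal (infsum Mj UNIV)"
  unfolding Zp_def by (subst nonneg_infsum_complete) (auto intro!: SUP_least)
 then show ?thesis by (rule order.strict_trans1) simp
qed

lemma Zp_finite': "Zp M \<psi> n < \<infinity>"
 using psi_bounded Zp_finite[OF _ Zp_1] by blast

text \<open>One point of comparable weight in the cylinder of each contributing word suffices, since
  the partition function takes suprema over cylinders.\<close>

lemma Op_le_Zp:
 assumes x: "x \<in> X" and I: "I \<subseteq> nwords UNIV n" and c: "0 <= c"
  and y: "!!w. w \<in> I ==> p w x ~= 0 ==> EX y:cyl M w. ennreal (p w x) <= ennreal c * exp_ereal (birkhoff n \<psi> y)"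
 shows "T I (%_. 1) x <= c * enn2real (Zp M \<psi> n)"
 unfolding Op_def
proof (rule infsum_le_finite_sums)
 show "(%w. p w x * 1) summable_on I"
  using Op_summable[OF adm_mono[OF adm_nwords I] bd_const x] .
 fix F assume F: "finite F" "F \<subseteq> I"
 let ?F = "{w \<in> F. p w x ~= 0}"
 have "(\<Sum>w\<in>F. p w x * 1) = (\<Sum>w\<in>?F. p w x)" using F by (intro sum.mono_neutral_cong_right) auto
 also have "ennreal ... = (\<Sum>w\<in>?F. ennreal (p w x))" by (simp add: sum_ennreal p_nonneg)
 also have "... <= (\<Sum>w\<in>?F. ennreal c * exp_ereal (SUP x \<in> cyl M w. birkhoff n \<psi> x))"
 proof (rule sum_mono)
  fix w assume "w \<in> ?F"
  then obtain y where y: "y \<in> cyl M w" "ennreal (p w x) <= ennreal c * exp_ereal (birkhoff n \<psi> y)"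
   using y[of w] F by auto
  note y(2)
  also have "ennreal c * exp_ereal (birkhoff n \<psi> y) <= ennreal c * exp_ereal (SUP x \<in> cyl M w. birkhoff n \<psi> x)"
   using y(1) by (intro mult_left_mono exp_ereal_mono SUP_upper) auto
  finally show "ennreal (p w x) <= ..." .
 qed
 also have "... <= ennreal c * Zp M \<psi> n"
 proof -
  have "length w = n & cyl M w ~= {}" if "w \<in> ?F" for w
   using that F(2) I y[of w] length_nwords[of w UNIV n] by auto
  then show ?thesis
   unfolding sum_distrib_left[symmetric] Zp_def using F
   by (intro mult_left_mono) (auto simp: nonneg_infsum_complete intro!: SUP_upper)
 qed
 also have "... = ennreal (c * enn2real (Zp M \<psi> n))"
  using Zp_finite'[of n] c by (simp add: ennreal_mult')
 finally show "(\<Sum>w\<in>F. p w x * 1) <= c * enn2real (Zp M \<psi> n)" using c by simp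
qed

end

lemma Op_nwords_le_Zp: assumes x: "x \<in> X" shows "T (nwords UNIV n) (%_. 1) x <= 1 * enn2real (Zp A \<psi> n)"
proof (rule Op_le_Zp[OF order_refl x order_refl])
 fix w assume w: "w \<in> nwords UNIV n" "p w x ~= 0"
 then have wX: "w \<frown> x \<in> X" using p_eq_0_or_in_X[OF x] by blast
 have "w \<frown> x \<in> cyl A w" using wX by (simp add: cyl_eq)
 moreover have "ennreal (p w x) <= ennreal 1 * exp_ereal (birkhoff n \<psi> (w \<frown> x))"
  using exp_birkhoff[OF wX] length_nwords[OF w(1)] by simp
 ultimately show "EX y:cyl A w. ennreal (p w x) <= ennreal 1 * exp_ereal (birkhoff n \<psi> y)" by blast
qed simp

text \<open>A closed word is realised by a periodic point, so returns to a state are counted by the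
 partition function of any subshift that contains these periodic points.\<close>

lemma Op_return_le_Zp:
 assumes M: "shift_space M \<subseteq> X" and x: "x \<in> X" "x 0 = a" and n: "0 < n"
  and per: "!!w. w ~= [] ==> hd w = a ==> p w x ~= 0 ==> w\<^sup>\<omega> \<in> shift_space M"
 shows "T (nwords UNIV n) (chi {a}) x <= exp K * enn2real (Zp M \<psi> n)"
proof -
 let ?I = "{w \<in> nwords UNIV n. hd w = a}"
 have "T (nwords UNIV n) (chi {a}) x = T ?I (%_. 1) x"
  unfolding Op_def
 proof (rule infsum_cong_neutral)
  fix w assume w: "w \<in> nwords UNIV n - ?I"
  then have "w ~= []" "hd w ~= a" using n length_nwords[of w UNIV n] by auto
  then show "p w x * chi {a} (w \<frown> x) = 0" by (cases w) (auto simp: chi_def)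
 next
  fix w assume w: "w \<in> nwords UNIV n \<inter> ?I"
  then have "w ~= []" "hd w = a" using n length_nwords[of w UNIV n] by auto
  then have "(w \<frown> x) 0 = a" by (cases w) auto
  then show "p w x * chi {a} (w \<frown> x) = p w x * 1" by (simp only: chi_def) simp
 qed auto
 also have "... <= exp K * enn2real (Zp M \<psi> n)"
 proof (rule Op_le_Zp[OF M x(1)])
  fix w assume w: "w \<in> ?I" "p w x ~= 0"
  then have lw: "length w = n" using length_nwords by blast
  then have ne: "w ~= []" using n by auto
  define y where "y = w\<^sup>\<omega>"
  have yM: "y \<in> shift_space M" unfolding y_def using per[OF ne] w by blast
  then have yX: "y \<in> X" using M by blast
  have yw: "w \<frown> y = y" unfolding y_def using iter_unroll[of w] ne by simp
  have y0: "y 0 = a" unfolding y_def using ne w(1) by (simp add: hd_conv_nth)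
  have "p w x <= exp (K * (1 - \<theta> ^ length w) * d x y) * p w y"
   by (rule p_dist[OF x(1) yX]) (simp add: x y0)
  also have "... <= exp K * p w y"
  proof (intro mult_right_mono p_nonneg)
   have "K * ((1 - \<theta> ^ length w) * d x y) <= K * (1 * 1)"
    using theta d_le_1 d_nonneg by (intro mult_left_mono mult_mono K_nonneg) auto
   then show "exp (K * (1 - \<theta> ^ length w) * d x y) <= exp K" by (simp add: mult.assoc)
  qed
  finally have "ennreal (p w x) <= ennreal (exp K) * ennreal (p w y)" by (simp add: ennreal_mult'[symmetric] ennreal_leI)
  also have "ennreal (p w y) = exp_ereal (birkhoff n \<psi> y)"
   using exp_birkhoff[of w y] yX lw unfolding yw by simp
  finally have "ennreal (p w x) <= ennreal (exp K) * exp_ereal (birkhoff n \<psi> y)" .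
  moreover have "y \<in> cyl M w"
  proof -
   have "y k = w ! k" if "k < length w" for k using fun_cong[OF yw, of k] that by simp
   then show ?thesis using yM by (simp add: cyl_eq)
  qed
  ultimately show "EX y:cyl M w. ennreal (p w x) <= ennreal (exp K) * exp_ereal (birkhoff n \<psi> y)" by blast
 qed auto
 finally show ?thesis .
qed

abbreviation err where "err n \<equiv> infsum (s n) UNIV"

lemma err_lim: "err \<longlonglongrightarrow> 0"
 by (rule infsum_dominated_null[of s "%a. 2 * Mj a"])
  (auto intro: s_nonneg s_le s_lim summable_on_cmult_right Mj_sum)

lemma s_summable: "s n summable_on UNIV"
 by (rule summable_on_comparison_test[OF summable_on_cmult_right[OF Mj_sum, of 2]]) (auto intro: s_le s_nonneg)

text \<open>For a fixed number of steps the error is uniform in the base point. In the induction the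
  new step contributes \<open>s n a\<close>, the earlier ones the inductive constant summed against
  \<open>Mj\<close>.\<close>

lemma Op_nwords_close:
 assumes f: "bd f"
 shows "EX D>=0. ALL n. ALL x:X. \<bar>Op (Gs n) 1 (nwords UNIV N) f x - T (nwords UNIV N) f x\<bar> <= D * err n"
proof (induction N)
 case 0
 show ?case by (intro exI[of _ 0]) (simp add: Op_def)
next
 case (Suc N)
 then obtain D where D: "0 <= D"
  "!!n x. x \<in> X ==> \<bar>Op (Gs n) 1 (nwords UNIV N) f x - T (nwords UNIV N) f x\<bar> <= D * err n" by blast
 let ?g = "T (nwords UNIV N) f"
 have bg: "bd ?g" by (rule bd_Op[OF adm_nwords f])
 obtain B where B: "0 <= B" "!!x. x \<in> X ==> \<bar>?g x\<bar> <= B" by (rule bdE[OF bg]) blast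
 let ?S = "infsum Mj UNIV"
 have S: "0 <= ?S" by (intro infsum_nonneg Mj_nonneg)
 show ?case
 proof (intro exI[of _ "?S * D + B"] conjI allI ballI)
  show "0 <= ?S * D + B" using S D B by simp
  fix n x assume x: "x \<in> X"
  let ?E = "err n"
  interpret R: rpf A \<theta> C "Gs n" Mj "ls n" "hs n" "ns n" UNIV A by (rule rpfs)
  interpret N: weight A \<theta> C "Gs n" Mj 1 by (rule R.weight_scale) simp
  let ?gn = "N.T (nwords UNIV N) f"
  have bgn: "bd ?gn" by (rule N.bd_Op[OF N.adm_nwords f])
  have E0: "0 <= ?E" by (intro infsum_nonneg s_nonneg)
  let ?F = "%a. Gs n (a ## x) * ?gn (a ## x) - G0 (a ## x) * ?g (a ## x)"
  have s1: "(%a. Gs n (a ## x) * ?gn (a ## x)) summable_on UNIV" by (rule N.letters_summable[OF bgn x])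
  have s2: "(%a. G0 (a ## x) * ?g (a ## x)) summable_on UNIV" by (rule letters_summable[OF bg x])
  note s2' = summable_on_uminus[THEN iffD2, OF s2]
  have sF: "?F summable_on UNIV" using summable_on_add[OF s1 s2'] by simp
  have sb: "(%a. Mj a * (D * ?E) + s n a * B) summable_on UNIV"
   by (intro summable_on_add summable_on_cmult_left Mj_sum s_summable)
  have Fb: "\<bar>?F a\<bar> <= Mj a * (D * ?E) + s n a * B" for a
  proof (cases "a ## x \<in> X")
   case True
   have "?F a = Gs n (a ## x) * (?gn (a ## x) - ?g (a ## x)) + (Gs n (a ## x) - G0 (a ## x)) * ?g (a ## x)"
    by (simp add: algebra_simps)
   moreover have "\<bar>Gs n (a ## x) * (?gn (a ## x) - ?g (a ## x))\<bar> <= Mj a * (D * ?E)"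
    unfolding abs_mult using D(2)[OF True] N.G_le[of "a ## x"] N.G_nonneg[of "a ## x"] Mj_nonneg
    by (intro mult_mono) auto
   moreover have "\<bar>(Gs n (a ## x) - G0 (a ## x)) * ?g (a ## x)\<bar> <= s n a * B"
    unfolding abs_mult using Gs_close[OF True, of n] B(2)[OF True] s_nonneg by (intro mult_mono) auto
   ultimately show ?thesis by linarith
  next
   case False
   then show ?thesis using D(1) B(1) E0 Mj_nonneg[of a] s_nonneg[of n a] by (simp add: N.G_off G_off)
  qed
  have "N.T (nwords UNIV (Suc N)) f x - T (nwords UNIV (Suc N)) f x = (\<Sum>\<^sub>\<infinity>a. Gs n (a ## x) * ?gn (a ## x)) - (\<Sum>\<^sub>\<infinity>a. G0 (a ## x) * ?g (a ## x))"
   unfolding N.Op_nwords_Suc[OF f x] Op_nwords_Suc[OF f x]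
   using N.Op_letters_unscaled[of UNIV ?gn x] Op_letters_unscaled[of UNIV ?g x] by simp
  also have "... = infsum ?F UNIV" using infsum_add[OF s1 s2'] by (simp add: infsum_uminus)
  finally have eq: "N.T (nwords UNIV (Suc N)) f x - T (nwords UNIV (Suc N)) f x = infsum ?F UNIV" .
  have "infsum ?F UNIV <= (\<Sum>\<^sub>\<infinity>a. Mj a * (D * ?E) + s n a * B)"
   using Fb by (intro infsum_mono sF sb) (auto simp: abs_le_iff)
  moreover have "(\<Sum>\<^sub>\<infinity>a. - (Mj a * (D * ?E) + s n a * B)) <= infsum ?F UNIV"
  proof (intro infsum_mono sF)
   show "(%a. - (Mj a * (D * ?E) + s n a * B)) summable_on UNIV" using sb by (simp only: summable_on_uminus)
   show "- (Mj a * (D * ?E) + s n a * B) <= ?F a" for a using Fb[of a] by linarith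
  qed
  moreover have "(\<Sum>\<^sub>\<infinity>a. Mj a * (D * ?E) + s n a * B) = ?S * (D * ?E) + ?E * B"
   by (simp add: infsum_add summable_on_cmult_left Mj_sum s_summable infsum_cmult_left')
  ultimately show "\<bar>N.T (nwords UNIV (Suc N)) f x - T (nwords UNIV (Suc N)) f x\<bar> <= (?S * D + B) * ?E"
   unfolding eq infsum_uminus by (simp add: algebra_simps)
 qed
qed

text \<open>\<open>ls n ^ N\<close> is the integral of the unscaled \<open>N\<close>-step operator
  applied to 1, which is close to the limit operator and thus bounded by the partition function.
  \<open>N\<close> is fixed before \<open>n\<close> grows, so no uniformity in \<open>N\<close> is
  needed.\<close>

theorem ls_upper: assumes "0 < \<eta>" shows "EV n. ls n < lam + \<eta>"
proof -
 define r where "r = lam + \<eta> / 2"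
 have r: "0 < r" "lam < r" "r < lam + \<eta>" using lam_pos assms by (auto simp: r_def)
 obtain b where b: "!!x. x \<in> X ==> \<psi> x <= ereal b" using psi_bounded[OF order_refl] by blast
 have "pressure A \<psi> < ereal (ln r)" unfolding P_eq using r lam_pos by simp
 from eventually_conj[OF Zp_growth[OF b Zp_1[OF order_refl] this r(1)] eventually_gt_at_top[of 0]]
 obtain N where N: "Zp A \<psi> N <= ennreal (r ^ N)" "0 < N"
  using eventually_happens'[OF sequentially_bot] by blast
 have le: "T (nwords UNIV N) (%_. 1) x <= r ^ N" if "x \<in> X" for x
 proof -
  have "T (nwords UNIV N) (%_. 1) x <= enn2real (Zp A \<psi> N)" using Op_nwords_le_Zp[OF that] by simp
  also have "... <= enn2real (ennreal (r ^ N))" by (rule enn2real_mono[OF N(1)]) simp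
  finally show ?thesis using r(1) by simp
 qed
 obtain D where D: "0 <= D"
  "!!n x. x \<in> X ==> \<bar>Op (Gs n) 1 (nwords UNIV N) (%_. 1) x - T (nwords UNIV N) (%_. 1) x\<bar> <= D * err n"
  using Op_nwords_close[OF bd_const, of N 1] by blast
 have ln: "ls n ^ N <= r ^ N + D * err n" for n
 proof -
  interpret R: rpf A \<theta> C "Gs n" Mj "ls n" "hs n" "ns n" UNIV A by (rule rpfs)
  have "ls n ^ N = ls n ^ N * (\<integral>x. R.T (nwords UNIV N) (%_. 1) x \<partial>ns n)"
   using R.int_nwords[OF R.bl_const, of N 1] R.prob_space by simp
  also have "... = (\<integral>x. ls n ^ N * R.T (nwords UNIV N) (%_. 1) x \<partial>ns n)" by simp
  also have "... <= (\<integral>x. r ^ N + D * err n \<partial>ns n)"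
  proof (intro R.int_mono R.bl_cmult R.bl_Op R.adm_nwords R.bl_const)
   fix x assume x: "x \<in> X"
   show "ls n ^ N * R.T (nwords UNIV N) (%_. 1) x <= r ^ N + D * err n"
    unfolding R.Op_nwords_scale using D(2)[OF x, of n] le[OF x] by linarith
  qed
  finally show ?thesis using R.prob_space by simp
 qed
 have "(%n. r ^ N + D * err n) \<longlonglongrightarrow> r ^ N + D * 0" by (intro tendsto_intros err_lim)
 moreover have "r ^ N < (lam + \<eta>) ^ N" using r N(2) by (intro power_strict_mono) auto
 ultimately have "EV n. r ^ N + D * err n < (lam + \<eta>) ^ N" by (intro order_tendstoD(2)) auto
 then show ?thesis
 proof eventually_elim
  case (elim n)
  then have "ls n ^ N < (lam + \<eta>) ^ N" using ln[of n] by linarith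
  then show ?case by (rule power_less_imp_less_base) (use lam_pos assms in simp)
 qed
qed

text \<open>The normalised return weights of \<open>a\<close> are summable, since the partition
  function of \<open>M\<close> grows strictly slower than \<open>lam ^ k\<close>. So in
  \<open>second_moment\<close> the correlations up to time \<open>N\<close> sum to a bounded
  multiple of \<open>m n\<close>, and \<open>N * m n\<close> is eventually below a constant that
  does not depend on \<open>N\<close>.\<close>

theorem null_state:
 assumes ls: "ls \<longlonglongrightarrow> lam" and M: "shift_space M \<subseteq> X" and P: "pressure M \<psi> < pressure A \<psi>"
  and per: "!!w x. x \<in> X ==> x 0 = a ==> w ~= [] ==> hd w = a ==> p w x ~= 0 ==> w\<^sup>\<omega> \<in> shift_space M"
 shows "(%n. \<integral>x. chi {a} x * hs n x \<partial>ns n) \<longlonglongrightarrow> 0"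
proof -
 obtain y where y: "pressure M \<psi> < ereal y" "y < ln lam"
  using ereal_dense2[OF P] unfolding P_eq by auto
 define r where "r = exp y"
 have "exp y < exp (ln lam)" using y(2) by (simp only: exp_less_cancel_iff)
 then have r: "0 < r" "r < lam" "pressure M \<psi> < ereal (ln r)" using y lam_pos by (auto simp: r_def)
 obtain b where b: "!!x. x \<in> shift_space M ==> \<psi> x <= ereal b" using psi_bounded[OF M] by blast
 define t where "t k = (if k = 0 then 1 else exp K * enn2real (Zp M \<psi> k) / lam ^ k)" for k :: nat
 have t0: "0 <= t k" for k using lam_pos by (simp add: t_def)
 have zg: "EV k. Zp M \<psi> k <= ennreal (r ^ k)"
  by (rule Zp_growth[OF _ Zp_1[OF M] r(3,1)]) (rule b)
 have "summable t"
 proof (rule summable_comparison_test_ev)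
  show "summable (%k. exp K * (r / lam) ^ k)" using r by (intro summable_mult summable_geometric) auto
  show "EV k. norm (t k) <= exp K * (r / lam) ^ k"
   using zg eventually_gt_at_top[of 0]
  proof eventually_elim
   case (elim k)
   have "enn2real (Zp M \<psi> k) <= enn2real (ennreal (r ^ k))" by (rule enn2real_mono[OF elim(1)]) simp
   then have "enn2real (Zp M \<psi> k) <= r ^ k" using r by simp
   then have "exp K * enn2real (Zp M \<psi> k) / lam ^ k <= exp K * r ^ k / lam ^ k"
    using lam_pos by (intro divide_right_mono mult_left_mono) auto
   then show ?case using elim(2) t0[of k] by (simp add: t_def power_divide)
  qed
 qed
 then have tS: "(\<Sum>k<N. t k) <= suminf t" for N by (rule sum_le_suminf) (auto simp: t0)
 have Tt: "T (nwords UNIV k) (chi {a}) x <= lam ^ k * t k" if x: "x \<in> X" "x 0 = a" for k x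
 proof (cases "k = 0")
  case False
  then show ?thesis using Op_return_le_Zp[OF M x, of k] per[OF x] lam_pos by (simp add: t_def)
 qed (simp add: t_def chi_def)
 define m where "m n = int_on (ns n) {a} (hs n)" for n
 have m0: "0 <= m n" for n
 proof -
  interpret R: rpf A \<theta> C "Gs n" Mj "ls n" "hs n" "ns n" UNIV A by (rule rpfs)
  show ?thesis unfolding m_def by (rule R.int_nonneg) (simp add: chi_def R.h_nonneg)
 qed
 have main: "EV n. m n <= 2 * exp K * (suminf t + 1) / N" if N: "0 < N" for N :: nat
 proof -
  \<comment> \<open>The slack \<open>1 / N\<close> at each of the \<open>N\<close> times adds up to
    1, whatever \<open>N\<close> is.\<close>
  have close: "EV n. ALL x:X. x 0 = a --> Op (Gs n) (ls n) (nwords UNIV k) (chi {a}) x <= t k + 1 / N" for k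
  proof -
   obtain D where D: "0 <= D"
    "!!n x. x \<in> X ==> \<bar>Op (Gs n) 1 (nwords UNIV k) (chi {a}) x - T (nwords UNIV k) (chi {a}) x\<bar> <= D * err n"
    using Op_nwords_close[OF bd_chi, of k "{a}"] by blast
   have "(%n. (lam ^ k * t k + D * err n) / ls n ^ k) \<longlonglongrightarrow> (lam ^ k * t k + D * 0) / lam ^ k"
    using lam_pos by (intro tendsto_intros err_lim ls) auto
   then have "EV n. (lam ^ k * t k + D * err n) / ls n ^ k < t k + 1 / N"
    using lam_pos N by (intro order_tendstoD(2)) auto
   then show ?thesis
   proof eventually_elim
    case (elim n)
    interpret R: rpf A \<theta> C "Gs n" Mj "ls n" "hs n" "ns n" UNIV A by (rule rpfs)
    show ?case
    proof (intro ballI impI)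
     fix x assume x: "x \<in> X" "x 0 = a"
     have "ls n ^ k * R.T (nwords UNIV k) (chi {a}) x <= lam ^ k * t k + D * err n"
      unfolding R.Op_nwords_scale using D(2)[OF x(1), of n] Tt[OF x, of k] by linarith
     then have "R.T (nwords UNIV k) (chi {a}) x <= (lam ^ k * t k + D * err n) / ls n ^ k"
      using R.l_pos by (simp add: pos_le_divide_eq mult.commute)
     then show "R.T (nwords UNIV k) (chi {a}) x <= t k + 1 / N" using elim by linarith
    qed
   qed
  qed
  have "EV n. ALL k:{..<N}. ALL x:X. x 0 = a --> Op (Gs n) (ls n) (nwords UNIV k) (chi {a}) x <= t k + 1 / N"
   by (intro eventually_ball_finite ballI close) simp
  then show ?thesis
  proof eventually_elim
   case (elim n)
   interpret R: rpf A \<theta> C "Gs n" Mj "ls n" "hs n" "ns n" UNIV A by (rule rpfs)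
   let ?c = "%k. \<integral>x. chi {a} x * R.T (nwords UNIV k) (%y. chi {a} y * hs n y) x \<partial>ns n"
   have c: "?c k <= exp K * (t k + 1 / N) * m n" if "k < N" for k
   proof -
    have "?c k <= (\<integral>x. exp K * (t k + 1 / N) * (chi {a} x * hs n x) \<partial>ns n)"
    proof (rule R.int_mono[OF R.bl_mult[OF R.bl_chi R.bl_Op[OF R.adm_nwords]] R.bl_cmult])
     show "R.bl (%y. chi {a} y * hs n y)" "R.bl (%y. chi {a} y * hs n y)" by (intro R.bl_mult R.bl_chi R.h_bl)+
     fix x assume x: "x \<in> X"
     show "chi {a} x * R.T (nwords UNIV k) (%y. chi {a} y * hs n y) x <= exp K * (t k + 1 / N) * (chi {a} x * hs n x)"
     proof (cases "x 0 = a")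
      case True
      have "R.T (nwords UNIV k) (%y. chi {a} y * hs n y) x <= exp K * hs n x * R.T (nwords UNIV k) (chi {a}) x"
       by (rule R.harn_chi_Op_le[OF R.h_harn R.h_bd R.adm_nwords x True])
      also have "... <= exp K * hs n x * (t k + 1 / N)"
       using elim that x True R.h_nonneg[OF x] by (intro mult_left_mono) auto
      finally show ?thesis using True by (simp add: chi_def mult_ac)
     qed (simp add: chi_def)
    qed
    then show ?thesis by (simp add: m_def)
   qed
   have "N * (m n)\<^sup>2 <= 2 * (\<Sum>k<N. ?c k)" using R.second_moment[OF N, of "{a}"] by (simp add: m_def)
   also have "... <= 2 * (\<Sum>k<N. exp K * (t k + 1 / N) * m n)" using c by (intro mult_left_mono sum_mono) auto
   also have "... = 2 * exp K * ((\<Sum>k<N. t k) + 1) * m n"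
   proof -
    have "(\<Sum>k<N. t k + 1 / N) = (\<Sum>k<N. t k) + 1" using N by (simp add: sum.distrib)
    then show ?thesis
     unfolding sum_distrib_right[symmetric] sum_distrib_left[symmetric] by (simp only: mult.assoc)
   qed
   also have "... <= 2 * exp K * (suminf t + 1) * m n"
    using tS m0 by (intro mult_right_mono mult_left_mono add_right_mono) auto
   finally have le: "N * m n * m n <= 2 * exp K * (suminf t + 1) * m n" by (simp add: power2_eq_square)
   show ?case
   proof (cases "m n = 0")
    case False
    then have "N * m n <= 2 * exp K * (suminf t + 1)" using m0[of n] by (intro mult_right_le_imp_le[OF le]) simp
    then show ?thesis using N by (simp add: pos_le_divide_eq mult.commute)
   qed (use tS[of 0] in simp)
  qed
 qed
 have "m \<longlonglongrightarrow> 0"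
 proof (rule order_tendstoI)
  fix c :: real assume "c < 0"
  then show "EV n. c < m n" by (intro always_eventually allI) (rule less_le_trans[OF _ m0])
 next
  fix c :: real assume c: "0 < c"
  have "(%N. 2 * exp K * (suminf t + 1) * (1 / real N)) \<longlonglongrightarrow> 2 * exp K * (suminf t + 1) * 0"
   by (intro tendsto_intros lim_1_over_n)
  then have "EV N. 2 * exp K * (suminf t + 1) * (1 / real N) < c" using c by (intro order_tendstoD(2)) auto
  from eventually_conj[OF this eventually_gt_at_top[of 0]]
  obtain N where N: "2 * exp K * (suminf t + 1) / real N < c" "0 < N" using eventually_happens'[OF sequentially_bot] by fastforce
  show "EV n. m n < c" using main[OF N(2)] by eventually_elim (use N(1) in linarith)
 qed
 then show ?thesis by (simp add: m_def[abs_def])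
qed

end

section \<open>The data of the theorem\<close>

text \<open>The given eigendata, with complex functions and an extended-valued potential, are
  translated to the real weight \<open>G\<close>. Real test functions are embedded by zero extension
  (\<open>Fb_of_real\<close>).\<close>

lemma rpf_of_RPF:
 assumes w: "weight A \<theta> C G Mj 1"
  and G: "!!x. x \<in> shift_space A ==> G x = (if M (x 0) (x (Suc 0)) then enn2real (exp_ereal (\<psi> x)) else 0)"
  and M_sub: "!!a b. M a b ==> A a b & a \<in> Us & b \<in> Us"
  and G_pos: "!!x. x \<in> shift_space A ==> 0 < G x \<longleftrightarrow> M (x 0) (x (Suc 0))"
  and irr: "!!a b. a \<in> Us ==> b \<in> Us ==> EX w. successively M (a # w @ [b])"
  and R: "is_RPF_measure A \<theta> M \<psi> m"
 shows "EX h \<nu>. rpf A \<theta> C G Mj (exp (real_of_ereal (pressure M \<psi>))) h \<nu> Us M &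
  m = density \<nu> (%x. ennreal (h x)) & (AE x in \<nu>. x \<in> shift_space M)"
proof -
 let ?l = "exp (real_of_ereal (pressure M \<psi>))"
 interpret weight A \<theta> C G Mj ?l by (rule weight.weight_scale[OF w]) simp
 obtain h \<nu> where hF: "(%x. complex_of_real (h x)) \<in> Fb A \<theta>" and h0: "!!x. 0 <= h x"
  and eig: "transfer A M \<psi> (%x. complex_of_real (h x)) = (%x. of_real ?l * complex_of_real (h x))"
  and nu: "prob_space \<nu>" "sets \<nu> = sets (borel_of_shift A)" "AE x in \<nu>. x \<in> shift_space M"
  and dual: "!!f. f \<in> Fb A \<theta> ==> (\<integral>x. transfer A M \<psi> f x \<partial>\<nu>) = of_real ?l * (\<integral>x. f x \<partial>\<nu>)"
  and hi: "(\<integral>x. h x \<partial>\<nu>) = 1" and m: "m = density \<nu> (%x. ennreal (h x))"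
  using R unfolding is_RPF_measure_def Let_def by blast
 have sp: "space \<nu> = X" using sets_eq_imp_space_eq[OF nu(2)] by (simp add: space_restrict_space)
 have tr: "transfer A M \<psi> f x = of_real (?l * T1 g x)"
  if x: "x \<in> X" and g: "bd g" and f: "!!y. y \<in> X ==> f y = of_real (g y)" for f g x
 proof -
  have "transfer A M \<psi> f x = (\<Sum>\<^sub>\<infinity>a\<in>{a. M a (x 0)}. of_real (enn2real (exp_ereal (\<psi> ([a] \<frown> x)))) * f ([a] \<frown> x))"
   using x by (simp add: transfer_def)
  also have "... = (\<Sum>\<^sub>\<infinity>a\<in>UNIV. complex_of_real (G (a ## x) * g (a ## x)))"
  proof (rule infsum_cong_neutral)
   fix a assume a: "a \<in> UNIV - {a. M a (x 0)}"
   have "G (a ## x) = 0" using G[of "a ## x"] G_off[of "a ## x"] a by (cases "a ## x \<in> X") auto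
   then show "complex_of_real (G (a ## x) * g (a ## x)) = 0" by simp
  next
   fix a assume "a \<in> {a. M a (x 0)} \<inter> UNIV"
   then have a: "M a (x 0)" by simp
   then have "a ## x \<in> X" using M_sub[OF a] x by (simp add: shift_space_build)
   then show "of_real (enn2real (exp_ereal (\<psi> ([a] \<frown> x)))) * f ([a] \<frown> x) = complex_of_real (G (a ## x) * g (a ## x))"
    using G[of "a ## x"] f[of "a ## x"] a by simp
  qed auto
  also have "... = complex_of_real (\<Sum>\<^sub>\<infinity>a. G (a ## x) * g (a ## x))"
   by (rule infsumI has_sum_bounded_linear[OF bounded_linear_of_real, unfolded o_def] has_sum_infsum letters_summable g x)+
  finally show ?thesis unfolding Op_letters_unscaled .
 qed
 have hbl: "bl h" using hF unfolding Fb_iff by simp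
 have "rpf A \<theta> C G Mj ?l h \<nu> Us M"
 proof (intro rpf.intro rpf_axioms.intro weight_axioms hbl h0 nu hi)
  fix x assume x: "x \<in> X"
  have "complex_of_real (?l * T1 h x) = of_real ?l * complex_of_real (h x)"
   using tr[OF x bl_bd[OF hbl], of "%x. complex_of_real (h x)"] fun_cong[OF eig, of x] by simp
  then have "?l * T1 h x = ?l * h x" by (simp only: of_real_mult[symmetric] of_real_eq_iff)
  then show "T1 h x = h x" by simp
 next
  fix g assume g: "bl g"
  let ?f = "%x. if x \<in> X then complex_of_real (g x) else 0"
  have f: "transfer A M \<psi> ?f x = of_real (?l * T1 g x)" if "x \<in> X" for x
   by (rule tr[OF that bl_bd[OF g]]) simp
  have "(\<integral>x. complex_of_real (?l * T1 g x) \<partial>\<nu>) = (\<integral>x. transfer A M \<psi> ?f x \<partial>\<nu>)"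
   by (intro Bochner_Integration.integral_cong refl) (simp only: sp f)
  also have "... = of_real ?l * (\<integral>x. ?f x \<partial>\<nu>)" by (rule dual[OF Fb_of_real[OF g]])
  also have "(\<integral>x. ?f x \<partial>\<nu>) = (\<integral>x. complex_of_real (g x) \<partial>\<nu>)"
   by (intro Bochner_Integration.integral_cong refl) (simp add: sp)
  finally have "complex_of_real (?l * (\<integral>x. T1 g x \<partial>\<nu>)) = complex_of_real (?l * (\<integral>x. g x \<partial>\<nu>))"
   unfolding integral_complex_of_real by simp
  then have "?l * (\<integral>x. T1 g x \<partial>\<nu>) = ?l * (\<integral>x. g x \<partial>\<nu>)" by (simp only: of_real_eq_iff)
  then show "(\<integral>x. T1 g x \<partial>\<nu>) = (\<integral>x. g x \<partial>\<nu>)" by simp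
 qed (use M_sub G_pos irr in auto)
 then show ?thesis using m nu(3) by blast
qed

lemma iter_shift_space:
 assumes "w ~= []" "successively M (w @ [hd w])" shows "w\<^sup>\<omega> \<in> shift_space M"
 unfolding shift_space_def
proof (intro CollectI allI)
 fix k let ?n = "length w" let ?i = "k mod ?n"
 have i: "?i < ?n" using assms(1) by simp
 have "M ((w @ [hd w]) ! ?i) ((w @ [hd w]) ! Suc ?i)" using assms(2) i by (simp add: successively_conv_nth)
 moreover have "(w @ [hd w]) ! Suc ?i = w ! (Suc k mod ?n)"
 proof (cases "Suc ?i = ?n")
  case True
  then show ?thesis using assms(1) by (simp add: mod_Suc nth_append hd_conv_nth)
 next
  case False
  then show ?thesis using i by (simp add: mod_Suc nth_append)
 qed
 ultimately show "M (w\<^sup>\<omega> k) (w\<^sup>\<omega> (Suc k))" using assms(1) i by (simp add: nth_append)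
qed

text \<open>At least one transition is required, so \<open>reach P a a\<close> says that
  \<open>a\<close> lies on a loop; \<open>comm_rel\<close> adds equality separately.\<close>

definition reach :: "('s => 's => bool) => 's => 's => bool" where
 "reach P a b \<longleftrightarrow> (EX w. successively P (a # w @ [b]))"

lemma reach_trans: assumes "reach P a b" "reach P b c" shows "reach P a c"
proof -
 obtain v w where "successively P (a # v @ [b])" "successively P (b # w @ [c])"
  using assms unfolding reach_def by auto
 then have "successively P (a # (v @ b # w) @ [c])"
  using successively_append_iff[of P "a # v @ [b]" "w @ [c]"] successively_append_iff[of P "[b]" "w @ [c]"] by simp
 then show ?thesis unfolding reach_def by blast
qed

lemma comm_rel_reach: "comm_rel P = {(a, b). a = b \<or> reach P a b & reach P b a}"
 by (auto simp: comm_rel_def reach_def)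

lemma equiv_comm: "equiv UNIV (comm_rel P)"
 unfolding comm_rel_reach by (intro equivI refl_onI symI transI) (auto intro: reach_trans)

locale theorem_setting =
 fixes A :: "'s::{countable, discrete_topology} => 's => bool"
  and \<theta> :: real and \<phi> :: "real => 's word => real" and \<phi>0 :: "'s word => ereal"
  and m0 :: nat and U :: "nat => 's set"
  and \<mu>e :: "real => 's word measure" and \<mu>U :: "'s set => 's word measure"
 assumes irrA: "irreducible_matrix A"
  and th: "0 < \<theta>" "\<theta> < 1"
  and A1: "cond_A1 A \<theta> \<phi>" and A2: "cond_A2 A \<phi>" and A3: "cond_A3 A \<phi> \<phi>0"
  and U: "bij_betw U {1..m0} (S0 A \<phi>0)" and m0: "m0 >= 2"
  and RPFe: "!!eps. eps \<in> {0<..<1} ==> is_RPF_measure A \<theta> A (%x. ereal (\<phi> eps x)) (\<mu>e eps)"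
  and RPFU: "!!V. V \<in> S0 A \<phi>0 ==> is_RPF_measure A \<theta> (submatrix_on (Bmat A \<phi>0) V) \<phi>0 (\<mu>U V)"
begin

abbreviation X where "X \<equiv> shift_space A"
abbreviation d where "d \<equiv> dtheta \<theta>"
abbreviation B where "B \<equiv> Bmat A \<phi>0"

definition C where "C = enn2real (SUP eps\<in>{0<..<1}. lip_seminorm A \<theta> 2 (\<phi> eps))"
definition Mj where "Mj a = enn2real (exp_ereal (SUP eps\<in>{0<..<1}. SUP x \<in> cyl A [a]. ereal (\<phi> eps x)))"
text \<open>Set to 0 off \<open>X\<close>, so that inadmissible branches drop out of all operator
  sums.\<close>

definition Ge where "Ge eps x = (if x \<in> X then exp (\<phi> eps x) else 0)"
definition G0 where "G0 x = (if x \<in> X then enn2real (exp_ereal (\<phi>0 x)) else 0)"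

lemma C_lip:
 assumes e: "eps \<in> {0<..<1}" and xy: "x \<in> X" "y \<in> X" "x 0 = y 0" "x (Suc 0) = y (Suc 0)"
 shows "\<phi> eps x <= \<phi> eps y + C * d x y"
proof (cases "x = y")
 case False
 have d: "0 < d x y" using False th by (simp add: dtheta_def)
 have "prefix 2 x = prefix 2 y" using xy unfolding prefix_eq_iff by (auto simp: less_2_cases_iff)
 then have "ennreal (norm (\<phi> eps x - \<phi> eps y) / d x y) <= lip_seminorm A \<theta> 2 (\<phi> eps)"
  unfolding lip_seminorm_def by (intro SUP_upper2[of "(x, y)"]) (use xy False in auto)
 also have "... <= (SUP eps\<in>{0<..<1}. lip_seminorm A \<theta> 2 (\<phi> eps))" by (rule SUP_upper[OF e])
 also have "... = ennreal C" using A1 by (simp add: C_def cond_A1_def)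
 finally have "\<bar>\<phi> eps x - \<phi> eps y\<bar> / d x y <= C" by (simp add: C_def)
 then have "\<bar>\<phi> eps x - \<phi> eps y\<bar> <= C * d x y" using d by (simp add: pos_divide_le_eq)
 then show ?thesis by linarith
qed (simp add: dtheta_def)

lemma Mj_fin: "exp_ereal (SUP eps\<in>{0<..<1}. SUP x \<in> cyl A [a]. ereal (\<phi> eps x)) = ennreal (Mj a)"
 and Mj_sum: "Mj summable_on UNIV"
proof -
 let ?E = "%a. exp_ereal (SUP eps\<in>{0<..<1}. SUP x \<in> cyl A [a]. ereal (\<phi> eps x))"
 have fin: "infsum ?E UNIV < \<infinity>" using A2 by (simp add: cond_A2_def)
 have le: "sum ?E F <= infsum ?E UNIV" if "finite F" for F
  using that by (subst nonneg_infsum_complete) (auto intro!: SUP_upper)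
 show E: "?E a = ennreal (Mj a)" for a
  using le[of "{a}"] fin by (simp add: Mj_def order.strict_trans1)
 show "Mj summable_on UNIV"
 proof (rule nonneg_bdd_above_summable_on)
  show "bdd_above (sum Mj ` {F. F \<subseteq> UNIV & finite F})"
  proof (rule bdd_aboveI2)
   fix F :: "'s set" assume "F \<in> {F. F \<subseteq> UNIV & finite F}"
   then have "ennreal (sum Mj F) <= ennreal (enn2real (infsum ?E UNIV))"
    using le[of F] fin unfolding E by (simp add: Mj_def)
   then show "sum Mj F <= enn2real (infsum ?E UNIV)" by (simp add: Mj_def)
  qed
 qed (simp add: Mj_def)
qed

lemma Ge_le: assumes "eps \<in> {0<..<1}" shows "Ge eps x <= Mj (x 0)"
proof (cases "x \<in> X")
 case True
 have "ereal (\<phi> eps x) <= (SUP x \<in> cyl A [x 0]. ereal (\<phi> eps x))" using True by (intro SUP_upper) (simp add: cyl_sing)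
 also have "... <= (SUP eps\<in>{0<..<1}. SUP x \<in> cyl A [x 0]. ereal (\<phi> eps x))" by (rule SUP_upper[OF assms])
 finally have "exp_ereal (ereal (\<phi> eps x)) <= ennreal (Mj (x 0))" unfolding Mj_fin[symmetric] by (rule exp_ereal_mono)
 then show ?thesis using True by (simp add: Ge_def exp_ereal_def Mj_def)
qed (simp add: Ge_def Mj_def)

lemma weight_e: assumes e: "eps \<in> {0<..<1}" shows "weight A \<theta> C (Ge eps) Mj 1"
proof
 show "Ge eps x <= exp (C * d x y) * Ge eps y" if xy: "x \<in> X" "y \<in> X" "x 0 = y 0" "x (Suc 0) = y (Suc 0)" for x y
  using C_lip[OF e xy] xy by (simp add: Ge_def add.commute flip: exp_add)
 show "Ge eps x <= Mj (x 0)" for x by (rule Ge_le[OF e])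
qed (use th in \<open>auto simp: C_def Ge_def Mj_sum\<close>)

lemma ev_01: "\<forall>\<^sub>F eps in at_right 0. eps \<in> {0<..<1::real}"
 by (rule eventually_at_right_real) simp

definition sup_diff :: "real => 's => ennreal" where
 "sup_diff eps a = (SUP x \<in> cyl A [a]. ennreal \<bar>exp (\<phi> eps x) - enn2real (exp_ereal (\<phi>0 x))\<bar>)"

lemma sup_diff_lim: "((%eps. sup_diff eps a) \<longlongrightarrow> 0) (at_right 0)"
 using A3 by (simp add: cond_A3_def sup_diff_def)

lemma sup_diff_ge: "x \<in> X ==> ennreal \<bar>Ge eps x - G0 x\<bar> <= sup_diff eps (x 0)"
 unfolding sup_diff_def by (intro SUP_upper2[of x]) (auto simp: cyl_sing Ge_def G0_def)

lemma G0_lim: assumes x: "x \<in> X" shows "((%eps. Ge eps x) \<longlongrightarrow> G0 x) (at_right 0)"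
proof -
 have "((%eps. ennreal \<bar>Ge eps x - G0 x\<bar>) \<longlongrightarrow> 0) (at_right 0)"
  by (rule tendsto_sandwich[OF _ _ tendsto_const sup_diff_lim[of "x 0"]]) (auto intro!: always_eventually sup_diff_ge x)
 then have "((%eps. enn2real (ennreal \<bar>Ge eps x - G0 x\<bar>)) \<longlongrightarrow> enn2real 0) (at_right 0)"
  by (intro tendsto_enn2real) auto
 then show ?thesis by (simp add: tendsto_rabs_zero_iff LIM_zero_iff)
qed

lemma G0_le: "G0 x <= Mj (x 0)"
proof (cases "x \<in> X")
 case True
 show ?thesis by (rule tendsto_upperbound[OF G0_lim[OF True]]) (auto intro: eventually_mono[OF ev_01] Ge_le)
qed (simp add: G0_def Mj_def)

text \<open>The distortion inequality passes to the pointwise limit of the exponentials, also where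
  that limit is 0.\<close>

lemma weight_0: "weight A \<theta> C G0 Mj 1"
proof
 show "G0 x <= exp (C * d x y) * G0 y" if xy: "x \<in> X" "y \<in> X" "x 0 = y 0" "x (Suc 0) = y (Suc 0)" for x y
 proof (rule tendsto_le[OF _ tendsto_mult[OF tendsto_const G0_lim[OF xy(2)]] G0_lim[OF xy(1)]])
  show "\<forall>\<^sub>F eps in at_right 0. Ge eps x <= exp (C * d x y) * Ge eps y"
   using ev_01 by eventually_elim (rule weight.G_dist[OF weight_e xy])
 qed simp
 show "G0 x <= Mj (x 0)" for x by (rule G0_le)
qed (use th in \<open>auto simp: C_def G0_def Mj_sum\<close>)

sublocale W0: weight A \<theta> C G0 Mj 1 by (rule weight_0)

lemma psi: "x \<in> X ==> exp_ereal (\<phi>0 x) = ennreal (G0 x)"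
 using A3 exp_ereal_finite_iff[of "\<phi>0 x"] by (simp add: cond_A3_def G0_def)

lemma finite_iff: "x \<in> X ==> \<bar>\<phi>0 x\<bar> ~= \<infinity> \<longleftrightarrow> 0 < G0 x"
 using psi[of x] A3 by (cases "\<phi>0 x") (auto simp: cond_A3_def exp_ereal_def G0_def)

text \<open>By distortion the positivity of \<open>G0\<close> depends only on the first two letters,
  so a single point decides the entry of \<open>B\<close>.\<close>

lemma B_iff: assumes x: "x \<in> X" shows "B (x 0) (x (Suc 0)) \<longleftrightarrow> 0 < G0 x"
proof
 assume "B (x 0) (x (Suc 0))"
 moreover have "x \<in> cyl A [x 0, x (Suc 0)]" using x by (simp add: cyl_eq less_Suc_eq)
 ultimately show "0 < G0 x" unfolding Bmat_def finite_iff[OF x, symmetric] by (elim conjE bspec)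
next
 assume pos: "0 < G0 x"
 have "\<bar>\<phi>0 y\<bar> ~= \<infinity>" if "y \<in> cyl A [x 0, x (Suc 0)]" for y
 proof -
  have y: "y \<in> X" "x 0 = y 0" "x (Suc 0) = y (Suc 0)" using that by (auto simp: cyl_eq less_Suc_eq)
  have "0 < exp (C * d x y) * G0 y" using pos W0.G_dist[OF x y(1,2,3)] by linarith
  then show ?thesis unfolding finite_iff[OF y(1)] by (simp add: zero_less_mult_iff)
 qed
 moreover have "x \<in> cyl A [x 0, x (Suc 0)]" using x by (simp add: cyl_eq less_Suc_eq)
 ultimately show "B (x 0) (x (Suc 0))" unfolding Bmat_def by (intro conjI ballI) auto
qed

lemma B_A: "B a b ==> A a b"
proof -
 assume "B a b"
 then obtain x where "x \<in> cyl A [a, b]" unfolding Bmat_def by blast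
 then have "x \<in> X" "x 0 = a" "x (Suc 0) = b" by (auto simp: cyl_eq)
 then show "A a b" unfolding shift_space_def by auto
qed

abbreviation BV where "BV V \<equiv> submatrix_on B V"

lemma BV_A: "BV V a b ==> A a b & a \<in> V & b \<in> V"
 by (auto simp: submatrix_on_def B_A)

lemma BV_sub: "shift_space (BV V) \<subseteq> X"
 using BV_A unfolding shift_space_def by blast

lemma class_reach:
 assumes "V \<in> UNIV // comm_rel B" "a \<in> V" "b \<in> V" shows "a = b \<or> reach B a b"
proof -
 have "(a, b) \<in> comm_rel B" using in_quotient_imp_in_rel[OF equiv_comm assms(1), of a b] assms(2,3) by simp
 then show ?thesis unfolding comm_rel_reach by blast
qed

text \<open>Each intermediate letter is reached from \<open>a\<close> and leads back to it through
  \<open>b\<close>, so it belongs to the class.\<close>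

lemma class_path:
 assumes V: "V \<in> UNIV // comm_rel B" and ab: "a \<in> V" "b \<in> V" and s: "successively B (a # w @ [b])"
 shows "successively (BV V) (a # w @ [b])"
proof -
 have "c \<in> V" if "c \<in> set w" for c
 proof -
  from split_list[OF that] obtain u v where w: "w = u @ c # v" by blast
  have "successively B (a # u @ [c])" "successively B (c # v @ [b])"
   using s successively_append_iff[of B "a # u @ [c]" "v @ [b]"] successively_append_iff[of B "a # u" "c # v @ [b]"]
   unfolding w by simp_all
  then have r: "reach B a c" "reach B c b" unfolding reach_def by blast+
  have "reach B c a" using class_reach[OF V ab(2,1)] r(2) reach_trans[OF r(2), of a] by blast
  then have "(a, c) \<in> comm_rel B" using r(1) unfolding comm_rel_reach by blast
  then show ?thesis by (rule in_quotient_imp_closed[OF equiv_comm V ab(1)])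
 qed
 then show ?thesis using ab by (intro successively_mono[OF s]) (auto simp: submatrix_on_def)
qed

lemma U_S0: "k \<in> {1..m0} ==> U k \<in> S0 A \<phi>0"
 using bij_betwE[OF U] by blast

lemma U_disj: "i \<in> {1..m0} ==> j \<in> {1..m0} ==> i ~= j ==> U i \<inter> U j = {}"
 using quotient_disj[OF equiv_comm, of "U i" B "U j"] U_S0[of i] U_S0[of j] bij_betw_imp_inj_on[OF U]
 by (auto simp: S0_def dest: inj_onD)

lemma two_states: "EX c. c ~= (a::'s)"
proof -
 have k: "1 \<in> {1..m0}" "2 \<in> {1..m0}" using m0 by auto
 have S: "U 1 \<in> S0 A \<phi>0" "U 2 \<in> S0 A \<phi>0" "U 1 ~= U 2"
  using k bij_betwE[OF U] bij_betw_imp_inj_on[OF U] by (auto dest: inj_onD)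
 have q: "U 1 \<in> UNIV // comm_rel B" "U 2 \<in> UNIV // comm_rel B" using S(1,2) by (auto simp: S0_def)
 have disj: "U 1 \<inter> U 2 = {}" using quotient_disj[OF equiv_comm q] S(3) by blast
 have "U 1 ~= {}" "U 2 ~= {}" by (rule in_quotient_imp_non_empty[OF equiv_comm q(1)], rule in_quotient_imp_non_empty[OF equiv_comm q(2)])
 then obtain x y where xy: "x \<in> U 1" "y \<in> U 2" by blast
 then have "x ~= y" using disj by blast
 then show ?thesis by (cases "x = a") auto
qed

text \<open>For \<open>a = b\<close> irreducibility is already met by a one-letter word, while
  \<open>reach\<close> needs a transition; a detour through a second state supplies the
  loop.\<close>

lemma reach_A: "reach A a b"
proof -
 have r: "reach A a b" if "a ~= b" for a b
 proof -
  obtain w where w: "w ~= []" "successively A w" "hd w = a" "last w = b"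
   using irrA unfolding irreducible_matrix_def by blast
  then obtain v where "w = a # v" by (cases w) auto
  with w that obtain u where "w = a # u @ [b]" by (cases v rule: rev_cases) auto
  then show ?thesis using w(2) unfolding reach_def by blast
 qed
 obtain c where "c ~= a" using two_states by blast
 then show ?thesis using r[of a b] r[of a c] r[of c a] reach_trans[of A a c a] by (cases "a = b") simp_all
qed

definition GV where "GV V x = (if BV V (x 0) (x (Suc 0)) then G0 x else 0)"
definition lam where "lam = exp (real_of_ereal (pressure A \<phi>0))"

lemma GV_weight: "weight A \<theta> C (GV V) Mj 1"
 unfolding GV_def[abs_def] by (rule W0.weight_restrict) simp

text \<open>A fixed choice of the eigenfunction and the conformal measure behind the given RPF
  measure, as a pair.\<close>

definition pe where "pe eps = (SOME p. rpf A \<theta> C (Ge eps) Mj (lambda_eps A \<phi> eps) (fst p) (snd p) UNIV A &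
 \<mu>e eps = density (snd p) (%x. ennreal (fst p x)))"
definition pV where "pV V = (SOME p. rpf A \<theta> C (GV V) Mj lam (fst p) (snd p) V (BV V) &
 \<mu>U V = density (snd p) (%x. ennreal (fst p x)) & (AE x in snd p. x \<in> shift_space (BV V)))"

lemma rpf_e:
 assumes e: "eps \<in> {0<..<1}"
 shows "rpf A \<theta> C (Ge eps) Mj (lambda_eps A \<phi> eps) (fst (pe eps)) (snd (pe eps)) UNIV A"
  and "\<mu>e eps = density (snd (pe eps)) (%x. ennreal (fst (pe eps) x))"
proof -
 have A: "A (x 0) (x (Suc 0))" if "x \<in> X" for x using that unfolding shift_space_def by auto
 have "EX h \<nu>. rpf A \<theta> C (Ge eps) Mj (lambda_eps A \<phi> eps) h \<nu> UNIV A &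
   \<mu>e eps = density \<nu> (%x. ennreal (h x)) & (AE x in \<nu>. x \<in> shift_space A)"
  unfolding lambda_eps_def
  by (rule rpf_of_RPF[OF weight_e[OF e] _ _ _ _ RPFe[OF e]])
   (use A reach_A in \<open>auto simp: Ge_def exp_ereal_def reach_def\<close>)
 then have "EX p. rpf A \<theta> C (Ge eps) Mj (lambda_eps A \<phi> eps) (fst p) (snd p) UNIV A &
   \<mu>e eps = density (snd p) (%x. ennreal (fst p x))" by auto
 from someI_ex[OF this] show "rpf A \<theta> C (Ge eps) Mj (lambda_eps A \<phi> eps) (fst (pe eps)) (snd (pe eps)) UNIV A"
  and "\<mu>e eps = density (snd (pe eps)) (%x. ennreal (fst (pe eps) x))"
  unfolding pe_def[symmetric] by blast+
qed

lemma rpf_V: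
 assumes V: "V \<in> S0 A \<phi>0"
 shows "rpf A \<theta> C (GV V) Mj lam (fst (pV V)) (snd (pV V)) V (BV V)"
  and "\<mu>U V = density (snd (pV V)) (%x. ennreal (fst (pV V) x))"
  and "AE x in snd (pV V). x \<in> shift_space (BV V)"
proof -
 have q: "V \<in> UNIV // comm_rel B" and P: "pressure (BV V) \<phi>0 = pressure A \<phi>0" using V by (auto simp: S0_def)
 \<comment> \<open>A class may be a single state without a loop, whose subshift is empty. The
   conformal measure carried by the subshift excludes this.\<close>
 obtain \<nu> where "prob_space \<nu>" "AE x in \<nu>. x \<in> shift_space (BV V)"
  using RPFU[OF V] unfolding is_RPF_measure_def Let_def by blast
 then obtain x where x: "x \<in> shift_space (BV V)" using eventually_happens' prob_space.ae_filter_bot by blast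
 then have "BV V (x 0) (x (Suc 0))" unfolding shift_space_def by auto
 then have x01: "x 0 \<in> V" "x (Suc 0) \<in> V" and "successively B (x 0 # [] @ [x (Suc 0)])" by (auto simp: submatrix_on_def)
 then have "reach B (x 0) (x (Suc 0))" unfolding reach_def by blast
 then have irr: "reach B a b" if "a \<in> V" "b \<in> V" for a b
  using class_reach[OF q that(1) x01(1)] class_reach[OF q x01(2) that(2)] reach_trans by metis
 have "EX h \<nu>. rpf A \<theta> C (GV V) Mj lam h \<nu> V (BV V) &
   \<mu>U V = density \<nu> (%x. ennreal (h x)) & (AE x in \<nu>. x \<in> shift_space (BV V))"
  unfolding lam_def P[symmetric]
 proof (rule rpf_of_RPF[OF GV_weight _ _ _ _ RPFU[OF V]])
  show "GV V x = (if BV V (x 0) (x (Suc 0)) then enn2real (exp_ereal (\<phi>0 x)) else 0)" if "x \<in> X" for x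
   using that by (simp add: GV_def G0_def)
  show "0 < GV V x \<longleftrightarrow> BV V (x 0) (x (Suc 0))" if "x \<in> X" for x
   using B_iff[OF that] by (auto simp: GV_def submatrix_on_def)
  show "EX w. successively (BV V) (a # w @ [b])" if "a \<in> V" "b \<in> V" for a b
   using irr[OF that] class_path[OF q that] unfolding reach_def by blast
 qed (rule BV_A)
 then have "EX p. rpf A \<theta> C (GV V) Mj lam (fst p) (snd p) V (BV V) &
   \<mu>U V = density (snd p) (%x. ennreal (fst p x)) & (AE x in snd p. x \<in> shift_space (BV V))"
  unfolding split_paired_Ex fst_conv snd_conv .
 from someI_ex[OF this] show "rpf A \<theta> C (GV V) Mj lam (fst (pV V)) (snd (pV V)) V (BV V)"
  and "\<mu>U V = density (snd (pV V)) (%x. ennreal (fst (pV V) x))"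
  and "AE x in snd (pV V). x \<in> shift_space (BV V)"
  unfolding pV_def[symmetric] by blast+
qed

end

text \<open>For a density, integrals of functions in \<open>bl\<close> reduce to the conformal measure.\<close>

lemma (in rpf)
 defines "\<mu> \<equiv> density \<nu> (%x. ennreal (h x))"
 shows RPF_sets: "sets \<mu> = sets (borel_of_shift A)" and RPF_prob: "prob_space \<mu>"
  and RPF_int: "!!f. bl f ==> (\<integral>x. f x \<partial>\<mu>) = (\<integral>x. f x * h x \<partial>\<nu>)"
  and RPF_Sig: "measure \<mu> (Sig A Q) = int_on \<nu> Q h"
proof -
 have hm: "h \<in> borel_measurable \<nu>" by (rule bl_meas[OF h_bl])
 have h0: "AE x in \<nu>. 0 <= h x" by (rule AE_I2) (simp add: nu_space h_nonneg)
 show s: "sets \<mu> = sets (borel_of_shift A)" by (simp add: \<mu>_def nu_sets)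
 have "emeasure \<mu> (space \<mu>) = (\<integral>\<^sup>+x. ennreal (h x) * indicator (space \<nu>) x \<partial>\<nu>)"
  unfolding \<mu>_def space_density by (rule emeasure_density) (use hm in auto)
 also have "... = (\<integral>\<^sup>+x. ennreal (h x) \<partial>\<nu>)" by (intro nn_integral_cong) simp
 also have "... = 1" using nn_integral_eq_integral[OF bl_int[OF h_bl] h0] h_int by simp
 finally show p: "prob_space \<mu>" by (rule prob_spaceI)
 show I: "(\<integral>x. f x \<partial>\<mu>) = (\<integral>x. f x * h x \<partial>\<nu>)" if "bl f" for f
  unfolding \<mu>_def using integral_density[OF bl_meas[OF that] hm h0] by (simp add: mult.commute)
 have sp: "space \<mu> = X" by (simp add: \<mu>_def nu_space)
 have "measure \<mu> (Sig A Q) = (\<integral>x. indicator (Sig A Q) x \<partial>\<mu>)"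
  using Sig_sets[of A Q] sets.sets_into_space[of "Sig A Q" \<mu>] by (simp add: s Int_absorb2)
 also have "... = (\<integral>x. chi Q x \<partial>\<mu>)"
  by (intro Bochner_Integration.integral_cong refl) (auto simp: sp chi_def Sig_eq)
 finally show "measure \<mu> (Sig A Q) = int_on \<nu> Q h" using I[OF bl_chi] by simp
qed

section \<open>Limits along sequences of parameters\<close>

text \<open>Limits in the parameter are taken along arbitrary sequences
  (\<open>sequentialI\<close>), to which the results on sequences of systems apply.\<close>

locale parameter_sequence = theorem_setting +
 fixes e :: "nat => real"
 assumes e_01: "!!n. e n \<in> {0<..<1}" and e_0: "filterlim e (at_right 0) sequentially"
begin

abbreviation Gs where "Gs \<equiv> %n. Ge (e n)"
abbreviation ls where "ls \<equiv> %n. lambda_eps A \<phi> (e n)"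
abbreviation hs where "hs \<equiv> %n. fst (pe (e n))"
abbreviation ns where "ns \<equiv> %n. snd (pe (e n))"
abbreviation s where "s \<equiv> %n a. enn2real (sup_diff (e n) a)"

lemma sup_diff_le: "sup_diff (e n) a <= ennreal (2 * Mj a)"
 unfolding sup_diff_def
proof (intro SUP_least ennreal_leI)
 fix x assume "x \<in> cyl A [a]"
 then have x: "x \<in> X" "x 0 = a" by (auto simp: cyl_sing)
 have "0 <= Ge (e n) x" "0 <= G0 x" by (simp_all add: Ge_def G0_def)
 then have "\<bar>Ge (e n) x - G0 x\<bar> <= 2 * Mj a" using Ge_le[OF e_01, of n x] G0_le[of x] unfolding x(2) by linarith
 then show "\<bar>exp (\<phi> (e n) x) - enn2real (exp_ereal (\<phi>0 x))\<bar> <= 2 * Mj a" using x(1) by (simp add: Ge_def G0_def)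
qed

lemma Gs_close: "x \<in> X ==> \<bar>Gs n x - G0 x\<bar> <= s n (x 0)"
 and s_le: "s n a <= 2 * Mj a" and s_lim: "(%n. s n a) \<longlonglongrightarrow> 0"
proof -
 have fin: "sup_diff (e n) a < \<infinity>" for a by (rule order.strict_trans1[OF sup_diff_le]) simp
 have M: "0 <= 2 * Mj a" for a by (simp add: Mj_def)
 show "\<bar>Gs n x - G0 x\<bar> <= s n (x 0)" if "x \<in> X"
  using enn2real_mono[OF sup_diff_ge[OF that, of "e n"]] fin by simp
 show "s n a <= 2 * Mj a" using enn2real_mono[OF sup_diff_le[of n a]] enn2real_ennreal[OF M] by simp
 have "((%n. sup_diff (e n) a) \<longlongrightarrow> 0) sequentially" by (rule filterlim_compose[OF sup_diff_lim e_0])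
 then have "(%n. s n a) \<longlonglongrightarrow> enn2real 0" by (intro tendsto_enn2real) auto
 then show "(%n. s n a) \<longlonglongrightarrow> 0" by simp
qed

sublocale P: perturbed A \<theta> C G0 Mj Gs ls hs ns s \<phi>0
proof (intro perturbed.intro perturbed_axioms.intro weight_0)
 show "\<bar>pressure A \<phi>0\<bar> ~= \<infinity>" using A3 by (simp add: cond_A3_def)
qed (rule rpf_e(1)[OF e_01] Gs_close s_le s_lim psi enn2real_nonneg | assumption)+

lemma P_lam: "P.lam = lam"
 by (simp add: P.lam_def lam_def)

lemma pert_V: assumes V: "V \<in> S0 A \<phi>0"
 shows "pert A \<theta> C (GV V) Mj lam (fst (pV V)) (snd (pV V)) V (BV V) Gs ls hs ns G0 s"
proof (intro pert.intro pert_axioms.intro rpf_V V P.rpfs)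
 show "EV n. ls n < lam + \<eta>" if "0 < \<eta>" for \<eta> using P.ls_upper[OF that] by (simp add: P_lam)
qed (rule Gs_close s_le s_lim enn2real_nonneg GV_def | assumption)+

lemma ls_lim: "ls \<longlonglongrightarrow> lam"
proof -
 have "1 \<in> {1..m0}" using m0 by simp
 from pert.ls_lim[OF pert_V[OF U_S0[OF this]]] show ?thesis .
qed

lemma Sig_mu: "measure (\<mu>e (e n)) (Sig A Q) = int_on (ns n) Q (hs n)"
 unfolding rpf_e(2)[OF e_01] by (rule rpf.RPF_Sig[OF P.rpfs])

text \<open>The class of \<open>a\<close> is none of the \<open>U k\<close>, so its pressure differs
  from the full one, which it cannot exceed. Closed words at \<open>a\<close> stay in the class, as
  \<open>null_state\<close> requires.\<close>

lemma null_class: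
 assumes a: "a \<notin> (\<Union>k\<in>{1..m0}. U k)"
 shows "(%n. measure (\<mu>e (e n)) (Sig A {a})) \<longlonglongrightarrow> 0"
proof -
 define V where "V = comm_rel B `` {a}"
 have q: "V \<in> UNIV // comm_rel B" and aV: "a \<in> V"
  unfolding V_def by (rule quotientI, simp) (simp add: comm_rel_def)
 have "V \<notin> S0 A \<phi>0" using a aV bij_betw_imp_surj_on[OF U] by auto
 then have ne: "pressure (BV V) \<phi>0 ~= pressure A \<phi>0" using q by (simp add: S0_def)
 obtain b c where b: "!!x. x \<in> shift_space (BV V) ==> \<phi>0 x <= ereal b" and c: "!!x. x \<in> X ==> \<phi>0 x <= ereal c"
  using P.psi_bounded[OF BV_sub[of V]] P.psi_bounded[OF order_refl] by blast
 have "pressure (BV V) \<phi>0 <= pressure A \<phi>0"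
 proof (rule LIMSEQ_le[OF pressure_tendsto[OF b P.Zp_1[OF BV_sub]] pressure_tendsto[OF c P.Zp_1[OF order_refl]]])
  show "EX N. ALL n>=N. ereal (1 / real n) * ln_ennreal (Zp (BV V) \<phi>0 n) <= ereal (1 / real n) * ln_ennreal (Zp A \<phi>0 n)"
   by (intro exI allI impI ereal_mult_left_mono ln_ennreal_mono Zp_mono BV_sub) simp
 qed
 then have P: "pressure (BV V) \<phi>0 < pressure A \<phi>0" using ne by simp
 show ?thesis
  unfolding Sig_mu
 proof (rule P.null_state[OF _ BV_sub P])
  show "ls \<longlonglongrightarrow> P.lam" unfolding P_lam by (rule ls_lim)
  fix w x assume x: "x \<in> X" "x 0 = a" and w: "w ~= []" "hd w = a" "W0.p w x ~= 0"
  have B: "successively B (v @ [x 0])" if "W0.p v x ~= 0" for v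
   using that
  proof (induction v)
   case (Cons c v)
   then have p: "G0 (c ## v \<frown> x) ~= 0" "W0.p v x ~= 0" by auto
   have cX: "c ## v \<frown> x \<in> X" by (rule ccontr) (use p(1) W0.G_off in simp)
   have "0 < G0 (c ## v \<frown> x)" using p(1) W0.G_nonneg[of "c ## v \<frown> x"] by linarith
   then have "B c ((v \<frown> x) 0)" using B_iff[OF cX] by simp
   moreover have "(v \<frown> x) 0 = hd (v @ [x 0])" by (cases v) auto
   ultimately show ?case using Cons.IH[OF p(2)] by (simp add: successively_Cons)
  qed simp
  obtain v where v: "w = a # v" using w(1,2) by (cases w) auto
  have "successively B (a # v @ [a])" using B[OF w(3)] x(2) v by simp
  then have "successively (BV V) (w @ [hd w])" using class_path[OF q aV aV] v by simp
  then show "w\<^sup>\<omega> \<in> shift_space (BV V)" by (rule iter_shift_space[OF w(1)])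
 qed
qed

lemma mu_chi:
 assumes "W0.bl f" shows "int_on (\<mu>e (e n)) {a} f = int_on (ns n) {a} (%x. (f x * hs n x))"
proof -
 interpret R: rpf A \<theta> C "Gs n" Mj "ls n" "hs n" "ns n" UNIV A by (rule P.rpfs)
 show ?thesis unfolding rpf_e(2)[OF e_01] by (subst R.RPF_int) (auto intro: R.bl_mult R.bl_chi assms simp: mult.assoc)
qed

lemma state_limit:
 assumes k: "k \<in> {1..m0}" and a: "a \<in> U k" "a0 \<in> U k" and f: "W0.bl f"
 shows "(%n. int_on (\<mu>e (e n)) {a} f / measure (\<mu>e (e n)) (Sig A {a0}))
  \<longlonglongrightarrow> int_on (\<mu>U (U k)) {a} f / measure (\<mu>U (U k)) (Sig A {a0})"
proof -
 note V = U_S0[OF k]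
 interpret p: pert A \<theta> C "GV (U k)" Mj lam "fst (pV (U k))" "snd (pV (U k))" "U k" "BV (U k)" Gs ls hs ns G0 s
  by (rule pert_V[OF V])
 have "int_on (\<mu>U (U k)) {a} f = p.mU a (%x. f x * fst (pV (U k)) x)"
  unfolding rpf_V(2)[OF V] mean_def by (subst p.RPF_int) (auto intro: p.bl_mult p.bl_chi f simp: mult.assoc)
 moreover have "measure (\<mu>U (U k)) (Sig A {a0}) = p.mU a0 (fst (pV (U k)))"
  unfolding rpf_V(2)[OF V] mean_def by (rule p.RPF_Sig)
 ultimately show ?thesis
  using p.component_limit[OF a f] unfolding Sig_mu mu_chi[OF f] mean_def by simp
qed

text \<open>Each escape rate times the mass of its own set is asymptotic to a flux. The two fluxes
  agree by \<open>flux_sym\<close> and cancel in the quotient.\<close>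

lemma c_eps_ratio:
 assumes ij: "i \<in> {1..m0}" "j \<in> {1..m0}" "i ~= j" and Q: "meets_all m0 U Q"
 shows "(%n. (ls n - c_eps A \<theta> \<phi> U (e n) Q i j) / (ls n - c_eps A \<theta> \<phi> U (e n) Q j i)
   * measure (\<mu>e (e n)) (Sig A (Q \<inter> U i)) / measure (\<mu>e (e n)) (Sig A (Q \<inter> U j))) \<longlonglongrightarrow> 1"
proof -
 have main: "EX fl. (ALL n. fl n = int_on (ns n) (Q \<inter> U j) (Op (Gs n) (ls n) (words_from (Q \<inter> U i) (- (Q \<inter> U i \<union> Q \<inter> U j))) (hs n)) & 0 < fl n)
  & (%n. (ls n - c_eps A \<theta> \<phi> U (e n) Q i j) / ls n * measure (\<mu>e (e n)) (Sig A (Q \<inter> U i)) / fl n) \<longlonglongrightarrow> 1"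
  if ij: "i \<in> {1..m0}" "j \<in> {1..m0}" "i ~= j" for i j
 proof -
  interpret p: pert A \<theta> C "GV (U i)" Mj lam "fst (pV (U i))" "snd (pV (U i))" "U i" "BV (U i)" Gs ls hs ns G0 s
   by (rule pert_V[OF U_S0[OF ij(1)]])
  let ?Q1 = "Q \<inter> U i" and ?Q2 = "Q \<inter> U j"
  have fin: "finite ?Q1" "finite ?Q2" "?Q1 ~= {}" "?Q2 ~= {}" "?Q1 \<subseteq> U i" "?Q2 \<inter> U i = {}"
   using Q ij U_disj[OF ij] by (auto simp: meets_all_def)
  obtain a where a: "a \<in> ?Q1" using fin(3) by blast
  then obtain x0 where x0: "x0 \<in> X" "x0 0 = a" using p.state_nonempty[of a] by blast
  have c: "c_eps A \<theta> \<phi> U (e n) Q i j = ls n * p.\<rho>s ?Q1 ?Q2 n" for n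
  proof -
   interpret k: killed A \<theta> C "Gs n" Mj "ls n" "hs n" "ns n" UNIV A ?Q1 "- (?Q1 \<union> ?Q2)" x0
    by (rule p.flux_killed[OF fin x0(1)]) (use x0 a in simp)
   have V: "- ((U i \<union> U j) \<inter> Q) = - (?Q1 \<union> ?Q2)" by blast
   show ?thesis unfolding c_eps_def V p.\<rho>s_def[OF fin]
    by (rule k.spectral_radius_killed) (simp add: Ge_def)
  qed
  have l: "0 < ls n" for n by (simp add: lambda_eps_def)
  have "(ls n - ls n * r) / ls n = 1 - r" for n r using l[of n] by (simp add: diff_divide_distrib)
  then have "(%n. (ls n - c_eps A \<theta> \<phi> U (e n) Q i j) / ls n * measure (\<mu>e (e n)) (Sig A ?Q1) / p.fl ?Q1 ?Q2 n) \<longlonglongrightarrow> 1"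
   using p.flux_limit[OF fin] unfolding c Sig_mu p.mass_def[OF fin, symmetric] by simp
  then show ?thesis using p.fl_def[OF fin] p.fl_pos[OF fin] by (intro exI[of _ "p.fl ?Q1 ?Q2"]) auto
 qed
 obtain fl where fl: "!!n. fl n = int_on (ns n) (Q \<inter> U j) (Op (Gs n) (ls n) (words_from (Q \<inter> U i) (- (Q \<inter> U i \<union> Q \<inter> U j))) (hs n))" "!!n. 0 < fl n"
  and l1: "(%n. (ls n - c_eps A \<theta> \<phi> U (e n) Q i j) / ls n * measure (\<mu>e (e n)) (Sig A (Q \<inter> U i)) / fl n) \<longlonglongrightarrow> 1"
  using main[OF ij] by blast
 obtain fl' where fl': "!!n. fl' n = int_on (ns n) (Q \<inter> U i) (Op (Gs n) (ls n) (words_from (Q \<inter> U j) (- (Q \<inter> U j \<union> Q \<inter> U i))) (hs n))"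
  and l2: "(%n. (ls n - c_eps A \<theta> \<phi> U (e n) Q j i) / ls n * measure (\<mu>e (e n)) (Sig A (Q \<inter> U j)) / fl' n) \<longlonglongrightarrow> 1"
  using main[OF ij(2,1)] ij(3) by blast
 have eq: "fl' n = fl n" for n
 proof -
  interpret R: rpf A \<theta> C "Gs n" Mj "ls n" "hs n" "ns n" UNIV A by (rule P.rpfs)
  show ?thesis unfolding fl fl' Un_commute[of "Q \<inter> U j"]
   by (rule R.flux_sym[symmetric]) (use Q U_disj[OF ij] in \<open>auto simp: meets_all_def\<close>)
 qed
 have "(%n. ((ls n - c_eps A \<theta> \<phi> U (e n) Q i j) / ls n * measure (\<mu>e (e n)) (Sig A (Q \<inter> U i)) / fl n) /
   ((ls n - c_eps A \<theta> \<phi> U (e n) Q j i) / ls n * measure (\<mu>e (e n)) (Sig A (Q \<inter> U j)) / fl n)) \<longlonglongrightarrow> 1 / 1"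
  using l2 unfolding eq by (intro tendsto_divide l1) auto
 moreover have "a / l * p / f / (b / l * q / f) = a / b * p / q" if "l ~= 0" "f ~= 0" for a b l p q f :: real
  using that by (simp add: field_simps)
 moreover have "ls n ~= 0" "fl n ~= 0" for n using fl(2)[of n] by (auto simp: lambda_eps_def)
 ultimately show ?thesis by simp
qed

end

section \<open>Component measures and their coefficients\<close>

context theorem_setting
begin

lemma mu_e: assumes "eps \<in> {0<..<1}" shows "sets (\<mu>e eps) = sets (borel_of_shift A)" "prob_space (\<mu>e eps)"
 unfolding rpf_e(2)[OF assms] by (rule rpf.RPF_sets[OF rpf_e(1)[OF assms]], rule rpf.RPF_prob[OF rpf_e(1)[OF assms]])

lemma mu_V: assumes "V \<in> S0 A \<phi>0" shows "sets (\<mu>U V) = sets (borel_of_shift A)" "prob_space (\<mu>U V)"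
 unfolding rpf_V(2)[OF assms] by (rule rpf.RPF_sets[OF rpf_V(1)[OF assms]], rule rpf.RPF_prob[OF rpf_V(1)[OF assms]])

lemma int_chi:
 assumes "sets \<mu> = sets (borel_of_shift A)" "finite_measure \<mu>"
 shows bl_integrable: "W0.bl f ==> integrable \<mu> f"
  and int_chi_eq: "(\<integral>x. chi Q x \<partial>\<mu>) = measure \<mu> (Sig A Q)"
  and int_chi_sum: "W0.bl f ==> finite Q ==> int_on \<mu> Q f = (\<Sum>a\<in>Q. \<integral>x. chi {a} x * f x \<partial>\<mu>)"
  and int_space: "space \<mu> = X"
proof -
 show sp: "space \<mu> = X" using sets_eq_imp_space_eq[OF assms(1)] by (simp add: space_restrict_space)
 show i: "integrable \<mu> f" if b: "W0.bl f" for f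
 proof -
  obtain c where "!!x. x \<in> X ==> \<bar>f x\<bar> <= c" by (rule W0.bdE[OF W0.bl_bd[OF b]]) blast
  then show ?thesis
   using W0.bl_measurable[OF b] assms(1)
   by (intro finite_measure.integrable_const_bound[OF assms(2), of _ c] AE_I2) (auto simp: sp cong: measurable_cong_sets)
 qed
 show "int_on \<mu> Q f = (\<Sum>a\<in>Q. \<integral>x. chi {a} x * f x \<partial>\<mu>)" if f: "W0.bl f" and Q: "finite Q"
 proof -
  have "int_on \<mu> Q f = (\<integral>x. (\<Sum>a\<in>Q. chi {a} x * f x) \<partial>\<mu>)"
   using Q by (intro Bochner_Integration.integral_cong refl) (simp add: chi_def flip: sum_distrib_right)
  also have "... = (\<Sum>a\<in>Q. \<integral>x. chi {a} x * f x \<partial>\<mu>)"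
   by (intro Bochner_Integration.integral_sum i W0.bl_mult W0.bl_chi f)
  finally show ?thesis .
 qed
 have "measure \<mu> (Sig A Q) = (\<integral>x. indicator (Sig A Q) x \<partial>\<mu>)"
  using Sig_sets[of A Q] sets.sets_into_space[of "Sig A Q" \<mu>] by (simp add: assms(1) Int_absorb2)
 also have "... = (\<integral>x. chi Q x \<partial>\<mu>)"
  by (intro Bochner_Integration.integral_cong refl) (auto simp: sp chi_def Sig_eq)
 finally show "(\<integral>x. chi Q x \<partial>\<mu>) = measure \<mu> (Sig A Q)" ..
qed

lemma finite_e: "eps \<in> {0<..<1} ==> finite_measure (\<mu>e eps)" and finite_V: "V \<in> S0 A \<phi>0 ==> finite_measure (\<mu>U V)"
 using mu_e(2) mu_V(2) prob_space.finite_measure by blast+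

lemma off_class:
 assumes V: "V \<in> S0 A \<phi>0" and "Q \<inter> V = {}" shows "int_on (\<mu>U V) Q f = (0::real)"
proof (rule integral_eq_zero_AE)
 have "AE x in snd (pV V). x 0 \<in> V" using rpf_V(3)[OF V] by (rule AE_mp) (auto simp: shift_space_def submatrix_on_def)
 then show "AE x in \<mu>U V. chi Q x * f x = 0"
  unfolding rpf_V(2)[OF V] using rpf.bl_meas[OF rpf_V(1)[OF V] rpf.h_bl[OF rpf_V(1)[OF V]]] assms(2)
  by (subst AE_density) (auto simp: chi_def)
qed

definition rep where "rep k = (SOME a. a \<in> U k)"

lemma rep: assumes "k \<in> {1..m0}" shows "rep k \<in> U k"
 unfolding rep_def using in_quotient_imp_non_empty[OF equiv_comm, of "U k" B] U_S0[OF assms]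
 by (intro someI_ex[of "%a. a \<in> U k"]) (auto simp: S0_def)

definition \<pi> where "\<pi> k = measure (\<mu>U (U k)) (Sig A {rep k})"
text \<open>The coefficient of \<open>\<mu>U (U k)\<close>, read off at one representative state of
  the component. A priori it need not converge as \<open>eps\<close> tends to 0.\<close>

definition q where "q k eps = measure (\<mu>e eps) (Sig A {rep k}) / \<pi> k"

lemma state_mass_pos:
 assumes V: "V \<in> S0 A \<phi>0" and a: "a \<in> V" shows "0 < measure (\<mu>U V) (Sig A {a})"
proof -
 interpret R: rpf A \<theta> C "GV V" Mj lam "fst (pV V)" "snd (pV V)" V "BV V" by (rule rpf_V(1)[OF V])
 obtain x where x: "x \<in> X" "x 0 = a" by (rule R.state_nonempty[OF a])
 have "0 < fst (pV V) x * measure (snd (pV V)) (cyl A [x 0])"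
  using R.h_pos[OF x(1)] R.state_pos[OF a] x(2) a by simp
 also have "... <= exp R.K * (\<integral>y. indicator (cyl A [x 0]) y * fst (pV V) y \<partial>snd (pV V))"
  by (rule R.harn_int_le[OF R.h_harn R.K_nonneg R.h_bd x(1)])
 also have "(\<integral>y. indicator (cyl A [x 0]) y * fst (pV V) y \<partial>snd (pV V)) = measure (\<mu>U V) (Sig A {a})"
  unfolding rpf_V(2)[OF V] R.RPF_Sig by (intro R.int_cong) (auto simp: cyl_sing chi_def x(2))
 finally show ?thesis by (simp add: zero_less_mult_iff)
qed

lemma pi_pos: "k \<in> {1..m0} ==> 0 < \<pi> k"
 unfolding \<pi>_def by (intro state_mass_pos U_S0 rep)

lemma q_nonneg: "k \<in> {1..m0} ==> 0 <= q k eps"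
 using pi_pos by (simp add: q_def less_imp_le)

lemma sequentialI:
 fixes F :: "real => real"
 assumes "!!e. parameter_sequence A \<theta> \<phi> \<phi>0 m0 U \<mu>e \<mu>U e ==> (%n. F (e n)) \<longlonglongrightarrow> c"
 shows "(F \<longlongrightarrow> c) (at_right 0)"
proof (rule tendsto_at_right_sequentially[of 0 1])
 fix e :: "nat => real" assume e: "!!n. 0 < e n" "!!n. e n < 1" "e \<longlonglongrightarrow> 0"
 have "e n \<in> {0<..} & e n ~= 0" for n using e(1)[of n] by simp
 then have "filterlim e (at_right 0) sequentially" using e(3) unfolding filterlim_at by simp
 then show "(%n. F (e n)) \<longlonglongrightarrow> c"
  using e by (intro assms parameter_sequence.intro parameter_sequence_axioms.intro theorem_setting_axioms) auto
qed simp

end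

context parameter_sequence
begin

text \<open>The quotient limit is multiplied by the mass of the representative state, which is at
  most 1, so the conclusion survives when this mass tends to 0. The other components do not charge
  \<open>a\<close>, and a state outside all of them loses its mass.\<close>

lemma state_asymptotics:
 assumes f: "W0.bl f"
 shows "(%n. int_on (\<mu>e (e n)) {a} f - (\<Sum>k=1..m0. q k (e n) * int_on (\<mu>U (U k)) {a} f)) \<longlonglongrightarrow> 0"
proof (cases "a \<in> (\<Union>k\<in>{1..m0}. U k)")
 case True
 then obtain k where k: "k \<in> {1..m0}" "a \<in> U k" by blast
 let ?I = "%n. \<integral>x. chi {a} x * f x \<partial>\<mu>e (e n)" and ?J = "\<integral>x. chi {a} x * f x \<partial>\<mu>U (U k)"
 let ?p = "%n. measure (\<mu>e (e n)) (Sig A {rep k})"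
 have p: "0 < ?p n" "\<bar>?p n\<bar> <= 1" for n
  using pert.mn_hs_pos[OF pert_V[OF U_S0[OF k(1)]], of n "rep k"] prob_space.prob_le_1[OF mu_e(2)[OF e_01]]
  unfolding Sig_mu mean_def by (auto simp: Sig_mu[symmetric])
 have "(%n. ?I n / ?p n - ?J / \<pi> k) \<longlonglongrightarrow> ?J / \<pi> k - ?J / \<pi> k"
  unfolding \<pi>_def by (intro tendsto_intros state_limit k rep f)
 then have "(%n. \<bar>?I n / ?p n - ?J / \<pi> k\<bar>) \<longlonglongrightarrow> 0" by (simp add: tendsto_rabs_zero_iff)
 then have "(%n. ?p n * (?I n / ?p n - ?J / \<pi> k)) \<longlonglongrightarrow> 0"
  by (rule Lim_null_comparison[rotated])
   (use p in \<open>auto simp: abs_mult intro!: always_eventually mult_left_le_one_le\<close>)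
 moreover have "?p n * (?I n / ?p n - ?J / \<pi> k) = ?I n - (\<Sum>k=1..m0. q k (e n) * int_on (\<mu>U (U k)) {a} f)" for n
 proof -
  have "int_on (\<mu>U (U j)) {a} f = 0" if "j \<in> {1..m0} - {k}" for j
   using that k U_disj[of j k] by (intro off_class U_S0) auto
  then have "(\<Sum>j=1..m0. q j (e n) * int_on (\<mu>U (U j)) {a} f) = q k (e n) * ?J"
   using k(1) by (subst sum.remove[of _ k]) auto
  then show ?thesis using p(1)[of n] by (simp add: q_def right_diff_distrib)
 qed
 ultimately show ?thesis by simp
next
 case False
 have z: "int_on (\<mu>U (U k)) {a} f = 0" if "k \<in> {1..m0}" for k
  using False that by (intro off_class U_S0) auto
 obtain c where c: "0 <= c" "!!x. x \<in> X ==> \<bar>f x\<bar> <= c" by (rule W0.blE[OF f], rule that)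
 have "norm (int_on (\<mu>e (e n)) {a} f) <= c * measure (\<mu>e (e n)) (Sig A {a})" for n
 proof -
  note m = mu_e(1)[OF e_01[of n]] finite_e[OF e_01[of n]]
  have "norm (int_on (\<mu>e (e n)) {a} f) <= (\<integral>x. c * chi {a} x \<partial>\<mu>e (e n))"
  proof (rule order_trans[OF integral_norm_bound Bochner_Integration.integral_mono])
   show "integrable (\<mu>e (e n)) (%x. norm (chi {a} x * f x))" "integrable (\<mu>e (e n)) (%x. c * chi {a} x)"
    by (intro integrable_norm bl_integrable[OF m] W0.bl_mult W0.bl_cmult W0.bl_chi f)+
  qed (use c in \<open>simp add: int_space[OF m] chi_def\<close>)
  then show ?thesis by (simp add: int_chi_eq[OF m])
 qed
 then have "(%n. \<integral>x. chi {a} x * f x \<partial>\<mu>e (e n)) \<longlonglongrightarrow> 0"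
  by (intro Lim_null_comparison[OF _ tendsto_mult_right_zero[OF null_class[OF False]]] always_eventually allI)
 then show ?thesis by (simp add: z)
qed

text \<open>With \<open>t j n\<close> tending to 1, the product is
  \<open>p i / (p i + (\<Sum>j. t j * p j))\<close> times the mass of \<open>Q\<close>. The masses
  may tend to 0, so limits of such quotients are avoided: the prefactor is at most 1, and its
  denominator differs from the mass of \<open>Q\<close> only through the \<open>1 - t j n\<close>
  and the null part \<open>r\<close>.\<close>

lemma delta_limit:
 assumes i: "i \<in> {1..m0}" and Q: "meets_all m0 U Q"
 shows "(%n. measure (\<mu>e (e n)) (Sig A Q) * delta_eps A \<theta> \<phi> m0 U (e n) Q i - measure (\<mu>e (e n)) (Sig A (Q \<inter> U i))) \<longlonglongrightarrow> 0"
proof -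
 let ?\<mu> = "%n Q. measure (\<mu>e (e n)) (Sig A Q)" let ?J = "{1..m0} - {i}"
 define p where "p j n = ?\<mu> n (Q \<inter> U j)" for j n
 define r where "r n = ?\<mu> n (Q - (\<Union>k\<in>{1..m0}. U k))" for n
 define R where "R j n = (ls n - c_eps A \<theta> \<phi> U (e n) Q i j) / (ls n - c_eps A \<theta> \<phi> U (e n) Q j i)" for j n
 define t where "t j n = R j n * p i n / p j n" for j n
 have fin: "finite Q" and ne: "j \<in> {1..m0} ==> Q \<inter> U j ~= {}" for j using Q by (auto simp: meets_all_def)
 have sum: "?\<mu> n S = (\<Sum>a\<in>S. ?\<mu> n {a})" if "finite S" for n S
  using int_chi_sum[OF mu_e(1)[OF e_01] finite_e[OF e_01] W0.bl_const[of 1] that, of n]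
  by (simp add: int_chi_eq[OF mu_e(1)[OF e_01] finite_e[OF e_01]])
 have p1: "p j n <= 1" for j n unfolding p_def by (rule prob_space.prob_le_1[OF mu_e(2)[OF e_01]])
 have p0: "0 < p j n" if j: "j \<in> {1..m0}" for j n
 proof -
  interpret p: pert A \<theta> C "GV (U j)" Mj lam "fst (pV (U j))" "snd (pV (U j))" "U j" "BV (U j)" Gs ls hs ns G0 s
   by (rule pert_V[OF U_S0[OF j]])
  have "0 < ?\<mu> n {a}" for a unfolding Sig_mu using p.mn_hs_pos[of n a] by (simp add: mean_def)
  then show ?thesis unfolding p_def using fin ne[OF j] by (subst sum) (auto intro!: sum_pos)
 qed
 have split: "?\<mu> n Q = p i n + (\<Sum>j\<in>?J. p j n) + r n" for n
 proof -
  have "?\<mu> n Q = ?\<mu> n (\<Union>j\<in>{1..m0}. Q \<inter> U j) + r n"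
   unfolding r_def using fin sum.Int_Diff[OF fin, of "%a. ?\<mu> n {a}" "\<Union>k\<in>{1..m0}. U k"]
   by (simp only: sum finite_Int finite_Diff UN_simps simp_thms Int_UN_distrib[symmetric])
  also have "?\<mu> n (\<Union>j\<in>{1..m0}. Q \<inter> U j) = (\<Sum>j\<in>{1..m0}. p j n)"
  proof -
   have "(\<Sum>a\<in>(\<Union>j\<in>{1..m0}. Q \<inter> U j). ?\<mu> n {a}) = (\<Sum>j\<in>{1..m0}. \<Sum>a\<in>Q \<inter> U j. ?\<mu> n {a})"
   proof (rule sum.UNION_disjoint)
    show "ALL i:{1..m0}. ALL j:{1..m0}. i ~= j --> Q \<inter> U i \<inter> (Q \<inter> U j) = {}" using U_disj by blast
   qed (use fin in auto)
   moreover have "?\<mu> n (\<Union>j\<in>{1..m0}. Q \<inter> U j) = (\<Sum>a\<in>(\<Union>j\<in>{1..m0}. Q \<inter> U j). ?\<mu> n {a})"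
    by (rule sum) (use fin in simp)
   moreover have "p j n = (\<Sum>a\<in>Q \<inter> U j. ?\<mu> n {a})" for j unfolding p_def by (rule sum) (use fin in simp)
   ultimately show ?thesis by (simp only:)
  qed
  finally show ?thesis using i by (simp add: sum.remove)
 qed
 have t: "t j \<longlonglongrightarrow> 1" if "j \<in> ?J" for j
  using c_eps_ratio[OF i _ _ Q, of j] that unfolding t_def R_def p_def by simp
 have r: "r \<longlonglongrightarrow> 0"
 proof -
  have "(%n. \<Sum>a\<in>Q - (\<Union>k\<in>{1..m0}. U k). ?\<mu> n {a}) \<longlonglongrightarrow> (\<Sum>a\<in>Q - (\<Union>k\<in>{1..m0}. U k). 0)"
   by (intro tendsto_sum null_class) simp
  moreover have "r = (%n. \<Sum>a\<in>Q - (\<Union>k\<in>{1..m0}. U k). ?\<mu> n {a})"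
   unfolding r_def by (rule ext, rule sum) (use fin in simp)
  ultimately show ?thesis by (simp only: sum.neutral_const)
 qed
 have "EV n. ALL j:?J. 0 < t j n"
  using t by (intro eventually_ball_finite ballI order_tendstoD(1)[of _ 1]) auto
 then have "EV n. norm (?\<mu> n Q * delta_eps A \<theta> \<phi> m0 U (e n) Q i - p i n) <= (\<Sum>j\<in>?J. \<bar>1 - t j n\<bar>) + r n"
 proof eventually_elim
  case (elim n)
  let ?S = "p i n + (\<Sum>j\<in>?J. t j n * p j n)"
  have nn: "0 <= (\<Sum>j\<in>?J. t j n * p j n)" using elim p0 by (intro sum_nonneg mult_nonneg_nonneg) (auto simp: less_imp_le)
  have S: "0 < ?S" "p i n <= ?S" using p0[OF i, of n] nn by auto
  have "p i n * (1 + (\<Sum>j\<in>?J. R j n)) = ?S"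
   using p0 by (simp add: distrib_left sum_distrib_left t_def) (intro sum.cong, auto simp: less_imp_neq[symmetric])
  then have "1 + (\<Sum>j\<in>?J. R j n) = ?S / p i n" using p0[OF i, of n] by (simp add: eq_divide_eq mult.commute)
  then have \<delta>: "delta_eps A \<theta> \<phi> m0 U (e n) Q i = p i n / ?S" unfolding delta_eps_def R_def by simp
  have "?\<mu> n Q * (p i n / ?S) - p i n = p i n / ?S * (?\<mu> n Q - ?S)" using S(1) by (simp add: field_simps)
  also have "?\<mu> n Q - ?S = (\<Sum>j\<in>?J. (1 - t j n) * p j n) + r n"
   unfolding split by (simp add: left_diff_distrib sum_subtractf)
  finally have "norm (?\<mu> n Q * delta_eps A \<theta> \<phi> m0 U (e n) Q i - p i n) = p i n / ?S * \<bar>(\<Sum>j\<in>?J. (1 - t j n) * p j n) + r n\<bar>"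
   unfolding \<delta> using S p0[OF i, of n] by (simp add: abs_mult)
  also have "... <= 1 * \<bar>(\<Sum>j\<in>?J. (1 - t j n) * p j n) + r n\<bar>" using S by (intro mult_right_mono) auto
  also have "... <= (\<Sum>j\<in>?J. \<bar>(1 - t j n) * p j n\<bar>) + r n"
  proof -
   have "0 <= r n" by (simp add: r_def)
   then show ?thesis unfolding mult_1 by (intro order_trans[OF abs_triangle_ineq add_mono[OF sum_abs]]) simp
  qed
  also have "(\<Sum>j\<in>?J. \<bar>(1 - t j n) * p j n\<bar>) <= (\<Sum>j\<in>?J. \<bar>1 - t j n\<bar>)"
   using p0 p1 by (intro sum_mono) (auto simp: abs_mult less_imp_le intro!: mult_left_le)
  finally show ?case by simp
 qed
 moreover have "(%n. (\<Sum>j\<in>?J. \<bar>1 - t j n\<bar>) + r n) \<longlonglongrightarrow> (\<Sum>j\<in>?J. \<bar>1 - 1\<bar>) + 0"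
  by (intro tendsto_intros t r)
 then have "(%n. (\<Sum>j\<in>?J. \<bar>1 - t j n\<bar>) + r n) \<longlonglongrightarrow> 0" by simp
 ultimately show ?thesis unfolding p_def by (rule Lim_null_comparison)
qed

end

section \<open>The equivalent conditions\<close>

text \<open>The mixture is the bind of a finite point measure, which supplies countable additivity.
  The integral formula for signed bounded functions follows from the nonnegative one after adding
  the bound \<open>B\<close>.\<close>

lemma sum_measure:
 fixes \<delta> :: "nat => real" and \<mu> :: "nat => 'a measure" and M :: "'a measure"
 assumes sets: "!!k. k \<in> I ==> sets (\<mu> k) = sets M" and prob: "!!k. k \<in> I ==> prob_space (\<mu> k)"
  and \<delta>: "!!k. k \<in> I ==> 0 <= \<delta> k" and fin: "finite I" "I ~= {}"
 obtains N where "sets N = sets M" "finite_measure N"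
  "!!E. E \<in> sets M ==> emeasure N E = (\<Sum>k\<in>I. ennreal (\<delta> k) * emeasure (\<mu> k) E)"
  "!!f B. f \<in> borel_measurable M ==> (!!x. x \<in> space M ==> \<bar>f x\<bar> <= B) ==>
   (\<integral>x. f x \<partial>N) = (\<Sum>k\<in>I. \<delta> k * (\<integral>x. f x \<partial>\<mu> k))"
proof -
 let ?P = "point_measure I (%k. ennreal (\<delta> k))"
 define N where "N = ?P \<bind> \<mu>"
 have sp: "space (\<mu> k) = space M" if "k \<in> I" for k by (rule sets_eq_imp_space_eq[OF sets[OF that]])
 have sub: "\<mu> \<in> ?P \<rightarrow>\<^sub>M subprob_algebra M"
  using sets prob prob_space_imp_subprob_space by (auto simp: space_subprob_algebra)
 have sN: "sets N = sets M" unfolding N_def using sets fin by (intro sets_bind) (simp_all add: space_point_measure)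
 have spN: "space N = space M" by (rule sets_eq_imp_space_eq[OF sN])
 have eN: "emeasure N E = (\<Sum>k\<in>I. ennreal (\<delta> k) * emeasure (\<mu> k) E)" if "E \<in> sets M" for E
  unfolding N_def using emeasure_bind[OF _ sub that] fin by (simp add: space_point_measure nn_integral_point_measure_finite)
 have nn: "(\<integral>\<^sup>+x. f x \<partial>N) = (\<Sum>k\<in>I. ennreal (\<delta> k) * (\<integral>\<^sup>+x. f x \<partial>\<mu> k))" if "f \<in> borel_measurable M" for f
  unfolding N_def nn_integral_bind[OF that sub] using fin by (simp add: nn_integral_point_measure_finite)
 have fN: "finite_measure N"
 proof (rule finite_measureI)
  show "emeasure N (space N) ~= \<infinity>"
   unfolding spN using prob_space.emeasure_space_1[OF prob] \<delta> by (simp add: eN sum_ennreal flip: sp)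
 qed
 have I: "(\<integral>x. f x \<partial>N) = (\<Sum>k\<in>I. \<delta> k * (\<integral>x. f x \<partial>\<mu> k))"
  if f: "f \<in> borel_measurable M" "!!x. x \<in> space M ==> \<bar>f x\<bar> <= B" for f B
 proof -
  let ?g = "%x. f x + B"
  have g0: "0 <= ?g x" if "x \<in> space M" for x using f(2)[OF that] by linarith
  have i: "integrable L f" "integrable L ?g" "ennreal (\<integral>x. ?g x \<partial>L) = (\<integral>\<^sup>+x. ennreal (?g x) \<partial>L)" "0 <= (\<integral>x. ?g x \<partial>L)"
   "(\<integral>x. ?g x \<partial>L) = (\<integral>x. f x \<partial>L) + measure L (space M) * B"
   if L: "finite_measure L" "sets L = sets M" for L
  proof -
   have spL: "space L = space M" by (rule sets_eq_imp_space_eq[OF L(2)])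
   show f: "integrable L f"
    using f measurable_cong_sets[OF L(2) refl] by (intro finite_measure.integrable_const_bound[OF L(1), of _ B] AE_I2) (auto simp: spL)
   have c: "integrable L (%_. B)" by (rule finite_measure.integrable_const[OF L(1)])
   show g: "integrable L ?g" by (rule Bochner_Integration.integrable_add[OF f c])
   show "ennreal (\<integral>x. ?g x \<partial>L) = (\<integral>\<^sup>+x. ennreal (?g x) \<partial>L)"
    using g0 by (intro nn_integral_eq_integral[symmetric] g AE_I2) (simp add: spL)
   show "0 <= (\<integral>x. ?g x \<partial>L)" using g0 by (intro integral_nonneg_AE AE_I2) (simp add: spL)
   show "(\<integral>x. ?g x \<partial>L) = (\<integral>x. f x \<partial>L) + measure L (space M) * B"
    using Bochner_Integration.integral_add[OF f c] by (simp add: spL)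
  qed
  note iN = i[OF fN sN] and ik = i[OF prob_space.finite_measure[OF prob] sets]
  have "ennreal (\<integral>x. ?g x \<partial>N) = (\<Sum>k\<in>I. ennreal (\<delta> k) * ennreal (\<integral>x. ?g x \<partial>\<mu> k))"
   unfolding iN(3) using f(1) by (subst nn) (auto intro!: sum.cong simp: ik(3))
  also have "... = ennreal (\<Sum>k\<in>I. \<delta> k * (\<integral>x. ?g x \<partial>\<mu> k))"
   using \<delta> ik(4) by (simp add: ennreal_mult[symmetric] sum_ennreal)
  finally have "(\<integral>x. ?g x \<partial>N) = (\<Sum>k\<in>I. \<delta> k * (\<integral>x. ?g x \<partial>\<mu> k))"
   using iN(4) \<delta> ik(4) by (subst (asm) ennreal_inj) (auto intro!: sum_nonneg)
  moreover have "measure N (space M) = (\<Sum>k\<in>I. \<delta> k)"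
  proof -
   have "emeasure N (space M) = (\<Sum>k\<in>I. ennreal (\<delta> k))"
    using prob_space.emeasure_space_1[OF prob] by (simp add: eN flip: sp)
   then show ?thesis using \<delta> by (simp add: measure_def sum_ennreal sum_nonneg)
  qed
  moreover have "(\<Sum>k\<in>I. \<delta> k * (\<integral>x. ?g x \<partial>\<mu> k)) = (\<Sum>k\<in>I. \<delta> k * (\<integral>x. f x \<partial>\<mu> k) + \<delta> k * B)"
   using prob_space.prob_space[OF prob] by (intro sum.cong refl) (simp add: ik(5) distrib_left flip: sp)
  ultimately show ?thesis by (simp add: iN(5) sum.distrib sum_distrib_right)
 qed
 show ?thesis by (rule that[OF sN fN _ I]) (simp_all add: eN)
qed

section \<open>Convergence of the coefficients and the four conditions\<close>

context theorem_setting
begin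

definition m where "m k Q = measure (\<mu>U (U k)) (Sig A Q)"

lemma asym:
 assumes f: "W0.bl f" and Q: "finite Q"
 shows "((%eps. int_on (\<mu>e eps) Q f - (\<Sum>k=1..m0. q k eps * int_on (\<mu>U (U k)) Q f)) \<longlongrightarrow> 0) (at_right 0)"
proof (rule sequentialI)
 fix e assume "parameter_sequence A \<theta> \<phi> \<phi>0 m0 U \<mu>e \<mu>U e"
 then interpret parameter_sequence A \<theta> \<phi> \<phi>0 m0 U \<mu>e \<mu>U e .
 have "(%n. \<Sum>a\<in>Q. int_on (\<mu>e (e n)) {a} f - (\<Sum>k=1..m0. q k (e n) * int_on (\<mu>U (U k)) {a} f)) \<longlonglongrightarrow> (\<Sum>a\<in>Q. 0)"
  by (intro tendsto_sum state_asymptotics f)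
 moreover have "(\<Sum>a\<in>Q. int_on (\<mu>e (e n)) {a} f - (\<Sum>k=1..m0. q k (e n) * int_on (\<mu>U (U k)) {a} f))
  = int_on (\<mu>e (e n)) Q f - (\<Sum>k=1..m0. q k (e n) * int_on (\<mu>U (U k)) Q f)" for n
 proof -
  have "(\<Sum>k=1..m0. q k (e n) * int_on (\<mu>U (U k)) Q f) = (\<Sum>k=1..m0. \<Sum>a\<in>Q. q k (e n) * int_on (\<mu>U (U k)) {a} f)"
   by (intro sum.cong refl) (simp add: int_chi_sum[OF mu_V(1)[OF U_S0] finite_V[OF U_S0] f Q] sum_distrib_left)
  then show ?thesis
   by (simp add: int_chi_sum[OF mu_e(1)[OF e_01] finite_e[OF e_01] f Q] sum_subtractf sum.swap[of _ Q])
 qed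
 ultimately show "(%n. int_on (\<mu>e (e n)) Q f - (\<Sum>k=1..m0. q k (e n) * int_on (\<mu>U (U k)) Q f)) \<longlonglongrightarrow> 0" by simp
qed

lemma ev_chi: "\<forall>\<^sub>F eps in at_right 0. int_on (\<mu>e eps) Q (%_. 1) = measure (\<mu>e eps) (Sig A Q)"
 using ev_01 by eventually_elim (simp add: int_chi_eq[OF mu_e(1) finite_e])

lemma m_eq: "k \<in> {1..m0} ==> (\<integral>x. chi Q x \<partial>\<mu>U (U k)) = m k Q"
 by (simp add: m_def int_chi_eq[OF mu_V(1)[OF U_S0] finite_V[OF U_S0]])

lemma asym_mass:
 assumes Q: "finite Q"
 shows "((%eps. measure (\<mu>e eps) (Sig A Q) - (\<Sum>k=1..m0. q k eps * m k Q)) \<longlongrightarrow> 0) (at_right 0)"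
proof (rule Lim_transform_eventually[OF asym[OF W0.bl_const[of 1] Q]])
 show "\<forall>\<^sub>F eps in at_right 0. int_on (\<mu>e eps) Q (%_. 1) - (\<Sum>k=1..m0. q k eps * int_on (\<mu>U (U k)) Q (%_. 1))
   = measure (\<mu>e eps) (Sig A Q) - (\<Sum>k=1..m0. q k eps * m k Q)"
  using ev_chi[of Q]
 proof eventually_elim
  case (elim eps)
  have "(\<Sum>k=1..m0. q k eps * int_on (\<mu>U (U k)) Q (%_. 1)) = (\<Sum>k=1..m0. q k eps * m k Q)"
   by (intro sum.cong refl) (simp add: m_eq)
  then show ?case using elim by simp
 qed
qed

text \<open>Among the component measures only that of \<open>U i\<close> charges
  \<open>Q \<inter> U i\<close>, so a single term of \<open>asym_mass\<close> for this set
  survives.\<close>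

lemma asym_delta:
 assumes i: "i \<in> {1..m0}" and Q: "meets_all m0 U Q"
 shows "((%eps. measure (\<mu>e eps) (Sig A Q) * delta_eps A \<theta> \<phi> m0 U eps Q i - q i eps * m i Q) \<longlongrightarrow> 0) (at_right 0)"
proof -
 have fin: "finite (Q \<inter> U i)" using Q by (simp add: meets_all_def)
 have "((%eps. measure (\<mu>e eps) (Sig A Q) * delta_eps A \<theta> \<phi> m0 U eps Q i - measure (\<mu>e eps) (Sig A (Q \<inter> U i))) \<longlongrightarrow> 0) (at_right 0)"
  by (rule sequentialI) (rule parameter_sequence.delta_limit[OF _ i Q])
 from tendsto_add[OF this asym_mass[OF fin]]
 have "((%eps. measure (\<mu>e eps) (Sig A Q) * delta_eps A \<theta> \<phi> m0 U eps Q i - (\<Sum>k=1..m0. q k eps * m k (Q \<inter> U i))) \<longlongrightarrow> 0) (at_right 0)" by simp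
 moreover have "(\<Sum>k=1..m0. q k eps * m k (Q \<inter> U i)) = q i eps * m i Q" for eps
 proof -
  have "m k (Q \<inter> U i) = 0" if "k \<in> {1..m0} - {i}" for k
  proof -
   have "Q \<inter> U i \<inter> U k = {}" using U_disj[of i k] i that by blast
   then show ?thesis using off_class[OF U_S0, of k "Q \<inter> U i" "%_. 1"] that m_eq[of k "Q \<inter> U i"] by simp
  qed
  moreover have "m i (Q \<inter> U i) = m i Q"
  proof -
   note I = bl_integrable[OF mu_V(1)[OF U_S0[OF i]] finite_V[OF U_S0[OF i]] W0.bl_chi]
   have "int_on (\<mu>U (U i)) Q (%_. 1) = (\<integral>x. chi (Q \<inter> U i) x + chi (Q - U i) x \<partial>\<mu>U (U i))"
    by (intro Bochner_Integration.integral_cong refl) (simp add: chi_def)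
   also have "... = m i (Q \<inter> U i) + int_on (\<mu>U (U i)) (Q - U i) (%_. 1)"
    using I m_eq[OF i, of "Q \<inter> U i"] by (subst Bochner_Integration.integral_add) auto
   also have "int_on (\<mu>U (U i)) (Q - U i) (%_. 1) = 0" by (rule off_class[OF U_S0[OF i]]) blast
   finally show ?thesis using m_eq[OF i, of Q] by simp
  qed
  ultimately show ?thesis using i by (subst sum.remove[of _ i]) auto
 qed
 ultimately show ?thesis by simp
qed

lemma m_pos: assumes k: "k \<in> {1..m0}" and "a \<in> Q" "a \<in> U k" shows "0 < m k Q"
proof -
 interpret finite_measure "\<mu>U (U k)" by (rule finite_V[OF U_S0[OF k]])
 have "measure (\<mu>U (U k)) (Sig A {a}) <= m k Q"
  unfolding m_def using assms(2) by (intro finite_measure_mono) (auto simp: Sig_eq mu_V(1)[OF U_S0[OF k]] Sig_sets[unfolded Sig_eq])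
 then show ?thesis using state_mass_pos[OF U_S0[OF k] assms(3)] by linarith
qed

text \<open>The hub of the equivalence: it implies the condition on all finite sets and the
  existence of the limit measure, and it follows from the weakest condition, the one on products
  along an exhausting sequence.\<close>

definition star where "star \<longleftrightarrow> (ALL k:{1..m0}. EX b. (q k \<longlongrightarrow> b) (at_right 0))"
definition \<beta> where "\<beta> k = Lim (at_right 0) (q k)"

lemma star_lim: "star ==> k \<in> {1..m0} ==> (q k \<longlongrightarrow> \<beta> k) (at_right 0)"
 unfolding star_def \<beta>_def using tendsto_Lim[of "at_right (0::real)" "q k"] by force

lemma \<beta>_nonneg: "star ==> k \<in> {1..m0} ==> 0 <= \<beta> k"
 by (rule tendsto_lowerbound[OF star_lim]) (simp_all add: q_nonneg)

lemma star_mass: assumes star and Q: "finite Q"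
 shows "((%eps. measure (\<mu>e eps) (Sig A Q)) \<longlongrightarrow> (\<Sum>k=1..m0. \<beta> k * m k Q)) (at_right 0)"
proof -
 have "((%eps. \<Sum>k=1..m0. q k eps * m k Q) \<longlongrightarrow> (\<Sum>k=1..m0. \<beta> k * m k Q)) (at_right 0)"
  by (intro tendsto_sum tendsto_mult tendsto_const star_lim[OF assms(1)])
 from tendsto_add[OF asym_mass[OF Q] this] show ?thesis by simp
qed

lemma star_product: assumes star and k: "k \<in> {1..m0}" and Q: "meets_all m0 U Q"
 shows "((%eps. measure (\<mu>e eps) (Sig A Q) * delta_eps A \<theta> \<phi> m0 U eps Q k) \<longlongrightarrow> \<beta> k * m k Q) (at_right 0)"
 using tendsto_add[OF asym_delta[OF k Q] tendsto_mult[OF star_lim[OF assms(1) k] tendsto_const[of "m k Q"]]] by simp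

lemma weights_of_star: assumes star and Q: "meets_all m0 U Q"
 shows "weights_converge A \<theta> \<phi> m0 U \<mu>e Q"
proof -
 let ?\<mu> = "%eps. measure (\<mu>e eps) (Sig A Q)" let ?a = "\<Sum>k=1..m0. \<beta> k * m k Q"
 have mu: "(?\<mu> \<longlongrightarrow> ?a) (at_right 0)" using Q by (intro star_mass assms) (simp add: meets_all_def)
 have "((%eps. delta_eps A \<theta> \<phi> m0 U eps Q k) \<longlongrightarrow> \<beta> k * m k Q / ?a) (at_right 0)" if a: "0 < ?a" and k: "k \<in> {1..m0}" for k
 proof (rule Lim_transform_eventually[OF tendsto_divide[OF star_product[OF assms(1) k Q] mu]])
  show "\<forall>\<^sub>F eps in at_right 0. ?\<mu> eps * delta_eps A \<theta> \<phi> m0 U eps Q k / ?\<mu> eps = delta_eps A \<theta> \<phi> m0 U eps Q k"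
   using order_tendstoD(1)[OF mu a] by eventually_elim simp
 qed (use a in simp)
 then show ?thesis unfolding weights_converge_def using mu by blast
qed

text \<open>When the limit mass is 0, nothing is known about the weights. Instead
  \<open>q k * m k Q\<close> is squeezed between 0 and the sum over all components, and
  \<open>asym_delta\<close> transfers its limit to the product.\<close>

lemma products_of_weights: assumes W: "weights_converge A \<theta> \<phi> m0 U \<mu>e Q" and Q: "meets_all m0 U Q"
 shows "products_converge A \<theta> \<phi> m0 U \<mu>e Q"
 unfolding products_converge_def
proof
 fix k assume k: "k \<in> {1..m0}"
 obtain a where a: "((%eps. measure (\<mu>e eps) (Sig A Q)) \<longlongrightarrow> a) (at_right 0)"
  "0 < a ==> EX d. ((%eps. delta_eps A \<theta> \<phi> m0 U eps Q k) \<longlongrightarrow> d) (at_right 0)"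
  using W k unfolding weights_converge_def by blast
 show "EX l. ((%eps. measure (\<mu>e eps) (Sig A Q) * delta_eps A \<theta> \<phi> m0 U eps Q k) \<longlongrightarrow> l) (at_right 0)"
 proof (cases "0 < a")
  case True
  then show ?thesis using a tendsto_mult by blast
 next
  case False
  have "0 <= a" by (rule tendsto_lowerbound[OF a(1)]) (auto intro: always_eventually)
  then have mu0: "((%eps. measure (\<mu>e eps) (Sig A Q)) \<longlongrightarrow> 0) (at_right 0)" using a(1) False by simp
  have m0': "0 <= q j eps * m j Q" if "j \<in> {1..m0}" for j eps using q_nonneg[OF that] by (simp add: m_def)
  have "finite Q" using Q by (simp add: meets_all_def)
  from tendsto_diff[OF mu0 asym_mass[OF this]]
  have "((%eps. \<Sum>j=1..m0. q j eps * m j Q) \<longlongrightarrow> 0) (at_right 0)" by simp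
  then have "((%eps. q k eps * m k Q) \<longlongrightarrow> 0) (at_right 0)"
   by (rule tendsto_sandwich[OF _ _ tendsto_const, rotated 2])
    (use m0' k in \<open>auto intro!: always_eventually member_le_sum\<close>)
  from tendsto_add[OF asym_delta[OF k Q] this] show ?thesis by (intro exI[of _ 0]) simp
 qed
qed

text \<open>Some \<open>Q n\<close> contains the representative state, so \<open>m k (Q n)\<close>
  is positive and \<open>asym_delta\<close> can be solved for \<open>q k\<close>.\<close>

lemma star_of_products: assumes Q: "exhausting m0 U Q" and P: "!!n. products_converge A \<theta> \<phi> m0 U \<mu>e (Q n)"
 shows star
 unfolding star_def
proof
 fix k assume k: "k \<in> {1..m0}"
 obtain n where n: "rep k \<in> Q n" using Q unfolding exhausting_def by blast
 have mQ: "meets_all m0 U (Q n)" using Q by (simp add: exhausting_def)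
 have pos: "0 < m k (Q n)" by (rule m_pos[OF k n rep[OF k]])
 obtain c where "((%eps. measure (\<mu>e eps) (Sig A (Q n)) * delta_eps A \<theta> \<phi> m0 U eps (Q n) k) \<longlongrightarrow> c) (at_right 0)"
  using P[of n] k unfolding products_converge_def by blast
 from tendsto_divide[OF tendsto_diff[OF this asym_delta[OF k mQ]] tendsto_const, of "m k (Q n)"]
 have "(q k \<longlongrightarrow> c / m k (Q n)) (at_right 0)" using pos by simp
 then show "EX b. (q k \<longlongrightarrow> b) (at_right 0)" ..
qed

lemma ex_exhausting: "EX Q. exhausting m0 U Q"
proof -
 let ?Q = "%n. rep ` {1..m0} \<union> from_nat ` {..n}"
 have "x \<in> (\<Union>n. ?Q n)" for x by (rule UN_I[of "to_nat x"]) (auto intro!: image_eqI[of _ _ "to_nat x"])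
 then have "(\<Union>n. ?Q n) = UNIV" by blast
 moreover have "?Q n \<inter> U k ~= {}" if "k \<in> {1..m0}" for n k using rep[OF that] that by blast
 moreover have "?Q n \<subseteq> ?Q (Suc n)" for n by auto
 ultimately have "exhausting m0 U ?Q" unfolding exhausting_def meets_all_def by simp
 then show ?thesis by (rule exI[of _ ?Q])
qed

lemma limit_integral:
 assumes L: "is_limit_measure A \<theta> \<mu>e \<mu>" and f: "W0.bl f" and Q: "finite Q" "!!x. x \<in> X ==> x 0 \<notin> Q ==> f x = 0"
 shows "integrable \<mu> f" and "((%eps. \<integral>x. f x \<partial>\<mu>e eps) \<longlongrightarrow> (\<integral>x. f x \<partial>\<mu>)) (at_right 0)"
proof -
 define F where "F x = (if x \<in> X then complex_of_real (f x) else 0)" for x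
 have "F \<in> Fb0 A \<theta>"
  unfolding Fb0_def F_def[abs_def] using W0.Fb_of_real[OF f] Q
  by (auto simp: Sig_eq intro!: exI[of _ Q])
 then have i: "integrable \<mu> F" and l: "((%eps. \<integral>x. F x \<partial>\<mu>e eps) \<longlongrightarrow> (\<integral>x. F x \<partial>\<mu>)) (at_right 0)"
  and s: "sets \<mu> = sets (borel_of_shift A)" using L by (auto simp: is_limit_measure_def)
 have F: "(\<integral>x. F x \<partial>M) = of_real (\<integral>x. f x \<partial>M)" if "sets M = sets (borel_of_shift A)" for M
 proof -
  have "space M = X" using sets_eq_imp_space_eq[OF that] by (simp add: space_restrict_space)
  then have "(\<integral>x. F x \<partial>M) = (\<integral>x. of_real (f x) \<partial>M)"
   by (intro Bochner_Integration.integral_cong refl) (simp add: F_def)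
  then show ?thesis by simp
 qed
 have sp: "space \<mu> = X" using sets_eq_imp_space_eq[OF s] by (simp add: space_restrict_space)
 have "integrable \<mu> (%x. Re (F x))" using i by simp
 then show "integrable \<mu> f" by (subst Bochner_Integration.integrable_cong[where g = "%x. Re (F x)"]) (auto simp: F_def sp)
 have "((%eps. Re (\<integral>x. F x \<partial>\<mu>e eps)) \<longlongrightarrow> Re (\<integral>x. F x \<partial>\<mu>)) (at_right 0)" by (rule tendsto_Re[OF l])
 then have "((%eps. Re (\<integral>x. F x \<partial>\<mu>e eps)) \<longlongrightarrow> (\<integral>x. f x \<partial>\<mu>)) (at_right 0)" by (simp add: F[OF s])
 then show "((%eps. \<integral>x. f x \<partial>\<mu>e eps) \<longlongrightarrow> (\<integral>x. f x \<partial>\<mu>)) (at_right 0)"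
  by (rule Lim_transform_eventually) (use ev_01 in eventually_elim, simp add: F mu_e(1))
qed

text \<open>The indicator of a single state vanishes at infinity, so it is a legitimate test
  function.\<close>

lemma star_of_limit: assumes "is_limit_measure A \<theta> \<mu>e \<mu>" shows star
 unfolding star_def
proof
 fix k assume k: "k \<in> {1..m0}"
 have "((%eps. \<integral>x. chi {rep k} x \<partial>\<mu>e eps) \<longlongrightarrow> (\<integral>x. chi {rep k} x \<partial>\<mu>)) (at_right 0)"
  by (rule limit_integral(2)[OF assms W0.bl_chi, of "{rep k}"]) (auto simp: chi_def)
 then have "((%eps. measure (\<mu>e eps) (Sig A {rep k})) \<longlongrightarrow> (\<integral>x. chi {rep k} x \<partial>\<mu>)) (at_right 0)"
  by (rule Lim_transform_eventually) (use ev_chi[of "{rep k}"] in simp)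
 from tendsto_divide[OF this tendsto_const[of "\<pi> k"]] pi_pos[OF k]
 show "EX b. (q k \<longlongrightarrow> b) (at_right 0)" unfolding q_def[abs_def] by auto
qed

definition \<mu>0 where "\<mu>0 = (SOME N. sets N = sets (borel_of_shift A) & finite_measure N &
 (ALL E:sets (borel_of_shift A). emeasure N E = (\<Sum>k=1..m0. ennreal (\<beta> k) * emeasure (\<mu>U (U k)) E)) &
 (ALL f. W0.bl f --> (\<integral>x. f x \<partial>N) = (\<Sum>k=1..m0. \<beta> k * (\<integral>x. f x \<partial>\<mu>U (U k)))))"

lemma mu0:
 assumes star
 shows "sets \<mu>0 = sets (borel_of_shift A)" "finite_measure \<mu>0"
  "E \<in> sets (borel_of_shift A) ==> emeasure \<mu>0 E = (\<Sum>k=1..m0. ennreal (\<beta> k) * emeasure (\<mu>U (U k)) E)"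
  "W0.bl f ==> (\<integral>x. f x \<partial>\<mu>0) = (\<Sum>k=1..m0. \<beta> k * (\<integral>x. f x \<partial>\<mu>U (U k)))"
proof -
 obtain N where N: "sets N = sets (borel_of_shift A)" "finite_measure N"
  "!!E. E \<in> sets (borel_of_shift A) ==> emeasure N E = (\<Sum>k=1..m0. ennreal (\<beta> k) * emeasure (\<mu>U (U k)) E)"
  "!!f B. f \<in> borel_measurable (borel_of_shift A) ==> (!!x. x \<in> space (borel_of_shift A) ==> \<bar>f x\<bar> <= B) ==>
   (\<integral>x. f x \<partial>N) = (\<Sum>k=1..m0. \<beta> k * (\<integral>x. f x \<partial>\<mu>U (U k)))"
  by (rule sum_measure[of "{1..m0}" "%k. \<mu>U (U k)" "borel_of_shift A" \<beta>])
   (use mu_V U_S0 \<beta>_nonneg[OF assms] m0 in auto)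
 have "(\<integral>x. f x \<partial>N) = (\<Sum>k=1..m0. \<beta> k * (\<integral>x. f x \<partial>\<mu>U (U k)))" if f: "W0.bl f" for f
 proof -
  obtain c where c: "0 <= c" "!!x. x \<in> X ==> \<bar>f x\<bar> <= c" by (rule W0.bdE[OF W0.bl_bd[OF f]], rule that)
  show ?thesis by (rule N(4)[OF W0.bl_measurable[OF f], of c]) (use c(2) in \<open>simp add: space_restrict_space\<close>)
 qed
 then have "EX N. sets N = sets (borel_of_shift A) & finite_measure N &
  (ALL E:sets (borel_of_shift A). emeasure N E = (\<Sum>k=1..m0. ennreal (\<beta> k) * emeasure (\<mu>U (U k)) E)) &
  (ALL f. W0.bl f --> (\<integral>x. f x \<partial>N) = (\<Sum>k=1..m0. \<beta> k * (\<integral>x. f x \<partial>\<mu>U (U k))))"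
  using N(1-3) by (intro exI[of _ N] conjI ballI allI impI)
 note m = someI_ex[OF this, folded \<mu>0_def]
 show "sets \<mu>0 = sets (borel_of_shift A)" "finite_measure \<mu>0"
  by (rule m[THEN conjunct1], rule m[THEN conjunct2, THEN conjunct1])
 show "E \<in> sets (borel_of_shift A) ==> emeasure \<mu>0 E = (\<Sum>k=1..m0. ennreal (\<beta> k) * emeasure (\<mu>U (U k)) E)"
  by (rule bspec[OF m[THEN conjunct2, THEN conjunct2, THEN conjunct1]])
 show "W0.bl f ==> (\<integral>x. f x \<partial>\<mu>0) = (\<Sum>k=1..m0. \<beta> k * (\<integral>x. f x \<partial>\<mu>U (U k)))"
  by (rule mp[OF spec[OF m[THEN conjunct2, THEN conjunct2, THEN conjunct2]]])
qed

lemma mu0_limit: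
 assumes star and f: "W0.bl f" and Q: "finite Q"
 shows "((%eps. \<integral>x. chi Q x * f x \<partial>\<mu>e eps) \<longlongrightarrow> int_on \<mu>0 Q f) (at_right 0)"
proof -
 have "((%eps. \<Sum>k=1..m0. q k eps * int_on (\<mu>U (U k)) Q f) \<longlongrightarrow> (\<Sum>k=1..m0. \<beta> k * int_on (\<mu>U (U k)) Q f)) (at_right 0)"
  by (intro tendsto_sum tendsto_mult tendsto_const star_lim[OF assms(1)])
 from tendsto_add[OF asym[OF f Q] this] show ?thesis by (simp add: mu0(4)[OF assms(1) W0.bl_mult[OF W0.bl_chi f]])
qed

text \<open>Mass may escape to infinity, but the total masses are bounded and \<open>f\<close> is
  uniformly small off a finite set of states. This replaces tightness.\<close>

lemma mu0_vanishing:
 assumes star and f: "W0.bl f" and van: "!!\<eta>. 0 < \<eta> ==> EX Q. finite Q & (ALL x:X. x 0 \<notin> Q --> \<bar>f x\<bar> < \<eta>)"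
 shows "((%eps. \<integral>x. f x \<partial>\<mu>e eps) \<longlongrightarrow> (\<integral>x. f x \<partial>\<mu>0)) (at_right 0)"
proof (rule tendstoI)
 fix \<eta>1 :: real assume \<eta>1: "0 < \<eta>1"
 note m0 = mu0(1,2)[OF assms(1)]
 define D where "D = measure \<mu>0 X"
 define \<eta> where "\<eta> = \<eta>1 / (3 + D)"
 have D: "0 <= D" by (simp add: D_def)
 then have \<eta>: "0 < \<eta>" "\<eta> * (3 + D) = \<eta>1" using \<eta>1 by (simp_all add: \<eta>_def)
 obtain Q where Q: "finite Q" "!!x. x \<in> X ==> x 0 \<notin> Q ==> \<bar>f x\<bar> < \<eta>" using van[OF \<eta>(1)] by blast
 have tail: "\<bar>(\<integral>x. f x \<partial>M) - int_on M Q f\<bar> <= \<eta> * measure M X"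
  if M: "sets M = sets (borel_of_shift A)" "finite_measure M" for M
 proof -
  note I = bl_integrable[OF M]
  have b: "W0.bl (%x. chi Q x * f x)" by (intro W0.bl_mult W0.bl_chi f)
  have "\<bar>(\<integral>x. f x \<partial>M) - int_on M Q f\<bar> = norm (\<integral>x. f x - chi Q x * f x \<partial>M)"
   by (simp add: Bochner_Integration.integral_diff[OF I[OF f] I[OF b]])
  also have "... <= (\<integral>x. \<eta> \<partial>M)"
  proof (rule order_trans[OF integral_norm_bound Bochner_Integration.integral_mono])
   show "integrable M (%x. norm (f x - chi Q x * f x))" "integrable M (%x. \<eta>)"
    by (intro integrable_norm I W0.bl_diff f b W0.bl_const)+
  qed (use Q(2) \<eta> in \<open>auto simp: int_space[OF M] chi_def less_imp_le\<close>)
  finally show ?thesis by (simp add: int_space[OF M] mult.commute)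
 qed
 have "\<forall>\<^sub>F eps in at_right 0. dist (int_on (\<mu>e eps) Q f) (int_on \<mu>0 Q f) < \<eta>"
  by (rule tendstoD[OF mu0_limit[OF assms(1) f Q(1)] \<eta>(1)])
 then show "\<forall>\<^sub>F eps in at_right 0. dist (\<integral>x. f x \<partial>\<mu>e eps) (\<integral>x. f x \<partial>\<mu>0) < \<eta>1"
  using ev_01
 proof eventually_elim
  case (elim eps)
  note me = mu_e(1)[OF elim(2)] finite_e[OF elim(2)]
  have "measure (\<mu>e eps) X = 1" using prob_space.prob_space[OF mu_e(2)[OF elim(2)]] by (simp add: int_space[OF me])
  then have "\<bar>(\<integral>x. f x \<partial>\<mu>e eps) - int_on (\<mu>e eps) Q f\<bar> <= \<eta>" using tail[OF me] by simp
  moreover have "\<bar>(\<integral>x. f x \<partial>\<mu>0) - int_on \<mu>0 Q f\<bar> <= \<eta> * D" unfolding D_def by (rule tail[OF m0])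
  moreover have "\<eta>1 = 3 * \<eta> + \<eta> * D" using \<eta>(2) by (simp add: algebra_simps)
  ultimately show ?case using elim(1) \<eta>(1) unfolding dist_real_def by linarith
 qed
qed

lemma limit_of_star: assumes star shows "is_limit_measure A \<theta> \<mu>e \<mu>0"
 unfolding is_limit_measure_def
proof (intro conjI ballI)
 note m0 = mu0(1,2)[OF assms]
 show "sets \<mu>0 = sets (borel_of_shift A)" by (rule m0)
 fix f assume "f \<in> Fb0 A \<theta>"
 then have F: "f \<in> Fb A \<theta>" and van: "!!\<eta>. 0 < \<eta> ==> EX Q. finite Q & (ALL x:Sig A (- Q). norm (f x) < \<eta>)"
  by (auto simp: Fb0_def)
 have b: "W0.bl (%x. Re (f x))" "W0.bl (%x. Im (f x))" using F unfolding W0.Fb_iff by auto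
 have int: "integrable M f" "(\<integral>x. f x \<partial>M) = Complex (\<integral>x. Re (f x) \<partial>M) (\<integral>x. Im (f x) \<partial>M)"
  if M: "sets M = sets (borel_of_shift A)" "finite_measure M" for M
 proof -
  have "integrable M (%x. complex_of_real (Re (f x)) + \<i> * complex_of_real (Im (f x)))"
   by (intro Bochner_Integration.integrable_add integrable_mult_right integrable_of_real bl_integrable[OF M] b)
  then show i: "integrable M f" by (simp flip: complex_eq)
  show "(\<integral>x. f x \<partial>M) = Complex (\<integral>x. Re (f x) \<partial>M) (\<integral>x. Im (f x) \<partial>M)" by (simp add: complex_eq_iff i)
 qed
 show "integrable \<mu>0 f" by (rule int(1)[OF m0])
 have v: "EX Q. finite Q & (ALL x:X. x 0 \<notin> Q --> \<bar>g (f x)\<bar> < \<eta>)" if "0 < \<eta>" "!!z. \<bar>g z\<bar> <= cmod z" for g \<eta>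
 proof -
  obtain Q where Q: "finite Q" "!!x. x \<in> Sig A (- Q) ==> norm (f x) < \<eta>" using van[OF \<open>0 < \<eta>\<close>] by blast
  have "\<bar>g (f x)\<bar> < \<eta>" if "x \<in> X" "x 0 \<notin> Q" for x
   by (rule order.strict_trans1[OF \<open>!!z. \<bar>g z\<bar> <= cmod z\<close> Q(2)]) (use that in \<open>simp add: Sig_eq\<close>)
  then show ?thesis using Q(1) by blast
 qed
 have "((%eps. Complex (\<integral>x. Re (f x) \<partial>\<mu>e eps) (\<integral>x. Im (f x) \<partial>\<mu>e eps)) \<longlongrightarrow> (\<integral>x. f x \<partial>\<mu>0)) (at_right 0)"
  unfolding int(2)[OF m0]
  by (intro tendsto_Complex mu0_vanishing assms b v abs_Re_le_cmod abs_Im_le_cmod)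
 then show "((%eps. \<integral>x. f x \<partial>\<mu>e eps) \<longlongrightarrow> (\<integral>x. f x \<partial>\<mu>0)) (at_right 0)"
  by (rule Lim_transform_eventually) (use ev_01 in eventually_elim, simp add: int(2)[OF mu_e(1) finite_e])
qed

text \<open>The hypothesis yields \<open>star\<close>, hence the limit measure \<open>\<mu>0\<close>
  as well. Indicators of cylinders of nonempty words are test functions, so both measures agree on
  them; additivity over the first letter settles the empty word.\<close>

lemma limit_unique:
 assumes L: "is_limit_measure A \<theta> \<mu>e \<mu>" shows "\<mu> = \<mu>0"
proof -
 have star by (rule star_of_limit[OF L])
 note m0 = mu0(1,2)[OF this]
 have s: "sets \<mu> = sets (borel_of_shift A)" using L by (simp add: is_limit_measure_def)
 have cyl: "emeasure \<mu> (cyl A (a # w)) = emeasure \<mu>0 (cyl A (a # w))" for a w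
 proof -
  let ?f = "indicator (cyl A (a # w)) :: 's word => real"
  have z: "x \<in> X ==> x 0 \<notin> {a} ==> ?f x = 0" for x by (auto simp: cyl_eq indicator_def)
  have fa: "finite {a}" by simp
  note l = limit_integral[OF _ W0.bl_cyl[of "a # w"] fa z]
  have "(\<integral>x. ?f x \<partial>\<mu>) = (\<integral>x. ?f x \<partial>\<mu>0)"
   by (rule tendsto_unique[OF _ l(2)[OF L] l(2)[OF limit_of_star[OF \<open>star\<close>]]]) simp
  moreover have "emeasure M (cyl A (a # w)) = ennreal (\<integral>x. ?f x \<partial>M)"
   if M: "is_limit_measure A \<theta> \<mu>e M" for M
  proof -
   have sM: "sets M = sets (borel_of_shift A)" using M by (simp add: is_limit_measure_def)
   have c: "cyl A (a # w) \<in> sets M" by (simp add: sM cyl_sets)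
   have "emeasure M (cyl A (a # w)) < \<infinity>" using l(1)[OF M] c by (simp add: integrable_indicator_iff)
   then show ?thesis using c sets.sets_into_space[OF c] by (simp add: emeasure_eq_ennreal_measure Int_absorb2)
  qed
  ultimately show ?thesis using L limit_of_star[OF \<open>star\<close>] by simp
 qed
 have all: "emeasure \<mu> (cyl A w) = emeasure \<mu>0 (cyl A w)" for w
 proof (cases w)
  case Nil
  have X: "cyl A [] = (\<Union>a. cyl A [a])" by (auto simp: cyl_eq)
  have dj: "disjoint_family_on (%a. cyl A [a]) UNIV" by (auto simp: disjoint_family_on_def cyl_sing)
  have "emeasure M (\<Union>a. cyl A [a]) = (\<integral>\<^sup>+a. emeasure M (cyl A [a]) \<partial>count_space UNIV)" if "sets M = sets (borel_of_shift A)" for M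
   by (rule emeasure_UN_countable[OF _ _ dj]) (simp_all add: that cyl_sets)
  then show ?thesis unfolding Nil X using s m0(1) cyl[of _ "[]"] by simp
 qed (simp add: cyl)
 show ?thesis
 proof (rule measure_eqI_generator_eq[OF Int_stable_cyl[of A]])
  show "insert {} (range (cyl A)) \<subseteq> Pow X" by (auto simp: cyl_def)
  show "E \<in> insert {} (range (cyl A)) ==> emeasure \<mu> E = emeasure \<mu>0 E" for E using all by auto
  have "sigma_sets X (insert {} (range (cyl A))) = sigma_sets X (range (cyl A))"
   by (intro sigma_sets_eqI) (auto intro: sigma_sets.Basic sigma_sets.Empty)
  then show "sets \<mu> = sigma_sets X (insert {} (range (cyl A)))" "sets \<mu>0 = sigma_sets X (insert {} (range (cyl A)))"
   by (simp_all add: s m0 sets_borel_of_shift)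
  show "range (%i::nat. cyl A []) \<subseteq> insert {} (range (cyl A))" "(\<Union>i::nat. cyl A []) = X" by (rule image_subsetI, simp) (simp add: cyl_eq)
  show "emeasure \<mu> (cyl A []) ~= \<infinity>" unfolding all using finite_measure.emeasure_finite[OF m0(2)] by simp
 qed
qed

text \<open>As \<open>Q\<close> exhausts the states, \<open>m k (Q n)\<close> increases to the total
  mass 1 of \<open>\<mu>U (U k)\<close>.\<close>

lemma weights_limit:
 assumes star and k: "k \<in> {1..m0}" and Q: "exhausting m0 U Q"
 shows "(%n. Lim (at_right 0) (%eps. measure (\<mu>e eps) (Sig A (Q n)) * delta_eps A \<theta> \<phi> m0 U eps (Q n) k)) \<longlonglongrightarrow> \<beta> k"
proof -
 interpret finite_measure "\<mu>U (U k)" by (rule finite_V[OF U_S0[OF k]])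
 have "Lim (at_right 0) (%eps. measure (\<mu>e eps) (Sig A (Q n)) * delta_eps A \<theta> \<phi> m0 U eps (Q n) k) = \<beta> k * m k (Q n)" for n
  using Q by (intro tendsto_Lim star_product[OF assms(1) k]) (simp_all add: exhausting_def)
 moreover have "(%n. m k (Q n)) \<longlonglongrightarrow> measure (\<mu>U (U k)) (\<Union>n. Sig A (Q n))"
  unfolding m_def
 proof (rule finite_Lim_measure_incseq)
  show "range (%n. Sig A (Q n)) \<subseteq> sets (\<mu>U (U k))" by (auto simp: mu_V(1)[OF U_S0[OF k]] Sig_sets)
  show "incseq (%n. Sig A (Q n))" using Q unfolding exhausting_def by (intro incseq_SucI) (auto simp: Sig_def)
 qed
 moreover have "(\<Union>n. Sig A (Q n)) = space (\<mu>U (U k))"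
  using Q by (auto simp: exhausting_def Sig_eq int_space[OF mu_V(1)[OF U_S0[OF k]] finite_V[OF U_S0[OF k]]])
 ultimately have eq: "Lim (at_right 0) (%eps. measure (\<mu>e eps) (Sig A (Q n)) * delta_eps A \<theta> \<phi> m0 U eps (Q n) k) = \<beta> k * m k (Q n)"
  and lim: "(%n. m k (Q n)) \<longlonglongrightarrow> 1" for n
  using prob_space.prob_space[OF mu_V(2)[OF U_S0[OF k]]] by simp_all
 show ?thesis unfolding eq using tendsto_mult[OF tendsto_const[of "\<beta> k"] lim] by simp
qed

end

theorem theorem1p2:
  fixes A :: "'s::{countable, discrete_topology} \<Rightarrow> 's \<Rightarrow> bool"
    and \<theta> :: real
    and \<phi> :: "real \<Rightarrow> 's word \<Rightarrow> real"
    and \<phi>0 :: "'s word \<Rightarrow> ereal"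
    and m0 :: nat
    and U :: "nat \<Rightarrow> 's set"
    and \<mu>\<epsilon> :: "real \<Rightarrow> 's word measure"
    and \<mu>U :: "'s set \<Rightarrow> 's word measure"
  assumes "irreducible_matrix A"
    and "0 < \<theta>" "\<theta> < 1"
    and "cond_A1 A \<theta> \<phi>" "cond_A2 A \<phi>" "cond_A3 A \<phi> \<phi>0"
    and "bij_betw U {1..m0} (S0 A \<phi>0)" "m0 \<ge> 2"
    and "\<And>\<epsilon>. \<epsilon> \<in> {0<..<1} \<Longrightarrow> is_RPF_measure A \<theta> A (\<lambda>x. ereal (\<phi> \<epsilon> x)) (\<mu>\<epsilon> \<epsilon>)"
    and "\<And>V. V \<in> S0 A \<phi>0 \<Longrightarrow>
           is_RPF_measure A \<theta> (submatrix_on (Bmat A \<phi>0) V) \<phi>0 (\<mu>U V)"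
  shows
    "((\<exists>\<mu>. is_limit_measure A \<theta> \<mu>\<epsilon> \<mu>) \<longleftrightarrow>
        (\<forall>Q. meets_all m0 U Q \<longrightarrow> weights_converge A \<theta> \<phi> m0 U \<mu>\<epsilon> Q)) \<and>
     ((\<forall>Q. meets_all m0 U Q \<longrightarrow> weights_converge A \<theta> \<phi> m0 U \<mu>\<epsilon> Q) \<longleftrightarrow>
        (\<exists>Q. exhausting m0 U Q \<and> (\<forall>n. weights_converge A \<theta> \<phi> m0 U \<mu>\<epsilon> (Q n)))) \<and>
     ((\<exists>Q. exhausting m0 U Q \<and> (\<forall>n. weights_converge A \<theta> \<phi> m0 U \<mu>\<epsilon> (Q n))) \<longleftrightarrow>
        (\<exists>Q. exhausting m0 U Q \<and> (\<forall>n. products_converge A \<theta> \<phi> m0 U \<mu>\<epsilon> (Q n)))) \<and>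
    (\<forall>\<mu> Q. is_limit_measure A \<theta> \<mu>\<epsilon> \<mu> \<and> exhausting m0 U Q \<and>
       (\<forall>n. products_converge A \<theta> \<phi> m0 U \<mu>\<epsilon> (Q n)) \<longrightarrow>
       (\<exists>\<delta> :: nat \<Rightarrow> real.
          (\<forall>k\<in>{1..m0}. 0 \<le> \<delta> k \<and>
             (\<lambda>n. Lim (at_right 0)
                (\<lambda>\<epsilon>. measure (\<mu>\<epsilon> \<epsilon>) (Sig A (Q n)) * delta_eps A \<theta> \<phi> m0 U \<epsilon> (Q n) k))
               \<longlonglongrightarrow> \<delta> k) \<and>
          (\<forall>E \<in> sets \<mu>. emeasure \<mu> E = (\<Sum>k=1..m0. ennreal (\<delta> k) * emeasure (\<mu>U (U k)) E))))"
proof -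
 interpret theorem_setting A \<theta> \<phi> \<phi>0 m0 U \<mu>\<epsilon> \<mu>U
  using assms by (rule theorem_setting.intro)
 let ?W = "weights_converge A \<theta> \<phi> m0 U \<mu>\<epsilon>" and ?P = "products_converge A \<theta> \<phi> m0 U \<mu>\<epsilon>"
 have mall: "meets_all m0 U (Q n)" if "exhausting m0 U Q" for Q n using that by (simp add: exhausting_def)
 have 1: "(EX \<mu>. is_limit_measure A \<theta> \<mu>\<epsilon> \<mu>) \<longleftrightarrow> star"
  using star_of_limit limit_of_star by blast
 have 4: "(EX Q. exhausting m0 U Q & (ALL n. ?P (Q n))) ==> star"
  using star_of_products by blast
 have 3: "(EX Q. exhausting m0 U Q & (ALL n. ?W (Q n))) ==> (EX Q. exhausting m0 U Q & (ALL n. ?P (Q n)))"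
  using products_of_weights mall by blast
 have 2: "(ALL Q. meets_all m0 U Q --> ?W Q) ==> (EX Q. exhausting m0 U Q & (ALL n. ?W (Q n)))"
  using ex_exhausting mall by blast
 have 5: "star ==> (ALL Q. meets_all m0 U Q --> ?W Q)"
  using weights_of_star by blast
 have 6: "EX \<delta>. (ALL k:{1..m0}. 0 <= \<delta> k &
    (%n. Lim (at_right 0) (%\<epsilon>. measure (\<mu>\<epsilon> \<epsilon>) (Sig A (Q n)) * delta_eps A \<theta> \<phi> m0 U \<epsilon> (Q n) k)) \<longlonglongrightarrow> \<delta> k) &
   (ALL E:sets \<mu>. emeasure \<mu> E = (\<Sum>k=1..m0. ennreal (\<delta> k) * emeasure (\<mu>U (U k)) E))"
  if L: "is_limit_measure A \<theta> \<mu>\<epsilon> \<mu>" and Q: "exhausting m0 U Q" for \<mu> Q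
 proof -
  have s: star by (rule star_of_limit[OF L])
  show ?thesis
   unfolding limit_unique[OF L] using mu0(1,3)[OF s] \<beta>_nonneg[OF s] weights_limit[OF s _ Q]
   by (intro exI[of _ \<beta>]) simp
 qed
 show ?thesis using 1 2 3 4 5 6 by (intro conjI allI impI; (elim conjE)?; meson)
qed

end
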